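(* (i) No Arnol'd flow with frequency in $\mathcal D\cap\mathcal E$ is of local rank one. (ii) No Kochergin flow with frequency in $\mathcal D$ is of local rank one. (iii) Any two Kochergin flows with frequencies in $\mathcal D$ and different exponents $\gamma\neq\gamma'$ are not isomorphic (as measure-preserving flows).
   Context: **Arnol'd and Kochergin flows.** Let $\mathbb T=\mathbb R/\mathbb Z$ with Lebesgue measure $\lambda$, $\alpha\in\mathbb R\setminus\mathbb Q$, $Tx=x+\alpha$ mod $1$. Let $h:(0,1)\to(0,\infty)$ and let $f\in C^2(\mathbb T\setminus\{0\})$, $f>0$, satisfy, for some constants $A_i,B_i>0$ ($i=1,2,3$), identifying $\mathbb T\setminus\{0\}$ with $(0,1)$ (so $x\to0^-$ means $x\to1^-$ in $(0,1)$): $$\lim_{x\to0^+}\frac{f(x)}{h(x)}=A_1,\quad \lim_{x\to0^-}\frac{f(x)}{h(1-x)}=B_1,$$ $$\lim_{x\to0^+}\frac{f'(x)}{h'(x)}=A_2,\quad \lim_{x\to0^-}\frac{f'(x)}{h'(1-x)}=-B_2,$$ $$\lim_{x\to0^+}\frac{f''(x)}{h''(x)}=A_3,\quad \lim_{x\to0^-}\frac{f''(x)}{h''(1-x)}=B_3.$$ The special flow $(T^f_t)$ acts on $\mathbb T^f=\{(x,s):x\in\mathbb T,\ 0\le s<f(x)\}$, equipped with the product of Lebesgue measures restricted to $\mathbb T^f$ and normalized to be a probability measure; points move vertically with unit speed and $(x,f(x))$ is identified with $(Tx,0)$: $T^f_t(x,s)=(T^{N}x,\ s+t-f^{(N)}(x))$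 with $N\in\mathbb Z$ the unique integer such that $f^{(N)}(x)\le s+t<f^{(N+1)}(x)$, where $f^{(n)}(x)=\sum_{i=0}^{n-1}f(T^ix)$ for $n\ge1$, $f^{(0)}=0$, $f^{(-n)}(x)=-\sum_{i=1}^nf(T^{-i}x)$. (The null set of points whose orbit meets the singularity is discarded.) If $h(x)=-\log x$ and $A_i\ne B_i$ for $i=1,2,3$, the flow is called an Arnol'd flow with frequency $\alpha$. If $h(x)=x^{-\gamma}$ with $0<\gamma<1$, it is called a Kochergin flow with frequency $\alpha$ and exponent $\gamma$. **Diophantine sets.** Let $(q_n)$ be the sequence of denominators of the continued fraction convergents of $\alpha$. $\mathcal D$ is the set of $\alpha\in\mathbb R\setminus\mathbb Q$ for which there is a constant $C(\alpha)$ with $q_{n+1}\le C(\alpha)\,q_n\log q_n(\log n)^2$ for all $n\ge2$. With $K_\alpha=\{n: q_{n+1}\le q_n\log^{7/8}q_n\}$, $\mathcal E$ is the set of $\alpha\in\mathbb R\setminus\mathbb Q$ with $\sum_{i\ge2,\ i\notin K_\alpha}\log^{-7/8}q_i<+\infty$. **Local rank one.** Let $(T_t)$ be an ergodic flow on a probability Borel space $(X,\mathcal B,\mu)$. For every $H>0$ and $\eta\in(0,1)$ the flow can be represented as (is isomorphic to, and is identified with) a special flow over an ergodic automorphism $S$ of a probability space $(Y,\mathcal C,\nu)$ under a roof function $\phi$ such that $\phi(y)\le H$ for every $y\in Y$ and such that there is a set $B=B(\eta,H)\in\mathcal C$ with $\nu(B)>1-\eta$ and $\phi(y)=H$ for every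 $y\in B$; the base $Y$ is viewed as the subset $Y\times\{0\}$ of $X$. The set $\bigcup_{0\le s<H}T_s(B)$ is called a tower for $(T_t)$ and the sets $T_s(B)$, $0\le s<H$, are its levels. For a finite partition $\mathcal P$ of $X$ and $\epsilon>0$, a level $T_s(B)$ is $\epsilon$-monochromatic (for $\mathcal P$) if its $1-\epsilon$ proportion with respect to $(T_s)_*\nu$ is contained in one atom of $\mathcal P$; a tower is $\epsilon$-monochromatic (for $\mathcal P$) if a $1-\epsilon$ proportion of its levels (with respect to Lebesgue measure on $[0,H]$) is $\epsilon$-monochromatic. For $\beta\in(0,1]$, an ergodic flow is a $\beta$-rank one flow if for every $\epsilon>0$ and every finite partition $\mathcal P$ of $X$ there exists a tower of $\mu$-measure greater than $\beta-\epsilon$ which is $\epsilon$-monochromatic for $\mathcal P$. A flow is of local rank one if it is a $\beta$-rank one flow for some $\beta\in(0,1]$. *)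

theory Defs
  imports "HOL-Probability.Probability"
begin

section \<open>Automorphisms, measure-preserving flows, isomorphism\<close>

definition ergodic_automorphism :: "'a measure \<Rightarrow> ('a \<Rightarrow> 'a) \<Rightarrow> bool" where
  "ergodic_automorphism Y S \<longleftrightarrow>
     prob_space Y \<and>
     bij_betw S (space Y) (space Y) \<and> S \<in> Y \<rightarrow>\<^sub>M Y \<and> inv_into (space Y) S \<in> Y \<rightarrow>\<^sub>M Y \<and>
     distr Y Y S = Y \<and>
     (\<forall>A\<in>sets Y. (AE y in Y. S y \<in> A \<longleftrightarrow> y \<in> A) \<longrightarrow> measure Y A = 0 \<or> measure Y A = 1)"

definition measure_preserving_flow :: "'a measure \<Rightarrow> (real \<Rightarrow> 'a \<Rightarrow> 'a) \<Rightarrow> bool" where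
  "measure_preserving_flow M T \<longleftrightarrow>
     prob_space M \<and>
     (\<lambda>(t, x). T t x) \<in> borel \<Otimes>\<^sub>M M \<rightarrow>\<^sub>M M \<and>
     (\<forall>t. distr M M (T t) = M) \<and>
     (\<forall>x\<in>space M. T 0 x = x) \<and>
     (\<forall>s t. \<forall>x\<in>space M. T (s + t) x = T s (T t x))"

definition ergodic_flow :: "'a measure \<Rightarrow> (real \<Rightarrow> 'a \<Rightarrow> 'a) \<Rightarrow> bool" where
  "ergodic_flow M T \<longleftrightarrow>
     measure_preserving_flow M T \<and>
     (\<forall>A\<in>sets M. (\<forall>t. AE x in M. T t x \<in> A \<longleftrightarrow> x \<in> A) \<longrightarrow> measure M A = 0 \<or> measure M A = 1)"

text \<open>Isomorphism modulo null sets: \<open>\<Theta>\<close> is measure preserving, has a measurable and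
  measure-preserving almost-everywhere inverse \<open>\<Psi>\<close>, and intertwines the two flows.\<close>

definition flow_isomorphism ::
  "'a measure \<Rightarrow> (real \<Rightarrow> 'a \<Rightarrow> 'a) \<Rightarrow> 'b measure \<Rightarrow> (real \<Rightarrow> 'b \<Rightarrow> 'b) \<Rightarrow> ('a \<Rightarrow> 'b) \<Rightarrow> bool" where
  "flow_isomorphism M T M' T' \<Theta> \<longleftrightarrow>
     \<Theta> \<in> M \<rightarrow>\<^sub>M M' \<and> distr M M' \<Theta> = M' \<and>
     (\<exists>\<Psi>. \<Psi> \<in> M' \<rightarrow>\<^sub>M M \<and> distr M' M \<Psi> = M \<and>
          (AE x in M. \<Psi> (\<Theta> x) = x) \<and> (AE y in M'. \<Theta> (\<Psi> y) = y)) \<and>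
     (\<forall>t. AE x in M. \<Theta> (T t x) = T' t (\<Theta> x))"

definition flow_isomorphic ::
  "'a measure \<Rightarrow> (real \<Rightarrow> 'a \<Rightarrow> 'a) \<Rightarrow> 'b measure \<Rightarrow> (real \<Rightarrow> 'b \<Rightarrow> 'b) \<Rightarrow> bool" where
  "flow_isomorphic M T M' T' \<longleftrightarrow> (\<exists>\<Theta>. flow_isomorphism M T M' T' \<Theta>)"


section \<open>Special flows\<close>

definition int_iterate :: "'a measure \<Rightarrow> ('a \<Rightarrow> 'a) \<Rightarrow> int \<Rightarrow> 'a \<Rightarrow> 'a" where
  "int_iterate Y S n =
     (if 0 \<le> n then S ^^ nat n else inv_into (space Y) S ^^ nat (- n))"

definition cocycle :: "'a measure \<Rightarrow> ('a \<Rightarrow> 'a) \<Rightarrow> ('a \<Rightarrow> real) \<Rightarrow> int \<Rightarrow> 'a \<Rightarrow> real" where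
  "cocycle Y S \<phi> n x =
     (if 0 \<le> n then \<Sum>i<nat n. \<phi> (int_iterate Y S (int i) x)
      else - (\<Sum>i=1..nat (- n). \<phi> (int_iterate Y S (- int i) x)))"

definition special_space :: "'a measure \<Rightarrow> ('a \<Rightarrow> real) \<Rightarrow> ('a \<times> real) set" where
  "special_space Y \<phi> = {(y, s). y \<in> space Y \<and> 0 \<le> s \<and> s < \<phi> y}"

definition special_measure :: "'a measure \<Rightarrow> ('a \<Rightarrow> real) \<Rightarrow> ('a \<times> real) measure" where
  "special_measure Y \<phi> =
     restrict_space (uniform_measure (Y \<Otimes>\<^sub>M lborel) (special_space Y \<phi>)) (special_space Y \<phi>)"

text \<open>For a positive roof there is at most one \<open>N\<close> as below, and for an automorphism of a
  probability space there is one for almost every point; the value at the remaining points is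
  irrelevant, since flows are only compared modulo null sets.\<close>

definition special_flow ::
  "'a measure \<Rightarrow> ('a \<Rightarrow> 'a) \<Rightarrow> ('a \<Rightarrow> real) \<Rightarrow> real \<Rightarrow> 'a \<times> real \<Rightarrow> 'a \<times> real" where
  "special_flow Y S \<phi> t = (\<lambda>(x, s).
     let N = (THE N. cocycle Y S \<phi> N x \<le> s + t \<and> s + t < cocycle Y S \<phi> (N + 1) x)
     in (int_iterate Y S N x, s + t - cocycle Y S \<phi> N x))"


section \<open>Arnol'd and Kochergin flows\<close>

text \<open>The circle is \<open>[0,1)\<close> with the singularity at \<open>0\<close>; the null set of points whose orbit under
  the rotation meets the singularity is removed.\<close>

definition circle_base :: "real \<Rightarrow> real measure" where
  "circle_base \<alpha> =
     restrict_space lborel {x \<in> {0..<1}. \<forall>n::int. frac (x + of_int n * \<alpha>) \<noteq> 0}"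

definition rotation :: "real \<Rightarrow> real \<Rightarrow> real" where
  "rotation \<alpha> x = frac (x + \<alpha>)"

definition C2_on_unit_interval :: "(real \<Rightarrow> real) \<Rightarrow> bool" where
  "C2_on_unit_interval f \<longleftrightarrow>
     (\<forall>x\<in>{0<..<1}. f differentiable (at x)) \<and>
     (\<forall>x\<in>{0<..<1}. deriv f differentiable (at x)) \<and>
     continuous_on {0<..<1} (deriv (deriv f))"

text \<open>The constants \<open>A\<^sub>i\<close>, \<open>B\<^sub>i\<close> are the values of \<open>A\<close>, \<open>B\<close> at \<open>i = 1, 2, 3\<close>. Only the values of
  \<open>f\<close> and \<open>h\<close> on \<open>(0,1)\<close> matter.\<close>

definition singular_roof ::
  "(real \<Rightarrow> real) \<Rightarrow> (real \<Rightarrow> real) \<Rightarrow> (nat \<Rightarrow> real) \<Rightarrow> (nat \<Rightarrow> real) \<Rightarrow> bool" where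
  "singular_roof h f A B \<longleftrightarrow>
     (\<forall>x\<in>{0<..<1}. 0 < h x) \<and>
     C2_on_unit_interval f \<and> (\<forall>x\<in>{0<..<1}. 0 < f x) \<and>
     (\<forall>i\<in>{1, 2, 3}. 0 < A i \<and> 0 < B i) \<and>
     ((\<lambda>x. f x / h x) \<longlongrightarrow> A 1) (at_right 0) \<and>
     ((\<lambda>x. f x / h (1 - x)) \<longlongrightarrow> B 1) (at_left 1) \<and>
     ((\<lambda>x. deriv f x / deriv h x) \<longlongrightarrow> A 2) (at_right 0) \<and>
     ((\<lambda>x. deriv f x / deriv h (1 - x)) \<longlongrightarrow> - B 2) (at_left 1) \<and>
     ((\<lambda>x. deriv (deriv f) x / deriv (deriv h) x) \<longlongrightarrow> A 3) (at_right 0) \<and>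
     ((\<lambda>x. deriv (deriv f) x / deriv (deriv h) (1 - x)) \<longlongrightarrow> B 3) (at_left 1)"

definition arnold_roof :: "(real \<Rightarrow> real) \<Rightarrow> bool" where
  "arnold_roof f \<longleftrightarrow>
     (\<exists>A B. singular_roof (\<lambda>x. - ln x) f A B \<and> (\<forall>i\<in>{1, 2, 3}. A i \<noteq> B i))"

definition kochergin_roof :: "real \<Rightarrow> (real \<Rightarrow> real) \<Rightarrow> bool" where
  "kochergin_roof \<gamma> f \<longleftrightarrow>
     0 < \<gamma> \<and> \<gamma> < 1 \<and> (\<exists>A B. singular_roof (\<lambda>x. x powr (- \<gamma>)) f A B)"

definition arnold_flow ::
  "real \<Rightarrow> (real \<times> real) measure \<Rightarrow> (real \<Rightarrow> real \<times> real \<Rightarrow> real \<times> real) \<Rightarrow> bool" where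
  "arnold_flow \<alpha> M T \<longleftrightarrow> \<alpha> \<notin> \<rat> \<and>
     (\<exists>f. arnold_roof f \<and> M = special_measure (circle_base \<alpha>) f \<and>
          T = special_flow (circle_base \<alpha>) (rotation \<alpha>) f)"

definition kochergin_flow ::
  "real \<Rightarrow> real \<Rightarrow> (real \<times> real) measure \<Rightarrow> (real \<Rightarrow> real \<times> real \<Rightarrow> real \<times> real) \<Rightarrow> bool" where
  "kochergin_flow \<alpha> \<gamma> M T \<longleftrightarrow> \<alpha> \<notin> \<rat> \<and>
     (\<exists>f. kochergin_roof \<gamma> f \<and> M = special_measure (circle_base \<alpha>) f \<and>
          T = special_flow (circle_base \<alpha>) (rotation \<alpha>) f)"


section \<open>Diophantine conditions\<close>

text \<open>For irrational \<open>\<alpha> = [a\<^sub>0; a\<^sub>1, a\<^sub>2, \<dots>]\<close>: complete quotients, partial quotients \<open>a\<^sub>n\<close>, and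
  the denominators \<open>q\<^sub>n\<close> of the convergents \<open>[a\<^sub>0; a\<^sub>1, \<dots>, a\<^sub>n]\<close>, so that \<open>q\<^sub>0 = 1\<close> and
  \<open>q\<^sub>1 = a\<^sub>1\<close>. In particular \<open>q\<^sub>n \<ge> 2\<close> for \<open>n \<ge> 2\<close>.\<close>

primrec complete_quotient :: "real \<Rightarrow> nat \<Rightarrow> real" where
  "complete_quotient \<alpha> 0 = \<alpha>"
| "complete_quotient \<alpha> (Suc n) = 1 / frac (complete_quotient \<alpha> n)"

definition partial_quotient :: "real \<Rightarrow> nat \<Rightarrow> int" where
  "partial_quotient \<alpha> n = \<lfloor>complete_quotient \<alpha> n\<rfloor>"

fun conv_denom :: "real \<Rightarrow> nat \<Rightarrow> int" where
  "conv_denom \<alpha> 0 = 1"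
| "conv_denom \<alpha> (Suc 0) = partial_quotient \<alpha> 1"
| "conv_denom \<alpha> (Suc (Suc n)) =
     partial_quotient \<alpha> (Suc (Suc n)) * conv_denom \<alpha> (Suc n) + conv_denom \<alpha> n"

definition dioph_D :: "real set" where
  "dioph_D = {\<alpha>. \<alpha> \<notin> \<rat> \<and>
     (\<exists>C::real. \<forall>n\<ge>2. real_of_int (conv_denom \<alpha> (n + 1))
        \<le> C * real_of_int (conv_denom \<alpha> n) * ln (real_of_int (conv_denom \<alpha> n)) * (ln (real n))\<^sup>2)}"

definition dioph_K :: "real \<Rightarrow> nat set" where
  "dioph_K \<alpha> = {n. real_of_int (conv_denom \<alpha> (n + 1))
     \<le> real_of_int (conv_denom \<alpha> n) * ln (real_of_int (conv_denom \<alpha> n)) powr (7 / 8)}"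

definition dioph_E :: "real set" where
  "dioph_E = {\<alpha>. \<alpha> \<notin> \<rat> \<and>
     (\<lambda>i. ln (real_of_int (conv_denom \<alpha> i)) powr (- (7 / 8))) summable_on {i. 2 \<le> i \<and> i \<notin> dioph_K \<alpha>}}"


section \<open>Local rank one\<close>

text \<open>A representation of \<open>(T\<^sub>t)\<close> as a special flow over \<open>S\<close> on \<open>Y\<close> under \<open>\<phi>\<close>, with base \<open>B\<close> of a
  tower of height \<open>H\<close>; \<open>\<Theta>\<close> is the identification of the special flow with \<open>(T\<^sub>t)\<close>. As the base
  \<open>Y \<times> {0}\<close> is viewed as a subset of the phase space \<open>X\<close>, the points of \<open>Y\<close> are taken from the
  type of the points of \<open>X\<close>.\<close>

definition tower_representation ::
  "'a measure \<Rightarrow> (real \<Rightarrow> 'a \<Rightarrow> 'a) \<Rightarrow> real \<Rightarrow> real \<Rightarrow>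
   'a measure \<Rightarrow> ('a \<Rightarrow> 'a) \<Rightarrow> ('a \<Rightarrow> real) \<Rightarrow> 'a set \<Rightarrow> ('a \<times> real \<Rightarrow> 'a) \<Rightarrow> bool" where
  "tower_representation M T \<eta> H Y S \<phi> B \<Theta> \<longleftrightarrow>
     ergodic_automorphism Y S \<and>
     \<phi> \<in> borel_measurable Y \<and> (\<forall>y\<in>space Y. 0 < \<phi> y \<and> \<phi> y \<le> H) \<and>
     B \<in> sets Y \<and> measure Y B > 1 - \<eta> \<and> (\<forall>y\<in>B. \<phi> y = H) \<and>
     flow_isomorphism (special_measure Y \<phi>) (special_flow Y S \<phi>) M T \<Theta>"

text \<open>Levels and towers as subsets of the special flow space.\<close>

definition tower_level ::
  "'a measure \<Rightarrow> ('a \<Rightarrow> 'a) \<Rightarrow> ('a \<Rightarrow> real) \<Rightarrow> 'a set \<Rightarrow> real \<Rightarrow> ('a \<times> real) set" where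
  "tower_level Y S \<phi> B s = special_flow Y S \<phi> s ` (B \<times> {0})"

definition tower ::
  "'a measure \<Rightarrow> ('a \<Rightarrow> 'a) \<Rightarrow> ('a \<Rightarrow> real) \<Rightarrow> 'a set \<Rightarrow> real \<Rightarrow> ('a \<times> real) set" where
  "tower Y S \<phi> B H = (\<Union>s\<in>{0..<H}. tower_level Y S \<phi> B s)"

text \<open>The value on a set \<open>E\<close> of the image under time \<open>s\<close> of the measure of \<open>Y = Y \<times> {0}\<close>.\<close>

definition level_measure ::
  "'a measure \<Rightarrow> ('a \<Rightarrow> 'a) \<Rightarrow> ('a \<Rightarrow> real) \<Rightarrow> real \<Rightarrow> ('a \<times> real) set \<Rightarrow> real" where
  "level_measure Y S \<phi> s E = measure Y {y \<in> space Y. special_flow Y S \<phi> s (y, 0) \<in> E}"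

definition monochromatic_level ::
  "'a measure \<Rightarrow> ('a \<Rightarrow> 'a) \<Rightarrow> ('a \<Rightarrow> real) \<Rightarrow> 'a set \<Rightarrow> ('a \<times> real \<Rightarrow> 'a) \<Rightarrow>
   real \<Rightarrow> 'a set set \<Rightarrow> real \<Rightarrow> bool" where
  "monochromatic_level Y S \<phi> B \<Theta> \<epsilon> P s \<longleftrightarrow>
     (\<exists>A\<in>P. level_measure Y S \<phi> s (tower_level Y S \<phi> B s \<inter> \<Theta> -` A)
            \<ge> (1 - \<epsilon>) * level_measure Y S \<phi> s (tower_level Y S \<phi> B s))"

definition monochromatic_tower ::
  "'a measure \<Rightarrow> ('a \<Rightarrow> 'a) \<Rightarrow> ('a \<Rightarrow> real) \<Rightarrow> 'a set \<Rightarrow> ('a \<times> real \<Rightarrow> 'a) \<Rightarrow>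
   real \<Rightarrow> real \<Rightarrow> 'a set set \<Rightarrow> bool" where
  "monochromatic_tower Y S \<phi> B \<Theta> H \<epsilon> P \<longleftrightarrow>
     measure lborel {s \<in> {0..<H}. monochromatic_level Y S \<phi> B \<Theta> \<epsilon> P s} \<ge> (1 - \<epsilon>) * H"

definition beta_rank_one :: "real \<Rightarrow> 'a measure \<Rightarrow> (real \<Rightarrow> 'a \<Rightarrow> 'a) \<Rightarrow> bool" where
  "beta_rank_one \<beta> M T \<longleftrightarrow>
     ergodic_flow M T \<and>
     (\<forall>\<epsilon>>0. \<forall>P. finite P \<and> P \<subseteq> sets M \<and> partition_on (space M) P \<longrightarrow>
        (\<exists>\<eta>\<in>{0<..<1}. \<exists>H>0. \<exists>Y S \<phi> B \<Theta>.
           tower_representation M T \<eta> H Y S \<phi> B \<Theta> \<and>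
           measure (special_measure Y \<phi>) (tower Y S \<phi> B H) > \<beta> - \<epsilon> \<and>
           monochromatic_tower Y S \<phi> B \<Theta> H \<epsilon> P))"

definition local_rank_one :: "'a measure \<Rightarrow> (real \<Rightarrow> 'a \<Rightarrow> 'a) \<Rightarrow> bool" where
  "local_rank_one M T \<longleftrightarrow> (\<exists>\<beta>. 0 < \<beta> \<and> \<beta> \<le> 1 \<and> beta_rank_one \<beta> M T)"

end

theory Submission
  imports Defs "HOL-Real_Asymp.Real_Asymp" "HOL-Number_Theory.Cong"
begin

text \<open>The proof rests on a quantitative separation of nearby orbits, \<open>drift_separation\<close>. Up to a small
proportion of the times \<open>t \<le> R\<close>, two orbits that at time \<open>t\<close> lie in a fixed large set and are close to
each other are horizontally closer than \<open>\<theta> R\<close>. Here \<open>\<theta> R\<close> is of the order \<open>R powr - b\<close>, with any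
\<open>b < 1 + \<gamma>\<close>, for Kochergin flows and \<open>1 / (R * sqrt (ln R))\<close> for Arnol'd flows, so \<open>R * \<theta> R\<close> tends to 0.

The separation is produced by the roof (\<open>base_separation\<close>, \<open>drift_separationI\<close>). Two points of the circle
at distance about \<open>2 ^ - j\<close> can remain close along the flow only at times at which their Birkhoff sums,
of equal or of different lengths, almost agree. For different lengths \<open>l\<close> and \<open>l'\<close> this forces the points
apart, since \<open>l - l'\<close> is not large and \<open>\<alpha>\<close> is Diophantine. For equal lengths it is rare. For a power
singularity (\<open>kochergin_base_separation\<close>) an orbit of length \<open>l\<close> comes within about \<open>1 / l\<close> of the
singularity, so the second derivative of the Birkhoff sum is at least about \<open>l powr (2 + \<gamma>)\<close>; by convexity
its derivative is small only on a set of small measure. For a logarithmic singularity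
(\<open>arnold_base_separation\<close>) convexity is too weak, but the asymmetry helps: the two one-sided sums of
\<open>1 / dist\<close> have the same leading term \<open>l * ln l\<close>, so the derivative has this size as long as the orbit
does not come too close to the singularity (\<open>asymmetric_derivative_sum\<close>).

A tower of a flow of local rank one supplies, on a time interval \<open>[0, R]\<close>, a family of orbits that spends
at most \<open>4 / \<beta>\<close> times the expected time in any set and whose members have, at most times, mostly the same
colour (\<open>rank_one_orbits\<close>). If the colours are small boxes, separation squeezes a quarter of the family
at some time into a box of width \<open>\<theta> R\<close> (\<open>drift_family_concentrates\<close>). This quarter then remains for a time
bounded below in a strip of measure \<open>O (\<theta> R)\<close>, hence \<open>R * \<theta> R\<close> is bounded below: a contradiction.

For two exponents \<open>\<gamma> < \<gamma>'\<close>, the orbits of an interval of length \<open>R powr - e\<close>, with \<open>e\<close> slightly larger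
than \<open>1 + \<gamma>\<close>, stay together during the time \<open>R\<close> in the first flow (\<open>kochergin_shadowing\<close>). An isomorphism
would turn them into a family of orbits of the second flow with mostly equal colours, and this family
would concentrate in a box of width \<open>\<theta> R\<close>, with \<open>R powr e * \<theta> R\<close> tending to 0. But the
isomorphism preserves the measure, and the interval is too long for that (\<open>no_common_factor\<close>).\<close>

abbreviation leb :: "real set => ennreal" where "leb \<equiv> emeasure lborel"
abbreviation \<mu> where "\<mu> \<equiv> emeasure"
abbreviation cyl :: "'a measure => ('a \<times> real) measure" where "cyl N \<equiv> N \<Otimes>\<^sub>M lborel"
abbreviation "hits N T w r A \<equiv> {y \<in> space N. T r (w y) \<in> A}"

section \<open>Continued fractions and distances to the integers\<close>

fun conv_num :: "real => nat => int" where
 "conv_num \<alpha> 0 = partial_quotient \<alpha> 0"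
| "conv_num \<alpha> (Suc 0) = partial_quotient \<alpha> 1 * partial_quotient \<alpha> 0 + 1"
| "conv_num \<alpha> (Suc (Suc n)) =
   partial_quotient \<alpha> (Suc (Suc n)) * conv_num \<alpha> (Suc n) + conv_num \<alpha> n"

lemma frac_irrational: "x \<notin> \<rat> ==> frac x \<notin> \<rat>"
 unfolding frac_def by (metis Rats_add Rats_of_int diff_add_cancel)

lemma frac_irrational_pos: "x \<notin> \<rat> ==> 0 < frac (x::real)"
 by (metis Rats_of_int frac_ge_0 frac_eq_0_iff Ints_cases order_le_less)

lemma complete_quotient_irrational: "\<alpha> \<notin> \<rat> ==> complete_quotient \<alpha> n \<notin> \<rat>"
proof (induction n)
 case (Suc n)
 have "1 / frac (complete_quotient \<alpha> n) \<in> \<rat> ==> frac (complete_quotient \<alpha> n) \<in> \<rat>"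
  using Rats_inverse by (fastforce simp: inverse_eq_divide)
 thus ?case using Suc frac_irrational by auto
qed simp

lemma complete_quotient_gt_1: "\<alpha> \<notin> \<rat> ==> 1 < complete_quotient \<alpha> (Suc n)"
 using frac_irrational_pos[OF complete_quotient_irrational[of \<alpha> n]] frac_lt_1[of "complete_quotient \<alpha> n"]
 by (simp add: field_simps)

lemma complete_quotient_eq:
 "\<alpha> \<notin> \<rat> ==> complete_quotient \<alpha> n = partial_quotient \<alpha> n + 1 / complete_quotient \<alpha> (Suc n)"
 unfolding partial_quotient_def by (simp add: frac_def)

lemma partial_quotient_ge_1: "\<alpha> \<notin> \<rat> ==> 1 <= partial_quotient \<alpha> (Suc n)"
 unfolding partial_quotient_def using complete_quotient_gt_1[of \<alpha> n] by linarith

lemma conv_denom_ge_1: "\<alpha> \<notin> \<rat> ==> 1 <= conv_denom \<alpha> n"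
proof (induction \<alpha> n rule: conv_denom.induct)
 case (3 \<alpha> n)
 have "1 * 1 <= partial_quotient \<alpha> (Suc (Suc n)) * conv_denom \<alpha> (Suc n)"
  using 3 partial_quotient_ge_1[of \<alpha> "Suc n"] by (intro mult_mono) auto
 thus ?case using 3 by simp
qed (use partial_quotient_ge_1[of _ 0] in auto)

lemma conv_denom_add_le:
 "\<alpha> \<notin> \<rat> ==> conv_denom \<alpha> (Suc n) + conv_denom \<alpha> n <= conv_denom \<alpha> (Suc (Suc n))"
 using mult_right_mono[of 1 "partial_quotient \<alpha> (Suc (Suc n))" "conv_denom \<alpha> (Suc n)"]
  partial_quotient_ge_1[of \<alpha> "Suc n"] conv_denom_ge_1[of \<alpha> "Suc n"] by simp

declare conv_denom.simps(2,3) [simp del]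

lemma convergent_determinant:
 "conv_num \<alpha> (Suc n) * conv_denom \<alpha> n - conv_num \<alpha> n * conv_denom \<alpha> (Suc n) = (-1) ^ n"
proof (induction n)
 case (Suc n)
 have "conv_num \<alpha> (Suc (Suc n)) * conv_denom \<alpha> (Suc n) - conv_num \<alpha> (Suc n) * conv_denom \<alpha> (Suc (Suc n))
  = - (conv_num \<alpha> (Suc n) * conv_denom \<alpha> n - conv_num \<alpha> n * conv_denom \<alpha> (Suc n))"
  by (simp add: algebra_simps conv_denom.simps)
 thus ?case using Suc by simp
qed (simp add: conv_denom.simps)

lemma coprime_convergent: "coprime (conv_num \<alpha> n) (conv_denom \<alpha> n)"
proof (rule coprimeI)
 fix d assume d: "d dvd conv_num \<alpha> n" "d dvd conv_denom \<alpha> n"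
 hence "d dvd conv_num \<alpha> (Suc n) * conv_denom \<alpha> n - conv_num \<alpha> n * conv_denom \<alpha> (Suc n)"
  by (meson dvd_diff dvd_mult dvd_mult2)
 thus "is_unit d" unfolding convergent_determinant
  by (metis dvd_minus_iff dvd_trans is_unit_power_iff minus_one_mult_self one_dvd dvd_mult_unit_iff' is_unit_mult_iff)
qed

text \<open>A step \<open>X = a + 1 / Y\<close> of the continued fraction algorithm preserves the shape of the equation that
 expresses \<open>\<alpha>\<close> by a complete quotient and two successive convergents.\<close>

lemma convergent_step:
 fixes \<alpha> :: real
 assumes "\<alpha> * (X * Q1 + Q0) = X * P1 + P0" "X = a + 1 / Y" "1 < Y"
 shows "\<alpha> * (Y * (a * Q1 + Q0) + Q1) = Y * (a * P1 + P0) + P1"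
proof -
 have "a * Y = Y * X - 1" using assms(2,3) by (simp add: field_simps)
 hence *: "Y * (a * U + V) + U = Y * (X * U + V)" for U V
  by (simp add: distrib_left mult.assoc[symmetric] mult.commute[of Y a] left_diff_distrib)
 show ?thesis unfolding * using assms(1) by (metis mult.left_commute)
qed

lemma complete_quotient_convergents:
 fixes \<alpha> :: real
 assumes "\<alpha> \<notin> \<rat>"
 shows "\<alpha> * (complete_quotient \<alpha> (n+2) * conv_denom \<alpha> (n+1) + conv_denom \<alpha> n)
  = complete_quotient \<alpha> (n+2) * conv_num \<alpha> (n+1) + conv_num \<alpha> n"
proof (induction n)
 case 0
 have gt: "1 < complete_quotient \<alpha> 1" "1 < complete_quotient \<alpha> 2"
  using complete_quotient_gt_1[OF assms, of 0] complete_quotient_gt_1[OF assms, of 1] by (simp_all only: One_nat_def numeral_2_eq_2)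
 have eq: "complete_quotient \<alpha> 0 = partial_quotient \<alpha> 0 + 1 / complete_quotient \<alpha> 1"
  "complete_quotient \<alpha> 1 = partial_quotient \<alpha> 1 + 1 / complete_quotient \<alpha> 2"
  using complete_quotient_eq[OF assms, of 0] complete_quotient_eq[OF assms, of 1]
  by (simp_all only: One_nat_def numeral_2_eq_2)
 have "\<alpha> * (complete_quotient \<alpha> 0 * 0 + 1) = complete_quotient \<alpha> 0 * 1 + 0" by simp
 from convergent_step[OF convergent_step[OF this eq(1) gt(1)] eq(2) gt(2)]
 show ?case by (simp add: numeral_2_eq_2 mult.commute add: conv_denom.simps del: complete_quotient.simps)
next
 case (Suc n)
 have gt: "1 < complete_quotient \<alpha> (Suc n + 2)"
  using complete_quotient_gt_1[OF assms, of "n+2"] by (simp only: add_Suc)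
 have eq: "complete_quotient \<alpha> (n+2) = partial_quotient \<alpha> (n+2) + 1 / complete_quotient \<alpha> (Suc n + 2)"
  using complete_quotient_eq[OF assms, of "n+2"] by (simp only: add_Suc)
 show ?case using convergent_step[OF Suc eq gt] by (simp add: conv_denom.simps del: complete_quotient.simps)
qed

text \<open>With \<open>Q\<close> as below, the error times \<open>Q\<close> is the determinant of two successive convergents, which is
 \<open>1\<close> in absolute value.\<close>

lemma convergent_error:
 fixes \<alpha> :: real
 assumes "\<alpha> \<notin> \<rat>"
 shows "abs (conv_denom \<alpha> (Suc n) * \<alpha> - conv_num \<alpha> (Suc n)) < 1 / conv_denom \<alpha> (Suc (Suc n))"
proof -
 define x where "x = complete_quotient \<alpha> (n+2)"
 define Q where "Q = x * conv_denom \<alpha> (n+1) + conv_denom \<alpha> n"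
 have e: "\<alpha> * Q = x * conv_num \<alpha> (n+1) + conv_num \<alpha> n"
  using complete_quotient_convergents[OF assms, of n] by (simp add: x_def Q_def)
 have "complete_quotient \<alpha> (n+2) ~= of_int z" for z
  using complete_quotient_irrational[OF assms] by (metis Rats_of_int)
 hence "real_of_int (partial_quotient \<alpha> (n+2)) < x"
  unfolding partial_quotient_def x_def using of_int_floor_le le_less by metis
 hence lt: "conv_denom \<alpha> (Suc (Suc n)) < Q"
  using conv_denom_ge_1[OF assms, of "Suc n"] unfolding Q_def by (simp add: conv_denom.simps)
 have pos: "0 < real_of_int (conv_denom \<alpha> (Suc (Suc n)))" using conv_denom_ge_1[OF assms, of "Suc (Suc n)"] by linarith
 have "(conv_denom \<alpha> (Suc n) * \<alpha> - conv_num \<alpha> (Suc n)) * Q =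
   conv_denom \<alpha> (Suc n) * (\<alpha> * Q) - conv_num \<alpha> (Suc n) * Q"
  by (simp add: left_diff_distrib)
 also have "... = - real_of_int (conv_num \<alpha> (Suc n) * conv_denom \<alpha> n - conv_num \<alpha> n * conv_denom \<alpha> (Suc n))"
  unfolding e by (simp add: Q_def algebra_simps)
 finally have "(conv_denom \<alpha> (Suc n) * \<alpha> - conv_num \<alpha> (Suc n)) * Q =
   - real_of_int (conv_num \<alpha> (Suc n) * conv_denom \<alpha> n - conv_num \<alpha> n * conv_denom \<alpha> (Suc n))" .
 hence "abs (conv_denom \<alpha> (Suc n) * \<alpha> - conv_num \<alpha> (Suc n)) * abs Q = 1"
  unfolding convergent_determinant abs_mult[symmetric] by simp
 hence "abs (conv_denom \<alpha> (Suc n) * \<alpha> - conv_num \<alpha> (Suc n)) = 1 / Q" using lt pos by (simp add: field_simps)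
 thus ?thesis using lt pos by (simp add: frac_less2)
qed

text \<open>The denominators at least double in two steps; hence the factor \<open>ln n\<close> in the growth condition is at
 most \<open>ln (4 * ln q)\<close> for the denominator \<open>q\<close> of number \<open>n\<close>.\<close>

lemma index_le_ln_conv_denom:
 fixes \<alpha> :: real
 assumes "\<alpha> \<notin> \<rat>"
 shows "real (n + 2) <= 4 * ln (conv_denom \<alpha> (n + 2)) & real (n + 3) <= 4 * ln (conv_denom \<alpha> (n + 3))"
proof (induction n)
 case 0
 have q: "conv_denom \<alpha> 1 \<ge> 1" "conv_denom \<alpha> 2 \<ge> 2" "conv_denom \<alpha> 3 \<ge> 3"
  using conv_denom_ge_1[OF assms, of 0] conv_denom_ge_1[OF assms, of 1]
   conv_denom_add_le[OF assms, of 0] conv_denom_add_le[OF assms, of 1]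
  by (auto simp: numeral_2_eq_2 numeral_3_eq_3)
 have "ln 2 <= ln (real_of_int (conv_denom \<alpha> 2))" "ln 2 <= ln (real_of_int (conv_denom \<alpha> 3))"
  "ln (3::real) <= ln (real_of_int (conv_denom \<alpha> 3))" using q by auto
 moreover have "ln (3::real) \<ge> 3/4" using ln3_gt_1 by simp
 ultimately show ?case using ln2_ge_two_thirds by (simp add: numeral_2_eq_2 numeral_3_eq_3)
next
 case (Suc n)
 have "2 * conv_denom \<alpha> (n+2) <= conv_denom \<alpha> (n+4)"
  using conv_denom_add_le[OF assms, of "n+2"] conv_denom_add_le[OF assms, of "n+1"] conv_denom_ge_1[OF assms, of "n+1"]
  by (simp add: eval_nat_numeral )
 hence "2 * real_of_int (conv_denom \<alpha> (n+2)) <= conv_denom \<alpha> (n+4)" by linarith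
 hence "ln (2 * real_of_int (conv_denom \<alpha> (n+2))) <= ln (conv_denom \<alpha> (n+4))"
  using conv_denom_ge_1[OF assms, of "n+2"] by (intro ln_mono) (auto simp del: conv_denom.simps)
 moreover have "ln (2 * real_of_int (conv_denom \<alpha> (n+2))) = ln 2 + ln (real_of_int (conv_denom \<alpha> (n+2)))"
  using conv_denom_ge_1[OF assms, of "n+2"] by (simp add: ln_mult)
 ultimately show ?case using Suc ln2_ge_two_thirds by (simp add: eval_nat_numeral )
qed

text \<open>What the proof uses about the frequency. The convergents are numbered from a late one on: then the
 factor \<open>(ln n)\<^sup>2\<close> is absorbed by an arbitrarily small power of \<open>ln (q n)\<close>, here \<open>1/16\<close>.\<close>

locale log_diophantine =
 fixes \<alpha> :: real and q :: "nat => nat" and p :: "nat => int" and C :: real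
 assumes irrational: "\<alpha> \<notin> \<rat>"
  and q_ge_2: "2 <= q n"
  and coprime_pq: "coprime (p n) (int (q n))"
  and approx: "abs (real (q n) * \<alpha> - p n) < 1 / real (q (Suc n))"
  and q_less: "q n < q (Suc n)"
  and q_add: "q n + q (Suc n) <= q (Suc (Suc n))"
  and C_pos: "0 < C"
  and q_growth: "real (q (Suc n)) <= C * q n * ln (q n) powr (17/16)"

lemma dioph_D_log_diophantine:
 assumes "\<alpha> \<in> dioph_D"
 shows "\<exists>q p C. log_diophantine \<alpha> q p C"
proof -
 have irr: "\<alpha> \<notin> \<rat>" using assms by (simp add: dioph_D_def)
 obtain C where C: "!!n. n \<ge> 2 ==> real_of_int (conv_denom \<alpha> (n + 1))
    <= C * real_of_int (conv_denom \<alpha> n) * ln (real_of_int (conv_denom \<alpha> n)) * (ln (real n))\<^sup>2"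
  using assms by (auto simp: dioph_D_def)
 have "((%x::real. (ln (4 * x))\<^sup>2 / x powr (1/16)) \<longlongrightarrow> 0) at_top" by real_asymp
 hence "eventually (%x::real. (ln (4 * x))\<^sup>2 / x powr (1/16) < 1) at_top"
  by (rule order_tendstoD) simp
 then obtain X0 where X0: "!!x::real. x \<ge> X0 ==> (ln (4 * x))\<^sup>2 / x powr (1/16) < 1"
  by (auto simp: eventually_at_top_linorder)
 obtain n0 :: nat where n0: "4 * max X0 1 <= real n0" by (meson real_arch_simple)
 hence n0': "4 <= n0" "4 * X0 <= real n0" by linarith+
 define m where "m = n0 - 2"
 have m: "n0 = Suc (Suc m)" using n0' by (simp add: m_def)
 define qq where "qq n = nat (conv_denom \<alpha> (n + n0))" for n
 have q: "int (qq n) = conv_denom \<alpha> (n + n0)" for n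
  using conv_denom_ge_1[OF irr, of "n + n0"] by (simp add: qq_def)
 hence qr: "real (qq n) = conv_denom \<alpha> (n + n0)" for n by (metis of_int_of_nat_eq)
 have lnq: "real (n + n0) <= 4 * ln (real (qq n))" for n
  using index_le_ln_conv_denom[OF irr, of "n + m"] by (simp add: qr m)
 have add: "int (qq n) + int (qq (Suc n)) <= int (qq (Suc (Suc n)))" for n
  using conv_denom_add_le[OF irr, of "n + n0"] unfolding q by (simp del: conv_denom.simps)
 have less: "int (qq n) < int (qq (Suc n))" for n
  using conv_denom_add_le[OF irr, of "n + Suc m"] conv_denom_ge_1[OF irr, of "n + Suc m"] unfolding q m by simp
 have "log_diophantine \<alpha> qq (%n. conv_num \<alpha> (n + n0)) (max C 1)"
 proof
  fix n
  show "coprime (conv_num \<alpha> (n + n0)) (int (qq n))" unfolding q by (rule coprime_convergent)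
  show "abs (real (qq n) * \<alpha> - conv_num \<alpha> (n + n0)) < 1 / real (qq (Suc n))"
   using convergent_error[OF irr, of "n + Suc m"] unfolding qr m by (simp del: conv_num.simps)
  show "qq n < qq (Suc n)" using less[of n] by simp
  show "qq n + qq (Suc n) <= qq (Suc (Suc n))" using add[of n] by simp
  show "2 <= qq n"
  proof -
   have "0 < real (n + n0)" using n0' by simp
   hence "0 < ln (qq n)" using lnq[of n] by linarith
   thus ?thesis by (cases "qq n"; cases "qq n - 1") auto
  qed
  define x where "x = ln (qq n)"
  have x: "real (n + n0) <= 4 * x" "X0 <= x" "1 <= x"
   using lnq[of n] unfolding x_def using n0' by linarith+
  have "(ln (real (n + n0)))\<^sup>2 <= (ln (4 * x))\<^sup>2"
   using x n0' by (intro power_mono ln_mono) auto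
  also have "... <= x powr (1/16)" using X0[OF x(2)] x by (simp add: field_simps)
  finally have l: "(ln (real (n + n0)))\<^sup>2 <= x powr (1/16)" .
  have "real (qq (Suc n)) <= C * qq n * x * (ln (real (n + n0)))\<^sup>2"
   using C[of "n + n0"] n0' by (simp add: qr x_def del: conv_denom.simps)
  also have "... <= max C 1 * qq n * x * (ln (real (n + n0)))\<^sup>2"
   using x by (intro mult_right_mono) auto
  also have "... <= max C 1 * qq n * x * x powr (1/16)"
   using x l by (intro mult_left_mono) auto
  also have "... = max C 1 * qq n * x powr (17/16)"
   using x powr_add[of x 1 "1/16"] by (simp add: mult.assoc)
  finally show "real (qq (Suc n)) <= max C 1 * qq n * ln (qq n) powr (17/16)" by (simp add: x_def)
 qed (use irr in auto)
 thus ?thesis by blast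
qed

context log_diophantine begin

abbreviation "rq n \<equiv> real (q n)"

lemma q_pos: "0 < rq n" using q_ge_2[of n] by simp

lemma q_ge_index: "n <= q n" by (induction n) (use q_less Suc_leI le_less_trans in \<open>blast+\<close>)

text \<open>The convergent with denominator \<open>q n\<close> misses the integers by at least \<open>1 / q n\<close> at all
 multiples below \<open>q n\<close>. The error it makes is at most \<open>1 / q (n + 1)\<close>, which is a proper fraction of that
 unless \<open>q (n + 1)\<close> is close to \<open>q n\<close>; in that case the next convergent does the job.\<close>

lemma dist_integer_ge_aux:
 assumes "k ~= 0" "abs k < int (q n)"
 shows "1 / rq n - 1 / rq (Suc n) <= abs (of_int k * \<alpha> - of_int z)"
proof -
 have "\<not> int (q n) dvd k" using assms zdvd_imp_le[of "int (q n)" "abs k"] by auto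
 hence "\<not> int (q n) dvd k * p n" using coprime_pq[of n]
  by (simp add: coprime_dvd_mult_left_iff coprime_commute)
 hence "k * p n - z * int (q n) ~= 0" by (metis dvd_triv_right eq_iff_diff_eq_0)
 hence "1 <= abs (k * p n - z * int (q n))" by linarith
 hence "1 <= abs (real_of_int (k * p n - z * int (q n)))" by linarith
 also have "... = q n * abs (k * (p n / q n) - z)"
  using q_pos[of n] by (simp add: abs_mult[symmetric] abs_of_pos field_simps)
 finally have 1: "1 / q n <= abs (k * (p n / q n) - z)" using q_pos[of n] by (simp add: field_simps)
 have "abs (k * \<alpha> - k * (p n / q n)) * q n = abs (real_of_int k) * abs (q n * \<alpha> - p n)"
 proof -
  have "(k * \<alpha> - k * (p n / q n)) * q n = k * (q n * \<alpha> - p n)" using q_pos[of n] by (simp add: field_simps)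
  thus ?thesis by (metis abs_mult abs_of_nat)
 qed
 also have "... <= rq n * (1 / rq (Suc n))"
 proof (rule mult_mono)
  show "abs (real_of_int k) <= rq n" using assms(2) by linarith
 qed (use approx[of n] in auto)
 finally have "abs (k * \<alpha> - k * (p n / q n)) <= 1 / rq (Suc n)" using q_pos[of n] by (simp add: field_simps)
 thus ?thesis using 1 by linarith
qed

lemma dist_integer_ge:
 assumes "k ~= 0" "abs k < int (q n)"
 shows "1 / (4 * rq n) <= abs (of_int k * \<alpha> - of_int z)"
proof (cases "3 * q n <= 2 * q (Suc n)")
 case True
 hence "3 * rq n <= 2 * rq (Suc n)" by linarith
 hence "1 / (4 * rq n) <= 1 / rq n - 1 / rq (Suc n)"
  using q_pos[of n] q_pos[of "Suc n"] by (simp add: field_simps)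
 thus ?thesis using dist_integer_ge_aux[OF assms] by (meson order_trans)
next
 case False
 hence 1: "2 * rq (Suc n) < 3 * rq n" by linarith
 have "rq n + q (Suc n) <= q (Suc (Suc n))" using q_add[of n] by linarith
 hence "5/3 * rq (Suc n) <= q (Suc (Suc n))" using 1 by linarith
 hence "1 / real (q (Suc (Suc n))) <= 3/5 * (1 / rq (Suc n))"
  using q_pos[of "Suc n"] q_pos[of "Suc (Suc n)"] by (simp add: field_simps)
 moreover have "2/3 * (1 / rq n) <= 1 / rq (Suc n)"
  using 1 q_pos[of n] q_pos[of "Suc n"] by (simp add: field_simps)
 moreover have "1 / (4 * rq n) <= 4/15 * (1 / rq n)" using q_pos[of n] by (simp add: field_simps)
 moreover have "abs k < int (q (Suc n))" using assms(2) q_less[of n] by linarith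
 ultimately show ?thesis using dist_integer_ge_aux[OF assms(1), of "Suc n" z] by linarith
qed

lemma denominator_at_scale:
 assumes "rq 0 <= y"
 obtains n where "rq n <= y" "y < rq (Suc n)"
proof -
 obtain m where m: "y < rq m" using q_ge_index by (meson le_less_trans not_le of_nat_mono reals_Archimedean2 order_less_le_trans)
 define n where "n = (LEAST m. y < rq m)"
 have n: "y < rq n" unfolding n_def using m by (rule LeastI)
 hence "n ~= 0" using assms by (metis not_le)
 then obtain k where k: "n = Suc k" using not0_implies_Suc by blast
 hence "\<not> y < rq k" using not_less_Least[of k "%m. y < rq m"] n_def by auto
 thus ?thesis using that[of k] n k by auto
qed

text \<open>The first \<open>q n\<close> points of an orbit lie within \<open>1 / q n\<close> of the points of a translate of the
 grid of mesh \<open>1 / q n\<close>, each of them used once.\<close>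

lemma grid_residues:
 "bij_betw (%i. (X + int i * p n) mod int (q n)) {..<q n} {0..<int (q n)}"
proof -
 have inj: "inj_on (%i. (X + int i * p n) mod int (q n)) {..<q n}"
 proof (rule inj_onI)
  fix i j assume ij: "i \<in> {..<q n}" "j \<in> {..<q n}" "(X + int i * p n) mod int (q n) = (X + int j * p n) mod int (q n)"
  hence "int (q n) dvd (int i - int j) * p n" by (simp add: mod_eq_dvd_iff algebra_simps)
  hence "int (q n) dvd (int i - int j)" using coprime_pq[of n]
   by (simp add: coprime_dvd_mult_left_iff coprime_commute)
  thus "i = j" using ij(1,2) zdvd_imp_le[of "int (q n)" "abs (int i - int j)"] by (cases "i = j") auto
 qed
 moreover have "(%i. (X + int i * p n) mod int (q n)) ` {..<q n} <= {0..<int (q n)}"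
  using q_ge_2[of n] by auto
 moreover have "card ((%i. (X + int i * p n) mod int (q n)) ` {..<q n}) = card {0..<int (q n)}"
  using card_image[OF inj] by simp
 ultimately show ?thesis unfolding bij_betw_def by (metis card_subset_eq finite_atLeastLessThan_int)
qed

lemma grid_point:
 assumes "i < q n"
 obtains e where "-1 < e" "e < 2" "x + real i * \<alpha> = (real_of_int (\<lfloor>rq n * x\<rfloor> + int i * p n) + e) / q n"
proof -
 define d where "d = rq n * \<alpha> - p n"
 have d: "abs (real i * d) < 1"
 proof -
  have "abs (real i * d) <= rq n * abs d" using assms by (simp add: abs_mult mult_right_mono)
  also have "... < rq n * (1 / rq (Suc n))" using approx[of n] q_pos[of n] unfolding d_def by (intro mult_strict_left_mono)
  also have "... <= 1" using q_less[of n] by simp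
  finally show ?thesis .
 qed
 have "x + real i * \<alpha> = (real_of_int (\<lfloor>rq n * x\<rfloor> + int i * p n) + (frac (rq n * x) + real i * d)) / q n"
  using q_pos[of n] by (simp add: frac_def d_def field_simps)
 moreover have "-1 < frac (rq n * x) + real i * d" "frac (rq n * x) + real i * d < 2"
  using d frac_ge_0[of "rq n * x"] frac_lt_1[of "rq n * x"] by linarith+
 ultimately show ?thesis using that by blast
qed

lemma orbit_close_to_integer:
 obtains i z where "i < q n" "abs (x + real i * \<alpha> - of_int z) <= 2 / q n"
proof -
 have "0 \<in> {0..<int (q n)}" using q_ge_2[of n] by auto
 hence "0 \<in> (%i. (\<lfloor>rq n * x\<rfloor> + int i * p n) mod int (q n)) ` {..<q n}"
  unfolding bij_betw_imp_surj_on[OF grid_residues] .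
 then obtain i where i: "i < q n" "(\<lfloor>rq n * x\<rfloor> + int i * p n) mod int (q n) = 0"
  unfolding image_iff by fastforce
 then obtain z where z: "\<lfloor>rq n * x\<rfloor> + int i * p n = int (q n) * z" by auto
 obtain e where e: "-1 < e" "e < 2" "x + real i * \<alpha> = (real_of_int (\<lfloor>rq n * x\<rfloor> + int i * p n) + e) / q n"
  using grid_point[OF i(1)] .
 hence "x + real i * \<alpha> - z = e / q n" using q_pos[of n] unfolding z by (simp add: field_simps)
 moreover have "abs (e / q n) <= 2 / q n" using e(1,2) q_pos[of n] by (simp add: divide_right_mono)
 ultimately show ?thesis using that[OF i(1), of z] by simp
qed

lemma ln_powr_le:
 fixes \<sigma> b :: real
 assumes "0 < \<sigma>" "0 <= b"
 obtains K where "1 <= K" "!!x. 1 <= x ==> ln x powr b <= K * x powr \<sigma>"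
proof -
 have "((%x::real. ln x powr b / x powr \<sigma>) \<longlongrightarrow> 0) at_top" using assms by real_asymp
 hence "eventually (%x::real. ln x powr b / x powr \<sigma> < 1) at_top"
  by (rule order_tendstoD) simp
 then obtain X0 where X0: "!!x::real. x \<ge> X0 ==> ln x powr b / x powr \<sigma> < 1"
  by (auto simp: eventually_at_top_linorder)
 define K where "K = max 1 (ln (max X0 1) powr b)"
 show thesis
 proof (rule that[of K])
  fix x :: real assume x: "1 <= x"
  hence xp: "1 <= x powr \<sigma>" using assms by (simp add: ge_one_powr_ge_zero)
  show "ln x powr b <= K * x powr \<sigma>"
  proof (cases "X0 <= x")
   case True
   hence "ln x powr b <= 1 * x powr \<sigma>" using X0[of x] xp by (simp add: divide_less_eq split: if_splits)
   also have "... <= K * x powr \<sigma>" by (intro mult_right_mono) (auto simp: K_def)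
   finally show ?thesis .
  next
   case False
   hence "ln x powr b <= ln (max X0 1) powr b" using x assms by (intro powr_mono2) auto
   also have "... <= K * 1" by (simp add: K_def)
   also have "... <= K * x powr \<sigma>" using xp by (intro mult_left_mono) (auto simp: K_def)
   finally show ?thesis .
  qed
 qed (simp add: K_def)
qed

text \<open>The growth condition leaves to \<open>\<alpha>\<close> the best possible Diophantine exponent \<open>1\<close>, up to \<open>\<sigma>\<close>.\<close>

lemma dist_integer_ge_powr:
 assumes "0 < \<sigma>"
 obtains c where "0 < c" "!!k z. k ~= 0 ==> c / abs (real_of_int k) powr (1 + \<sigma>) <= abs (of_int k * \<alpha> - of_int z)"
proof -
 obtain K where K: "1 <= K" "!!x::real. 1 <= x ==> ln x powr (17/16) <= K * x powr \<sigma>"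
  using ln_powr_le[of \<sigma> "17/16"] assms by auto
 define c where "c = min (1 / (4 * rq 0)) (1 / (4 * C * K))"
 have c: "0 < c" "c <= 1 / (4 * rq 0)" "c <= 1 / (4 * C * K)"
  using q_pos[of 0] C_pos K(1) by (auto simp: c_def)
 show thesis
 proof (rule that[OF c(1)])
  fix k z :: int assume k: "k ~= 0"
  hence k1: "1 <= abs (real_of_int k)" by linarith
  hence kp: "1 <= abs (real_of_int k) powr (1 + \<sigma>)" using assms by (simp add: ge_one_powr_ge_zero)
  show "c / abs (real_of_int k) powr (1 + \<sigma>) <= abs (of_int k * \<alpha> - of_int z)"
  proof (cases "rq 0 <= abs (real_of_int k)")
   case False
   hence "abs k < int (q 0)" by linarith
   hence "1 / (4 * rq 0) <= abs (of_int k * \<alpha> - of_int z)" by (rule dist_integer_ge[OF k])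
   moreover have "c / abs (real_of_int k) powr (1 + \<sigma>) <= c" using c(1) kp
    by (simp add: divide_le_eq mult_le_cancel_left1)
   ultimately show ?thesis using c(2) by linarith
  next
   case True
   then obtain n where n: "rq n <= abs (real_of_int k)" "abs (real_of_int k) < rq (Suc n)"
    using denominator_at_scale by blast
   from n(2) have "abs k < int (q (Suc n))" by linarith
   hence 1: "1 / (4 * rq (Suc n)) <= abs (of_int k * \<alpha> - of_int z)" by (rule dist_integer_ge[OF k])
   have "rq (Suc n) <= C * q n * ln (q n) powr (17/16)" by (rule q_growth)
   also have "... <= C * q n * (K * q n powr \<sigma>)"
    using C_pos q_ge_2[of n] by (intro mult_left_mono K(2)) auto
   also have "... = C * K * q n powr (1 + \<sigma>)" using q_pos[of n] by (simp add: powr_add)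
   also have "... <= C * K * abs (real_of_int k) powr (1 + \<sigma>)"
    using C_pos K(1) n(1) assms by (intro mult_left_mono powr_mono2) auto
   finally have "4 * rq (Suc n) <= 4 * C * K * abs (real_of_int k) powr (1 + \<sigma>)" by simp
   hence "1 / (4 * C * K * abs (real_of_int k) powr (1 + \<sigma>)) <= 1 / (4 * rq (Suc n))"
    using q_pos[of "Suc n"] by (intro divide_left_mono) (use C_pos K(1) kp in \<open>auto intro!: mult_pos_pos\<close>)
   moreover have "c / abs (real_of_int k) powr (1 + \<sigma>) <= (1 / (4 * C * K)) / abs (real_of_int k) powr (1 + \<sigma>)"
    using c(3) kp by (intro divide_right_mono) auto
   ultimately show ?thesis using 1 by simp
  qed
 qed
qed

end

section \<open>Roof functions and their Birkhoff sums\<close>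

lemma tendsto_ratio_bound:
 fixes g H :: "'a => real"
 assumes "((%x. g x / H x) \<longlongrightarrow> A) F" "0 < eps" "eventually (%x. 0 < H x) F"
 shows "eventually (%x. abs (g x - A * H x) <= eps * H x) F"
proof -
 have "eventually (%x. dist (g x / H x) A < eps) F" using assms(1,2) by (rule tendstoD)
 thus ?thesis using assms(3)
 proof eventually_elim
  case (elim x)
  have "g x - A * H x = (g x / H x - A) * H x" using elim(2) by (simp add: field_simps)
  hence "abs (g x - A * H x) = abs (g x / H x - A) * H x" using elim(2) by (simp add: abs_mult)
  also have "... <= eps * H x" using elim by (intro mult_right_mono) (auto simp: dist_real_def)
  finally show ?case .
 qed
qed

text \<open>A function with one-sided singularities of type \<open>H\<close> at both ends of \<open>(0,1)\<close> is its leading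
 part up to a small multiple of \<open>H\<close> and a bounded error, uniformly on \<open>(0,1)\<close>.\<close>

lemma two_sided_singularity_bound:
 fixes g H :: "real => real"
 assumes g: "continuous_on {0<..<1} g" and H: "continuous_on {0<..1} H" and Hpos: "!!x. x \<in> {0<..1} ==> 0 < H x"
  and A: "((%x. g x / H x) \<longlongrightarrow> A) (at_right 0)"
  and B: "((%x. g x / H (1 - x)) \<longlongrightarrow> B) (at_left 1)" and eps: "0 < eps"
 shows "\<exists>C>0. \<forall>x\<in>{0<..<1}. abs (g x - A * H x - B * H (1 - x)) <= eps * (H x + H (1 - x)) + C"
proof -
 have "eventually (%x::real. 0 < x & x < 1) (at_right 0)"
  unfolding eventually_at_right_field by (intro exI[of _ 1]) auto
 hence "eventually (%x. 0 < H x) (at_right 0)"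
  by eventually_elim (use Hpos in auto)
 hence "eventually (%x. abs (g x - A * H x) <= eps * H x) (at_right 0)"
  by (rule tendsto_ratio_bound[OF A eps])
 then obtain d1 where d1: "0 < d1" "!!x. 0 < x ==> x < d1 ==> abs (g x - A * H x) <= eps * H x"
  unfolding eventually_at_right_field by auto
 have "eventually (%x::real. 0 < x & x < 1) (at_left 1)"
  unfolding eventually_at_left_field by (intro exI[of _ 0]) auto
 hence "eventually (%x. 0 < H (1 - x)) (at_left 1)"
  by eventually_elim (use Hpos in auto)
 hence "eventually (%x. abs (g x - B * H (1 - x)) <= eps * H (1 - x)) (at_left 1)"
  by (rule tendsto_ratio_bound[OF B eps])
 then obtain d2 where d2: "d2 < 1" "!!x. d2 < x ==> x < 1 ==> abs (g x - B * H (1 - x)) <= eps * H (1 - x)"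
  unfolding eventually_at_left_field by auto
 define d where "d = min (min d1 (1 - d2)) (1/2)"
 have d: "0 < d" "d <= d1" "d <= 1 - d2" "d <= 1/2" using d1(1) d2(1) unfolding d_def by linarith+
 have "compact (H ` {d..1})"
  using d(1) by (intro compact_continuous_image continuous_on_subset[OF H]) auto
 from compact_imp_bounded[OF this] obtain K where "\<forall>y\<in>H ` {d..1}. norm y <= K" unfolding bounded_iff by blast
 hence K: "!!x. x \<in> {d..1} ==> abs (H x) <= K" by auto
 have "compact (g ` {d..1-d})"
  using d(1) by (intro compact_continuous_image continuous_on_subset[OF g]) auto
 from compact_imp_bounded[OF this] obtain L where "\<forall>y\<in>g ` {d..1-d}. norm y <= L" unfolding bounded_iff by blast
 hence L: "!!x. x \<in> {d..1-d} ==> abs (g x) <= L" by auto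
 have K0: "0 <= K" using K[of 1] d(4) by fastforce
 have L0: "0 <= L" using L[of d] d(4) by fastforce
 define C where "C = L + abs A * K + abs B * K + 1"
 have AK: "0 <= abs A * K" "0 <= abs B * K" using K0 by auto
 show ?thesis
 proof (intro exI[of _ C] conjI ballI)
  show "0 < C" using L0 AK by (simp add: C_def)
 next
  fix x :: real assume x: "x \<in> {0<..<1}"
  have Hx: "0 < H x" "0 < H (1 - x)" using Hpos x by auto
  hence eH: "0 <= eps * H x" "0 <= eps * H (1 - x)" using eps by auto
  have AH: "abs (A * H x) <= abs A * K" if "d <= x" using K[of x] that x by (auto simp: abs_mult intro: mult_left_mono)
  have BH: "abs (B * H (1 - x)) <= abs B * K" if "x <= 1 - d"
   using K[of "1 - x"] that x by (auto simp: abs_mult intro: mult_left_mono)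
  consider "x < d" | "1 - d < x" | "d <= x" "x <= 1 - d" by linarith
  thus "abs (g x - A * H x - B * H (1 - x)) <= eps * (H x + H (1 - x)) + C"
  proof cases
   case 1
   have "abs (g x - A * H x) <= eps * H x" using d1(2)[of x] x 1 d by auto
   thus ?thesis using BH 1 d(4) eH AK L0 unfolding C_def distrib_left by linarith
  next
   case 2
   have "abs (g x - B * H (1 - x)) <= eps * H (1 - x)" using d2(2)[of x] x 2 d by auto
   thus ?thesis using AH 2 d(4) eH AK L0 unfolding C_def distrib_left by linarith
  next
   case 3
   thus ?thesis using AH BH L[of x] eH unfolding C_def distrib_left by auto
  qed
 qed
qed

lemma C2_on_unit_intervalD:
 assumes "C2_on_unit_interval f" "x \<in> {0<..<1}"
 shows "(f has_real_derivative deriv f x) (at x)" "(deriv f has_real_derivative deriv (deriv f) x) (at x)"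
 using assms by (simp_all add: C2_on_unit_interval_def DERIV_deriv_iff_real_differentiable)

lemma C2_on_unit_interval_continuous:
 assumes "C2_on_unit_interval f"
 shows "continuous_on {0<..<1} f" "continuous_on {0<..<1} (deriv f)" "continuous_on {0<..<1} (deriv (deriv f))"
proof -
 have "isCont f x" "isCont (deriv f) x" if "x \<in> {0<..<1}" for x
  using C2_on_unit_intervalD[OF assms that] DERIV_isCont by blast+
 thus "continuous_on {0<..<1} f" "continuous_on {0<..<1} (deriv f)"
  by (auto intro!: continuous_at_imp_continuous_on)
qed (use assms in \<open>simp add: C2_on_unit_interval_def\<close>)

lemma deriv_powr: "0 < x ==> deriv (%x. c * x powr s) x = c * (s * x powr (s - 1))" for x s c :: real
 by (rule DERIV_imp_deriv) (auto intro!: derivative_eq_intros)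

lemma deriv2_powr: "0 < x ==> deriv (deriv (%x. x powr s)) x = s * ((s - 1) * x powr (s - 2))" for x s :: real
proof -
 assume x: "0 < x"
 hence "eventually (%y. y \<in> {0<..}) (nhds x)" by (intro eventually_nhds_in_open) auto
 hence "eventually (%y. deriv (%x. x powr s) y = s * y powr (s - 1)) (nhds x)"
  by eventually_elim (use deriv_powr[of _ 1 s] in auto)
 hence "deriv (deriv (%x. x powr s)) x = deriv (%y. s * y powr (s - 1)) x" by (intro deriv_cong_ev refl)
 thus ?thesis using deriv_powr[OF x, of s "s - 1"] by simp
qed

lemma deriv_minus_ln: "0 < x ==> deriv (%x. - ln x) x = - (1 / x)" for x :: real
 by (rule DERIV_imp_deriv) (auto intro!: derivative_eq_intros)

lemma positive_lower_bound:
 fixes f :: "real => real"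
 assumes f: "continuous_on {0<..<1} f" and pos: "!!x. x \<in> {0<..<1} ==> 0 < f x"
  and r: "filterlim f at_top (at_right 0)" and l: "filterlim f at_top (at_left 1)"
 obtains c where "0 < c" "!!x. x \<in> {0<..<1} ==> c <= f x"
proof -
 have "eventually (%x. 1 <= f x) (at_right 0)" "eventually (%x. 1 <= f x) (at_left 1)"
  using r l by (auto simp: filterlim_at_top)
 then obtain d1 d2 where d1: "0 < d1" "!!x. 0 < x ==> x < d1 ==> 1 <= f x"
  and d2: "d2 < 1" "!!x. d2 < x ==> x < 1 ==> 1 <= f x"
  unfolding eventually_at_right_field eventually_at_left_field by auto
 define d where "d = min (min d1 (1 - d2)) (1/2)"
 have d: "0 < d" "d <= d1" "d <= 1 - d2" "d <= 1/2" using d1(1) d2(1) unfolding d_def by linarith+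
 have "compact {d..1-d}" "{d..1-d} ~= {}" "continuous_on {d..1-d} f"
  using d by (auto intro: continuous_on_subset[OF f])
 then obtain m where m: "m \<in> {d..1-d}" "!!x. x \<in> {d..1-d} ==> f m <= f x"
  using continuous_attains_inf[of "{d..1-d}" f] by blast
 show thesis
 proof (rule that[of "min 1 (f m)"])
  show "0 < min 1 (f m)" using pos[of m] m(1) d by auto
  fix x :: real assume "x \<in> {0<..<1}"
  thus "min 1 (f m) <= f x" using d1(2)[of x] d2(2)[of x] m(2)[of x] d by fastforce
 qed
qed

lemma singular_roof_lower_bound:
 assumes "singular_roof h f A B"
  and h: "filterlim h at_top (at_right 0)" "filterlim (%x. h (1 - x)) at_top (at_left 1)"
 obtains c where "0 < c" "!!x. x \<in> {0<..<1} ==> c <= f x"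
proof (rule positive_lower_bound[of f])
 have AB: "0 < A 1" "0 < B 1" "((%x. f x / h x) \<longlongrightarrow> A 1) (at_right 0)"
  "((%x. f x / h (1 - x)) \<longlongrightarrow> B 1) (at_left 1)"
  using assms(1) by (auto simp: singular_roof_def)
 have "filterlim (%x. (f x / h x) * h x) at_top (at_right 0)"
  by (rule filterlim_tendsto_pos_mult_at_top[OF AB(3,1) h(1)])
 moreover have "eventually (%x. (f x / h x) * h x = f x) (at_right 0)"
  using filterlim_at_top_dense[THEN iffD1, OF h(1), rule_format, of 0] by eventually_elim auto
 ultimately show "filterlim f at_top (at_right 0)" by (simp cong: filterlim_cong)
 have "filterlim (%x. (f x / h (1 - x)) * h (1 - x)) at_top (at_left 1)"
  by (rule filterlim_tendsto_pos_mult_at_top[OF AB(4,2) h(2)])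
 moreover have "eventually (%x. (f x / h (1 - x)) * h (1 - x) = f x) (at_left 1)"
  using filterlim_at_top_dense[THEN iffD1, OF h(2), rule_format, of 0] by eventually_elim auto
 ultimately show "filterlim f at_top (at_left 1)" by (simp cong: filterlim_cong)
qed (use assms(1) C2_on_unit_interval_continuous that in \<open>auto simp: singular_roof_def\<close>)

lemma tendsto_div_at_ends:
 fixes g :: "real => real"
 assumes h: "!!x. x \<in> {0<..<1} ==> h x = k * H x" and k: "k ~= 0"
 shows "((%x. g x / h x) \<longlongrightarrow> L) (at_right 0) ==> ((%x. g x / H x) \<longlongrightarrow> k * L) (at_right 0)"
  and "((%x. g x / h (1 - x)) \<longlongrightarrow> L) (at_left 1) ==> ((%x. g x / H (1 - x)) \<longlongrightarrow> k * L) (at_left 1)"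
proof -
 assume "((%x. g x / h x) \<longlongrightarrow> L) (at_right 0)"
 hence "((%x. k * (g x / h x)) \<longlongrightarrow> k * L) (at_right 0)" by (intro tendsto_intros)
 moreover have "eventually (%x. k * (g x / h x) = g x / H x) (at_right 0)"
  unfolding eventually_at_right_field using h k by (intro exI[of _ 1]) auto
 ultimately show "((%x. g x / H x) \<longlongrightarrow> k * L) (at_right 0)" by (rule Lim_transform_eventually)
next
 assume "((%x. g x / h (1 - x)) \<longlongrightarrow> L) (at_left 1)"
 hence "((%x. k * (g x / h (1 - x))) \<longlongrightarrow> k * L) (at_left 1)" by (intro tendsto_intros)
 moreover have "eventually (%x. k * (g x / h (1 - x)) = g x / H (1 - x)) (at_left 1)"
  unfolding eventually_at_left_field using h k by (intro exI[of _ 0]) auto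
 ultimately show "((%x. g x / H (1 - x)) \<longlongrightarrow> k * L) (at_left 1)" by (rule Lim_transform_eventually)
qed

text \<open>The constants in the following bounds are uniform on \<open>(0,1)\<close>.\<close>

lemma kochergin_roof_bounds:
 assumes "kochergin_roof \<gamma> f"
 obtains c C where "0 < c" "0 < C"
  "!!x. x \<in> {0<..<1} ==> c <= f x"
  "!!x. x \<in> {0<..<1} ==> f x <= C * (x powr (-\<gamma>) + (1 - x) powr (-\<gamma>))"
  "!!x. x \<in> {0<..<1} ==> abs (deriv f x) <= C * (x powr (-\<gamma>-1) + (1 - x) powr (-\<gamma>-1))"
  "!!x. x \<in> {0<..<1} ==> c * (x powr (-\<gamma>-2) + (1 - x) powr (-\<gamma>-2)) - C <= deriv (deriv f) x"
proof -
 obtain A B where roof: "singular_roof (%x. x powr (- \<gamma>)) f A B" and \<gamma>: "0 < \<gamma>" "\<gamma> < 1"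
  using assms by (auto simp: kochergin_roof_def)
 hence C2: "C2_on_unit_interval f" and AB: "0 < A 1" "0 < A 2" "0 < A 3" "0 < B 1" "0 < B 2" "0 < B 3"
  by (auto simp: singular_roof_def)
 note cont = C2_on_unit_interval_continuous[OF C2]
 obtain c1 where c1: "0 < c1" "!!x. x \<in> {0<..<1} ==> c1 <= f x"
 proof (rule singular_roof_lower_bound[OF roof])
  show "filterlim (%x::real. x powr (- \<gamma>)) at_top (at_right 0)" using \<gamma> by real_asymp
  show "filterlim (%x::real. (1 - x) powr (- \<gamma>)) at_top (at_left 1)" using \<gamma> by real_asymp
 qed blast
 have H: "continuous_on {0<..1} (%x::real. x powr s)" "!!x. x \<in> {0<..1} ==> 0 < (x::real) powr s" for s
  by (auto intro!: continuous_intros)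
 have d1: "deriv (%x. x powr -\<gamma>) x = (-\<gamma>) * x powr (-\<gamma>-1)" if "x \<in> {0<..<1}" for x :: real
  using deriv_powr[of x 1 "-\<gamma>"] that by simp
 have d2: "deriv (deriv (%x. x powr -\<gamma>)) x = (\<gamma> * (\<gamma> + 1)) * x powr (-\<gamma>-2)" if "x \<in> {0<..<1}" for x :: real
  using deriv2_powr[of x "-\<gamma>"] that by (simp add: algebra_simps)
 have "((%x. f x / x powr (-\<gamma>)) \<longlongrightarrow> A 1) (at_right 0)" "((%x. f x / (1 - x) powr (-\<gamma>)) \<longlongrightarrow> B 1) (at_left 1)"
  using roof by (auto simp: singular_roof_def)
 from two_sided_singularity_bound[OF cont(1) H(1)[of "-\<gamma>"] H(2) this, of 1]
 obtain C1 where C1: "0 < C1" "!!x. x \<in> {0<..<1} ==> abs (f x - A 1 * x powr -\<gamma> - B 1 * (1 - x) powr -\<gamma>) <= 1 * (x powr -\<gamma> + (1 - x) powr -\<gamma>) + C1"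
  by auto
 have l1: "((%x. deriv f x / x powr (-\<gamma>-1)) \<longlongrightarrow> (-\<gamma>) * A 2) (at_right 0)"
  using roof by (intro tendsto_div_at_ends(1)[OF d1]) (use \<gamma> in \<open>auto simp: singular_roof_def\<close>)
 have l2: "((%x. deriv f x / (1 - x) powr (-\<gamma>-1)) \<longlongrightarrow> (-\<gamma>) * (- B 2)) (at_left 1)"
  using roof by (intro tendsto_div_at_ends(2)[OF d1]) (use \<gamma> in \<open>auto simp: singular_roof_def\<close>)
 from two_sided_singularity_bound[OF cont(2) H(1)[of "-\<gamma>-1"] H(2) l1 l2, of 1] obtain C2 where C2: "0 < C2" "!!x. x \<in> {0<..<1} ==>
   abs (deriv f x - ((-\<gamma>) * A 2) * x powr (-\<gamma>-1) - ((-\<gamma>) * (- B 2)) * (1 - x) powr (-\<gamma>-1)) <= 1 * (x powr (-\<gamma>-1) + (1 - x) powr (-\<gamma>-1)) + C2"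
  by auto
 define A' where "A' = \<gamma> * (\<gamma> + 1) * A 3"
 define B' where "B' = \<gamma> * (\<gamma> + 1) * B 3"
 define e where "e = min A' B' / 2"
 have e: "0 < e" "e <= A' / 2" "e <= B' / 2" using AB \<gamma> by (auto simp: e_def A'_def B'_def)
 have l3: "((%x. deriv (deriv f) x / x powr (-\<gamma>-2)) \<longlongrightarrow> A') (at_right 0)"
  unfolding A'_def using roof by (intro tendsto_div_at_ends(1)[OF d2]) (use \<gamma> in \<open>auto simp: singular_roof_def\<close>)
 have l4: "((%x. deriv (deriv f) x / (1 - x) powr (-\<gamma>-2)) \<longlongrightarrow> B') (at_left 1)"
  unfolding B'_def using roof by (intro tendsto_div_at_ends(2)[OF d2]) (use \<gamma> in \<open>auto simp: singular_roof_def\<close>)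
 from two_sided_singularity_bound[OF cont(3) H(1)[of "-\<gamma>-2"] H(2) l3 l4 e(1)] obtain C3 where C3: "0 < C3" "!!x. x \<in> {0<..<1} ==>
   abs (deriv (deriv f) x - A' * x powr (-\<gamma>-2) - B' * (1 - x) powr (-\<gamma>-2)) <= e * (x powr (-\<gamma>-2) + (1 - x) powr (-\<gamma>-2)) + C3"
  by auto
 define C where "C = A 1 + B 1 + 1 + C1 + \<gamma> * A 2 + \<gamma> * B 2 + 1 + C2 + C3"
 define c where "c = min c1 e"
 have gA: "0 < \<gamma> * A 2" "0 < \<gamma> * B 2" using AB \<gamma> by auto
 have *: "A0 * u + B0 * v + (1 * (u + v) + K) <= C * (u + v)"
  if "1 <= u" "1 <= v" "A0 + B0 + 1 + K <= C" "0 <= A0" "0 <= B0" "0 <= K" for u v A0 B0 K :: real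
 proof -
  have "A0 * u + B0 * v + (1 * (u + v) + K) <= A0 * (u + v) + B0 * (u + v) + (1 * (u + v) + K * (u + v))"
   using that by (intro add_mono mult_left_mono) (auto simp: mult_le_cancel_left1)
  also have "... = (A0 + B0 + 1 + K) * (u + v)" by (simp add: algebra_simps)
  also have "... <= C * (u + v)" using that by (intro mult_right_mono) auto
  finally show ?thesis .
 qed
 show thesis
 proof (rule that[of c C])
  show "0 < c" "0 < C" using c1 e AB gA C1 C2 C3 by (auto simp: c_def C_def)
  fix x :: real assume x: "x \<in> {0<..<1}"
  have ge1: "1 <= x powr -s" "1 <= (1 - x) powr -s" if "0 < s" for s :: real
  proof -
   have "1 <= y powr -s" if "0 < y" "y < 1" for y :: real
    using powr_mono'[of "-s" 0 y] that \<open>0 < s\<close> by auto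
   thus "1 <= x powr -s" "1 <= (1 - x) powr -s" using x by auto
  qed
  show "c <= f x" using c1(2)[OF x] by (auto simp: c_def)
  have "f x <= A 1 * x powr -\<gamma> + B 1 * (1 - x) powr -\<gamma> + (1 * (x powr -\<gamma> + (1 - x) powr -\<gamma>) + C1)"
   using C1(2)[OF x] by linarith
  also have "... <= C * (x powr (-\<gamma>) + (1 - x) powr (-\<gamma>))"
   using ge1[of \<gamma>] \<gamma> AB C1 C2 C3 gA by (intro *) (auto simp: C_def)
  finally show "f x <= C * (x powr (-\<gamma>) + (1 - x) powr (-\<gamma>))" .
  have "abs (deriv f x) <= (\<gamma> * A 2) * x powr (-\<gamma>-1) + (\<gamma> * B 2) * (1 - x) powr (-\<gamma>-1) + (1 * (x powr (-\<gamma>-1) + (1 - x) powr (-\<gamma>-1)) + C2)"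
  proof -
   have "abs d <= a * u + b * v + E" if "abs (d - (-a) * u - b * v) <= E" "0 <= a * u" "0 <= b * v" for d a b u v E :: real
    using that by (auto simp: abs_if split: if_splits)
   from this[of "deriv f x" "\<gamma> * A 2" "x powr (-\<gamma>-1)" "\<gamma> * B 2" "(1 - x) powr (-\<gamma>-1)"] show ?thesis
    using C2(2)[OF x] gA by auto
  qed
  also have "... <= C * (x powr (-\<gamma>-1) + (1 - x) powr (-\<gamma>-1))"
   using ge1[of "\<gamma>+1"] \<gamma> AB C1 C2 C3 gA by (intro *) (auto simp: C_def)
  finally show "abs (deriv f x) <= C * (x powr (-\<gamma>-1) + (1 - x) powr (-\<gamma>-1))" .
  have "c * (x powr (-\<gamma>-2) + (1 - x) powr (-\<gamma>-2)) <= e * (x powr (-\<gamma>-2) + (1 - x) powr (-\<gamma>-2))"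
   by (intro mult_right_mono) (auto simp: c_def)
  moreover have "(2 * e) * x powr (-\<gamma>-2) <= A' * x powr (-\<gamma>-2)" "(2 * e) * (1 - x) powr (-\<gamma>-2) <= B' * (1 - x) powr (-\<gamma>-2)"
   using e by (intro mult_right_mono, auto)+
  moreover have "C3 <= C" using AB gA C1 C2 by (simp add: C_def)
  ultimately show "c * (x powr (-\<gamma>-2) + (1 - x) powr (-\<gamma>-2)) - C <= deriv (deriv f) x"
   using C3(2)[OF x] unfolding distrib_left by linarith
 qed
qed

lemma arnold_roof_bounds:
 assumes "arnold_roof f"
 obtains c C A B where "0 < c" "0 < C" "0 < A" "0 < B" "A ~= B"
  "!!x. x \<in> {0<..<1} ==> c <= f x"
  "!!x. x \<in> {0<..<1} ==> f x <= C * (x powr (-1/32) + (1 - x) powr (-1/32))"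
  "!!eps. 0 < eps ==> \<exists>K>0. \<forall>x\<in>{0<..<1}. abs (deriv f x + A / x - B / (1 - x)) <= eps * (1 / x + 1 / (1 - x)) + K"
proof -
 obtain A B where roof: "singular_roof (%x. - ln x) f A B" and ne: "A 2 ~= B 2"
  using assms by (auto simp: arnold_roof_def)
 hence C2: "C2_on_unit_interval f" and AB: "0 < A 2" "0 < B 2"
  by (auto simp: singular_roof_def)
 note cont = C2_on_unit_interval_continuous[OF C2]
 obtain c where c: "0 < c" "!!x. x \<in> {0<..<1} ==> c <= f x"
 proof (rule singular_roof_lower_bound[OF roof])
  show "filterlim (%x::real. - ln x) at_top (at_right 0)" by real_asymp
  show "filterlim (%x::real. - ln (1 - x)) at_top (at_left 1)" by real_asymp
 qed blast
 have r0: "((%x. (f x / (- ln x)) * ((- ln x) / x powr (-1/32))) \<longlongrightarrow> A 1 * 0) (at_right 0)"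
 proof (rule tendsto_mult)
  show "((%x. f x / (- ln x)) \<longlongrightarrow> A 1) (at_right 0)" using roof by (simp add: singular_roof_def)
  show "((%x::real. (- ln x) / x powr (-1/32)) \<longlongrightarrow> 0) (at_right 0)" by real_asymp
 qed
 have "((%x. f x / x powr (-1/32)) \<longlongrightarrow> 0) (at_right 0)"
  using r0 unfolding mult_zero_right
  by (rule Lim_transform_eventually) (auto simp: eventually_at_right_field intro!: exI[of _ 1])
 moreover have l0: "((%x. (f x / (- ln (1 - x))) * ((- ln (1 - x)) / (1 - x) powr (-1/32))) \<longlongrightarrow> B 1 * 0) (at_left 1)"
 proof (rule tendsto_mult)
  show "((%x. f x / (- ln (1 - x))) \<longlongrightarrow> B 1) (at_left 1)" using roof by (simp add: singular_roof_def)
  show "((%x::real. (- ln (1 - x)) / (1 - x) powr (-1/32)) \<longlongrightarrow> 0) (at_left 1)" by real_asymp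
 qed
 have "((%x. f x / (1 - x) powr (-1/32)) \<longlongrightarrow> 0) (at_left 1)"
  using l0 unfolding mult_zero_right
  by (rule Lim_transform_eventually) (auto simp: eventually_at_left_field intro!: exI[of _ 0])
 moreover have "continuous_on {0<..1} (%x::real. x powr (-1/32))" by (auto intro!: continuous_intros)
 ultimately obtain C where C: "0 < C" "!!x. x \<in> {0<..<1} ==> abs (f x) <= 1 * (x powr (-1/32) + (1 - x) powr (-1/32)) + C"
  using two_sided_singularity_bound[OF cont(1), of "%x. x powr (-1/32)" 0 0 1] by auto
 have d1: "deriv (%x. - ln x) x = (-1) * (1 / x)" if "x \<in> {0<..<1}" for x :: real
  using deriv_minus_ln[of x] that by simp
 have l1: "((%x. deriv f x / (1 / x)) \<longlongrightarrow> (-1) * A 2) (at_right 0)"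
  using roof by (intro tendsto_div_at_ends(1)[OF d1]) (auto simp: singular_roof_def)
 have l2: "((%x. deriv f x / (1 / (1 - x))) \<longlongrightarrow> (-1) * (- B 2)) (at_left 1)"
  using roof by (intro tendsto_div_at_ends(2)[OF d1]) (auto simp: singular_roof_def)
 have Hc: "continuous_on {0<..1} (%x::real. 1 / x)" by (auto intro!: continuous_intros)
 show thesis
 proof (rule that[of c "1 + C" "A 2" "B 2"])
  show "\<exists>K>0. \<forall>x\<in>{0<..<1}. abs (deriv f x + A 2 / x - B 2 / (1 - x)) <= eps * (1 / x + 1 / (1 - x)) + K" if "0 < eps" for eps
   using two_sided_singularity_bound[OF cont(2) Hc _ l1 l2 that] by simp
  fix x :: real assume x: "x \<in> {0<..<1}"
  have ge1: "1 <= y powr (-1/32)" if "0 < y" "y < 1" for y :: real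
   using powr_mono'[of "-1/32" 0 y] that by auto
  have "f x <= (x powr (-1/32) + (1 - x) powr (-1/32)) + C * 1" using C(2)[OF x] by auto
  also have "C * 1 <= C * (x powr (-1/32) + (1 - x) powr (-1/32))"
   using ge1[of x] ge1[of "1 - x"] x C(1) by (intro mult_left_mono) auto
  finally show "f x <= (1 + C) * (x powr (-1/32) + (1 - x) powr (-1/32))" by (simp add: distrib_right)
 qed (use c C AB ne in auto)
qed

definition birkhoff :: "real => (real => real) => nat => real => real" where
 "birkhoff \<alpha> f n x = (\<Sum>i<n. f (frac (x + real i * \<alpha>)))"

definition regular_on :: "real => nat => real set => bool" where
 "regular_on \<alpha> n S \<longleftrightarrow> (\<forall>x\<in>S. \<forall>i<n. x + real i * \<alpha> \<notin> \<int>)"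

lemma frac_in_unit: "x \<notin> \<int> ==> frac x \<in> {0<..<1::real}"
 using frac_ge_0[of x] frac_lt_1[of x] by (auto simp: less_le)

lemma frac_eqI: "0 <= y ==> y < 1 ==> x = y + of_int z ==> frac x = (y::real)"
 by (simp add: frac_eq)

lemma birkhoff_add: "birkhoff \<alpha> f (m + n) x = birkhoff \<alpha> f m x + birkhoff \<alpha> f n (x + real m * \<alpha>)"
proof -
 have "(\<Sum>i<m + n. f (frac (x + real i * \<alpha>))) = (\<Sum>i<m. f (frac (x + real i * \<alpha>))) + (\<Sum>i<n. f (frac (x + real (m + i) * \<alpha>)))"
  by (induction n) auto
 thus ?thesis by (simp add: birkhoff_def algebra_simps)
qed

lemma birkhoff_Suc: "birkhoff \<alpha> f (Suc n) x = birkhoff \<alpha> f n x + f (frac (x + real n * \<alpha>))"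
 by (simp add: birkhoff_def)

lemma birkhoff_0 [simp]: "birkhoff \<alpha> f 0 x = 0"
 by (simp add: birkhoff_def)

lemma birkhoff_add_of_int: "birkhoff \<alpha> f n (x + of_int z) = birkhoff \<alpha> f n x"
 unfolding birkhoff_def using frac_add_of_int_right[of _ z] by (metis (no_types, lifting) add.commute add.left_commute)

lemma birkhoff_frac: "birkhoff \<alpha> f n (frac x + t) = birkhoff \<alpha> f n (x + t)"
 using birkhoff_add_of_int[of \<alpha> f n "frac x + t" "\<lfloor>x\<rfloor>"] by (simp add: frac_def algebra_simps)

lemma birkhoff_has_derivative:
 assumes "!!x. x \<in> {0<..<1} ==> (f has_real_derivative f' x) (at x)" "regular_on \<alpha> n {x}"
 shows "(birkhoff \<alpha> f n has_real_derivative birkhoff \<alpha> f' n x) (at x)"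
proof -
 have "((%x. f (frac (x + real i * \<alpha>))) has_real_derivative f' (frac (x + real i * \<alpha>)) * 1) (at x)" if "i < n" for i
 proof (rule DERIV_chain2[of f])
  have nz: "x + real i * \<alpha> \<notin> \<int>" using assms(2) that by (auto simp: regular_on_def)
  thus "(f has_real_derivative f' (frac (x + real i * \<alpha>))) (at (frac (x + real i * \<alpha>)))"
   by (intro assms(1) frac_in_unit)
  have "((%x. real_of_int \<lfloor>x + real i * \<alpha>\<rfloor>) has_real_derivative 0) (at x)"
   using nz by (intro floor_has_real_derivative) (auto intro!: continuous_intros)
  thus "((%x. frac (x + real i * \<alpha>)) has_real_derivative 1) (at x)"
   unfolding frac_def by (auto intro!: derivative_eq_intros)
 qed
 thus ?thesis unfolding birkhoff_def[abs_def] by (intro DERIV_sum) auto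
qed

lemma birkhoff_mean_value:
 assumes "!!x. x \<in> {0<..<1} ==> (f has_real_derivative f' x) (at x)" "a < b" "regular_on \<alpha> n {a..b}"
 obtains \<xi> where "a < \<xi>" "\<xi> < b" "birkhoff \<alpha> f n b - birkhoff \<alpha> f n a = (b - a) * birkhoff \<alpha> f' n \<xi>"
proof -
 have "(birkhoff \<alpha> f n has_real_derivative birkhoff \<alpha> f' n x) (at x)" if "a <= x" "x <= b" for x
  using assms that by (intro birkhoff_has_derivative) (auto simp: regular_on_def)
 from MVT2[OF assms(2) this] show thesis using that by blast
qed

lemma min_frac_le_dist: "min (frac x) (1 - frac x) <= abs (x - of_int z)" for x :: real
proof -
 have "z <= \<lfloor>x\<rfloor> \<or> \<lfloor>x\<rfloor> + 1 <= z" by linarith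
 hence "real_of_int z <= of_int \<lfloor>x\<rfloor> \<or> of_int \<lfloor>x\<rfloor> + 1 <= real_of_int z" by linarith
 thus ?thesis unfolding frac_def by linarith
qed

section \<open>Separation of Birkhoff sums for power singularities\<close>

text \<open>Two orbits of the flow that start at distance about \<open>2 ^ - j\<close> are compared for a time proportional to
 \<open>N j\<close>. The first part keeps them apart when they have crossed different numbers of floors, the second
 part says that they can be close with equal numbers only for a small proportion of these numbers.\<close>

definition pair_separation ::
 "real => (real => real) => (nat => real) => real => real => real => real set => nat => bool" where
 "pair_separation \<alpha> f N \<rho> p C X j \<longleftrightarrow>
  (\<forall>a\<in>X. \<forall>a'\<in>X. (1/2) ^ Suc j < abs (a - a') --> abs (a - a') <= (1/2) ^ j -->
   (\<forall>l l'. l ~= l' --> real l <= 2 * N j --> real l' <= 2 * N j -->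
     abs (birkhoff \<alpha> f l a - birkhoff \<alpha> f l' a') < 2 -->
     (\<forall>z::int. 2 powr (- \<rho> * j) < abs (a' - a + (real l' - real l) * \<alpha> - z))) &
   card {l. real l <= 2 * N j & abs (birkhoff \<alpha> f l a - birkhoff \<alpha> f l a') < 2} <= C * j powr (- p) * N j)"

definition base_separation :: "real => (real => real) => (nat => real) => bool" where
 "base_separation \<alpha> f N \<longleftrightarrow>
  (\<exists>\<rho> p C. 0 < \<rho> & \<rho> < 1 & 0 < p & 0 < C &
   (\<forall>kap>0. \<exists>j0. \<exists>X\<in>sets borel. X <= {0<..<1} & leb ({0<..<1} - X) <= ennreal kap &
    (\<forall>j\<ge>j0. pair_separation \<alpha> f N \<rho> p C X j)))"

lemma emeasure_UN_le_card:
 fixes d :: real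
 assumes "finite I" "!!i. i \<in> I ==> A i \<in> sets M" "!!i. i \<in> I ==> \<mu> M (A i) <= ennreal d" "0 <= d"
 shows "\<mu> M (\<Union>i\<in>I. A i) <= ennreal (card I * d)"
proof -
 have "\<mu> M (\<Union>i\<in>I. A i) <= (\<Sum>i\<in>I. \<mu> M (A i))"
  using assms by (intro emeasure_subadditive_finite) auto
 also have "... <= (\<Sum>i\<in>I. ennreal d)" using assms by (intro sum_mono) auto
 also have "... = ennreal (card I * d)" using assms(4) by (simp add: ennreal_mult' ennreal_of_nat_eq_real_of_nat)
 finally show ?thesis .
qed

text \<open>Pairs at distance about \<open>r\<close> at which the sums of length \<open>l\<close> almost agree. Between successive
 singularities the sum is strictly convex, so its derivative is small only near one place; apart from
 the neighbourhoods of the \<open>l\<close> singularities this leaves \<open>l\<close> short intervals.\<close>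

lemma singular_cover:
 fixes f f' f'' :: "real => real"
 assumes f: "!!x. x \<in> {0<..<1} ==> (f has_real_derivative f' x) (at x)"
  and f': "!!x. x \<in> {0<..<1} ==> (f' has_real_derivative f'' x) (at x)"
  and convex: "!!x. regular_on \<alpha> l {x} ==> kap <= birkhoff \<alpha> f'' l x" and kap: "0 < kap"
  and r: "0 < r" and l: "0 < l"
 obtains U where "U \<in> sets borel" "leb U <= ennreal (l * (8 * r + 16 / (r * kap)))"
  "!!a a'. a \<in> {0<..<1} ==> abs (a - a') <= r ==> r / 2 < abs (a - a') ==>
    abs (birkhoff \<alpha> f l a - birkhoff \<alpha> f l a') < 2 ==> a \<in> U"
proof -
 define Si where "Si = (%i. frac (- real i * \<alpha>)) ` {..<l}"
 have fin: "finite Si" and card: "card Si <= l" and ne: "0 \<in> Si"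
  using card_image_le[of "{..<l}" "%i. frac (- real i * \<alpha>)"] l by (auto simp: Si_def image_iff intro!: bexI[of _ 0])
 define P where "P = {a \<in> {0<..<1}. (\<forall>s\<in>Si. r < abs (a - s)) & r < 1 - a &
  (\<exists>a'. abs (a - a') <= r & r / 2 < abs (a - a') & abs (birkhoff \<alpha> f l a - birkhoff \<alpha> f l a') < 2)}"
 have unit_reg: "regular_on \<alpha> l {x}" if "x \<in> {0<..<1}" "x \<notin> Si" for x
 proof -
  have "x + real i * \<alpha> \<notin> \<int>" if i: "i < l" for i
  proof
   assume "x + real i * \<alpha> \<in> \<int>"
   then obtain z where "x + real i * \<alpha> = of_int z" by (auto elim: Ints_cases)
   hence "- real i * \<alpha> = x + of_int (- z)" by simp
   hence "frac (- real i * \<alpha>) = frac x" by (metis frac_add_of_int_right)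
   also have "... = x" using that(1) \<open>x \<in> {0<..<1}\<close> by simp
   finally show False using that \<open>x \<notin> Si\<close> i by (auto simp: Si_def image_iff)
  qed
  thus ?thesis by (auto simp: regular_on_def)
 qed
 have in01: "x \<in> {0<..<1}" if "a \<in> P" "abs (x - a) <= r" for a x
  using that ne unfolding P_def by auto
 have notSi: "x \<notin> Si" if "a \<in> P" "abs (x - a) <= r" for a x
  using that unfolding P_def by (auto simp: abs_minus_commute not_less)
 \<comment> \<open>The mean value theorem turns a small difference of the sums into a small derivative nearby.\<close>
 have small: "\<exists>\<xi>. abs (\<xi> - a) <= r & abs (birkhoff \<alpha> f' l \<xi>) <= 4 / r" if a: "a \<in> P" for a
 proof -
  obtain a' where a': "abs (a - a') <= r" "r / 2 < abs (a - a')" "abs (birkhoff \<alpha> f l a - birkhoff \<alpha> f l a') < 2"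
   using a by (auto simp: P_def)
  define u v where "u = min a a'" and "v = max a a'"
  have uv: "u < v" "v - u = abs (a - a')" "abs (birkhoff \<alpha> f l v - birkhoff \<alpha> f l u) < 2"
   using a' r by (auto simp: u_def v_def min_def max_def abs_minus_commute)
  have cl: "abs (x - a) <= r" if "x \<in> {u..v}" for x using that a'(1) by (auto simp: u_def v_def)
  have "regular_on \<alpha> l {u..v}"
   using unit_reg in01[OF a cl] notSi[OF a cl] by (auto simp: regular_on_def)
  then obtain \<xi> where \<xi>: "u < \<xi>" "\<xi> < v" "birkhoff \<alpha> f l v - birkhoff \<alpha> f l u = (v - u) * birkhoff \<alpha> f' l \<xi>"
   using birkhoff_mean_value[OF f uv(1)] by blast
  have "(r / 2) * abs (birkhoff \<alpha> f' l \<xi>) <= (v - u) * abs (birkhoff \<alpha> f' l \<xi>)"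
   using uv a' by (intro mult_right_mono) auto
  also have "... < 2" using uv \<xi>(3) by (simp add: abs_mult)
  finally have "abs (birkhoff \<alpha> f' l \<xi>) <= 4 / r" using r by (simp add: field_simps)
  thus ?thesis using cl[of \<xi>] \<xi> by (intro exI[of _ \<xi>]) auto
 qed
 define L where "L a = Max {s \<in> Si. s < a}" for a
 define D where "D = 8 / (r * kap) + 2 * r"
 have D: "0 < D" using r kap by (auto simp: D_def intro!: add_pos_pos)
 \<comment> \<open>Between two consecutive singularities the derivative is monotone with slope at least \<open>kap\<close>, so it is small
  only on a short interval.\<close>
 have diam: "b - a <= D" if "a \<in> P" "b \<in> P" "L a = L b" "a < b" for a b
 proof -
  have no: "s <= a" if "s \<in> Si" "s < b" for s
  proof -
   have "s <= L b" using fin that by (auto simp: L_def intro: Max_ge)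
   moreover have "L a \<in> {s \<in> Si. s < a}" unfolding L_def
    using fin ne \<open>a \<in> P\<close> by (intro Max_in) (auto simp: P_def)
   ultimately show ?thesis using \<open>L a = L b\<close> by auto
  qed
  obtain \<xi> \<eta> where x: "abs (\<xi> - a) <= r" "abs (birkhoff \<alpha> f' l \<xi>) <= 4 / r" and e: "abs (\<eta> - b) <= r" "abs (birkhoff \<alpha> f' l \<eta>) <= 4 / r"
   using small[OF \<open>a \<in> P\<close>] small[OF \<open>b \<in> P\<close>] by blast
  have "\<eta> - \<xi> <= 8 / (r * kap)"
  proof (cases "\<xi> < \<eta>")
   case True
   have "x \<in> {0<..<1} & x \<notin> Si" if "x \<in> {\<xi>..\<eta>}" for x
   proof -
    have "abs (x - a) <= r \<or> (abs (x - b)) <= r \<or> a < x & x < b"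
     using \<open>x \<in> {\<xi>..\<eta>}\<close> x(1) e(1) by (simp add: abs_le_iff) linarith
    then consider "abs (x - a) <= r" | "abs (x - b) <= r" | "a < x" "x < b" by blast
    thus ?thesis
    proof cases
     case 3
     thus ?thesis using no[of x] \<open>a \<in> P\<close> \<open>b \<in> P\<close> by (auto simp: P_def)
    qed (use in01 notSi \<open>a \<in> P\<close> \<open>b \<in> P\<close> in blast)+
   qed
   hence reg: "regular_on \<alpha> l {\<xi>..\<eta>}" using unit_reg by (auto simp: regular_on_def)
   then obtain \<zeta> where z: "\<xi> < \<zeta>" "\<zeta> < \<eta>" "birkhoff \<alpha> f' l \<eta> - birkhoff \<alpha> f' l \<xi> = (\<eta> - \<xi>) * birkhoff \<alpha> f'' l \<zeta>"
    using birkhoff_mean_value[OF f' True] by blast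
   have "(\<eta> - \<xi>) * kap <= (\<eta> - \<xi>) * birkhoff \<alpha> f'' l \<zeta>"
    using reg z True by (intro mult_left_mono convex) (auto simp: regular_on_def)
   also have "... <= 8 / r" using x(2) e(2) z(3) by linarith
   finally show ?thesis using r kap by (simp add: field_simps)
  next
   case False
   hence "\<eta> - \<xi> <= 0" by simp
   also have "0 <= 8 / (r * kap)" using r kap by simp
   finally show ?thesis .
  qed
  thus ?thesis using x(1) e(1) unfolding D_def by linarith
 qed
 define c where "c s = (SOME a. a \<in> P & L a = s)" for s
 define U where "U = (\<Union>s\<in>Si. {s-r..s+r}) Un {1-r..1} Un (\<Union>s\<in>Si. {c s - D..c s + D})"
 have meas: "(\<Union>s\<in>Si. {s-r..s+r}) \<in> sets lborel" "(\<Union>s\<in>Si. {c s - D..c s + D}) \<in> sets lborel"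
  by (intro sets.finite_UN fin; simp)+
 show thesis
 proof (rule that[of U])
  show "U \<in> sets borel" using meas by (simp add: U_def sets.Un)
  have "leb U <= leb ((\<Union>s\<in>Si. {s-r..s+r}) Un {1-r..1}) + leb (\<Union>s\<in>Si. {c s - D..c s + D})"
   unfolding U_def using meas by (intro emeasure_subadditive sets.Un) auto
  also have "... <= (leb (\<Union>s\<in>Si. {s-r..s+r}) + leb {1-r..1}) + leb (\<Union>s\<in>Si. {c s - D..c s + D})"
   using meas by (intro add_right_mono emeasure_subadditive) auto
  also have "... <= (ennreal (card Si * (2 * r)) + ennreal r) + ennreal (card Si * (2 * D))"
  proof (intro add_mono)
   show "leb (\<Union>s\<in>Si. {s-r..s+r}) <= ennreal (card Si * (2 * r))"
    by (rule emeasure_UN_le_card) (use fin r in auto)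
   show "leb (\<Union>s\<in>Si. {c s - D..c s + D}) <= ennreal (card Si * (2 * D))"
    by (rule emeasure_UN_le_card) (use fin D in auto)
  qed (use r in auto)
  also have "... = ennreal (card Si * (2 * r) + r + card Si * (2 * D))"
   using r D by (simp add: ennreal_plus)
  also have "... <= ennreal (l * (8 * r + 16 / (r * kap)))"
  proof (rule ennreal_leI)
   have "card Si * (2 * r) + r + card Si * (2 * D) <= real l * (2 * r) + real l * r + real l * (2 * D)"
    using card l r D by (intro add_mono mult_right_mono) auto
   also have "... <= l * (8 * r + 16 / (r * kap))"
    using r by (simp add: D_def algebra_simps)
   finally show "card Si * (2 * r) + r + card Si * (2 * D) <= l * (8 * r + 16 / (r * kap))" .
  qed
  finally show "leb U <= ennreal (l * (8 * r + 16 / (r * kap)))" .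
 next
  fix a a' assume a: "a \<in> {0<..<1}" "abs (a - a') <= r" "r / 2 < abs (a - a')" "abs (birkhoff \<alpha> f l a - birkhoff \<alpha> f l a') < 2"
  show "a \<in> U"
  proof (cases "a \<in> P")
   case False
   thus ?thesis using a unfolding P_def U_def by fastforce
  next
   case True
   hence c: "c (L a) \<in> P" "L (c (L a)) = L a" unfolding c_def by (metis (mono_tags, lifting) someI_ex)+
   have "abs (a - c (L a)) <= D"
    using diam[OF True c(1)] diam[OF c(1) True] c(2) D by (cases a "c (L a)" rule: linorder_cases) auto
   moreover have "L a \<in> Si"
    using Max_in[of "{s \<in> Si. s < a}"] fin ne True unfolding L_def P_def by auto
   ultimately show ?thesis unfolding U_def by fastforce
  qed
 qed
qed

lemma emeasure_UN_geometric:
 fixes K x :: real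
 assumes E: "!!j. j0 <= j ==> E j \<in> sets M" "!!j. j0 <= j ==> \<mu> M (E j) <= ennreal (K * x ^ j)"
  and x: "0 <= x" "x < 1" and K: "0 <= K"
 shows "\<mu> M (\<Union>j\<in>{j0..}. E j) <= ennreal (K * x ^ j0 / (1 - x))"
proof -
 have "(\<Union>j\<in>{j0..}. E j) = (\<Union>i. E (i + j0))"
 proof (intro equalityI subsetI)
  fix y assume "y \<in> (\<Union>j\<in>{j0..}. E j)"
  then obtain j where "j0 <= j" "y \<in> E (j - j0 + j0)" by auto
  thus "y \<in> (\<Union>i. E (i + j0))" by blast
 qed auto
 also have "\<mu> M ... <= (\<Sum>i. \<mu> M (E (i + j0)))"
  using E(1) by (intro emeasure_subadditive_countably) auto
 also have "... <= (\<Sum>i. ennreal (K * x ^ (i + j0)))"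
  using E(2) by (intro suminf_le) auto
 also have "... = ennreal (\<Sum>i. K * x ^ j0 * x ^ i)"
 proof (subst suminf_ennreal2)
  show "summable (%i. K * x ^ (i + j0))"
   using x by (auto intro!: summable_mult summable_mult2 summable_geometric simp: power_add)
 qed (use x K in \<open>auto simp: power_add mult_ac\<close>)
 also have "(\<Sum>i. K * x ^ j0 * x ^ i) = K * x ^ j0 / (1 - x)"
  using x by (subst suminf_mult) (auto simp: suminf_geometric)
 finally show ?thesis .
qed

lemma geometric_tail:
 fixes K x kap :: real
 assumes E: "!!j. j1 <= j ==> E j \<in> sets M" "!!j. j1 <= j ==> \<mu> M (E j) <= ennreal (K * x ^ j)"
  and x: "0 <= x" "x < 1" and K: "0 <= K" and kap: "0 < kap"
 shows "\<exists>j0\<ge>j1. \<mu> M (\<Union>j\<in>{j0..}. E j) <= ennreal kap"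
proof -
 have "(%j. K * x ^ j / (1 - x)) \<longlonglongrightarrow> K * 0 / (1 - x)"
  using x by (intro tendsto_intros LIMSEQ_power_zero) auto
 hence "eventually (%j. K * x ^ j / (1 - x) < kap) sequentially"
  using kap by (intro order_tendstoD(2)) auto
 then obtain j2 where j2: "!!j. j2 <= j ==> K * x ^ j / (1 - x) < kap" by (auto simp: eventually_sequentially)
 define j0 where "j0 = max j1 j2"
 have "\<mu> M (\<Union>j\<in>{j0..}. E j) <= ennreal (K * x ^ j0 / (1 - x))"
  using E x K by (intro emeasure_UN_geometric) (auto simp: j0_def)
 also have "... <= ennreal kap" using j2[of j0] by (intro ennreal_leI) (auto simp: j0_def)
 finally show ?thesis by (intro exI[of _ j0]) (auto simp: j0_def)
qed

text \<open>Markov's inequality for the number of sets that contain a point.\<close>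

lemma emeasure_frequently_covered:
 fixes U :: "'b => 'a set" and u t :: real
 assumes "finite L" "!!l. l \<in> L ==> U l \<in> sets M" "!!l. l \<in> L ==> \<mu> M (U l) <= ennreal u" "0 <= u" "0 < t"
 shows "{x \<in> space M. t <= real (card {l \<in> L. x \<in> U l})} \<in> sets M" (is "?E \<in> _")
  and "\<mu> M {x \<in> space M. t <= real (card {l \<in> L. x \<in> U l})} <= ennreal (card L * u / t)"
proof -
 have cnt: "real (card {l \<in> L. x \<in> U l}) = (\<Sum>l\<in>L. indicator (U l) x)" for x
 proof -
  have "(\<Sum>l\<in>{l\<in>L. x \<in> U l}. 1) = (\<Sum>l\<in>L. if x \<in> U l then 1 else (0::real))"
   by (rule sum.inter_filter[OF assms(1)])
  thus ?thesis by (simp add: indicator_def of_bool_def)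
 qed
 have cnt': "ennreal (real (card {l \<in> L. x \<in> U l})) = (\<Sum>l\<in>L. indicator (U l) x)" for x
 proof -
  have "(\<Sum>l\<in>L. ennreal (indicator (U l) x)) = ennreal (\<Sum>l\<in>L. indicator (U l) x)"
   by (rule sum_ennreal) simp
  thus ?thesis unfolding cnt by (simp add: ennreal_indicator)
 qed
 show "?E \<in> sets M" unfolding cnt using assms by (auto intro!: measurable)
 have "\<mu> M ?E <= \<mu> M {x \<in> space M. 1 <= ennreal (1 / t) * (\<Sum>l\<in>L. indicator (U l) x)}"
 proof (rule emeasure_mono)
  show "{x \<in> space M. 1 <= ennreal (1 / t) * (\<Sum>l\<in>L. indicator (U l) x)} \<in> sets M"
   using assms by (auto intro!: measurable)
  show "?E <= {x \<in> space M. 1 <= ennreal (1 / t) * (\<Sum>l\<in>L. indicator (U l) x)}"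
   unfolding cnt'[symmetric] using assms(5) by (auto simp: ennreal_mult[symmetric] ennreal_1[symmetric] simp del: ennreal_1)
 qed
 also have "... <= ennreal (1 / t) * (\<integral>\<^sup>+x. (\<Sum>l\<in>L. indicator (U l) x) * indicator (space M) x \<partial>M)"
  using assms by (intro nn_integral_Markov_inequality) (auto intro!: borel_measurable_sum)
 also have "(\<integral>\<^sup>+x. (\<Sum>l\<in>L. indicator (U l) x) * indicator (space M) x \<partial>M) = (\<integral>\<^sup>+x. (\<Sum>l\<in>L. indicator (U l) x) \<partial>M)"
  by (intro nn_integral_cong) simp
 also have "... = (\<Sum>l\<in>L. \<mu> M (U l))" using assms by (subst nn_integral_sum) auto
 also have "... <= (\<Sum>l\<in>L. ennreal u)" using assms by (intro sum_mono) auto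
 also have "... = ennreal (card L * u)" using assms(4) by (simp add: ennreal_mult' ennreal_of_nat_eq_real_of_nat)
 also have "ennreal (1 / t) * ... = ennreal (card L * u / t)"
  using assms(4,5) by (subst ennreal_mult[symmetric]) auto
 finally show "\<mu> M ?E <= ennreal (card L * u / t)" by (simp add: mult_left_mono)
qed

context log_diophantine begin

abbreviation "Bs \<equiv> birkhoff \<alpha>"
abbreviation "orb x i \<equiv> x + real i * \<alpha>"

lemma q_growth_powr:
 assumes "0 < \<sigma>"
 obtains K where "1 <= K" "!!n. rq (Suc n) <= K * rq n powr (1 + \<sigma>)"
proof -
 obtain K where K: "1 <= K" "!!x::real. 1 <= x ==> ln x powr (17/16) <= K * x powr \<sigma>"
  using ln_powr_le[of \<sigma> "17/16"] assms by auto
 show thesis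
 proof (rule that[of "max 1 (C * K)"])
  fix n
  have "rq (Suc n) <= C * q n * ln (q n) powr (17/16)" by (rule q_growth)
  also have "... <= C * q n * (K * q n powr \<sigma>)"
   using C_pos q_ge_2[of n] by (intro mult_left_mono K(2)) auto
  also have "... = C * K * q n powr (1 + \<sigma>)" using q_pos[of n] by (simp add: powr_add)
  also have "... <= max 1 (C * K) * q n powr (1 + \<sigma>)" by (intro mult_right_mono) auto
  finally show "rq (Suc n) <= max 1 (C * K) * rq n powr (1 + \<sigma>)" .
 qed simp
qed

text \<open>Among any \<open>l\<close> successive points of an orbit one comes as close to the singularity as the
 denominator at scale \<open>l\<close> predicts, and this single visit already makes the second derivative large.\<close>

lemma birkhoff_second_derivative_lower:
 assumes f'': "!!x. x \<in> {0<..<1} ==> c * (x powr (-\<gamma>-2) + (1 - x) powr (-\<gamma>-2)) - C' <= f'' x"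
  and pos: "0 < c" "0 < C'" "0 < \<gamma>" "0 < \<sigma>" and s: "1 < (2 + \<gamma>) / (1 + \<sigma>)"
 obtains kap l0 where "0 < kap" "!!l x. l0 <= l ==> regular_on \<alpha> l {x} ==> kap * real l powr ((2 + \<gamma>) / (1 + \<sigma>)) <= Bs f'' l x"
proof -
 obtain K where K: "1 <= K" "!!n. rq (Suc n) <= K * rq n powr (1 + \<sigma>)"
  using q_growth_powr[OF pos(4)] by blast
 define s where "s = (2 + \<gamma>) / (1 + \<sigma>)"
 define kap where "kap = c * (1/2) powr (\<gamma> + 2) * (1 / K) powr s"
 have kap: "0 < kap" using pos K by (simp add: kap_def)
 have "((%l::nat. C' * real l / (kap / 2 * real l powr s)) \<longlongrightarrow> 0) sequentially"
  using kap pos s unfolding s_def[symmetric] by real_asymp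
 hence "eventually (%l::nat. C' * real l / (kap / 2 * real l powr s) < 1) sequentially"
  by (rule order_tendstoD) simp
 then obtain l1 where l1: "!!l. l1 <= l ==> C' * real l / (kap / 2 * real l powr s) < 1"
  by (auto simp: eventually_sequentially)
 show thesis
 proof (rule that[of "kap / 2" "max (max l1 (q 0)) 1"])
  fix l x assume l: "max (max l1 (q 0)) 1 <= l" and reg: "regular_on \<alpha> l {x}"
  obtain n where n: "rq n <= real l" "real l < rq (Suc n)"
   using denominator_at_scale[of "real l"] l by auto
  obtain i z where i: "i < q n" "abs (orb x i - of_int z) <= 2 / q n"
   using orbit_close_to_integer by blast
  define t where "t k = c * (frac (orb x k) powr (-\<gamma>-2) + (1 - frac (orb x k)) powr (-\<gamma>-2))" for k :: nat
  have t0: "0 <= t k" for k using pos by (simp add: t_def)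
  have unit: "frac (orb x k) \<in> {0<..<1}" if "k < l" for k
   using reg that by (intro frac_in_unit) (auto simp: regular_on_def)
  have il: "i < l" using i n by linarith
  have "c * (2 / q n) powr (-\<gamma>-2) <= t i"
  proof -
   have "min (frac (orb x i)) (1 - frac (orb x i)) <= 2 / q n"
    using min_frac_le_dist i(2) by (rule order_trans)
   then consider "frac (orb x i) <= 2 / q n" | "1 - frac (orb x i) <= 2 / q n" by linarith
   hence "(2 / q n) powr (-\<gamma>-2) <= frac (orb x i) powr (-\<gamma>-2) + (1 - frac (orb x i)) powr (-\<gamma>-2)"
   proof cases
    case 1
    hence "(2 / q n) powr (-\<gamma>-2) <= frac (orb x i) powr (-\<gamma>-2)"
     using unit[OF il] pos by (intro powr_mono2') auto
    thus ?thesis by (simp add: add_increasing2)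
   next
    case 2
    hence "(2 / q n) powr (-\<gamma>-2) <= (1 - frac (orb x i)) powr (-\<gamma>-2)"
     using unit[OF il] pos by (intro powr_mono2') auto
    thus ?thesis by (simp add: add_increasing)
   qed
   thus ?thesis using pos by (simp add: t_def)
  qed
  also have "t i <= (\<Sum>k<l. t k)" using il t0 by (intro member_le_sum) auto
  also have "(\<Sum>k<l. t k) = (\<Sum>k<l. t k - C') + C' * l" by (simp add: sum_subtractf)
  also have "(\<Sum>k<l. t k - C') <= Bs f'' l x"
   unfolding birkhoff_def t_def using f'' unit by (intro sum_mono) auto
  finally have 1: "c * (2 / q n) powr (-\<gamma>-2) - C' * l <= Bs f'' l x" by simp
  have "(real l / K) powr s <= (rq n powr (1 + \<sigma>)) powr s"
   using n(2) K(2)[of n] K(1) s pos unfolding s_def[symmetric] by (intro powr_mono2) (auto simp: field_simps)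
  also have "... = rq n powr (\<gamma> + 2)" using pos by (simp add: powr_powr s_def add.commute)
  finally have "kap * real l powr s <= c * (1/2) powr (\<gamma> + 2) * rq n powr (\<gamma> + 2)"
   using pos K(1) by (simp add: kap_def powr_divide field_simps)
  also have "... = c * (2 / q n) powr (-\<gamma>-2)"
   using q_pos[of n] by (simp add: powr_divide powr_minus_divide field_simps powr_diff powr_add)
  finally have 2: "kap * real l powr s <= c * (2 / q n) powr (-\<gamma>-2)" .
  have "C' * real l <= kap / 2 * real l powr s" using l1[of l] l kap by (simp add: field_simps)
  thus "kap / 2 * real l powr ((2 + \<gamma>) / (1 + \<sigma>)) <= Bs f'' l x"
   using 1 2 unfolding s_def by linarith
 qed (use kap in simp)
qed

end

context log_diophantine begin

text \<open>For every length \<open>l\<close> between \<open>2 powr (a * (1 - \<sigma>) * j)\<close> and \<open>2 * 2 powr (a * j)\<close>, the points that have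
 a bad partner at distance about \<open>2 ^ - j\<close> are covered by a set of measure \<open>O (2 powr (- 2 * \<delta> * j))\<close>: in the bound
 of \<open>singular_cover\<close> the term \<open>2 ^ j * l / kap\<close> is about \<open>2 ^ j * l powr - (1 + \<gamma>)\<close>, which is small because of
 \<open>1 / (1 + \<gamma>) < a\<close>, and the term \<open>l / 2 ^ j\<close> is small because of \<open>a < 1\<close>. Outside a set of summable measure
 only few lengths are bad, and the shorter lengths are few anyway.\<close>

lemma kochergin_base_separation:
 assumes roof: "kochergin_roof \<gamma> f" and a: "1 / (1 + \<gamma>) < a" "a < 1"
 shows "base_separation \<alpha> f (%j. 2 powr (a * j))"
proof -
 have \<gamma>: "0 < \<gamma>" "\<gamma> < 1" using roof by (auto simp: kochergin_roof_def)
 have a0: "0 < a" using order.strict_trans[OF _ a(1), of 0] \<gamma> by simp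
 have ag: "1 < a * (1 + \<gamma>)" using a(1) \<gamma> by (simp add: field_simps)
 have C2: "C2_on_unit_interval f" using roof by (auto simp: kochergin_roof_def singular_roof_def)
 obtain c0 C0 where c0: "0 < c0" "0 < C0"
  and f2: "!!x. x \<in> {0<..<1} ==> c0 * (x powr (-\<gamma>-2) + (1 - x) powr (-\<gamma>-2)) - C0 <= deriv (deriv f) x"
  using kochergin_roof_bounds[OF roof] by metis
 \<comment> \<open>All the exponents below are strict inequalities that hold for \<open>\<sigma> = 0\<close>.\<close>
 have "((%\<sigma>. (2 + \<gamma>) / (1 + \<sigma>)) \<longlongrightarrow> (2 + \<gamma>) / (1 + 0)) (at_right 0)"
  "((%\<sigma>. a * (1 - \<sigma>) * ((2 + \<gamma>) / (1 + \<sigma>) - 1)) \<longlongrightarrow> a * (1 - 0) * ((2 + \<gamma>) / (1 + 0) - 1)) (at_right 0)"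
  "((%\<sigma>. a * (1 + \<sigma>)) \<longlongrightarrow> a * (1 + 0)) (at_right 0)"
  by (intro tendsto_intros; simp)+
 from order_tendstoD(1)[OF this(1), of 1] order_tendstoD(1)[OF this(2), of 1] order_tendstoD(2)[OF this(3), of 1]
 have "eventually (%\<sigma>. 1 < (2 + \<gamma>) / (1 + \<sigma>)) (at_right 0)"
  "eventually (%\<sigma>. 1 < a * (1 - \<sigma>) * ((2 + \<gamma>) / (1 + \<sigma>) - 1)) (at_right 0)"
  "eventually (%\<sigma>. a * (1 + \<sigma>) < 1) (at_right 0)"
  using \<gamma> a ag by simp_all
 moreover have "eventually (%\<sigma>::real. 0 < \<sigma> & \<sigma> < 1) (at_right 0)"
  unfolding eventually_at_right_field by (intro exI[of _ 1]) auto
 ultimately have "eventually (%\<sigma>. 1 < (2 + \<gamma>) / (1 + \<sigma>) & 1 < a * (1 - \<sigma>) * ((2 + \<gamma>) / (1 + \<sigma>) - 1) & a * (1 + \<sigma>) < 1 & 0 < \<sigma> & \<sigma> < 1) (at_right 0)"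
  by eventually_elim auto
 then obtain \<sigma> where \<sigma>: "1 < (2 + \<gamma>) / (1 + \<sigma>)" "1 < a * (1 - \<sigma>) * ((2 + \<gamma>) / (1 + \<sigma>) - 1)" "a * (1 + \<sigma>) < 1" "0 < \<sigma>" "\<sigma> < 1"
  by (auto dest: eventually_happens)
 define s where "s = (2 + \<gamma>) / (1 + \<sigma>)"
 define b where "b = a * (1 - \<sigma>) * (s - 1) - 1"
 define \<delta> where "\<delta> = min (1 - a) b / 2"
 define \<rho> where "\<rho> = (1 + a * (1 + \<sigma>)) / 2"
 have s: "1 < s" and b: "0 < b" and \<delta>: "0 < \<delta>" "2 * \<delta> <= 1 - a" "2 * \<delta> <= b" and \<rho>: "0 < \<rho>" "\<rho> < 1" "a * (1 + \<sigma>) < \<rho>"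
  using \<sigma> a a0 by (auto simp: s_def b_def \<delta>_def \<rho>_def add_pos_pos)
 obtain kap2 l0 where kap2: "0 < kap2" "!!l x. l0 <= l ==> regular_on \<alpha> l {x} ==> kap2 * real l powr s <= Bs (deriv (deriv f)) l x"
  unfolding s_def using birkhoff_second_derivative_lower[OF f2 c0 \<gamma>(1) \<sigma>(4,1)] by metis
 obtain c3 where c3: "0 < c3" "!!k z. k ~= 0 ==> c3 / abs (real_of_int k) powr (1 + \<sigma>) <= abs (of_int k * \<alpha> - of_int z)"
  using dist_integer_ge_powr[OF \<sigma>(4)] by metis
 define N where "N j = 2 powr (a * real j)" for j :: nat
 define M where "M j = 2 powr (a * (1 - \<sigma>) * real j)" for j :: nat
 define K1 where "K1 = 16 + 16 / kap2"
 have K1: "0 < K1" using kap2(1) by (auto simp: K1_def add_pos_pos)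
 define r where "r j = (1/2::real) ^ j" for j
 have r: "r j = 2 powr (- real j)" for j by (simp add: r_def powr_minus powr_realpow power_one_over field_simps)
 have rpos: "0 < r j" for j by (simp add: r_def)
 have N1: "1 <= N j" for j using a0 by (simp add: N_def ge_one_powr_ge_zero)
 define good where "good U l j \<longleftrightarrow> U \<in> sets borel & leb U <= ennreal (K1 * 2 powr (- (2 * \<delta> * j))) &
  (\<forall>a\<in>{0<..<1}. \<forall>a'. abs (a - a') <= r j --> r j / 2 < abs (a - a') --> abs (Bs f l a - Bs f l a') < 2 --> a \<in> U)"
  for U :: "real set" and l j :: nat
 have ex: "\<exists>U. good U l j" if l: "l0 <= l" "0 < l" "M j <= real l" "real l <= 2 * N j" for l j
 proof -
  have kl: "0 < kap2 * real l powr s" using l kap2(1) by simp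
  obtain U where U: "U \<in> sets borel" "leb U <= ennreal (l * (8 * r j + 16 / (r j * (kap2 * real l powr s))))"
   "!!a a'. a \<in> {0<..<1} ==> abs (a - a') <= r j ==> r j / 2 < abs (a - a') ==> abs (Bs f l a - Bs f l a') < 2 ==> a \<in> U"
   using singular_cover[OF C2_on_unit_intervalD[OF C2] kap2(2)[OF l(1)] kl rpos l(2)] by metis
  have "l * (8 * r j + 16 / (r j * (kap2 * real l powr s))) = 8 * (l * r j) + 16 / kap2 * (1 / r j * real l powr (1 - s))"
   using l kap2(1) rpos[of j] by (simp add: field_simps powr_diff)
  also have "... <= 8 * (2 * N j * r j) + 16 / kap2 * (1 / r j * M j powr (1 - s))"
   using l s kap2(1) rpos[of j] by (intro add_mono mult_left_mono mult_right_mono powr_mono2') (auto simp: M_def)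
  also have "... = 16 * 2 powr (- ((1 - a) * j)) + 16 / kap2 * 2 powr (- (b * j))"
   by (simp add: N_def M_def r powr_powr powr_minus_divide[symmetric] flip: powr_add) (simp add: b_def algebra_simps)
  also have "... <= 16 * 2 powr (- (2 * \<delta> * j)) + 16 / kap2 * 2 powr (- (2 * \<delta> * j))"
   using kap2(1) \<delta> by (intro add_mono mult_left_mono powr_mono) (auto intro!: mult_right_mono)
  also have "... = K1 * 2 powr (- (2 * \<delta> * j))" by (simp add: K1_def distrib_right)
  finally have "l * (8 * r j + 16 / (r j * (kap2 * real l powr s))) <= K1 * 2 powr (- (2 * \<delta> * j))" .
  hence "good U l j" unfolding good_def using U by (auto intro: order_trans ennreal_leI)
  thus ?thesis ..
 qed
 define U where "U l j = (SOME U. good U l j)" for l j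
 have U: "good (U l j) l j" if "l0 <= l" "0 < l" "M j <= real l" "real l <= 2 * N j" for l j
  unfolding U_def using ex[OF that] by (rule someI_ex)
 have "filterlim (%j::nat. M j) at_top sequentially" unfolding M_def using a0 \<sigma> by real_asymp
 hence "eventually (%j. max (real l0) 1 <= M j) sequentially" unfolding filterlim_at_top by blast
 then obtain j1 where j1: "!!j. j1 <= j ==> max (real l0) 1 <= M j" by (auto simp: eventually_sequentially)
 define L where "L j = {l. M j <= real l & real l <= 2 * N j}" for j
 have finle: "finite {l. real l <= y}" "real (card {l. real l <= y}) <= y + 1" if "0 <= y" for y
 proof -
  have "{l. real l <= y} = {..nat \<lfloor>y\<rfloor>}" using that by (auto simp: le_nat_floor le_nat_iff le_floor_iff)
  thus "finite {l. real l <= y}" "real (card {l. real l <= y}) <= y + 1" using that by auto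
 qed
 have finL: "finite (L j)" and cardL: "real (card (L j)) <= 3 * N j" for j
 proof -
  show "finite (L j)" unfolding L_def by (rule finite_subset[OF _ finle(1)[of "2 * N j"]]) (use N1[of j] in auto)
  have "card (L j) <= card {l. real l <= 2 * N j}" unfolding L_def using N1[of j] by (intro card_mono finle) auto
  thus "real (card (L j)) <= 3 * N j" using finle(2)[of "2 * N j"] N1[of j] by linarith
 qed
 have UL: "good (U l j) l j" if "j1 <= j" "l \<in> L j" for l j
  using U[of l j] j1[OF that(1)] that(2) by (auto simp: L_def)
 define t where "t j = 2 powr (- (\<delta> * real j)) * N j" for j
 define E where "E j = {x. t j <= real (card {l \<in> L j. x \<in> U l j})}" for j
 have t: "0 < t j" for j using N1[of j] by (simp add: t_def)
 have Efacts: "E j \<in> sets lborel" "leb (E j) <= ennreal (card (L j) * (K1 * 2 powr (- (2 * \<delta> * j))) / t j)"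
  if j: "j1 <= j" for j
 proof -
  have 1: "U l j \<in> sets lborel" "leb (U l j) <= ennreal (K1 * 2 powr (- (2 * \<delta> * j)))" if "l \<in> L j" for l
   using UL[OF j that] by (auto simp: good_def)
  have 2: "0 <= K1 * 2 powr (- (2 * \<delta> * j))" using K1 by simp
  show "E j \<in> sets lborel" "leb (E j) <= ennreal (card (L j) * (K1 * 2 powr (- (2 * \<delta> * j))) / t j)"
   using emeasure_frequently_covered[OF finL 1 2 t] by (simp_all add: E_def)
 qed
 have "\<exists>j0\<ge>j1. leb (\<Union>j\<in>{j0..}. E j) <= ennreal kap" if "0 < kap" for kap
 proof (rule geometric_tail[OF _ _ _ _ _ that])
  fix j assume j: "j1 <= j"
  show "E j \<in> sets lborel" by (rule Efacts(1)[OF j])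
  have "leb (E j) <= ennreal (card (L j) * (K1 * 2 powr (- (2 * \<delta> * j))) / t j)"
   by (rule Efacts(2)[OF j])
  also have "... <= ennreal (3 * N j * (K1 * 2 powr (- (2 * \<delta> * j))) / t j)"
   using cardL[of j] K1 t[of j] by (intro ennreal_leI divide_right_mono mult_right_mono) auto
  also have "3 * N j * (K1 * 2 powr (- (2 * \<delta> * j))) / t j = 3 * K1 * (2 powr (- (2 * \<delta> * j)) / 2 powr (- (\<delta> * j)))"
   using N1[of j] by (simp add: t_def)
  also have "2 powr (- (2 * \<delta> * j)) / 2 powr (- (\<delta> * j)) = (2 powr (- \<delta>)) ^ j"
   by (simp add: powr_diff[symmetric] powr_realpow[symmetric] powr_powr)
  finally show "leb (E j) <= ennreal (3 * K1 * (2 powr (- \<delta>)) ^ j)" .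
 next
  show "2 powr (- \<delta>) < (1::real)" using powr_less_mono[of "- \<delta>" 0 2] \<delta>(1) by simp
 qed (use K1 in auto)
 note tail = this
 have "eventually (%j::nat. (M j + 1 + t j) / (real j powr (-1) * N j) < 1) sequentially"
 proof (rule order_tendstoD)
  show "(%j::nat. (M j + 1 + t j) / (real j powr (-1) * N j)) \<longlonglongrightarrow> 0"
  proof (rule Lim_transform_eventually)
   have "0 < a * \<sigma>" using a0 \<sigma> by simp
   moreover have "(%j::nat. real j * 2 powr (- u * j)) \<longlonglongrightarrow> 0" if "0 < u" for u :: real using that by real_asymp
   ultimately have "(%j::nat. real j * 2 powr (- (a * \<sigma>) * j) + real j * 2 powr (- a * j) + real j * 2 powr (- \<delta> * j)) \<longlonglongrightarrow> 0 + 0 + 0"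
    using a0 \<delta>(1) by (intro tendsto_add) blast+
   thus "(%j::nat. real j * 2 powr (- (a * \<sigma>) * j) + real j * 2 powr (- a * j) + real j * 2 powr (- \<delta> * j)) \<longlonglongrightarrow> 0" by simp
   have "(M j + 1 + t j) / (real j powr (-1) * N j) = real j * (M j / N j) + real j * (1 / N j) + real j * (t j / N j)" if "1 <= j" for j
    using N1[of j] that by (simp add: powr_minus_divide field_simps)
   moreover have "M j / N j = 2 powr (- (a * \<sigma>) * j)" "1 / N j = 2 powr (- a * j)" "t j / N j = 2 powr (- \<delta> * j)" for j
    using N1[of j] by (simp_all add: M_def t_def) (simp_all add: N_def powr_diff[symmetric] powr_minus_divide algebra_simps)
   ultimately show "eventually (%j. real j * 2 powr (- (a * \<sigma>) * j) + real j * 2 powr (- a * j) + real j * 2 powr (- \<delta> * j) = (M j + 1 + t j) / (real j powr (-1) * N j)) sequentially"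
    by (auto simp: eventually_sequentially intro!: exI[of _ 1])
  qed
 qed simp
 then obtain j2 where j2: "!!j. j2 <= j ==> (M j + 1 + t j) / (real j powr (-1) * N j) < 1" by (auto simp: eventually_sequentially)
 have "eventually (%j::nat. (2 powr (- \<rho> * j) + r j) / (c3 / (2 * N j) powr (1 + \<sigma>)) < 1) sequentially"
 proof (rule order_tendstoD)
  have "(%j::nat. 2 powr (- u * j)) \<longlonglongrightarrow> 0" if "0 < u" for u :: real using that by real_asymp
  from tendsto_add[OF this this, of "\<rho> - a * (1 + \<sigma>)" "1 - a * (1 + \<sigma>)"]
  have "(%j::nat. (2 powr (- \<rho> * j) + 2 powr (- real j)) * (2 powr (a * (1 + \<sigma>) * j))) \<longlonglongrightarrow> 0"
   using \<sigma> \<rho> by (simp add: distrib_right powr_add[symmetric] left_diff_distrib)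
  hence "(%j::nat. (2 powr (1 + \<sigma>) / c3) * ((2 powr (- \<rho> * j) + 2 powr (- real j)) * (2 powr (a * (1 + \<sigma>) * j)))) \<longlonglongrightarrow> (2 powr (1 + \<sigma>) / c3) * 0"
   by (intro tendsto_intros)
  thus "(%j::nat. (2 powr (- \<rho> * j) + r j) / (c3 / (2 * N j) powr (1 + \<sigma>))) \<longlonglongrightarrow> 0"
   using c3(1) by (simp add: r N_def powr_mult powr_powr field_simps)
 qed simp
 then obtain j3 where j3: "!!j. j3 <= j ==> (2 powr (- \<rho> * j) + r j) / (c3 / (2 * N j) powr (1 + \<sigma>)) < 1" by (auto simp: eventually_sequentially)
 show ?thesis unfolding base_separation_def
 proof (rule exI[of _ \<rho>], rule exI[of _ 1], rule exI[of _ 1], intro conjI allI impI)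
  fix kap :: real assume "0 < kap"
  obtain j0 where j0: "j1 <= j0" "leb (\<Union>j\<in>{j0..}. E j) <= ennreal kap" using tail[OF \<open>0 < kap\<close>] by blast
  have Emeas: "E j \<in> sets borel" if "j1 <= j" for j using Efacts(1)[OF that] by simp
  have Um: "(\<Union>j\<in>{j0..}. E j) \<in> sets borel" using Emeas j0(1) by (intro sets.countable_UN') auto
  define X where "X = {0<..<1} - (\<Union>j\<in>{j0..}. E j)"
  define J where "J = max (max j0 j2) (max j3 1)"
  have cnt: "card {l. real l <= 2 * N j & abs (Bs f l x - Bs f l x') < 2} <= 1 * j powr (-1) * N j"
   if j: "J <= j" and x: "x \<in> X" and d: "(1/2) ^ Suc j < abs (x - x')" "abs (x - x') <= (1/2) ^ j" for j x x'
  proof -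
   let ?B = "{l. real l <= 2 * N j & abs (Bs f l x - Bs f l x') < 2}"
   have jj: "j1 <= j" "j0 <= j" "j2 <= j" "1 <= j" using j j0 by (auto simp: J_def)
   have M0: "0 <= M j" by (simp add: M_def)
   have "?B <= {l. real l <= M j} Un {l \<in> L j. x \<in> U l j}"
   proof
    fix l assume l: "l \<in> ?B"
    show "l \<in> {l. real l <= M j} Un {l \<in> L j. x \<in> U l j}"
    proof (cases "real l <= M j")
     case False
     hence lL: "l \<in> L j" using l by (auto simp: L_def)
     have "x \<in> U l j" using UL[OF jj(1) lL] x d l unfolding good_def r_def X_def by auto
     thus ?thesis using lL by auto
    qed auto
   qed
   hence "card ?B <= card ({l. real l <= M j} Un {l \<in> L j. x \<in> U l j})"
    using finL finle(1)[OF M0] by (intro card_mono) auto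
   also have "... <= card {l. real l <= M j} + card {l \<in> L j. x \<in> U l j}" by (rule card_Un_le)
   finally have "real (card ?B) <= (M j + 1) + real (card {l \<in> L j. x \<in> U l j})"
    using finle(2)[OF M0] by linarith
   also have "real (card {l \<in> L j. x \<in> U l j}) <= t j"
    using x jj(2) by (auto simp: X_def E_def not_le intro: less_imp_le)
   also have "M j + 1 + t j <= real j powr (-1) * N j"
    using j2[OF jj(3)] N1[of j] jj(4) by (simp add: divide_less_eq pos_le_divide_eq)
   finally show ?thesis by simp
  qed
  have sep: "2 powr (- \<rho> * j) < abs (x' - x + (real l' - real l) * \<alpha> - of_int z)"
   if j: "J <= j" and d: "abs (x - x') <= (1/2) ^ j" and l: "l ~= l'" "real l <= 2 * N j" "real l' <= 2 * N j" for j x x' l l' z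
  proof -
   let ?k = "int l' - int l"
   have k: "?k ~= 0" "abs (real_of_int ?k) <= 2 * N j" "0 < abs (real_of_int ?k)" using l by auto
   have "c3 / (2 * N j) powr (1 + \<sigma>) <= c3 / abs (real_of_int ?k) powr (1 + \<sigma>)"
    using k c3(1) \<sigma>(4) by (intro divide_left_mono powr_mono2 mult_pos_pos) auto
   also have "... <= abs (?k * \<alpha> - of_int z)" by (rule c3(2)[OF k(1)])
   finally have "c3 / (2 * N j) powr (1 + \<sigma>) <= abs ((real l' - real l) * \<alpha> - of_int z)" by simp
   moreover have "2 powr (- \<rho> * j) + r j < c3 / (2 * N j) powr (1 + \<sigma>)"
    using j3[of j] j c3(1) N1[of j] by (simp add: J_def pos_less_divide_eq divide_less_eq split: if_splits)
   ultimately show ?thesis using d unfolding r_def by linarith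
  qed
  have XE: "leb ({0<..<1} - X) <= ennreal kap"
   by (rule order_trans[OF emeasure_mono j0(2)]) (use Um in \<open>auto simp: X_def\<close>)
  have Xm: "X \<in> sets borel" using Um by (auto simp: X_def)
  show "\<exists>j0. \<exists>X\<in>sets borel. X <= {0<..<1} & leb ({0<..<1} - X) <= ennreal kap &
    (\<forall>j\<ge>j0. pair_separation \<alpha> f (%j. 2 powr (a * real j)) \<rho> 1 1 X j)"
   using XE sep cnt unfolding N_def pair_separation_def
   by (intro exI[of _ J] bexI[OF _ Xm] conjI allI ballI impI) (auto simp: X_def)
 qed (use \<rho> in auto)
qed

end

section \<open>Separation of Birkhoff sums for asymmetric logarithmic singularities\<close>

definition idist :: "real => real" where
 "idist y = min (frac y) (1 - frac y)"

lemma idist_le: "idist y <= abs (y - of_int z)"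
 unfolding idist_def by (rule min_frac_le_dist)

lemma idist_attained: obtains z where "abs (y - of_int z) = idist y"
proof (cases "frac y <= 1 - frac y")
 case True
 thus ?thesis using that[of "\<lfloor>y\<rfloor>"] by (simp add: idist_def frac_def)
next
 case False
 have "abs (y - of_int (\<lfloor>y\<rfloor> + 1)) = 1 - frac y" using frac_lt_1[of y] unfolding frac_def by simp
 thus ?thesis using that[of "\<lfloor>y\<rfloor> + 1"] False by (simp add: idist_def)
qed

lemma idist_nonneg: "0 <= idist y"
 using frac_ge_0[of y] frac_lt_1[of y] by (simp add: idist_def)

lemma idist_lipschitz: "idist y <= idist y' + abs (y - y')"
proof -
 obtain z where "abs (y' - of_int z) = idist y'" using idist_attained .
 thus ?thesis using idist_le[of y z] by linarith
qed

lemma idist_pos_not_Int: "0 < idist y ==> y \<notin> \<int>"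
 by (auto simp: idist_def)

lemma harm_le_ln: "1 <= n ==> harm n <= ln (real n) + 1"
 using euler_mascheroni_sequence_decreasing[of 1 n] by (simp add: harm_def)

lemma separated_width:
 fixes A :: "real set"
 assumes "finite A" "A ~= {}" "!!a b. a \<in> A ==> b \<in> A ==> a < b ==> s <= b - a"
 shows "(real (card A) - 1) * s <= Max A - Min A"
 using assms
proof (induction "card A" arbitrary: A)
 case (Suc n)
 show ?case
 proof (cases "n = 0")
  case True
  then obtain a where "A = {a}" using Suc(2) by (metis One_nat_def card_1_singletonE)
  thus ?thesis by simp
 next
  case False
  define B where "B = A - {Max A}"
  have M: "Max A \<in> A" using Suc by auto
  have B: "finite B" "card B = n" "B <= A" using Suc M by (auto simp: B_def)
  hence ne: "B ~= {}" using False by auto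
  have "(real (card B) - 1) * s <= Max B - Min B" by (rule Suc.hyps(1)) (use B ne Suc.prems(3) in auto)
  moreover have "Max B \<in> B" using B ne by auto
  hence "Max B \<in> A" "Max B ~= Max A" by (auto simp: B_def)
  hence "Max B < Max A" using Suc.prems(1) by (simp add: less_le)
  hence "s <= Max A - Max B" using Suc.prems(3)[OF \<open>Max B \<in> A\<close> M] by simp
  moreover have "Min A <= Min B" using B ne Suc.prems(1) by (intro Min_antimono) auto
  ultimately show ?thesis using Suc(2) B(2) by (simp add: algebra_simps flip: Suc(2))
 qed
qed simp

lemma separated_count:
 fixes A :: "real set"
 assumes "finite A" "0 < s" "!!a b. a \<in> A ==> b \<in> A ==> a < b ==> s <= b - a" "A <= {u..v}" "u <= v"
 shows "real (card A) <= (v - u) / s + 1"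
proof (cases "A = {}")
 case False
 have "(real (card A) - 1) * s <= Max A - Min A" by (rule separated_width) (use assms False in auto)
 also have "... <= v - u" using assms(4) Max_in[OF assms(1) False] Min_in[OF assms(1) False] by (intro diff_mono) auto
 finally show ?thesis using assms(2) by (simp add: field_simps)
qed (use assms in auto)

text \<open>In increasing order, the element number \<open>k\<close> is at least \<open>r + (k - 1) * s\<close>.\<close>

lemma separated_sum_inverse:
 fixes A :: "real set"
 assumes "finite A" "0 < s" "0 < r" "!!a b. a \<in> A ==> b \<in> A ==> a < b ==> s <= b - a" "!!a. a \<in> A ==> r <= a"
 shows "(\<Sum>a\<in>A. 1 / a) <= 1 / r + harm (card A) / s"
proof -
 have "(\<Sum>a\<in>A. 1 / a) <= 1 / r + harm (card A - 1) / s"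
  using assms(1,4,5)
 proof (induction "card A" arbitrary: A)
  case 0
  thus ?case using assms(2,3) by (simp add: harm_def)
 next
  case (Suc n)
  show ?case
  proof (cases "n = 0")
   case True
   then obtain a where a: "A = {a}" using Suc(2) by (metis One_nat_def card_1_singletonE)
   hence "1 / a <= 1 / r" using Suc.prems(3)[of a] assms(3) by (intro divide_left_mono mult_pos_pos) auto
   thus ?thesis using a by (simp add: harm_def)
  next
   case False
   have cA: "card A = Suc n" using Suc(2) by simp
   have ne: "A ~= {}" using Suc by auto
   have M: "Max A \<in> A" "Min A \<in> A" using Suc.prems(1) ne by auto
   define B where "B = A - {Max A}"
   have B: "finite B" "card B = n" "A = insert (Max A) B" "Max A \<notin> B" using Suc M by (auto simp: B_def)
   have IH: "(\<Sum>a\<in>B. 1 / a) <= 1 / r + harm (card B - 1) / s"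
    by (rule Suc.hyps(1)) (use B Suc.prems B_def in auto)
   have "(real (card A) - 1) * s <= Max A - Min A" by (rule separated_width) (use Suc.prems ne in auto)
   hence "n * s <= Max A - Min A" by (simp add: cA)
   moreover have "r <= Min A" using Suc.prems M by auto
   ultimately have "n * s <= Max A" using assms(3) by linarith
   moreover have "0 < real n * s" using assms(2) False by simp
   ultimately have "1 / Max A <= 1 / (real n * s)"
    using order.strict_trans2[OF \<open>0 < real n * s\<close>, of "Max A"] by (intro divide_left_mono mult_pos_pos[of "Max A"]) auto
   also have "... = (1 / real n) / s" by simp
   finally have "1 / Max A <= (1 / real n) / s" .
   moreover have "harm n = harm (n - 1) + 1 / real n" using False harm_Suc[of "n - 1"]
    by (simp add: inverse_eq_divide)
   ultimately show ?thesis using IH B cA sum.remove[OF Suc.prems(1) M(1), of "%a. 1 / a"]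
    by (simp add: add_divide_distrib flip: B_def)
  qed
 qed
 also have "harm (card A - 1) / s <= harm (card A) / s" using assms(2) by (intro divide_right_mono harm_mono) auto
 finally show ?thesis by simp
qed

context log_diophantine begin

text \<open>The reflection of the circle exchanges the two sides of the singularity.\<close>

lemma log_diophantine_neg: "log_diophantine (- \<alpha>) q (%n. - p n) C"
proof
 show "- \<alpha> \<notin> \<rat>" using irrational by simp
 show "abs (rq n * - \<alpha> - real_of_int (- p n)) < 1 / rq (Suc n)" for n using approx[of n] by simp
qed (use q_ge_2 coprime_pq q_less q_add C_pos q_growth in auto)

lemma orbit_separated:
 assumes "i ~= i'" "abs (int i - int i') < int (q n)"
 shows "1 / (4 * rq n) <= abs ((orb x i - of_int z) - (orb x i' - of_int z'))"
 using dist_integer_ge[of "int i - int i'" n "z - z'"] assms by (simp add: algebra_simps)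

text \<open>Signed distances of the orbit points to the integers.\<close>

lemma orbit_signed_points:
 assumes I: "I <= {b..<b + q n}"
 obtains g where "!!i. i \<in> I ==> abs (g i) = idist (orb x i)" "inj_on g I"
  "!!i i'. i \<in> I ==> i' \<in> I ==> i ~= i' ==> 1 / (4 * rq n) <= abs (g i - g i')"
proof -
 have "\<forall>i. \<exists>z. abs (orb x i - of_int z) = idist (orb x i)" using idist_attained by metis
 then obtain z where z: "!!i. abs (orb x i - of_int (z i)) = idist (orb x i)" by metis
 define g where "g i = orb x i - of_int (z i)" for i
 have sep: "1 / (4 * rq n) <= abs (g i - g i')" if "i \<in> I" "i' \<in> I" "i ~= i'" for i i'
 proof -
  have "i \<in> {b..<b + q n}" "i' \<in> {b..<b + q n}" using that I by auto
  hence "abs (int i - int i') < int (q n)" by auto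
  thus ?thesis unfolding g_def by (rule orbit_separated[OF that(3)])
 qed
 have "inj_on g I"
 proof (rule inj_onI, rule ccontr)
  fix i i' assume "i \<in> I" "i' \<in> I" "g i = g i'" "i ~= i'"
  thus False using sep[of i i'] q_pos[of n] by simp
 qed
 thus thesis using that[of g] z sep by (auto simp: g_def)
qed

lemma close_orbit_count:
 assumes I: "I <= {b..<b + q n}" and close: "!!i. i \<in> I ==> idist (orb x i) <= \<delta>" and \<delta>: "0 <= \<delta>"
 shows "real (card I) <= 8 * rq n * \<delta> + 1"
proof -
 obtain g where g: "!!i. i \<in> I ==> abs (g i) = idist (orb x i)" "inj_on g I"
  "!!i i'. i \<in> I ==> i' \<in> I ==> i ~= i' ==> 1 / (4 * rq n) <= abs (g i - g i')"
  using orbit_signed_points[OF I, of x] by metis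
 have fin: "finite I" using I finite_subset by blast
 have "real (card (g ` I)) <= (\<delta> - (- \<delta>)) / (1 / (4 * rq n)) + 1"
 proof (rule separated_count)
  show "g ` I <= {- \<delta>..\<delta>}" using g(1) close by (fastforce simp: abs_le_iff)
  show "1 / (4 * rq n) <= v - u" if "u \<in> g ` I" "v \<in> g ` I" "u < v" for u v
   using that g(3) by fastforce
 qed (use fin q_pos[of n] \<delta> in auto)
 thus ?thesis using card_image[OF g(2)] by (simp add: mult_ac)
qed

lemma close_orbit_sum:
 assumes I: "I <= {b..<b + q n}" and far: "!!i. i \<in> I ==> r <= idist (orb x i)" and r: "0 < r"
  and K: "card I <= K"
 shows "(\<Sum>i\<in>I. 1 / idist (orb x i)) <= 2 / r + 8 * rq n * harm K"
proof -
 obtain g where g: "!!i. i \<in> I ==> abs (g i) = idist (orb x i)" "inj_on g I"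
  "!!i i'. i \<in> I ==> i' \<in> I ==> i ~= i' ==> 1 / (4 * rq n) <= abs (g i - g i')"
  using orbit_signed_points[OF I, of x] by metis
 have fin: "finite I" using I finite_subset by blast
 have half: "(\<Sum>i\<in>J. 1 / idist (orb x i)) <= 1 / r + 4 * rq n * harm K"
  if J: "J <= I" and e: "e \<in> {1, -1}" and sgn: "!!i. i \<in> J ==> e * g i = idist (orb x i)" for J and e :: real
 proof -
  have inj: "inj_on (%i. e * g i) J" using inj_on_subset[OF g(2) J] e by (auto simp: inj_on_def)
  have finJ: "finite J" using J fin finite_subset by blast
  have "(\<Sum>i\<in>J. 1 / idist (orb x i)) = (\<Sum>i\<in>J. 1 / (e * g i))" using sgn by (intro sum.cong) auto
  also have "... = (\<Sum>a\<in>(%i. e * g i) ` J. 1 / a)" by (subst sum.reindex[OF inj]) simp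
  also have "... <= 1 / r + harm (card ((%i. e * g i) ` J)) / (1 / (4 * rq n))"
  proof (rule separated_sum_inverse)
   show "1 / (4 * rq n) <= v - u" if uv: "u \<in> (%i. e * g i) ` J" "v \<in> (%i. e * g i) ` J" "u < v" for u v
   proof -
    obtain i i' where i: "i \<in> J" "i' \<in> J" "u = e * g i" "v = e * g i'" using uv by auto
    have "1 / (4 * rq n) <= abs (g i - g i')" by (rule g(3)) (use i J uv in auto)
    also have "abs (g i - g i') = abs (u - v)" using i e by auto
    finally show ?thesis using uv by simp
   qed
   show "r <= a" if "a \<in> (%i. e * g i) ` J" for a using that sgn far J by auto
  qed (use finJ q_pos[of n] r in auto)
  also have "harm (card ((%i. e * g i) ` J)) / (1 / (4 * rq n)) <= harm K / (1 / (4 * rq n))"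
   using card_image[OF inj] card_mono[OF fin J] K by (intro divide_right_mono harm_mono) auto
  finally show ?thesis by (simp add: mult.commute)
 qed
 define P where "P = {i \<in> I. 0 <= g i}"
 have "(\<Sum>i\<in>I. 1 / idist (orb x i)) = (\<Sum>i\<in>P. 1 / idist (orb x i)) + (\<Sum>i\<in>I - P. 1 / idist (orb x i))"
  using sum.subset_diff[of P I] fin by (simp add: P_def add.commute)
 also have "... <= (1 / r + 4 * rq n * harm K) + (1 / r + 4 * rq n * harm K)"
 proof (rule add_mono)
  show "(\<Sum>i\<in>P. 1 / idist (orb x i)) <= 1 / r + 4 * rq n * harm K"
  proof (rule half[of P 1])
   show "1 * g i = idist (orb x i)" if "i \<in> P" for i
    using g(1)[of i] that by (simp add: P_def)
  qed (auto simp: P_def)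
  show "(\<Sum>i\<in>I - P. 1 / idist (orb x i)) <= 1 / r + 4 * rq n * harm K"
  proof (rule half[of "I - P" "-1"])
   show "- 1 * g i = idist (orb x i)" if "i \<in> I - P" for i
    using g(1)[of i] that by (auto simp: P_def)
  qed auto
 qed
 finally show ?thesis by (simp add: mult_ac)
qed

text \<open>Comparison of one block of length \<open>q n\<close> with the grid of mesh \<open>1 / q n\<close>.\<close>

lemma truncated_block_sum:
 assumes Q: "5 <= q n"
 defines "T \<equiv> rq n / 3"
 shows "abs (Bs (%y. min (1 / y) T) (q n) x - q n * ln (q n)) <= 3 * rq n"
proof -
 let ?Q = "q n"
 define X where "X = \<lfloor>real ?Q * x\<rfloor>"
 define r where "r i = (X + int i * p n) mod int ?Q" for i
 have r: "bij_betw r {..<?Q} {0..<int ?Q}" unfolding r_def by (rule grid_residues)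
 have frac_eq: "\<exists>e. -1 < e & e < 2 & (1 <= r i --> r i <= int ?Q - 2 --> frac (orb x i) = (real_of_int (r i) + e) / ?Q)"
  if i: "i < ?Q" for i
 proof -
  obtain e where e: "-1 < e" "e < 2" "orb x i = (real_of_int (X + int i * p n) + e) / ?Q"
   using grid_point[OF i, of x] unfolding X_def by metis
  have "X + int i * p n = r i + int ?Q * ((X + int i * p n) div int ?Q)" unfolding r_def by simp
  hence "real_of_int (X + int i * p n) = real_of_int (r i) + real ?Q * of_int ((X + int i * p n) div int ?Q)"
   by (metis of_int_add of_int_mult of_int_of_nat_eq)
  hence *: "orb x i = (real_of_int (r i) + e) / ?Q + of_int ((X + int i * p n) div int ?Q)"
   using e(3) q_pos[of n] by (simp add: field_simps)
  have "frac (orb x i) = (real_of_int (r i) + e) / ?Q" if "1 <= r i" "r i <= int ?Q - 2"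
  proof (rule frac_eqI[OF _ _ *])
   have "1 <= real_of_int (r i)" "real_of_int (r i) <= real ?Q - 2" using that by linarith+
   thus "0 <= (real_of_int (r i) + e) / ?Q" "(real_of_int (r i) + e) / ?Q < 1"
    using e q_pos[of n] by simp_all
  qed
  thus ?thesis using e by blast
 qed
 define w where "w i = min (1 / frac (orb x i)) T" for i
 have T: "0 < T" using q_pos[of n] by (simp add: T_def)
 have w0: "0 <= w i" "w i <= T" for i using T by (auto simp: w_def)
 have sum_r: "(\<Sum>i<?Q. F (r i)) = (\<Sum>k<?Q. F (int k))" for F :: "int => real"
 proof -
  have "(\<Sum>i<?Q. F (r i)) = (\<Sum>k\<in>{0..<int ?Q}. F k)" by (rule sum.reindex_bij_betw[OF r])
  also have "... = (\<Sum>k<?Q. F (int k))"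
   by (rule sum.reindex_bij_witness[of _ int nat]) auto
  finally show ?thesis .
 qed
 have up: "w i <= (if r i < 2 \<or> r i = int ?Q - 1 then T else 0) + (if 2 <= r i then real ?Q / (real_of_int (r i) - 1) else 0)"
  if i: "i < ?Q" for i
 proof (cases "2 <= r i & r i ~= int ?Q - 1")
  case True
  have "r i \<in> {0..<int ?Q}" using r i by (auto simp: bij_betw_def)
  hence r1: "1 <= r i" "r i <= int ?Q - 2" "2 <= real_of_int (r i)" using True by auto
  then obtain e where e: "-1 < e" "frac (orb x i) = (real_of_int (r i) + e) / ?Q" using frac_eq[OF i] by blast
  have "w i <= 1 / frac (orb x i)" by (simp add: w_def)
  also have "... = ?Q / (real_of_int (r i) + e)" using e by simp
  also have "... <= real ?Q / (real_of_int (r i) - 1)" using e r1 by (intro divide_left_mono mult_pos_pos) auto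
  finally show ?thesis using True by auto
 next
  case False
  thus ?thesis using w0(2)[of i] T by (auto intro: add_increasing2)
 qed
 have lo: "(if 1 <= r i & r i <= int ?Q - 2 then real ?Q / (real_of_int (r i) + 2) else 0) <= w i" if i: "i < ?Q" for i
 proof (cases "1 <= r i & r i <= int ?Q - 2")
  case True
  then obtain e where e: "-1 < e" "e < 2" "frac (orb x i) = (real_of_int (r i) + e) / ?Q" using frac_eq[OF i] by blast
  have r1: "1 <= real_of_int (r i)" using True by linarith
  have "real ?Q / (real_of_int (r i) + 2) <= ?Q / (real_of_int (r i) + e)"
   using e r1 by (intro divide_left_mono mult_pos_pos) auto
  also have "... = 1 / frac (orb x i)" using e by simp
  finally have "real ?Q / (real_of_int (r i) + 2) <= 1 / frac (orb x i)" .
  moreover have "real ?Q / (real_of_int (r i) + 2) <= T"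
   unfolding T_def using r1 by (intro divide_left_mono) auto
  ultimately show ?thesis using True by (simp add: w_def)
 qed (use w0 in auto)
 have "(\<Sum>i<?Q. w i) <= (\<Sum>k<?Q. (if int k < 2 \<or> int k = int ?Q - 1 then T else 0) + (if 2 <= int k then real ?Q / (real_of_int (int k) - 1) else 0))"
  unfolding sum_r[symmetric, of "%k. (if k < 2 \<or> k = int ?Q - 1 then T else 0) + (if 2 <= k then real ?Q / (real_of_int k - 1) else 0)"]
  by (intro sum_mono up) auto
 also have "... = (\<Sum>k<?Q. (if int k < 2 \<or> int k = int ?Q - 1 then T else 0)) + (\<Sum>k<?Q. if 2 <= k then real ?Q / (real k - 1) else 0)"
  by (simp add: sum.distrib cong: if_cong)
 also have "(\<Sum>k<?Q. (if int k < 2 \<or> int k = int ?Q - 1 then T else 0)) = (\<Sum>k\<in>{0, 1, ?Q - 1}. T)"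
  using Q by (intro sum.mono_neutral_cong_right) auto
 also have "... = ?Q" using Q by (simp add: T_def)
 also have "(\<Sum>k<?Q. if 2 <= k then real ?Q / (real k - 1) else 0) = (\<Sum>k\<in>{2..<?Q}. real ?Q / (real k - 1))"
  by (intro sum.mono_neutral_cong_right) auto
 also have "... = (\<Sum>k\<in>{1..?Q - 2}. real ?Q / real k)"
  using Q by (intro sum.reindex_bij_witness[of _ Suc "%k. k - 1"]) auto
 also have "... = ?Q * harm (?Q - 2)" by (simp add: harm_def sum_distrib_left divide_inverse)
 also have "... <= ?Q * (ln ?Q + 1)"
  using harm_le_ln[of ?Q] harm_mono[of "?Q - 2" ?Q, where 'a = real] Q by (intro mult_left_mono) auto
 finally have 1: "(\<Sum>i<?Q. w i) <= ?Q * ln ?Q + 2 * ?Q" by (simp add: algebra_simps)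
 have "?Q * (ln ?Q - 3/2) <= ?Q * (harm ?Q - 3/2)"
 proof (intro mult_left_mono diff_right_mono)
  have "ln (real ?Q) <= ln (real ?Q + 1)" using Q by simp
  thus "ln ?Q <= harm ?Q" using harm_ge_ln[of ?Q] by simp
 qed simp
 also have "harm ?Q = (\<Sum>k\<in>{1..2}. inverse (real k)) + (\<Sum>k\<in>{3..?Q}. inverse (real k))"
 proof -
  have "{1..?Q} = {1..2} Un {3..?Q}" using Q by auto
  thus ?thesis unfolding harm_def by (simp only:) (rule sum.union_disjoint, auto)
 qed
 also have "(\<Sum>k\<in>{1..2}. inverse (real k)) = 3/2" by (simp add: numeral_2_eq_2)
 also have "?Q * (3/2 + (\<Sum>k\<in>{3..?Q}. inverse (real k)) - 3/2) = ?Q * (\<Sum>k\<in>{3..?Q}. inverse (real k))"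
  by (simp only: add_diff_cancel_left')
 also have "... = (\<Sum>k\<in>{3..?Q}. real ?Q / real k)"
  by (simp only: sum_distrib_left divide_inverse)
 also have "... = (\<Sum>k\<in>{1..?Q - 2}. real ?Q / (real k + 2))"
  using Q by (intro sum.reindex_bij_witness[of _ "%k. k + 2" "%k. k - 2"]) auto
 also have "... = (\<Sum>k<?Q. (if 1 <= int k & int k <= int ?Q - 2 then real ?Q / (real_of_int (int k) + 2) else 0))"
  using Q by (intro sum.mono_neutral_cong_left) auto
 also have "... <= (\<Sum>i<?Q. w i)"
  unfolding sum_r[symmetric, of "%k. (if 1 <= k & k <= int ?Q - 2 then real ?Q / (real_of_int k + 2) else 0)"]
  by (intro sum_mono lo) auto
 finally have 2: "?Q * ln ?Q - 3/2 * ?Q <= (\<Sum>i<?Q. w i)" by (simp add: algebra_simps)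
 show ?thesis using 1 2 q_pos[of n] by (simp add: birkhoff_def w_def abs_le_iff)
qed

lemma truncated_sum:
 assumes Q: "5 <= q n"
 defines "T \<equiv> rq n / 3"
 shows "abs (Bs (%y. min (1 / y) T) m x - m * ln (q n)) <= q n * ln (q n) + 3 * real m + 3 * rq n"
proof -
 let ?B = "Bs (%y. min (1 / y) T)"
 let ?Q = "q n"
 have blocks: "abs (?B (k * ?Q) x - real k * (?Q * ln ?Q)) <= real k * (3 * ?Q)" for k x
 proof (induction k arbitrary: x)
  case (Suc k)
  have "?B (Suc k * ?Q) x = ?B ?Q x + ?B (k * ?Q) (x + real ?Q * \<alpha>)"
   unfolding mult_Suc birkhoff_add ..
  moreover have "abs (?B ?Q x - ?Q * ln ?Q) <= 3 * real ?Q" unfolding T_def by (rule truncated_block_sum[OF Q])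
  ultimately show ?case using Suc[of "x + real ?Q * \<alpha>"] by (simp add: distrib_right)
 qed simp
 define k t where "k = m div ?Q" and "t = m mod ?Q"
 have m: "m = k * ?Q + t" "t < ?Q" using Q by (auto simp: k_def t_def)
 define y where "y = x + real (k * ?Q) * \<alpha>"
 have T: "0 < T" using q_pos[of n] by (simp add: T_def)
 have nonneg: "0 <= min (1 / frac z) T" for z using T by auto
 have "?B t y <= ?B ?Q y" unfolding birkhoff_def using m(2) nonneg by (intro sum_mono2) auto
 also have "... <= ?Q * ln ?Q + 3 * ?Q" using truncated_block_sum[OF Q, of y] unfolding T_def by linarith
 finally have up: "?B t y <= ?Q * ln ?Q + 3 * ?Q" .
 have lo: "0 <= ?B t y" unfolding birkhoff_def using nonneg by (intro sum_nonneg) auto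
 have "?B m x = ?B (k * ?Q) x + ?B t y" unfolding m(1) birkhoff_add y_def ..
 moreover have "real m * ln ?Q = real k * (?Q * ln ?Q) + t * ln ?Q" unfolding m(1) by (simp add: algebra_simps)
 moreover have "real k * (3 * ?Q) <= 3 * real m" unfolding m(1) by simp
 moreover have "t * ln ?Q <= ?Q * ln ?Q" "0 <= t * ln ?Q" using m(2) Q by (auto intro!: mult_right_mono)
 ultimately show ?thesis using blocks[of k x] up lo by linarith
qed

end

lemma sum_le_windows:
 fixes G :: "nat => real"
 assumes W: "!!b. (\<Sum>i\<in>{b..<b + Q}. G i) <= W" and G: "!!i. 0 <= G i" and Q: "0 < Q"
 shows "(\<Sum>i<m. G i) <= (real m / real Q + 1) * W"
proof -
 have W0: "0 <= W" using W[of 0] sum_nonneg[of "{0..<0 + Q}" G] G by (meson order_trans)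
 have "(\<Sum>i<k * Q. G i) <= real k * W" for k
 proof (induction k)
  case (Suc k)
  have "(\<Sum>i<Suc k * Q. G i) = (\<Sum>i<k * Q. G i) + (\<Sum>i\<in>{k * Q..<k * Q + Q}. G i)"
   using sum.atLeastLessThan_concat[of 0 "k * Q" "k * Q + Q" G] by (simp add: lessThan_atLeast0 add.commute)
  thus ?case using Suc W[of "k * Q"] by (simp add: distrib_right)
 qed simp
 note blocks = this
 have "m <= (m div Q + 1) * Q" using dividend_less_div_times[OF Q, of m] by simp
 hence "(\<Sum>i<m. G i) <= (\<Sum>i<(m div Q + 1) * Q. G i)" using G by (intro sum_mono2) auto
 also have "... <= real (m div Q + 1) * W" by (rule blocks)
 also have "... <= (real m / real Q + 1) * W"
 proof (intro mult_right_mono W0)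
  have "real (m div Q * Q) <= real m" using div_times_less_eq_dividend[of m Q] of_nat_mono by blast
  thus "real (m div Q + 1) <= real m / real Q + 1" using Q by (simp add: field_simps)
 qed
 finally show ?thesis .
qed

lemma idist_minus: "idist (- y) = idist y"
 by (auto simp: idist_def frac_neg elim!: Ints_cases)

context log_diophantine begin

text \<open>The nearest points are few and separated, so they contribute little; the truncated sum over the
 others is governed by the grid.\<close>

lemma inverse_frac_sum:
 assumes Q: "5 <= q n'" and r: "0 < r" and far: "!!i. i < m ==> r <= idist (orb x i)"
  and K: "24 * rq n / rq n' + 1 <= real K"
 shows "abs (Bs (%y. 1 / y) m x - m * ln (q n')) <=
  q n' * ln (q n') + 3 * real m + 3 * rq n' + (real m / rq n + 1) * (2 / r + 8 * rq n * harm K)"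
proof -
 define T where "T = rq n' / 3"
 have T: "0 < T" using q_pos[of n'] by (simp add: T_def)
 define y where "y i = orb x i" for i
 define I where "I = {i. i < m & frac (y i) < 1 / T}"
 have fr: "0 < frac (y i)" "idist (y i) <= frac (y i)" "r <= idist (y i)" if "i < m" for i
  using far[OF that] r unfolding y_def idist_def by linarith+
 define G where "G i = (if i \<in> I then 1 / idist (y i) else 0)" for i
 have G0: "0 <= G i" for i using idist_nonneg[of "y i"] by (simp add: G_def)
 have diff: "0 <= 1 / frac (y i) - min (1 / frac (y i)) T & 1 / frac (y i) - min (1 / frac (y i)) T <= G i" if i: "i < m" for i
 proof (cases "i \<in> I")
  case True
  have "1 / frac (y i) <= 1 / idist (y i)" using fr[OF i] r by (intro divide_left_mono mult_pos_pos) auto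
  moreover have "0 <= min (1 / frac (y i)) T" using T by simp
  moreover have "G i = 1 / idist (y i)" using True by (simp add: G_def)
  ultimately show ?thesis using min.cobounded1[of "1 / frac (y i)" T] by linarith
 next
  case False
  hence "1 / T <= frac (y i)" using i by (simp add: I_def)
  hence "1 / frac (y i) <= T" using fr[OF i] T by (simp add: field_simps)
  thus ?thesis using False by (simp add: G_def)
 qed
 have "(\<Sum>i<m. G i) <= (real m / rq n + 1) * (2 / r + 8 * rq n * harm K)"
 proof (rule sum_le_windows)
  fix b
  let ?J = "I Int {b..<b + q n}"
  have "(\<Sum>i\<in>{b..<b + q n}. G i) = (\<Sum>i\<in>?J. 1 / idist (orb x i))"
   by (intro sum.mono_neutral_cong_right) (auto simp: G_def y_def)
  also have "... <= 2 / r + 8 * rq n * harm K"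
  proof (rule close_orbit_sum[where b = b])
   have "real (card ?J) <= 8 * rq n * (1 / T) + 1"
   proof (rule close_orbit_count[where b = b])
    show "idist (orb x i) <= 1 / T" if "i \<in> ?J" for i
     using that fr(2)[of i] by (auto simp: I_def y_def)
   qed (use T in auto)
   also have "... <= real K" using K by (simp add: T_def)
   finally show "card ?J <= K" by simp
  qed (use far r in \<open>auto simp: I_def\<close>)
  finally show "(\<Sum>i\<in>{b..<b + q n}. G i) <= 2 / r + 8 * rq n * harm K" .
 qed (use G0 q_ge_2[of n] in auto)
 moreover have "Bs (%y. 1 / y) m x - Bs (%y. min (1 / y) T) m x = (\<Sum>i<m. 1 / frac (y i) - min (1 / frac (y i)) T)"
  by (simp add: birkhoff_def y_def sum_subtractf)
 moreover have "0 <= (\<Sum>i<m. 1 / frac (y i) - min (1 / frac (y i)) T)" using diff by (intro sum_nonneg) auto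
 moreover have "(\<Sum>i<m. 1 / frac (y i) - min (1 / frac (y i)) T) <= (\<Sum>i<m. G i)" using diff by (intro sum_mono) auto
 moreover have "abs (Bs (%y. min (1 / y) T) m x - m * ln (q n')) <= q n' * ln (q n') + 3 * real m + 3 * rq n'"
  unfolding T_def by (rule truncated_sum[OF Q])
 ultimately show ?thesis by linarith
qed

lemma inverse_one_minus_frac_sum:
 assumes Q: "5 <= q n'" and r: "0 < r" and far: "!!i. i < m ==> r <= idist (orb x i)"
  and K: "24 * rq n / rq n' + 1 <= real K"
 shows "abs (Bs (%y. 1 / (1 - y)) m x - m * ln (q n')) <=
  q n' * ln (q n') + 3 * real m + 3 * rq n' + (real m / rq n + 1) * (2 / r + 8 * rq n * harm K)"
proof -
 have m: "- x + real i * (- \<alpha>) = - (orb x i)" for i by simp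
 have "orb x i \<notin> \<int>" if "i < m" for i using far[OF that] r by (intro idist_pos_not_Int) auto
 hence "Bs (%y. 1 / (1 - y)) m x = birkhoff (- \<alpha>) (%y. 1 / y) m (- x)"
  unfolding birkhoff_def m by (intro sum.cong refl, subst frac_neg) auto
 moreover have "r <= idist (- x + real i * (- \<alpha>))" if "i < m" for i
  unfolding m idist_minus by (rule far[OF that])
 ultimately show ?thesis
  using log_diophantine.inverse_frac_sum[OF log_diophantine_neg Q r, of m "- x" n K] K by simp
qed

text \<open>Because the two one-sided sums have the same leading term, an asymmetry of the two
 singularities makes the derivative of the Birkhoff sums grow like \<open>m ln m\<close>, as long as the orbit
 avoids the singularity a little.\<close>

lemma asymmetric_derivative_sum:
 fixes f' :: "real => real"
 assumes f': "!!eps. 0 < eps ==> \<exists>K>0. \<forall>x\<in>{0<..<1}. abs (f' x + A / x - B / (1 - x)) <= eps * (1 / x + 1 / (1 - x)) + K"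
  and AB: "0 < A" "0 < B" "A ~= B"
 obtains j1 where "!!j n m x. j1 <= j ==> 2 ^ j * real j powr (-2) <= rq n ==> rq n <= 2 ^ j ==>
   rq n * real j powr (-1/8) <= real m ==> (!!i. i < m ==> 1 / (rq n * real j powr (5/8)) <= idist (orb x i)) ==>
   abs (A - B) / 4 * (real m * real j) <= abs (Bs f' m x)"
proof -
 define D where "D = abs (A - B)"
 have D: "0 < D" using AB by (simp add: D_def)
 define eps where "eps = D / 32"
 have eps: "0 < eps" using D by (simp add: eps_def)
 obtain K where K: "0 < K" "!!x. x \<in> {0<..<1} ==> abs (f' x + A / x - B / (1 - x)) <= eps * (1 / x + 1 / (1 - x)) + K"
  using f'[OF eps] by auto
 define E where "E j = real j powr (-7/8) + 3 / real j + 3 * real j powr (-15/8) +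
   2 * real j powr (-7/8) * (2 * real j powr (5/8) + 8 * (ln (24 * real j powr 3 + 3) + 1))" for j :: nat
 define S where "S = A + B + 2 * eps"
 have S: "0 < S" using AB eps by (simp add: S_def)
 have "E \<longlonglongrightarrow> 0" unfolding E_def by real_asymp
 hence e1: "eventually (%j. E j < D / (16 * S)) sequentially" using D S by (intro order_tendstoD) auto
 have "(%j::nat. K / real j) \<longlonglongrightarrow> 0" by real_asymp
 hence e2: "eventually (%j::nat. K / real j < D / 16) sequentially" using D by (intro order_tendstoD) auto
 have e3: "eventually (%j::nat. max (rq 0) 5 < 2 ^ j * real j powr (-5)) sequentially"
 proof -
  have "filterlim (%j::nat. 2 ^ j * real j powr (-5)) at_top sequentially" by real_asymp
  thus ?thesis unfolding filterlim_at_top_dense by blast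
 qed
 have "(%j::nat. C * real j powr (17/16) / real j powr 2) \<longlonglongrightarrow> 0" by real_asymp
 hence e4: "eventually (%j::nat. C * real j powr (17/16) / real j powr 2 < 1) sequentially" by (intro order_tendstoD) auto
 have "(%j::nat. ln (real j powr 5) / real j) \<longlonglongrightarrow> 0" by real_asymp
 hence e5: "eventually (%j::nat. ln (real j powr 5) / real j < 1/8) sequentially" by (intro order_tendstoD) auto
 have "eventually (%j. E j < D / (16 * S) & K / real j < D / 16 & max (rq 0) 5 < 2 ^ j * real j powr (-5) &
  C * real j powr (17/16) / real j powr 2 < 1 & ln (real j powr 5) / real j < 1/8 & 1 <= j) sequentially"
  using e1 e2 e3 e4 e5 eventually_ge_at_top[of 1] by eventually_elim auto
 then obtain j1 where j1: "!!j. j1 <= j ==> E j < D / (16 * S) & K / real j < D / 16 & max (rq 0) 5 < 2 ^ j * real j powr (-5) &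
  C * real j powr (17/16) / real j powr 2 < 1 & ln (real j powr 5) / real j < 1/8 & 1 <= j"
  by (auto simp: eventually_sequentially)
 show thesis
 proof (rule that[of j1])
  fix j n m x
  assume j: "j1 <= j" and q1: "2 ^ j * real j powr (-2) <= rq n" and q2: "rq n <= 2 ^ j"
   and m: "rq n * real j powr (-1/8) <= real m"
   and far: "!!i. i < m ==> 1 / (rq n * real j powr (5/8)) <= idist (orb x i)"
  note J = j1[OF j]
  have jp: "1 <= real j" using J by simp
  let ?Q = "rq n"
  have Qpos: "0 < ?Q" by (rule q_pos)
  \<comment> \<open>The block length \<open>q n'\<close>: small against \<open>q n\<close>, but with almost the same logarithm.\<close>
  have "rq 0 <= ?Q / real j"
  proof -
   have "rq 0 <= 2 ^ j * real j powr (-5)" using J by linarith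
   also have "... <= 2 ^ j * real j powr (-3)" using jp by (intro mult_left_mono powr_mono) auto
   also have "... = (2 ^ j * real j powr (-2)) / real j"
    using jp powr_diff[of "real j" "-2" 1] by simp
   also have "... <= ?Q / real j" using q1 by (intro divide_right_mono) auto
   finally show ?thesis .
  qed
  then obtain n' where n': "rq n' <= ?Q / real j" "?Q / real j < real (q (Suc n'))"
   using denominator_at_scale by blast
  let ?q = "rq n'"
  have qpos: "0 < ?q" by (rule q_pos)
  have "?Q / real j <= ?Q / 1" using jp Qpos by (intro divide_left_mono) auto
  hence qQ: "?q <= 2 ^ j" using n'(1) q2 by linarith
  have lnq: "ln ?q <= real j"
  proof -
   have "ln ?q <= ln (2 ^ j)" using qQ qpos by simp
   also have "... = real j * ln 2" by (simp add: ln_realpow)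
   also have "... <= real j * 1" using ln_2_less_1 by (intro mult_left_mono) auto
   finally show ?thesis by simp
  qed
  have Qq: "?Q <= real j powr 3 * ?q"
  proof -
   have "?Q <= real j * (C * ?q * ln ?q powr (17/16))"
    using n'(2) q_growth[of n'] jp by (simp add: divide_less_eq mult.commute) (meson less_imp_le mult_left_mono of_nat_0_le_iff order_trans)
   also have "... <= real j * (C * ?q * real j powr (17/16))"
    using lnq C_pos qpos q_ge_2[of n'] by (intro mult_left_mono powr_mono2) auto
   also have "... = (C * real j powr (17/16)) * (real j * ?q)" by simp
   also have "... <= real j powr 2 * (real j * ?q)"
    using J jp qpos by (intro mult_right_mono) (auto simp: divide_less_eq)
   also have "... = real j powr 3 * ?q" using jp powr_add[of "real j" 2 1] by simp
   finally show ?thesis .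
  qed
  have q5: "2 ^ j * real j powr (-5) <= ?q"
  proof -
   have "2 ^ j * real j powr (-5) * real j powr 3 = 2 ^ j * real j powr (-2)" using powr_add[of "real j" "-5" 3] by simp
   also have "... <= ?q * real j powr 3" using q1 Qq by (simp add: mult.commute)
   finally show ?thesis using jp by simp
  qed
  hence five: "5 <= q n'" using J by linarith
  have lnq2: "real j / 2 <= ln ?q"
  proof -
   have "ln (2 ^ j * real j powr (-5)) = real j * ln 2 - ln (real j powr 5)"
    using jp by (simp add: ln_mult ln_realpow ln_powr)
   moreover have "ln (2 ^ j * real j powr (-5)) <= ln ?q" using q5 jp by (intro ln_mono) auto
   moreover have "real j * (2/3) <= real j * ln 2" using ln2_ge_two_thirds by (intro mult_left_mono) auto
   moreover have "ln (real j powr 5) <= real j / 8" using J jp by (simp add: divide_less_eq)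
   ultimately show ?thesis by linarith
  qed
  define Kn where "Kn = nat \<lceil>24 * real j powr 3 + 1\<rceil>"
  have Kn: "24 * real j powr 3 + 1 <= real Kn" "real Kn <= 24 * real j powr 3 + 3" "1 <= Kn"
  proof -
   have "0 <= 24 * real j powr 3" by simp
   thus "24 * real j powr 3 + 1 <= real Kn" "real Kn <= 24 * real j powr 3 + 3" "1 <= Kn"
    unfolding Kn_def by linarith+
  qed
  define r where "r = 1 / (?Q * real j powr (5/8))"
  have r: "0 < r" using Qpos jp by (simp add: r_def)
  have far': "r <= idist (orb x i)" if "i < m" for i using far[OF that] by (simp add: r_def)
  define Err where "Err = ?q * ln ?q + 3 * real m + 3 * ?q + (real m / ?Q + 1) * (2 / r + 8 * ?Q * harm Kn)"
  have KK: "24 * ?Q / ?q + 1 <= real Kn"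
  proof -
   have "24 * ?Q / ?q <= 24 * real j powr 3" using Qq qpos by (simp add: divide_le_eq)
   thus ?thesis using Kn(1) by linarith
  qed
  have Sp: "abs (Bs (%y. 1 / y) m x - m * ln ?q) <= Err"
   unfolding Err_def by (rule inverse_frac_sum[OF five r far' KK])
  have Sm: "abs (Bs (%y. 1 / (1 - y)) m x - m * ln ?q) <= Err"
   unfolding Err_def by (rule inverse_one_minus_frac_sum[OF five r far' KK])
  have Qm: "?Q <= real m * real j powr (1/8)"
  proof -
   have "?Q = ?Q * real j powr (-1/8) * real j powr (1/8)" using jp by (simp add: powr_add[symmetric] mult.assoc)
   also have "... <= real m * real j powr (1/8)" using m by (intro mult_right_mono) auto
   finally show ?thesis .
  qed
  have Err: "Err <= E j * (real m * real j)"
  proof -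
   have "?q * ln ?q <= (?Q / real j) * real j" using n'(1) lnq qpos jp q_ge_2[of n'] by (intro mult_mono) auto
   also have "... = ?Q" using jp by simp
   also have "... <= real m * real j powr (1/8)" by (rule Qm)
   also have "... = real j powr (-7/8) * (real m * real j)" using jp powr_add[of "real j" "-7/8" 1] by simp
   finally have 1: "?q * ln ?q <= real j powr (-7/8) * (real m * real j)" .
   have 2: "3 * real m = 3 / real j * (real m * real j)" using jp by simp
   have "?q <= real m * real j powr (1/8) / real j" using n'(1) Qm jp divide_right_mono[OF Qm, of "real j"] by linarith
   also have "... = real j powr (-15/8) * (real m * real j)"
    using jp powr_add[of "real j" "-15/8" 2] powr_realpow[of "real j" 2] by (simp add: field_simps power2_eq_square powr_numeral)
   finally have 3: "3 * ?q <= 3 * real j powr (-15/8) * (real m * real j)" by simp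
   have "1 <= real m / ?Q * real j powr (1/8)" using Qm Qpos by (simp add: le_divide_eq)
   moreover have "real m / ?Q <= real m / ?Q * real j powr (1/8)"
    using mult_left_mono[of 1 "real j powr (1/8)" "real m / ?Q"] jp Qpos by (simp add: ge_one_powr_ge_zero)
   ultimately have w: "real m / ?Q + 1 <= 2 * (real m / ?Q * real j powr (1/8))" unfolding mult_2 by (rule add_mono[rotated])
   have "harm Kn <= ln (real Kn) + 1" by (rule harm_le_ln[OF Kn(3)])
   also have "... <= ln (24 * real j powr 3 + 3) + 1" using Kn by simp
   finally have h: "harm Kn <= ln (24 * real j powr 3 + 3) + 1" .
   have "(real m / ?Q + 1) * (2 / r + 8 * ?Q * harm Kn) <= 2 * (real m / ?Q * real j powr (1/8)) * (2 * (?Q * real j powr (5/8)) + 8 * ?Q * (ln (24 * real j powr 3 + 3) + 1))"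
    using w h r Qpos by (intro mult_mono add_mono mult_left_mono) (auto simp: r_def harm_nonneg add_nonneg_nonneg)
   also have "... = 2 * (real j powr (1/8)) * (2 * real j powr (5/8) + 8 * (ln (24 * real j powr 3 + 3) + 1)) * real m"
    using Qpos by (simp add: field_simps)
   also have "real j powr (1/8) = real j powr (-7/8) * real j" using jp powr_add[of "real j" "-7/8" 1] by simp
   finally have 4: "(real m / ?Q + 1) * (2 / r + 8 * ?Q * harm Kn) <=
    2 * real j powr (-7/8) * (2 * real j powr (5/8) + 8 * (ln (24 * real j powr 3 + 3) + 1)) * (real m * real j)"
    by (simp add: mult_ac)
   have "E j * (real m * real j) = real j powr (-7/8) * (real m * real j) + 3 / real j * (real m * real j) +
     3 * real j powr (-15/8) * (real m * real j) + 2 * real j powr (-7/8) * (2 * real j powr (5/8) +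
     8 * (ln (24 * real j powr 3 + 3) + 1)) * (real m * real j)"
    by (simp only: E_def distrib_right)
   thus ?thesis unfolding Err_def using 1 2 3 4 by linarith
  qed
  have mj0: "0 <= real m * real j" by simp
  have unit: "frac (orb x i) \<in> {0<..<1}" if "i < m" for i
   using far'[OF that] r by (intro frac_in_unit idist_pos_not_Int) auto
  have "abs (Bs f' m x + A * Bs (%y. 1 / y) m x - B * Bs (%y. 1 / (1 - y)) m x)
   = abs (\<Sum>i<m. f' (frac (orb x i)) + A / frac (orb x i) - B / (1 - frac (orb x i)))"
   by (simp add: birkhoff_def sum_distrib_left sum.distrib sum_subtractf)
  also have "... <= (\<Sum>i<m. eps * (1 / frac (orb x i) + 1 / (1 - frac (orb x i))) + K)"
   by (rule order_trans[OF sum_abs]) (use K(2) unit in \<open>auto intro!: sum_mono\<close>)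
  also have "... = eps * (Bs (%y. 1 / y) m x + Bs (%y. 1 / (1 - y)) m x) + K * m"
   by (simp add: birkhoff_def sum_distrib_left sum.distrib distrib_left)
  finally have main: "abs (Bs f' m x + A * Bs (%y. 1 / y) m x - B * Bs (%y. 1 / (1 - y)) m x)
   <= eps * (Bs (%y. 1 / y) m x + Bs (%y. 1 / (1 - y)) m x) + K * m" .
  let ?p = "Bs (%y. 1 / y) m x" and ?s = "Bs (%y. 1 / (1 - y)) m x" and ?L = "real m * ln ?q"
  have "abs (A * (?p - ?L)) <= A * Err" "abs (B * (?s - ?L)) <= B * Err"
   using Sp Sm AB by (auto simp: abs_mult intro!: mult_left_mono)
  moreover have "eps * (?p + ?s) <= eps * (2 * ?L + 2 * Err)" using Sp Sm eps by (intro mult_left_mono) auto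
  moreover have "Bs f' m x = (Bs f' m x + A * ?p - B * ?s) - A * (?p - ?L) + B * (?s - ?L) - (A - B) * ?L"
   by (simp add: algebra_simps)
  moreover have "abs ((A - B) * ?L) = D * ?L" using q_ge_2[of n'] by (simp add: abs_mult D_def)
  ultimately have "D * ?L - A * Err - B * Err - eps * (2 * ?L + 2 * Err) - K * m <= abs (Bs f' m x)"
   using main by linarith
  moreover have "D * (real m * (real j / 2)) <= D * ?L" using D lnq2 by (intro mult_left_mono) auto
  moreover have "eps * (2 * ?L) <= eps * (2 * (real m * real j))" using eps lnq by (intro mult_left_mono) auto
  moreover have "S * Err <= S * (E j * (real m * real j))" using S Err by (intro mult_left_mono) auto
  moreover have "S * (E j * (real m * real j)) <= D / 16 * (real m * real j)"
  proof -
   have "S * E j <= D / 16" using J S by (simp add: field_simps)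
   from mult_right_mono[OF this mj0] show ?thesis by (simp add: mult.assoc)
  qed
  moreover have "K * m <= D / 16 * (real m * real j)"
  proof -
   have "K <= D / 16 * real j" using J jp by (simp add: divide_less_eq)
   hence "K * m <= D / 16 * real j * m" by (intro mult_right_mono) auto
   thus ?thesis by (simp add: mult_ac)
  qed
  moreover have "A * Err + B * Err + eps * (2 * Err) = S * Err" by (simp add: S_def algebra_simps)
  ultimately show "abs (A - B) / 4 * (real m * real j) <= abs (Bs f' m x)"
   unfolding D_def[symmetric] eps_def distrib_left by (simp add: algebra_simps)
 qed
qed

end

text \<open>\<open>H\<close> cuts the line into at most \<open>card H + 1\<close> gaps, each of which contains elements of \<open>L\<close> at mutual distance at
 most \<open>w\<close>.\<close>

lemma card_le_gaps:
 fixes L H :: "nat set" and w :: real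
 assumes L: "finite L" and H: "finite H" and w: "0 <= w"
  and gap: "!!l l'. l \<in> L ==> l' \<in> L ==> l < l' ==> {l..<l'} Int H = {} ==> real (l' - l) <= w"
 shows "real (card L) <= (real (card H) + 1) * (w + 1)"
proof -
 define c where "c l = card {i \<in> H. i < l}" for l
 have fibre: "real (card {l \<in> L. c l = k}) <= w + 1" for k
 proof (cases "{l \<in> L. c l = k} = {}")
  case False
  let ?F = "{l \<in> L. c l = k}"
  have F: "finite ?F" using L by simp
  define a b where "a = Min ?F" and "b = Max ?F"
  have ab: "a \<in> ?F" "b \<in> ?F" "?F <= {a..b}" using F False Min_in[OF F False] Max_in[OF F False] by (auto simp: a_def b_def)
  have "real (b - a) <= w"
  proof (cases "a < b")
   case True
   have "{a..<b} Int H = {}"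
   proof (rule ccontr)
    assume "{a..<b} Int H ~= {}"
    then obtain h where h: "a <= h" "h < b" "h \<in> H" by auto
    hence "{i \<in> H. i < a} <= {i \<in> H. i < b}" "h \<in> {i \<in> H. i < b}" "h \<notin> {i \<in> H. i < a}" by auto
    hence "{i \<in> H. i < a} \<subset> {i \<in> H. i < b}" by blast
    hence "c a < c b" unfolding c_def by (intro psubset_card_mono) (use H in auto)
    thus False using ab by simp
   qed
   thus ?thesis using gap[of a b] ab True by simp
  qed (use w in simp)
  moreover have "card ?F <= card {a..b}" using ab(3) by (intro card_mono) auto
  hence "real (card ?F) <= real (b - a) + 1" using ab by auto
  ultimately show ?thesis by linarith
 next
  case True
  thus ?thesis using w by (simp only: card.empty)
 qed
 have "c l <= card H" for l unfolding c_def by (intro card_mono H) auto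
 hence "L <= (\<Union>k\<in>{..card H}. {l \<in> L. c l = k})" by auto
 hence "card L <= card (\<Union>k\<in>{..card H}. {l \<in> L. c l = k})" using L by (intro card_mono) auto
 also have "... <= (\<Sum>k\<in>{..card H}. card {l \<in> L. c l = k})" by (rule card_UN_le) simp
 finally have "real (card L) <= real (\<Sum>k\<in>{..card H}. card {l \<in> L. c l = k})" by (rule of_nat_mono)
 also have "... = (\<Sum>k\<in>{..card H}. real (card {l \<in> L. c l = k}))" by simp
 also have "... <= (\<Sum>k\<in>{..card H}. w + 1)" using fibre by (intro sum_mono)
 finally show ?thesis by (simp add: add.commute)
qed

lemma birkhoff_lower:
 assumes c: "!!x. x \<in> {0<..<1} ==> c <= f x" and reg: "regular_on \<alpha> n {x}"
 shows "c * real n <= birkhoff \<alpha> f n x"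
proof -
 have "(\<Sum>i<n. c) <= birkhoff \<alpha> f n x"
  unfolding birkhoff_def using reg by (intro sum_mono c frac_in_unit) (auto simp: regular_on_def)
 thus ?thesis by (simp add: mult.commute)
qed

context log_diophantine begin

lemma hits_le_windows:
 assumes I: "I <= {..<m}" and close: "!!i. i \<in> I ==> idist (orb x i) <= \<delta>" and \<delta>: "0 <= \<delta>"
 shows "real (card I) <= (real m / rq n + 1) * (8 * rq n * \<delta> + 1)"
proof -
 have "(\<Sum>i<m. if i \<in> I then 1 else 0) <= (real m / rq n + 1) * (8 * rq n * \<delta> + 1)"
 proof (rule sum_le_windows)
  fix b
  have "(\<Sum>i\<in>{b..<b + q n}. if i \<in> I then 1 else 0) = real (card (I Int {b..<b + q n}))"
   by (subst sum.inter_restrict[symmetric]) (auto simp: Int_commute)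
  also have "... <= 8 * rq n * \<delta> + 1"
   by (rule close_orbit_count[where b = b]) (use close \<delta> in auto)
  finally show "(\<Sum>i\<in>{b..<b + q n}. if i \<in> I then 1 else 0) <= 8 * rq n * \<delta> + 1" .
 qed (use q_ge_2[of n] in auto)
 also have "(\<Sum>i<m. if i \<in> I then 1 else 0) = real (card I)"
  using I by (subst sum.inter_restrict[symmetric]) (auto simp: Int_absorb1)
 finally show ?thesis .
qed

text \<open>Between two visits to the singularity the difference of the Birkhoff sums of two nearby points
 drifts steadily, so it returns to a bounded interval only during a short time.\<close>

lemma drift_between_hits:
 fixes f f' :: "real => real"
 assumes f: "!!x. x \<in> {0<..<1} ==> (f has_real_derivative f' x) (at x)"
  and slope: "!!m x. m0 <= real m ==> (!!i. i < m ==> r <= idist (orb x i)) ==> d * real m <= abs (Bs f' m x)"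
  and d: "0 < d" and r: "0 < r" and aa: "0 < abs (a - a')" "abs (a - a') <= r" and l: "l < l'"
  and D: "abs (Bs f l a - Bs f l a') < 2" "abs (Bs f l' a - Bs f l' a') < 2"
  and nohit: "!!i. l <= i ==> i < l' ==> 2 * r <= idist (orb a i)"
 shows "real (l' - l) <= max m0 (4 / (d * abs (a - a')))"
proof (cases "m0 <= real (l' - l)")
 case True
 define m where "m = l' - l"
 have l': "l' = l + m" using l by (simp add: m_def)
 define u v where "u = min a a' + real l * \<alpha>" and "v = max a a' + real l * \<alpha>"
 have uv: "u < v" "v - u = abs (a - a')" using aa by (auto simp: u_def v_def min_def max_def)
 have far: "r <= idist (orb x i)" if "x \<in> {u..v}" "i < m" for x i
 proof -
  have "abs (orb a l - x) <= r" using that(1) aa by (auto simp: u_def v_def min_def max_def split: if_splits)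
  moreover have "2 * r <= idist (a + real (l + i) * \<alpha>)" using nohit[of "l + i"] that(2) l' by simp
  moreover have "idist (a + real (l + i) * \<alpha>) <= idist (orb x i) + abs ((a + real (l + i) * \<alpha>) - (orb x i))"
   by (rule idist_lipschitz)
  moreover have "(a + real (l + i) * \<alpha>) - (orb x i) = orb a l - x" by (simp add: algebra_simps)
  ultimately show ?thesis by simp
 qed
 have "regular_on \<alpha> m {u..v}" unfolding regular_on_def
  using far r by (auto intro!: idist_pos_not_Int intro: order.strict_trans2)
 then obtain \<xi> where xi: "u < \<xi>" "\<xi> < v" "Bs f m v - Bs f m u = (v - u) * Bs f' m \<xi>"
  using birkhoff_mean_value[OF f uv(1)] by blast
 have "d * real m * abs (a - a') <= abs (Bs f' m \<xi>) * abs (a - a')"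
  using slope[of m \<xi>] True far[of \<xi>] xi by (intro mult_right_mono) (auto simp: m_def)
 also have "... = abs (Bs f m v - Bs f m u)" using xi(3) uv by (simp add: abs_mult)
 also have "... = abs (Bs f m (orb a l) - Bs f m (orb a' l))"
  by (auto simp: u_def v_def min_def max_def)
 also have "... < 4" using D unfolding l' birkhoff_add by linarith
 finally have "real m <= 4 / (d * abs (a - a'))" using d aa by (simp add: pos_le_divide_eq mult_ac)
 thus ?thesis by (simp add: m_def)
qed simp

text \<open>Far from the singularity two nearby points have nearby values of the roof; close to it the
 values themselves are bounded by assumption.\<close>

lemma birkhoff_difference_bound:
 fixes f f' :: "real => real"
 assumes f: "!!x. x \<in> {0<..<1} ==> (f has_real_derivative f' x) (at x)"
  and f': "!!x. x \<in> {0<..<1} ==> abs (f' x) <= C1 / idist x"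
  and r: "0 < r" "abs (a - a') <= r" and l: "l <= q n"
  and bnd: "!!i. i < l ==> abs (f (frac (orb a i)) - f (frac (orb a' i))) <= V" and V: "0 <= V"
 shows "abs (Bs f l a - Bs f l a') <= 2 * C1 * (1 + 8 * rq n * r * harm l) + (16 * rq n * r + 1) * V"
proof -
 have C1: "0 <= C1" using f'[of "1/2"] by (auto simp: idist_def frac_eq)
 define g where "g i = abs (f (frac (orb a i)) - f (frac (orb a' i)))" for i :: nat
 define F where "F = {i. i < l & 2 * r <= idist (orb a i)}"
 have far: "g i <= 2 * C1 * r * (1 / idist (orb a i))" if i: "i \<in> F" for i
 proof (cases "a = a'")
  case True
  thus ?thesis using C1 r idist_nonneg by (simp add: g_def)
 next
  case False
  define u v where "u = min a a' + real i * \<alpha>" and "v = max a a' + real i * \<alpha>"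
  have uv: "u < v" "v - u = abs (a - a')" using False by (auto simp: u_def v_def min_def max_def)
  have near: "idist (orb a i) / 2 <= idist x" if "x \<in> {u..v}" for x
  proof -
   have "abs ((orb a i) - x) <= r" using that r by (auto simp: u_def v_def min_def max_def split: if_splits)
   thus ?thesis using idist_lipschitz[of "orb a i" x] i unfolding F_def by auto
  qed
  have pos: "0 < idist (orb a i)" using i r by (auto simp: F_def)
  have "regular_on \<alpha> 1 {u..v}" unfolding regular_on_def
   using near pos by (auto intro!: idist_pos_not_Int intro: order.strict_trans2[of 0 "idist (orb a i) / 2"])
  then obtain \<xi> where xi: "u < \<xi>" "\<xi> < v" "Bs f 1 v - Bs f 1 u = (v - u) * Bs f' 1 \<xi>"
   using birkhoff_mean_value[OF f uv(1)] by blast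
  have nxi: "idist (orb a i) / 2 <= idist \<xi>" using near xi by simp
  have "abs (f' (frac \<xi>)) <= C1 / idist (frac \<xi>)"
   using nxi pos by (intro f' frac_in_unit idist_pos_not_Int) auto
  also have "idist (frac \<xi>) = idist \<xi>" by (simp add: idist_def)
  also have "C1 / idist \<xi> <= C1 / (idist (orb a i) / 2)"
   using nxi pos C1 by (intro divide_left_mono mult_pos_pos) auto
  finally have b: "abs (f' (frac \<xi>)) <= 2 * C1 * (1 / idist (orb a i))" by (simp add: mult_ac)
  have "g i = abs (f (frac v) - f (frac u))" by (auto simp: g_def u_def v_def min_def max_def)
  also have "... = abs (a - a') * abs (f' (frac \<xi>))" using xi(3) uv by (simp add: birkhoff_def abs_mult)
  also have "... <= r * (2 * C1 * (1 / idist (orb a i)))" using r b by (intro mult_mono) auto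
  finally show ?thesis by (simp add: mult_ac)
 qed
 have F: "F <= {..<l}" by (auto simp: F_def)
 have "abs (Bs f l a - Bs f l a') <= (\<Sum>i<l. g i)"
  unfolding birkhoff_def g_def sum_subtractf[symmetric] by (rule sum_abs)
 also have "... = (\<Sum>i\<in>F. g i) + (\<Sum>i\<in>{..<l} - F. g i)"
  using sum.subset_diff[OF F, of g] by (simp add: add.commute)
 also have "(\<Sum>i\<in>F. g i) <= 2 * C1 * r * (\<Sum>i\<in>F. 1 / idist (orb a i))"
  unfolding sum_distrib_left using far by (intro sum_mono)
 also have "... <= 2 * C1 * r * (2 / (2 * r) + 8 * rq n * harm l)"
 proof (intro mult_left_mono close_orbit_sum[where b = 0])
  show "card F <= l" using card_mono[OF _ F] by simp
  show "F <= {0..<0 + q n}" using F l by auto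
 qed (use r C1 in \<open>auto simp: F_def\<close>)
 also have "... = 2 * C1 * (1 + 8 * rq n * r * harm l)" using r by (simp add: field_simps)
 also have "(\<Sum>i\<in>{..<l} - F. g i) <= (\<Sum>i\<in>{..<l} - F. V)" using bnd by (intro sum_mono) (auto simp: g_def)
 also have "... = card ({..<l} - F) * V" by simp
 also have "... <= (8 * rq n * (2 * r) + 1) * V"
 proof (intro mult_right_mono V close_orbit_count[where b = 0 and x = a])
  show "{..<l} - F <= {0..<0 + q n}" using l by auto
 qed (use r in \<open>auto simp: F_def\<close>)
 finally show ?thesis by (simp add: mult_ac)
qed

lemma close_visit_cover:
 fixes \<delta> :: real
 assumes "0 < \<delta>" "\<delta> < 1"
 obtains U where "U \<in> sets borel" "leb U <= ennreal (real m * (6 * \<delta>))"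
  "!!x i. x \<in> {0<..<1} ==> i < m ==> idist (orb x i) <= \<delta> ==> x \<in> U"
proof -
 define s where "s i = frac (- real i * \<alpha>)" for i :: nat
 define P where "P = {..<m} \<times> {-1..1::int}"
 define W where "W = (%(i, k). {s i + of_int k - \<delta>..s i + of_int k + \<delta>})"
 have P: "finite P" "card P = m * 3" by (auto simp: P_def)
 show thesis
 proof (rule that[of "\<Union>ik\<in>P. W ik"])
  show "(\<Union>ik\<in>P. W ik) \<in> sets borel" using P by (intro sets.finite_UN) (auto simp: W_def)
  have "leb (\<Union>ik\<in>P. W ik) <= ennreal (real (card P) * (2 * \<delta>))"
   using P assms by (intro emeasure_UN_le_card) (auto simp: W_def split: prod.splits)
  thus "leb (\<Union>ik\<in>P. W ik) <= ennreal (real m * (6 * \<delta>))" using P by (simp add: mult_ac)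
 next
  fix x i assume x: "x \<in> {0<..<1}" and i: "i < m" and d: "idist (orb x i) <= \<delta>"
  obtain z where z: "abs (orb x i - of_int z) = idist (orb x i)" using idist_attained .
  define k where "k = z + \<lfloor>- real i * \<alpha>\<rfloor>"
  have e: "orb x i - of_int z = x - s i - of_int k" by (simp add: s_def frac_def k_def)
  have "abs (x - s i - of_int k) <= \<delta>" using z d e by simp
  moreover have "0 <= s i" "s i < 1" by (simp_all add: s_def frac_lt_1)
  ultimately have "-2 < real_of_int k" "real_of_int k < 2" using x assms by (auto simp: abs_le_iff)
  hence "k \<in> {-1..1}" by auto
  hence "(i, k) \<in> P" using i by (simp add: P_def)
  moreover have "x \<in> W (i, k)" using \<open>\<bar>x - s i - of_int k\<bar> \<le> \<delta>\<close> by (auto simp: W_def abs_le_iff)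
  ultimately show "x \<in> (\<Union>ik\<in>P. W ik)" by blast
 qed
qed

end

context log_diophantine begin

text \<open>Up to \<open>2 * N j\<close> an orbit enters the critical neighbourhood of the singularity only a few times. Between
 two such visits the derivative of a sum over \<open>m\<close> points is of the order \<open>m * j\<close>, so the sums of two points at
 distance \<open>2 ^ - j\<close> almost agree for at most \<open>O (2 ^ j / j)\<close> lengths, besides the short ones. The choice
 \<open>N j = 2 ^ j / sqrt j\<close> leaves enough room between this number and \<open>N j\<close>, and still makes \<open>N j\<close> small
 compared with \<open>2 ^ j\<close>.\<close>

lemma arnold_base_separation:
 assumes roof: "arnold_roof f"
 shows "base_separation \<alpha> f (%j. 2 ^ j * real j powr (-1/2))"
proof -
 have C2: "C2_on_unit_interval f" using roof by (auto simp: arnold_roof_def singular_roof_def)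
 obtain c Cf A B where cf: "0 < c" "0 < Cf" and AB: "0 < A" "0 < B" "A ~= B"
  and flo: "!!x. x \<in> {0<..<1} ==> c <= f x"
  and fup: "!!x. x \<in> {0<..<1} ==> f x <= Cf * (x powr (-1/32) + (1 - x) powr (-1/32))"
  and f': "!!eps. 0 < eps ==> \<exists>K>0. \<forall>x\<in>{0<..<1}. abs (deriv f x + A / x - B / (1 - x)) <= eps * (1 / x + 1 / (1 - x)) + K"
  using arnold_roof_bounds[OF roof] by metis
 define D where "D = abs (A - B) / 4"
 have D: "0 < D" using AB by (simp add: D_def)
 obtain j1 where slope: "!!j n m x. j1 <= j ==> 2 ^ j * real j powr (-2) <= rq n ==> rq n <= 2 ^ j ==>
   rq n * real j powr (-1/8) <= real m ==> (!!i. i < m ==> 1 / (rq n * real j powr (5/8)) <= idist (orb x i)) ==>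
   D * (real m * real j) <= abs (Bs (deriv f) m x)"
  unfolding D_def using asymmetric_derivative_sum[OF f' AB] by metis
 obtain K1 where K1: "0 < K1" "!!x. x \<in> {0<..<1} ==> abs (deriv f x + A / x - B / (1 - x)) <= 1 * (1 / x + 1 / (1 - x)) + K1"
  using f'[of 1] by auto
 define C1 where "C1 = A + B + 2 + K1"
 have C1: "0 < C1" using AB K1 by (simp add: C1_def)
 have f'bound: "abs (deriv f x) <= C1 / idist x" if x: "x \<in> {0<..<1}" for x
 proof -
  have i: "idist x = min x (1 - x)" using x by (simp add: idist_def frac_eq)
  hence pos: "0 < idist x" "idist x <= x" "idist x <= 1 - x" "idist x <= 1" using x by auto
  have "1 / x <= 1 / idist x" "1 / (1 - x) <= 1 / idist x" "1 <= 1 / idist x"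
   using pos x by (auto intro!: divide_left_mono mult_pos_pos simp: le_divide_eq)
  note this(1,2) mult_left_mono[OF this(1), of A] mult_left_mono[OF this(2), of B] mult_left_mono[OF this(3), of K1]
  hence *: "A * (1 / x) <= A * (1 / idist x)" "B * (1 / (1 - x)) <= B * (1 / idist x)" "K1 * 1 <= K1 * (1 / idist x)"
   "1 / x <= 1 / idist x" "1 / (1 - x) <= 1 / idist x"
   using AB K1(1) by simp_all
  have "0 <= A * (1 / x)" "0 <= B * (1 / (1 - x))" using AB x by auto
  hence "abs (deriv f x) <= A * (1 / x) + B * (1 / (1 - x)) + (1 * (1 / x + 1 / (1 - x)) + K1)"
   using K1(2)[OF x] by (auto simp: abs_le_iff)
  also have "... <= A * (1 / idist x) + B * (1 / idist x) + (1 / idist x + 1 / idist x) + K1 * (1 / idist x)"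
   using add_mono[OF add_mono[OF *(1,2)] add_mono[OF add_mono[OF *(4,5)] *(3)]] by (simp add: add.assoc)
  also have "... = C1 / idist x" by (simp add: C1_def add_divide_distrib)
  finally show ?thesis .
 qed
 obtain c3 where c3: "0 < c3" "!!k z. k ~= 0 ==> c3 / abs (real_of_int k) powr (1 + 1/4) <= abs (of_int k * \<alpha> - of_int z)"
  using dist_integer_ge_powr[of "1/4"] by (metis zero_less_divide_1_iff zero_less_numeral)
 define N where "N j = 2 ^ j * real j powr (-1/2)" for j :: nat
 define \<delta> where "\<delta> j = (2 * Cf) ^ 32 * (1/16) ^ j" for j :: nat
 have \<delta>pos: "0 < \<delta> j" for j using cf by (simp add: \<delta>_def)
 define h where "h j = 16 * C * real j powr (7/16) + 4 * real j powr (1/8) + 3" for j :: nat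
 \<comment> \<open>The finitely many asymptotic inequalities used for large \<open>j\<close>.\<close>
 define big where "big j \<longleftrightarrow> j1 <= j & 1 <= j & rq 0 <= 2 * N j & 32 <= real j powr (1/2) &
   16 <= real j powr (5/8) & C * real j powr (25/16) / (2 * real j powr 2) < 1 &
   (10 * N j * real j powr (-1/8) + (h j + 1) * (8 / D * (2 ^ j / real j) + 1)) / (real j powr (-1/32) * N j) < 1 &
   (2 * C1 * (1 + 8 * C * real j powr (17/16) * (real j + 1)) + (16 * C * real j powr (17/16) + 1) * (2 powr (real j / 8))) / (2 powr (real j / 4)) < 1 &
   ((2 + 2 powr (real j / 4)) / c) / (2 powr (real j / 3)) < 1 & (2 powr (- (1/2) * real j) + (1/2) ^ j) / (c3 / (2 powr (real j / 3)) powr (1 + 1/4)) < 1 & \<delta> j < 1"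
  for j :: nat
 have small: "eventually (%j. u j < 1) sequentially" if "u \<longlonglongrightarrow> 0" for u :: "nat => real"
  using that by (rule order_tendstoD) simp
 have large: "eventually (%j. b <= u j) sequentially" if "filterlim u at_top sequentially" for u :: "nat => real" and b
  using that unfolding filterlim_at_top by blast
 have "filterlim (%j. 2 * N j) at_top sequentially" "filterlim (%j::nat. real j powr (1/2)) at_top sequentially"
  "filterlim (%j::nat. real j powr (5/8)) at_top sequentially" unfolding N_def by real_asymp+
 note L = this[THEN large]
 have "(%j::nat. C * real j powr (25/16) / (2 * real j powr 2)) \<longlonglongrightarrow> 0" by real_asymp
 note S1 = small[OF this]
 have "(%j::nat. (10 * N j * real j powr (-1/8) + (h j + 1) * (8 / D * (2 ^ j / real j) + 1)) / (real j powr (-1/32) * N j)) \<longlonglongrightarrow> 0"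
  unfolding N_def h_def using C_pos D by real_asymp
 note S2 = small[OF this]
 have "(%j::nat. (2 * C1 * (1 + 8 * C * real j powr (17/16) * (real j + 1)) + (16 * C * real j powr (17/16) + 1) * (2 powr (real j / 8))) / (2 powr (real j / 4))) \<longlonglongrightarrow> 0"
  using C_pos C1 by real_asymp
 note S3 = small[OF this]
 have "(%j::nat. ((2 + 2 powr (real j / 4)) / c) / (2 powr (real j / 3))) \<longlonglongrightarrow> 0"
  using cf by real_asymp
 note S4 = small[OF this]
 have "(%j::nat. (2 powr (- (1/2) * real j) + (1/2) ^ j) / (c3 / (2 powr (real j / 3)) powr (1 + 1/4))) \<longlonglongrightarrow> 0"
 proof -
  have "(%j::nat. 2 powr (- (1/12) * real j)) \<longlonglongrightarrow> 0" "(%j::nat. 2 powr (- (7/12) * real j)) \<longlonglongrightarrow> 0"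
   by real_asymp+
  from tendsto_divide[OF tendsto_add[OF this] tendsto_const[of c3]]
  have lim: "(%j::nat. (2 powr (- (1/12) * real j) + 2 powr (- (7/12) * real j)) / c3) \<longlonglongrightarrow> 0" using c3(1) by simp
  have "(2 powr (- (1/12) * real j) + 2 powr (- (7/12) * real j)) / c3 = (2 powr (- (1/2) * real j) + (1/2) ^ j) / (c3 / (2 powr (real j / 3)) powr (1 + 1/4))" for j :: nat
  proof -
   have "(1/2) ^ j = 2 powr (- real j)" by (simp add: powr_minus_divide powr_realpow power_one_over)
   moreover have "(2 powr (- (1/2) * real j) + 2 powr (- real j)) * 2 powr (5/12 * real j) = 2 powr (- (1/12) * real j) + 2 powr (- (7/12) * real j)"
    by (simp add: distrib_right powr_add[symmetric])
   ultimately show ?thesis by (simp add: powr_powr mult.commute[of 5 "real j"])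
  qed
  note eq = ext[OF this]
  show ?thesis using lim unfolding eq .
 qed
 note S5 = small[OF this]
 have "\<delta> \<longlonglongrightarrow> 0" unfolding \<delta>_def using cf by real_asymp
 note S6 = small[OF this]
 have ev: "eventually big sequentially"
  unfolding big_def using L(1)[of "rq 0"] L(2)[of 32] L(3)[of 16] S1 S2 S3 S4 S5 S6
   eventually_ge_at_top[of j1] eventually_ge_at_top[of 1] by eventually_elim auto
 then obtain j2 where j2: "!!j. j2 <= j ==> big j" by (auto simp: eventually_sequentially)
 define mm where "mm j = nat \<lfloor>2 * N j\<rfloor>" for j
 have mm: "real (mm j) <= 2 * N j" "2 * N j < real (mm j) + 1" for j
  unfolding mm_def by (auto simp: N_def)
 have lmm: "real l <= 2 * N j \<longleftrightarrow> l <= mm j" for l j using mm[of j] by linarith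
 \<comment> \<open>Points whose orbit comes extremely close to the singularity are removed.\<close>
 have "\<exists>U. U \<in> sets borel & leb U <= ennreal (real (mm j + 1) * (6 * \<delta> j)) &
  (\<forall>x\<in>{0<..<1}. \<forall>i<mm j + 1. idist (orb x i) <= \<delta> j --> x \<in> U)" if "j2 <= j" for j
  using close_visit_cover[OF \<delta>pos, of j "mm j + 1"] j2[OF that] unfolding big_def by metis
 then obtain E where E: "!!j. j2 <= j ==> E j \<in> sets borel"
  "!!j. j2 <= j ==> leb (E j) <= ennreal (real (mm j + 1) * (6 * \<delta> j))"
  "!!j x i. j2 <= j ==> x \<in> {0<..<1} ==> i <= mm j ==> idist (orb x i) <= \<delta> j ==> x \<in> E j"
  unfolding less_Suc_eq_le[symmetric] Suc_eq_plus1 by metis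
 have Emeas: "leb (E j) <= ennreal (18 * (2 * Cf) ^ 32 * (1/8) ^ j)" if j: "j2 <= j" for j
 proof -
  have "N j <= 2 ^ j" using j2[OF j] by (auto simp: N_def big_def powr_minus_divide divide_le_eq mult_le_cancel_left1 ge_one_powr_ge_zero)
  moreover have "(1::real) <= 2 ^ j" by simp
  ultimately have "real (mm j + 1) <= 3 * 2 ^ j" using mm(1)[of j] by linarith
  hence "real (mm j + 1) * (6 * \<delta> j) <= 3 * 2 ^ j * (6 * \<delta> j)" using \<delta>pos[of j] by (intro mult_right_mono) auto
  also have "... = 18 * (2 * Cf) ^ 32 * (2 ^ j * (1/16) ^ j)" by (simp add: \<delta>_def)
  also have "2 ^ j * (1/16) ^ j = (1/8::real) ^ j" by (simp flip: power_mult_distrib)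
  finally show ?thesis using E(2)[OF j] by (meson ennreal_leI order_trans)
 qed
 show ?thesis unfolding base_separation_def N_def[symmetric]
 proof (rule exI[of _ "1/2"], rule exI[of _ "1/32"], rule exI[of _ 1], intro conjI allI impI)
  fix kap :: real assume kap: "0 < kap"
  obtain j0 where j0: "j2 <= j0" "leb (\<Union>j\<in>{j0..}. E j) <= ennreal kap"
   using geometric_tail[of j2 E lborel "18 * (2 * Cf) ^ 32" "1/8" kap] E(1) Emeas kap cf by auto
  define X where "X = {0<..<1} - (\<Union>j\<in>{j0..}. E j)"
  have Um: "(\<Union>j\<in>{j0..}. E j) \<in> sets borel" using E(1) j0(1) by (intro sets.countable_UN') auto
  have XE: "leb ({0<..<1} - X) <= ennreal kap"
   by (rule order_trans[OF emeasure_mono j0(2)]) (use Um in \<open>auto simp: X_def\<close>)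
  have Xm: "X \<in> sets borel" using Um by (auto simp: X_def)
  have Xd: "\<delta> j < idist (orb x i)" if "x \<in> X" "j0 <= j" "i <= mm j" for x j i
   using E(3)[of j x i] that j0(1) unfolding X_def by (force simp: not_le[symmetric])
  have Xf: "0 < f (frac (orb x i)) & f (frac (orb x i)) <= 2 powr (real j / 8)"
   if "x \<in> X" "j0 <= j" "i <= mm j" for x j i
  proof -
   let ?y = "orb x i"
   have d: "\<delta> j < idist ?y" by (rule Xd[OF that])
   hence u: "frac ?y \<in> {0<..<1}" using \<delta>pos[of j] by (intro frac_in_unit idist_pos_not_Int) auto
   have "frac ?y powr (-1/32) <= \<delta> j powr (-1/32)" "(1 - frac ?y) powr (-1/32) <= \<delta> j powr (-1/32)"
    using d \<delta>pos[of j] by (auto simp: idist_def intro!: powr_mono2')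
   hence "Cf * (frac ?y powr (-1/32) + (1 - frac ?y) powr (-1/32)) <= Cf * (\<delta> j powr (-1/32) + \<delta> j powr (-1/32))"
    using cf by (intro mult_left_mono add_mono) auto
   also have "... = 2 * Cf * \<delta> j powr (-1/32)" by simp
   also have "\<delta> j powr (-1/32) = (2 * Cf) powr (-1) * 2 powr (real j / 8)"
   proof -
    have "\<delta> j = (2 * Cf) powr 32 * 2 powr (- 4 * real j)"
    proof -
     have "(1/16::real) ^ j = (2 powr (-4)) powr real j" by (simp add: powr_realpow powr_minus_divide)
     thus ?thesis using cf by (simp add: \<delta>_def powr_realpow powr_powr powr_numeral)
    qed
    hence "\<delta> j powr (-1/32) = ((2 * Cf) powr 32 * 2 powr (- 4 * real j)) powr (-1/32)" by (simp only:)
    also have "... = ((2 * Cf) powr 32) powr (-1/32) * (2 powr (- 4 * real j)) powr (-1/32)" by (rule powr_mult)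
    also have "... = (2 * Cf) powr (32 * (-1/32)) * 2 powr ((- 4 * real j) * (-1/32))" by (simp only: powr_powr)
    also have "... = (2 * Cf) powr (-1) * 2 powr (real j / 8)"
     by (rule arg_cong2[where f = "%u v. (2 * Cf) powr u * 2 powr v"]) simp_all
    finally show ?thesis .
   qed
   also have "2 * Cf * ((2 * Cf) powr (-1) * 2 powr (real j / 8)) = 2 powr (real j / 8)"
    using cf by (simp add: powr_minus_divide)
   finally show ?thesis using fup[OF u] flo[OF u] cf(1) by linarith
  qed
  have main: "(\<forall>l l'. l ~= l' --> real l <= 2 * N j --> real l' <= 2 * N j -->
       abs (Bs f l x - Bs f l' x') < 2 -->
       (\<forall>z::int. 2 powr (- (1/2) * j) < abs (x' - x + (real l' - real l) * \<alpha> - z))) &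
     card {l. real l <= 2 * N j & abs (Bs f l x - Bs f l x') < 2} <= 1 * j powr (- (1/32)) * N j"
   if j: "j0 <= j" and x: "x \<in> X" "x' \<in> X" and d: "(1/2) ^ Suc j < abs (x - x')" "abs (x - x') <= (1/2) ^ j" for j x x'
  proof -
   have bj: "big j" using j2 j j0(1) by simp
   have jp: "1 <= real j" using bj by (simp add: big_def)
   have Npos: "0 < N j" using jp by (simp add: N_def)
   have half: "(1/2::real) ^ j = 1 / 2 ^ j" by (simp add: power_one_over)
   obtain n where n: "rq n <= 2 * N j" "2 * N j < rq (Suc n)"
    using denominator_at_scale[of "2 * N j"] bj unfolding big_def by blast
   let ?Q = "rq n"
   have Qpos: "0 < ?Q" by (rule q_pos)
   have N2: "32 * N j <= 2 ^ j"
   proof -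
    have "32 * N j <= real j powr (1/2) * (2 ^ j * real j powr (-1/2))"
     unfolding N_def using bj by (intro mult_right_mono) (auto simp: big_def)
    also have "... = 2 ^ j" using jp by (simp add: powr_minus_divide)
    finally show ?thesis .
   qed
   have Q2: "?Q <= 2 ^ j" using n(1) N2 Npos by linarith
   have lnle: "ln y <= real j" if "0 < y" "y <= 2 ^ j" for y :: real
   proof -
    have "ln y <= ln (2 ^ j)" using that by simp
    also have "... = real j * ln 2" by (simp add: ln_realpow)
    also have "... <= real j * 1" using ln_2_less_1 by (intro mult_left_mono) auto
    finally show ?thesis by simp
   qed
   have grow: "rq (Suc n) <= C * ?Q * real j powr (17/16)"
   proof -
    have "rq (Suc n) <= C * ?Q * ln ?Q powr (17/16)" by (rule q_growth)
    also have "... <= C * ?Q * real j powr (17/16)"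
     using lnle[OF Qpos Q2] C_pos q_ge_2[of n] by (intro mult_left_mono powr_mono2) auto
    finally show ?thesis .
   qed
   have Qlow: "2 ^ j * real j powr (-2) <= ?Q"
   proof -
    have "2 * 2 ^ j * real j powr (-1/2) <= C * ?Q * real j powr (17/16)" using n(2) grow by (simp add: N_def)
    hence "2 * 2 ^ j * real j powr (-1/2) * real j powr (1/2) <= C * ?Q * real j powr (17/16) * real j powr (1/2)"
     by (intro mult_right_mono) auto
    hence "2 * 2 ^ j <= (C * real j powr (25/16)) * ?Q" using jp by (simp add: mult.assoc powr_add[symmetric] mult_ac)
    also have "... <= (2 * real j powr 2) * ?Q" using bj jp by (intro mult_right_mono) (auto simp: big_def divide_less_eq)
    finally have "2 ^ j <= real j powr 2 * ?Q" by simp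
    hence "2 ^ j / real j powr 2 <= ?Q" using jp by (simp add: pos_divide_le_eq mult.commute)
    thus ?thesis by (simp add: powr_minus_divide)
   qed
   define r where "r = max ((1/2) ^ j) (1 / (?Q * real j powr (5/8)))"
   have r: "0 < r" "(1/2) ^ j <= r" "1 / (?Q * real j powr (5/8)) <= r" by (auto simp: r_def less_max_iff_disj)
   define H where "H = {i. i < mm j & idist (orb x i) < 2 * r}"
   have finH: "finite H" by (simp add: H_def)
   have rQ: "16 * ?Q * r <= 1"
   proof -
    have "16 * ?Q * (1/2) ^ j <= 1" using n(1) N2 by (simp add: half divide_le_eq)
    moreover have "16 * ?Q * (1 / (?Q * real j powr (5/8))) <= 1" using bj Qpos by (simp add: big_def divide_le_eq)
    ultimately show ?thesis by (simp add: r_def max_def)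
   qed
   have cardH1: "real (card H) <= 2 * (2 * N j / ?Q + 1)"
   proof -
    have "real (card H) <= (real (mm j) / ?Q + 1) * (8 * ?Q * (2 * r) + 1)"
     by (rule hits_le_windows[where x = x]) (use r in \<open>auto simp: H_def\<close>)
    also have "... <= (2 * N j / ?Q + 1) * (1 + 1)"
     using mm(1)[of j] rQ Qpos Npos r by (intro mult_mono add_mono divide_right_mono) auto
    finally show ?thesis by simp
   qed
   have mmq: "mm j <= q (Suc n)" using mm(1)[of j] n(2) by linarith
   have cardH2: "real (card H) <= h j"
   proof (cases "(1/2) ^ j <= 1 / (?Q * real j powr (5/8))")
    case True
    hence r': "r = 1 / (?Q * real j powr (5/8))" by (simp add: r_def)
    have "real (card H) <= 8 * rq (Suc n) * (2 * r) + 1"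
    proof (rule close_orbit_count[where b = 0 and x = x])
     show "H <= {0..<0 + q (Suc n)}" using mmq by (auto simp: H_def)
    qed (use r in \<open>auto simp: H_def\<close>)
    also have "8 * rq (Suc n) * (2 * r) <= 8 * (C * ?Q * real j powr (17/16)) * (2 * r)"
     using grow r by (intro mult_right_mono mult_left_mono) auto
    also have "... = 16 * C * (real j powr (17/16) / real j powr (5/8))" using Qpos by (simp add: r')
    also have "real j powr (17/16) / real j powr (5/8) = real j powr (7/16)" by (simp add: powr_diff[symmetric])
    finally have "real (card H) <= 16 * C * real j powr (7/16) + 1" by simp
    moreover have "0 <= 4 * real j powr (1/8)" by simp
    ultimately show ?thesis unfolding h_def by linarith
   next
    case False
    hence "2 ^ j < ?Q * real j powr (5/8)" using Qpos jp by (simp add: half field_simps)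
    hence "2 ^ j * real j powr (-1/2) <= ?Q * real j powr (5/8) * real j powr (-1/2)" by (intro mult_right_mono) auto
    hence "2 * N j / ?Q <= 2 * (real j powr (5/8) * real j powr (-1/2))"
     using Qpos by (simp add: N_def divide_le_eq mult_ac)
    also have "... = 2 * real j powr (1/8)" by (simp add: powr_add[symmetric])
    finally have "real (card H) <= 4 * real j powr (1/8) + 2" using cardH1 by simp
    moreover have "0 <= 16 * C * real j powr (7/16)" using C_pos by simp
    ultimately show ?thesis unfolding h_def by linarith
   qed
   define Lx where "Lx = {l. real l <= 2 * N j & abs (Bs f l x - Bs f l x') < 2}"
   define w where "w = ?Q * real j powr (-1/8) + 8 / D * (2 ^ j / real j)"
   have w0: "0 <= w" using D jp by (simp add: w_def)
   have "real (card Lx) <= (real (card H) + 1) * (w + 1)"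
   proof (rule card_le_gaps[OF _ finH w0])
    show "finite Lx" by (rule finite_subset[of _ "{..mm j}"]) (auto simp: Lx_def lmm)
    fix l l' assume l: "l \<in> Lx" "l' \<in> Lx" "l < l'" "{l..<l'} Int H = {}"
    have "real (l' - l) <= max (?Q * real j powr (-1/8)) (4 / (D * real j * abs (x - x')))"
    proof (rule drift_between_hits[where r = r and l = l and l' = l'])
     show "D * real j * real m <= abs (Bs (deriv f) m y)"
      if m: "?Q * real j powr (-1/8) <= real m" and far: "!!i. i < m ==> r <= idist (orb y i)" for m y
     proof -
      have "D * (real m * real j) <= abs (Bs (deriv f) m y)"
       using bj Qlow Q2 m order_trans[OF r(3) far] by (intro slope) (auto simp: big_def)
      thus ?thesis by (simp add: mult_ac)
     qed
     show "2 * r <= idist (orb x i)" if "l <= i" "i < l'" for i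
     proof -
      have "i \<notin> H" using that l(4) by auto
      moreover have "i < mm j" using that l(2) by (auto simp: Lx_def lmm)
      ultimately show ?thesis by (simp add: H_def)
     qed
     show "0 < abs (x - x')" "abs (x - x') <= r" using d r by (auto intro: order.strict_trans[rotated])
    qed (use C2_on_unit_intervalD[OF C2] D jp r l in \<open>auto simp: Lx_def\<close>)
    also have "4 / (D * real j * abs (x - x')) <= 4 / (D * real j * (1/2) ^ Suc j)"
     using d D jp by (intro divide_left_mono mult_left_mono mult_pos_pos) (auto intro: order.strict_trans[rotated])
    also have "4 / (D * real j * (1/2) ^ Suc j) = 8 / D * (2 ^ j / real j)" by (simp add: power_one_over)
    finally have "real (l' - l) <= max (?Q * real j powr (-1/8)) (8 / D * (2 ^ j / real j))" by (simp add: max.mono)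
    also have "... <= w" using D jp by (simp add: w_def)
    finally show "real (l' - l) <= w" .
   qed
   also have "... = (real (card H) + 1) * (?Q * real j powr (-1/8)) + (real (card H) + 1) * (8 / D * (2 ^ j / real j) + 1)"
    by (simp add: w_def algebra_simps)
   also have "... <= 10 * N j * real j powr (-1/8) + (h j + 1) * (8 / D * (2 ^ j / real j) + 1)"
   proof (rule add_mono)
    have "(real (card H) + 1) * ?Q <= (2 * (2 * N j / ?Q + 1) + 1) * ?Q" using cardH1 by (intro mult_right_mono) auto
    also have "... = 4 * N j + 3 * ?Q" using Qpos by (simp add: field_simps)
    also have "... <= 10 * N j" using n(1) by simp
    finally show "(real (card H) + 1) * (?Q * real j powr (-1/8)) <= 10 * N j * real j powr (-1/8)"
     by (simp add: mult.assoc[symmetric] mult_right_mono)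
    show "(real (card H) + 1) * (8 / D * (2 ^ j / real j) + 1) <= (h j + 1) * (8 / D * (2 ^ j / real j) + 1)"
     using cardH2 D jp by (intro mult_right_mono add_nonneg_nonneg) auto
   qed
   also have "... <= real j powr (-1/32) * N j" using bj jp Npos by (simp add: big_def divide_less_eq)
   finally have card: "real (card Lx) <= real j powr (-1/32) * N j" .
   have diff: "abs (Bs f l x - Bs f l x') <= 2 powr (real j / 4)" if l: "l <= mm j" for l
   proof -
    let ?V = "2 powr (real j / 8)" and ?q = "rq (Suc n)"
    have "abs (Bs f l x - Bs f l x') <= 2 * C1 * (1 + 8 * ?q * (1/2) ^ j * harm l) + (16 * ?q * (1/2) ^ j + 1) * ?V"
    proof (rule birkhoff_difference_bound[OF C2_on_unit_intervalD(1)[OF C2] f'bound])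
     show "abs (f (frac (orb x i)) - f (frac (orb x' i))) <= ?V" if "i < l" for i
      using Xf[OF x(1) j, of i] Xf[OF x(2) j, of i] that l by (auto simp: abs_le_iff)
    qed (use d l mmq in auto)
    moreover have q': "?q * (1/2) ^ j <= C * real j powr (17/16)"
    proof -
     have "C * ?Q * real j powr (17/16) <= C * 2 ^ j * real j powr (17/16)"
      using Q2 C_pos by (intro mult_right_mono mult_left_mono) auto
     from order_trans[OF grow this] have "?q * (1/2) ^ j <= C * 2 ^ j * real j powr (17/16) * (1/2) ^ j"
      by (intro mult_right_mono) auto
     thus ?thesis by (simp add: half)
    qed
    moreover have "harm l <= real j + 1"
    proof (cases "l = 0")
     case False
     have "real l <= 2 ^ j" using l mm(1)[of j] N2 Npos by linarith
     thus ?thesis using harm_le_ln[of l] lnle[of "real l"] False by simp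
    qed (simp add: harm_def)
    hence "(?q * (1/2) ^ j) * harm l <= (C * real j powr (17/16)) * (real j + 1)"
     by (rule mult_mono[OF q']) (use C_pos in \<open>auto simp: harm_nonneg\<close>)
    hence "2 * C1 * (1 + 8 * ((?q * (1/2) ^ j) * harm l)) <= 2 * C1 * (1 + 8 * ((C * real j powr (17/16)) * (real j + 1)))"
     using C1 by (intro mult_left_mono) auto
    moreover have "(16 * (?q * (1/2) ^ j) + 1) * ?V <= (16 * (C * real j powr (17/16)) + 1) * ?V"
     using q' by (intro mult_right_mono) auto
    moreover have "2 * C1 * (1 + 8 * C * real j powr (17/16) * (real j + 1)) + (16 * C * real j powr (17/16) + 1) * ?V <= 2 powr (real j / 4)"
     using bj by (simp add: big_def divide_less_eq)
    ultimately show ?thesis unfolding mult.assoc by linarith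
   qed
   have reg: "regular_on \<alpha> l {y}" if "y \<in> X" "l <= mm j" for l y
    unfolding regular_on_def using Xd[OF that(1) j] \<delta>pos[of j] that(2) by (auto intro!: idist_pos_not_Int intro: order.strict_trans)
   have near: "c * (real l' - real l) <= 2 + 2 powr (real j / 4)"
    if "l <= l'" "l' <= mm j" "abs (Bs f l y - Bs f l' y') < 2" "y' \<in> X"
     and dd: "abs (Bs f l y - Bs f l y') <= 2 powr (real j / 4)" for l l' y y'
   proof -
    have l': "l' = l + (l' - l)" using that(1) by simp
    have rg: "regular_on \<alpha> (l' - l) {orb y' l}" unfolding regular_on_def
    proof (intro ballI allI impI)
     fix z i assume "z \<in> {orb y' l}" "i < l' - l"
     hence zi: "orb z i = y' + real (l + i) * \<alpha>" "l + i < l'" by (auto simp: algebra_simps)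
     have "y' + real (l + i) * \<alpha> \<notin> \<int>" using reg[OF that(4,2)] zi(2) unfolding regular_on_def by blast
     thus "orb z i \<notin> \<int>" unfolding zi(1) .
    qed
    have "Bs f l' y' = Bs f l y' + Bs f (l' - l) (orb y' l)"
     by (subst l') (rule birkhoff_add)
    moreover have "c * real (l' - l) <= Bs f (l' - l) (orb y' l)"
     by (rule birkhoff_lower[OF flo rg])
    ultimately show ?thesis using that(1,3) dd by (simp add: of_nat_diff)
   qed
   have sep: "2 powr (- (1/2) * j) < abs (x' - x + (real l' - real l) * \<alpha> - of_int z)"
    if l: "l ~= l'" "l <= mm j" "l' <= mm j" "abs (Bs f l x - Bs f l' x') < 2" for l l' z
   proof -
    let ?k = "int l' - int l"
    have "c * abs (real l' - real l) <= 2 + 2 powr (real j / 4)"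
    proof (cases "l <= l'")
     case True
     thus ?thesis using near[of l l' x x'] l x diff[of l] by simp
    next
     case False
     have "c * (real l - real l') <= 2 + 2 powr (real j / 4)"
      using near[of l' l x' x] l x diff[of l'] False by (simp add: abs_minus_commute)
     thus ?thesis using False by simp
    qed
    hence "abs (real l' - real l) <= (2 + 2 powr (real j / 4)) / c" using cf by (simp add: pos_le_divide_eq mult.commute)
    also have "... <= 2 powr (real j / 3)"
    proof -
     have "((2 + 2 powr (real j / 4)) / c) / (2 powr (real j / 3)) < 1" using bj unfolding big_def by blast
     moreover have "0 < 2 powr (real j / 3)" by simp
     ultimately show ?thesis by (simp only: pos_divide_less_eq[of "2 powr (real j / 3)"] mult_1 less_imp_le)
    qed
    finally have kb: "abs (real_of_int ?k) <= 2 powr (real j / 3)" by simp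
    have k0: "?k ~= 0" "0 < abs (real_of_int ?k)" using l by auto
    have "c3 / (2 powr (real j / 3)) powr (1 + 1/4) <= c3 / abs (real_of_int ?k) powr (1 + 1/4)"
     using kb k0 c3(1) by (intro divide_left_mono powr_mono2 mult_pos_pos) auto
    also have "... <= abs (?k * \<alpha> - of_int z)" by (rule c3(2)[OF k0(1)])
    finally have "c3 / (2 powr (real j / 3)) powr (1 + 1/4) <= abs ((real l' - real l) * \<alpha> - of_int z)" by simp
    moreover have "2 powr (- (1/2) * j) + (1/2) ^ j < c3 / (2 powr (real j / 3)) powr (1 + 1/4)"
    proof -
     have "0 < c3 / (2 powr (real j / 3)) powr (1 + 1/4)" using c3(1) by simp
     moreover have "(2 powr (- (1/2) * j) + (1/2) ^ j) / (c3 / (2 powr (real j / 3)) powr (1 + 1/4)) < 1"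
      using bj by (simp add: big_def)
     ultimately show ?thesis by (simp only: pos_divide_less_eq mult_1)
    qed
    ultimately show ?thesis using d(2) by linarith
   qed
   show ?thesis using sep card unfolding Lx_def lmm by auto
  qed
  show "\<exists>j0. \<exists>X\<in>sets borel. X <= {0<..<1} & leb ({0<..<1} - X) <= ennreal kap &
    (\<forall>j\<ge>j0. pair_separation \<alpha> f N (1/2) (1/32) 1 X j)"
   using XE main unfolding pair_separation_def
   by (intro exI[of _ j0] bexI[OF _ Xm] conjI allI ballI impI) (auto simp: X_def)
 qed auto
qed

end

section \<open>Special flows over the rotation\<close>

lemma cocycle_of_nat: "cocycle Y S \<phi> (int n) y = (\<Sum>i<n. \<phi> ((S ^^ i) y))"
 by (simp add: cocycle_def int_iterate_def)

lemma cocycle_nonpos: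
 assumes S: "bij_betw S (space Y) (space Y)" and \<phi>: "!!y. y \<in> space Y ==> 0 < \<phi> y" and y: "y \<in> space Y" and N: "N <= 0"
 shows "cocycle Y S \<phi> N y <= 0"
proof (cases "N = 0")
 case True
 thus ?thesis by (simp add: cocycle_def)
next
 case False
 have inv: "(inv_into (space Y) S ^^ k) y \<in> space Y" for k
  using y bij_betw_inv_into[OF S] by (induction k) (auto simp: bij_betw_def)
 have "0 <= (\<Sum>i=1..nat (- N). \<phi> (int_iterate Y S (- int i) y))"
  by (intro sum_nonneg) (auto simp: int_iterate_def inv \<phi> less_imp_le)
 thus ?thesis using False N by (simp add: cocycle_def)
qed

lemma special_flow_eval:
 assumes S: "bij_betw S (space Y) (space Y)" and \<phi>: "!!y. y \<in> space Y ==> 0 < \<phi> y" and y: "y \<in> space Y"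
  and n: "(\<Sum>i<n. \<phi> ((S ^^ i) y)) <= s + t" "s + t < (\<Sum>i<Suc n. \<phi> ((S ^^ i) y))"
 shows "special_flow Y S \<phi> t (y, s) = ((S ^^ n) y, s + t - (\<Sum>i<n. \<phi> ((S ^^ i) y)))"
proof -
 have it: "(S ^^ k) y \<in> space Y" for k using y S by (induction k) (auto simp: bij_betw_def)
 define A where "A k = (\<Sum>i<k. \<phi> ((S ^^ i) y))" for k
 have A: "A k <= A k'" if "k <= k'" for k k'
  unfolding A_def using that \<phi>[OF it] by (intro sum_mono2) (auto simp: less_imp_le)
 have A0: "0 <= A k" for k unfolding A_def using \<phi>[OF it] by (intro sum_nonneg) (auto simp: less_imp_le)
 have cA: "cocycle Y S \<phi> (int k) y = A k" for k unfolding A_def by (rule cocycle_of_nat)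
 have "(THE N. cocycle Y S \<phi> N y <= s + t & s + t < cocycle Y S \<phi> (N + 1) y) = int n"
 proof (rule the_equality)
  have "cocycle Y S \<phi> (int n + 1) y = A (Suc n)" using cA[of "Suc n"] by (simp add: add.commute)
  thus "cocycle Y S \<phi> (int n) y <= s + t & s + t < cocycle Y S \<phi> (int n + 1) y"
   using n by (simp add: cA A_def)
 next
  fix N assume N: "cocycle Y S \<phi> N y <= s + t & s + t < cocycle Y S \<phi> (N + 1) y"
  have "0 <= s + t" using n(1) A0[of n] by (simp add: A_def)
  hence "0 < cocycle Y S \<phi> (N + 1) y" using N by linarith
  hence "0 < N + 1" using cocycle_nonpos[of S Y \<phi> y "N + 1", OF S \<phi> y] by (cases "0 < N + 1") auto
  then obtain k where k: "N = int k" by (metis zero_le_imp_eq_int zless_add1_eq le_less)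
  have N1: "A k <= s + t" "s + t < A (Suc k)" using N cA[of k] cA[of "Suc k"] by (auto simp: k add.commute)
  have "\<not> k < n" using A[of "Suc k" n] N1 n by (auto simp: A_def Suc_le_eq)
  moreover have "\<not> n < k" using A[of "Suc n" k] N1 n by (auto simp: A_def Suc_le_eq)
  ultimately show "N = int n" using k by simp
 qed
 thus ?thesis by (simp add: special_flow_def int_iterate_def cocycle_of_nat)
qed

lemma special_flow_in_fibre:
 assumes "bij_betw S (space Y) (space Y)" "!!y. y \<in> space Y ==> 0 < \<phi> y" "y \<in> space Y" "0 <= s + t" "s + t < \<phi> y"
 shows "special_flow Y S \<phi> t (y, s) = (y, s + t)"
 using special_flow_eval[of S Y \<phi> y 0 s t] assms by simp

definition generic :: "real => real set" where
 "generic \<alpha> = {x \<in> {0..<1}. \<forall>n::int. frac (x + of_int n * \<alpha>) ~= 0}"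

lemma space_circle_base: "space (circle_base \<alpha>) = generic \<alpha>"
 by (simp add: circle_base_def generic_def space_restrict_space)

lemma generic_not_Int: "x \<in> generic \<alpha> ==> x + of_int n * \<alpha> \<notin> \<int>"
 by (auto simp: generic_def frac_eq_0_iff)

lemma generic_frac:
 assumes "x \<in> generic \<alpha>"
 shows "frac (x + of_int n * \<alpha>) \<in> generic \<alpha>"
proof -
 have "frac (frac (x + of_int n * \<alpha>) + of_int m * \<alpha>) ~= 0" for m
 proof -
  have "frac (frac (x + of_int n * \<alpha>) + of_int m * \<alpha>) = frac ((x + of_int n * \<alpha>) + of_int m * \<alpha>)" by simp
  also have "(x + of_int n * \<alpha>) + of_int m * \<alpha> = x + of_int (n + m) * \<alpha>" by (simp add: algebra_simps)
  finally have e: "frac (frac (x + of_int n * \<alpha>) + of_int m * \<alpha>) = frac (x + of_int (n + m) * \<alpha>)" .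
  show ?thesis unfolding e frac_eq_0_iff by (rule generic_not_Int[OF assms])
 qed
 thus ?thesis by (simp add: generic_def frac_lt_1 del: frac_eq_0_iff)
qed

lemma generic_unit: "x \<in> generic \<alpha> ==> frac (x + of_int n * \<alpha>) \<in> {0<..<1}"
 using generic_not_Int by (intro frac_in_unit)

lemma generic_self: "x \<in> generic \<alpha> ==> x \<in> {0<..<1}"
 using generic_unit[of x \<alpha> 0] by (simp add: generic_def)

lemma countable_circle_exceptions: "countable ({0<..<1} - generic \<alpha>)"
proof -
 have "{0<..<1} - generic \<alpha> <= range (%n::int. frac (- of_int n * \<alpha>))"
 proof
  fix x assume x: "x \<in> {0<..<1} - generic \<alpha>"
  then obtain n :: int where "frac (x + of_int n * \<alpha>) = 0" by (auto simp: generic_def)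
  then obtain z where "x + of_int n * \<alpha> = of_int z" by (auto simp: frac_eq_0_iff elim: Ints_cases)
  hence "- of_int n * \<alpha> = x + of_int (- z)" by simp
  hence "frac (- of_int n * \<alpha>) = frac x" by (metis frac_add_of_int_right)
  hence "frac (- of_int n * \<alpha>) = x" using x by simp
  thus "x \<in> range (%n::int. frac (- of_int n * \<alpha>))" by (metis rangeI)
 qed
 thus ?thesis by (rule countable_subset) simp
qed

lemma generic_eq: "generic \<alpha> = {0<..<1} - ({0<..<1} - generic \<alpha>)"
 using generic_self by blast

lemma generic_borel [measurable]: "generic \<alpha> \<in> sets borel"
proof -
 have "{0<..<1} - generic \<alpha> \<in> sets borel" by (rule sets.countable[OF _ countable_circle_exceptions]) simp
 thus ?thesis by (subst generic_eq) (rule sets.Diff, simp)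
qed

lemma rotation_generic: "x \<in> generic \<alpha> ==> rotation \<alpha> x \<in> generic \<alpha>"
 using generic_frac[of x \<alpha> 1] by (simp add: rotation_def)

lemma rotation_funpow: "x \<in> {0..<1} ==> (rotation \<alpha> ^^ n) x = frac (x + real n * \<alpha>)"
proof (induction n)
 case (Suc n)
 hence "(rotation \<alpha> ^^ Suc n) x = frac (frac (x + real n * \<alpha>) + \<alpha>)"
  by (simp add: rotation_def[of \<alpha> "frac (x + real n * \<alpha>)"])
 also have "... = frac (x + real (Suc n) * \<alpha>)" by (simp add: algebra_simps)
 finally show ?case .
qed simp

lemma bij_rotation: "bij_betw (rotation \<alpha>) (generic \<alpha>) (generic \<alpha>)"
proof (rule bij_betw_byWitness[where f' = "%x. frac (x - \<alpha>)"])
 show "\<forall>x\<in>generic \<alpha>. frac (rotation \<alpha> x - \<alpha>) = x"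
 proof
  fix x assume "x \<in> generic \<alpha>"
  hence "frac x = x" by (simp add: generic_def)
  moreover have "frac (frac (x + \<alpha>) - \<alpha>) = frac (x + \<alpha> - \<alpha>)"
   using frac_add_simps(1)[of "x + \<alpha>" "- \<alpha>"] by simp
  ultimately show "frac (rotation \<alpha> x - \<alpha>) = x" by (simp add: rotation_def)
 qed
 show "\<forall>x\<in>generic \<alpha>. rotation \<alpha> (frac (x - \<alpha>)) = x"
  by (auto simp: rotation_def generic_def)
 show "rotation \<alpha> ` generic \<alpha> <= generic \<alpha>" using rotation_generic by auto
 show "(%x. frac (x - \<alpha>)) ` generic \<alpha> <= generic \<alpha>"
  using generic_frac[of _ \<alpha> "-1"] by auto
qed

locale roof_flow =
 fixes \<alpha> :: real and f :: "real => real" and c :: real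
 assumes c_pos: "0 < c" and roof_ge: "!!x. x \<in> {0<..<1} ==> c <= f x" and roof_continuous: "continuous_on {0<..<1} f"
begin

abbreviation Y where "Y \<equiv> circle_base \<alpha>"
abbreviation M where "M \<equiv> special_measure (circle_base \<alpha>) f"
abbreviation T where "T \<equiv> special_flow (circle_base \<alpha>) (rotation \<alpha>) f"
abbreviation S where "S \<equiv> birkhoff \<alpha> f"

lemma space_M: "space M = {(x, u). x \<in> generic \<alpha> & 0 <= u & u < f x}"
 by (auto simp: special_measure_def special_space_def space_restrict_space space_circle_base space_pair_measure)

lemma roof_pos: "x \<in> generic \<alpha> ==> c <= f x"
 using roof_ge generic_self by blast

lemma S_ge: "x \<in> generic \<alpha> ==> c * real n <= S n x"
proof -
 assume x: "x \<in> generic \<alpha>"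
 have "(\<Sum>i<n. c) <= S n x"
  unfolding birkhoff_def using generic_unit[OF x, of "int i" for i] by (intro sum_mono roof_ge) auto
 thus ?thesis by (simp add: mult.commute)
qed

lemma S_mono:
 assumes x: "x \<in> generic \<alpha>" and mn: "m <= n"
 shows "S m x <= S n x"
proof -
 have "0 <= c * real (n - m)" using c_pos by simp
 also have "... <= S (n - m) (frac (x + real m * \<alpha>))"
  using S_ge[of "frac (x + real m * \<alpha>)"] generic_frac[OF x, of "int m"] by simp
 also have "... = S (n - m) (x + real m * \<alpha>)" using birkhoff_frac[of \<alpha> f "n - m" "x + real m * \<alpha>" 0] by simp
 finally show ?thesis using birkhoff_add[of \<alpha> f m "n - m" x] mn by simp
qed

lemma flow_eval:
 assumes x: "x \<in> generic \<alpha>" and n: "S n x <= u + t" "u + t < S (Suc n) x"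
 shows "T t (x, u) = (frac (x + real n * \<alpha>), u + t - S n x)"
proof -
 have *: "(\<Sum>i<k. f ((rotation \<alpha> ^^ i) x)) = S k x" for k
  using x by (simp add: birkhoff_def rotation_funpow generic_def)
 have "T t (x, u) = ((rotation \<alpha> ^^ n) x, u + t - (\<Sum>i<n. f ((rotation \<alpha> ^^ i) x)))"
  by (rule special_flow_eval) (use x n bij_rotation roof_pos c_pos in \<open>auto simp: space_circle_base * intro: order.strict_trans2\<close>)
 thus ?thesis using x by (simp add: * rotation_funpow generic_def)
qed

lemma flow_step:
 assumes w: "(x, u) \<in> space M" and t: "0 <= t"
 obtains n where "S n x <= u + t" "u + t < S (Suc n) x" "T t (x, u) = (frac (x + real n * \<alpha>), u + t - S n x)"
proof -
 have x: "x \<in> generic \<alpha>" "0 <= u" using w by (auto simp: space_M)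
 obtain k :: nat where k: "(u + t) / c < real k" using reals_Archimedean2 by blast
 hence "u + t < S k x" using S_ge[OF x(1), of k] c_pos by (simp add: divide_less_eq mult.commute)
 define n where "n = (LEAST n. u + t < S (Suc n) x)"
 have "u + t < S (Suc k) x" using \<open>u + t < S k x\<close> S_mono[OF x(1), of k "Suc k"] by linarith
 hence n: "u + t < S (Suc n) x" unfolding n_def by (rule LeastI)
 have "S n x <= u + t"
 proof (cases n)
  case (Suc m)
  hence "\<not> u + t < S (Suc m) x" using not_less_Least[of m "%n. u + t < S (Suc n) x"] n_def by auto
  thus ?thesis using Suc by simp
 qed (use x t in simp)
 thus thesis using that n flow_eval[OF x(1)] by blast
qed

lemma flow_space:
 assumes "w \<in> space M" "0 <= t"
 shows "T t w \<in> space M"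
proof -
 obtain x u where w: "w = (x, u)" by (cases w)
 hence x: "x \<in> generic \<alpha>" using assms by (auto simp: space_M)
 obtain n where n: "S n x <= u + t" "u + t < S (Suc n) x" "T t (x, u) = (frac (x + real n * \<alpha>), u + t - S n x)"
  using flow_step assms w by blast
 thus ?thesis using generic_frac[OF x, of "int n"] by (auto simp: w space_M birkhoff_Suc)
qed

lemma flow_add:
 assumes w: "w \<in> space M" and "0 <= s" "0 <= t"
 shows "T (s + t) w = T s (T t w)"
proof -
 obtain x u where xu: "w = (x, u)" by (cases w)
 hence x: "x \<in> generic \<alpha>" using w by (auto simp: space_M)
 obtain n where n: "S n x <= u + t" "u + t < S (Suc n) x" "T t (x, u) = (frac (x + real n * \<alpha>), u + t - S n x)"
  using flow_step assms xu by blast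
 define x' v where "x' = frac (x + real n * \<alpha>)" and "v = u + t - S n x"
 have x': "x' \<in> generic \<alpha>" using generic_frac[OF x, of "int n"] by (simp add: x'_def)
 have "T t w \<in> space M" using flow_space assms by blast
 hence "(x', v) \<in> space M" by (simp add: xu n(3) x'_def v_def)
 then obtain m where m: "S m x' <= v + s" "v + s < S (Suc m) x'" "T s (x', v) = (frac (x' + real m * \<alpha>), v + s - S m x')"
  using flow_step assms(2) by blast
 have SS: "S (n + k) x = S n x + S k x'" for k
  using birkhoff_add[of \<alpha> f n k x] birkhoff_frac[of \<alpha> f k "x + real n * \<alpha>" 0] by (simp add: x'_def)
 have "T (s + t) (x, u) = (frac (x + real (n + m) * \<alpha>), u + (s + t) - S (n + m) x)"
  by (rule flow_eval[OF x]) (use m SS[of m] SS[of "Suc m"] in \<open>simp_all add: v_def\<close>)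
 moreover have "frac (x' + real m * \<alpha>) = frac (x + real (n + m) * \<alpha>)" by (simp add: x'_def algebra_simps)
 ultimately show ?thesis using m(3) SS[of m] by (simp add: xu n(3) x'_def[symmetric] v_def)
qed

text \<open>The number of floors crossed is bounded by the elapsed time.\<close>

lemma floors_le_time:
 assumes w: "(x, u) \<in> space M" and t: "0 <= t" and n: "S n x <= u + t"
 shows "c * (real n - 1) <= t"
proof (cases n)
 case (Suc m)
 have x: "x \<in> generic \<alpha>" "u < f x" using w by (auto simp: space_M)
 have fx: "frac x = x" using x(1) by (simp add: generic_def)
 have "S (1 + m) x = S 1 x + S m (x + real 1 * \<alpha>)" by (rule birkhoff_add)
 also have "S 1 x = f x" using fx by (simp add: birkhoff_def)
 also have "S m (x + real 1 * \<alpha>) = S m (frac (x + of_int 1 * \<alpha>))" using birkhoff_frac[of \<alpha> f m "x + \<alpha>" 0] by simp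
 finally have "S n x = f x + S m (frac (x + of_int 1 * \<alpha>))" by (simp add: Suc)
 thus ?thesis using S_ge[OF generic_frac[OF x(1), of 1], of m] x(2) n Suc by simp
qed (use c_pos t in simp)

end

section \<open>From the base to the flow\<close>

lemma special_space_measurable:
 assumes "\<phi> \<in> borel_measurable Y"
 shows "special_space Y \<phi> \<in> sets (cyl Y)"
proof -
 have "{w \<in> space (cyl Y). 0 <= snd w & snd w < \<phi> (fst w)} \<in> sets (cyl Y)"
  using assms by measurable
 also have "{w \<in> space (cyl Y). 0 <= snd w & snd w < \<phi> (fst w)} = special_space Y \<phi>"
  by (auto simp: special_space_def space_pair_measure)
 finally show ?thesis .
qed

lemma space_special: "space (special_measure Y \<phi>) = special_space Y \<phi>"
 by (auto simp: special_measure_def space_restrict_space space_pair_measure special_space_def)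

lemma sets_special:
 assumes "\<phi> \<in> borel_measurable Y"
 shows "A \<in> sets (special_measure Y \<phi>) \<longleftrightarrow> A \<in> sets (cyl Y) & A <= special_space Y \<phi>"
 unfolding special_measure_def using special_space_measurable[OF assms] sets.sets_into_space[OF special_space_measurable[OF assms]]
 by (subst sets_restrict_space_iff) (auto simp: Int_absorb2)

lemma emeasure_special:
 assumes "\<phi> \<in> borel_measurable Y" "A \<in> sets (special_measure Y \<phi>)"
 shows "\<mu> (special_measure Y \<phi>) A = \<mu> (cyl Y) A / \<mu> (cyl Y) (special_space Y \<phi>)"
proof -
 have O: "special_space Y \<phi> \<in> sets (cyl Y)" using special_space_measurable assms(1) by blast
 have A: "A \<in> sets (cyl Y)" "A <= special_space Y \<phi>" using assms sets_special by blast+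
 have "\<mu> (special_measure Y \<phi>) A = \<mu> (uniform_measure (cyl Y) (special_space Y \<phi>)) A"
  unfolding special_measure_def using O A sets.sets_into_space[OF O]
  by (intro emeasure_restrict_space) (auto simp: Int_absorb2)
 also have "... = \<mu> (cyl Y) (special_space Y \<phi> Int A) / \<mu> (cyl Y) (special_space Y \<phi>)"
  by (rule emeasure_uniform_measure[OF O A(1)])
 finally show ?thesis using A by (simp add: Int_absorb1)
qed

lemma divide_antimono_ennreal:
 fixes a b c :: ennreal
 assumes "0 < c" "c < top" "c <= b"
 shows "a / b <= a / c"
proof (rule divide_le_posI_ennreal)
 have "a = a / c * c" using assms by (simp add: ennreal_divide_times)
 also have "... <= a / c * b" using assms by (intro mult_left_mono) auto
 finally show "a <= b * (a / c)" by (simp add: mult.commute)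
qed (use assms in auto)

lemma measurable_special_fst_snd:
 "fst \<in> special_measure Y \<phi> \<rightarrow>\<^sub>M Y" "snd \<in> borel_measurable (special_measure Y \<phi>)"
proof -
 have "fst \<in> uniform_measure (cyl Y) (special_space Y \<phi>) \<rightarrow>\<^sub>M Y"
  "snd \<in> borel_measurable (uniform_measure (cyl Y) (special_space Y \<phi>))"
  by (simp_all add: measurable_cong_sets[OF sets_uniform_measure refl])
 thus "fst \<in> special_measure Y \<phi> \<rightarrow>\<^sub>M Y" "snd \<in> borel_measurable (special_measure Y \<phi>)"
  unfolding special_measure_def by (simp_all add: measurable_restrict_space1)
qed

text \<open>Greedy covering: a set of times that is thin in the window following each of its points is
 thin. The windows used are disjoint, and all of them except the last one fit into \<open>[0, R]\<close>.\<close>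

lemma window_cover:
 fixes A :: "real set" and W :: "real => real"
 assumes A: "A <= {0..R}" and R: "0 < R" and \<eta>: "0 < \<eta>" and Wm: "0 < Wm"
  and W: "!!t. t \<in> A ==> Wm <= W t & W t <= R"
  and Z: "!!t. t \<in> A ==> \<exists>Z\<in>sets borel. leb Z <= ennreal (\<eta> * W t) & A Int {t..t + W t} <= Z"
 shows "\<exists>Z\<in>sets borel. leb Z <= ennreal (4 * \<eta> * R) & A <= Z"
proof -
 have claim: "\<exists>Z\<in>sets borel. leb Z <= ennreal (2 * \<eta> * (2 * R - x)) & A Int {x..R} <= Z"
  if "0 <= x" "x <= R" "R - x < real k * Wm" for k x
  using that
 proof (induction k arbitrary: x)
  case (Suc k)
  show ?case
  proof (cases "A Int {x..R} = {}")
   case True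
   thus ?thesis by (intro bexI[of _ "{}"]) auto
  next
   case False
   define s where "s = Inf (A Int {x..R})"
   have bdd: "bdd_below (A Int {x..R})" by (intro bdd_belowI[of _ x]) auto
   have "\<exists>t0\<in>A Int {x..R}. t0 < s + \<eta> * Wm"
    using cInf_lessD[OF False, of "s + \<eta> * Wm"] \<eta> Wm by (simp add: s_def)
   then obtain t0 where t0: "t0 \<in> A" "x <= t0" "t0 <= R" "t0 < s + \<eta> * Wm" by auto
   have sle: "s <= t" if "t \<in> A Int {x..R}" for t unfolding s_def by (rule cInf_lower[OF that bdd])
   note Wt = W[OF t0(1)]
   obtain Z1 where Z1: "Z1 \<in> sets borel" "leb Z1 <= ennreal (\<eta> * W t0)" "A Int {t0..t0 + W t0} <= Z1"
    using Z[OF t0(1)] by blast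
   have "\<exists>Z2\<in>sets borel. leb Z2 <= ennreal (2 * \<eta> * (2 * R - x - W t0)) & A Int {t0 + W t0..R} <= Z2"
   proof (cases "t0 + W t0 <= R")
    case True
    have "\<exists>Z\<in>sets borel. leb Z <= ennreal (2 * \<eta> * (2 * R - (t0 + W t0))) & A Int {t0 + W t0..R} <= Z"
     by (rule Suc.IH) (use True Suc.prems Wt Wm t0 in \<open>auto simp: algebra_simps\<close>)
    moreover have "ennreal (2 * \<eta> * (2 * R - (t0 + W t0))) <= ennreal (2 * \<eta> * (2 * R - x - W t0))"
     using t0 \<eta> by (intro ennreal_leI mult_left_mono) auto
    ultimately show ?thesis by (meson order_trans)
   next
    case False
    hence "A Int {t0 + W t0..R} = {}" by auto
    thus ?thesis by (intro bexI[of _ "{}"]) auto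
   qed
   then obtain Z2 where Z2: "Z2 \<in> sets borel" "leb Z2 <= ennreal (2 * \<eta> * (2 * R - x - W t0))" "A Int {t0 + W t0..R} <= Z2"
    by blast
   define Z where "Z = ({s..t0} Un Z1) Un Z2"
   have "leb Z <= leb ({s..t0} Un Z1) + leb Z2"
    unfolding Z_def using Z1 Z2 by (intro emeasure_subadditive) auto
   also have "... <= (leb {s..t0} + leb Z1) + leb Z2"
    using Z1 by (intro add_right_mono emeasure_subadditive) auto
   also have "... <= (ennreal (\<eta> * W t0) + ennreal (\<eta> * W t0)) + ennreal (2 * \<eta> * (2 * R - x - W t0))"
   proof (intro add_mono Z1 Z2)
    have "s <= t0" using sle t0 by auto
    moreover have "\<eta> * Wm <= \<eta> * W t0" using Wt \<eta> by (intro mult_left_mono) auto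
    ultimately show "leb {s..t0} <= ennreal (\<eta> * W t0)" using t0 by (simp add: ennreal_leI)
   qed
   also have "... = ennreal (\<eta> * W t0 + \<eta> * W t0 + 2 * \<eta> * (2 * R - x - W t0))"
   proof -
    have "0 <= \<eta> * W t0" using \<eta> Wt Wm by (intro mult_nonneg_nonneg) auto
    moreover have "0 <= 2 * \<eta> * (2 * R - x - W t0)" using \<eta> Wt Suc.prems by (intro mult_nonneg_nonneg) auto
    ultimately show ?thesis by (simp add: ennreal_plus[symmetric] del: ennreal_plus)
   qed
   also have "\<eta> * W t0 + \<eta> * W t0 + 2 * \<eta> * (2 * R - x - W t0) = 2 * \<eta> * (2 * R - x)" by (simp add: algebra_simps)
   finally have "leb Z <= ennreal (2 * \<eta> * (2 * R - x))" .
   moreover have "A Int {x..R} <= Z"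
   proof
    fix t assume t: "t \<in> A Int {x..R}"
    have st: "s <= t" by (rule sle[OF t])
    consider "t <= t0" | "t0 <= t" "t <= t0 + W t0" | "t0 + W t0 <= t" by linarith
    thus "t \<in> Z"
    proof cases
     case 1 thus ?thesis using st by (simp add: Z_def)
    next
     case 2 thus ?thesis using t Z1(3) by (auto simp: Z_def)
    next
     case 3 thus ?thesis using t Z2(3) by (auto simp: Z_def)
    qed
   qed
   moreover have "Z \<in> sets borel" using Z1 Z2 by (simp add: Z_def)
   ultimately show ?thesis by blast
  qed
 qed simp
 obtain k :: nat where "R / Wm < real k" using reals_Archimedean2 by blast
 hence "R - 0 < real k * Wm" using Wm by (simp add: divide_less_eq)
 from claim[OF order_refl _ this] R obtain Z where "Z \<in> sets borel" "leb Z <= ennreal (2 * \<eta> * (2 * R - 0))" "A Int {0..R} <= Z"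
  by auto
 thus ?thesis using A by (intro bexI[of _ Z]) (auto simp: mult_ac Int_absorb2)
qed

lemma dyadic_class:
 fixes \<theta> :: real
 assumes "0 < \<theta>" "\<theta> <= 1"
 obtains j :: nat where "(1/2) ^ Suc j < \<theta>" "\<theta> <= (1/2) ^ j"
proof -
 obtain k :: nat where k: "(1/2) ^ k < \<theta>" using real_arch_pow_inv[OF assms(1), of "1/2"] by auto
 define j where "j = (LEAST j. (1/2) ^ Suc j < \<theta>)"
 have "(1/2) ^ Suc k < \<theta>" using k by (intro order.strict_trans1[OF _ k]) (simp add: power_Suc)
 hence j: "(1/2) ^ Suc j < \<theta>" unfolding j_def by (rule LeastI)
 have "\<theta> <= (1/2) ^ j"
 proof (cases j)
  case (Suc i)
  hence "\<not> (1/2) ^ Suc i < \<theta>" using not_less_Least[of i "%j. (1/2) ^ Suc j < \<theta>"] j_def by auto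
  thus ?thesis using Suc by simp
 qed (use assms in simp)
 thus thesis using that j by blast
qed

lemma emeasure_translate:
 fixes t :: real
 assumes "Z \<in> sets borel"
 shows "(%s. t + s) ` Z \<in> sets borel" "leb ((%s. t + s) ` Z) = leb Z"
proof -
 have im: "(%s. t + s) ` Z = (+) (- t) -` Z Int space borel" by (force simp: image_iff)
 show "(%s. t + s) ` Z \<in> sets borel" unfolding im using assms by measurable
 have "leb Z = \<mu> (distr lborel borel ((+) (- t))) Z" by (subst lborel_distr_plus) simp
 also have "... = leb ((+) (- t) -` Z Int space lborel)" using assms by (intro emeasure_distr) auto
 finally show "leb ((%s. t + s) ` Z) = leb Z" by (simp add: im)
qed

lemma emeasure_base: "A \<in> sets borel ==> A <= generic \<alpha> ==> \<mu> (circle_base \<alpha>) A = leb A"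
 unfolding circle_base_def generic_def[symmetric] by (subst emeasure_restrict_space) auto

lemma sets_base: "A \<in> sets borel ==> A Int generic \<alpha> \<in> sets (circle_base \<alpha>)"
 unfolding circle_base_def generic_def[symmetric] by (auto simp: sets_restrict_space)

lemma circle_base_prob: "prob_space (circle_base \<alpha>)"
proof
 have "leb ({0<..<1} - generic \<alpha>) = 0"
  by (rule emeasure_lborel_countable[OF countable_circle_exceptions])
 hence "leb ({0<..<1::real}) = leb (generic \<alpha>)"
  using emeasure_Diff_null_set[of "{0<..<1} - generic \<alpha>" lborel "{0<..<1}"] generic_eq[of \<alpha>]
  by (simp add: null_sets_def)
 thus "\<mu> (circle_base \<alpha>) (space (circle_base \<alpha>)) = 1"
  using emeasure_base[of "generic \<alpha>" \<alpha>] by (simp add: space_circle_base)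
qed

context roof_flow begin

lemma roof_measurable: "f \<in> borel_measurable Y"
proof -
 have "f \<in> borel_measurable (restrict_space borel {0<..<1})"
  by (rule borel_measurable_continuous_on_restrict[OF roof_continuous])
 hence "f \<in> borel_measurable (restrict_space (restrict_space borel {0<..<1}) (generic \<alpha>))"
  by (rule measurable_restrict_space1)
 also have "restrict_space (restrict_space borel {0<..<1}) (generic \<alpha>) = restrict_space borel (generic \<alpha>)"
  using generic_self[of _ \<alpha>] by (subst restrict_restrict_space) (auto intro!: arg_cong[where f = "restrict_space borel"])
 finally have "f \<in> borel_measurable (restrict_space borel (generic \<alpha>))" .
 thus ?thesis unfolding circle_base_def generic_def[symmetric]
  by (subst measurable_cong_sets[OF sets_restrict_space_cong[OF sets_lborel] refl])
qed

definition F where "F = \<mu> (cyl Y) (special_space Y f)"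

lemma F_ge: "ennreal c <= F"
proof -
 have "\<mu> (cyl Y) (generic \<alpha> \<times> {0..<c}) = \<mu> Y (generic \<alpha>) * leb {0..<c}"
  using sets_base[of UNIV] by (intro lborel.emeasure_pair_measure_Times) auto
 also have "... = ennreal c" using c_pos prob_space.emeasure_space_1[OF circle_base_prob[of \<alpha>]] by (simp add: space_circle_base)
 finally have "ennreal c = \<mu> (cyl Y) (generic \<alpha> \<times> {0..<c})" ..
 also have "... <= F" unfolding F_def
  using special_space_measurable[OF roof_measurable] roof_pos
  by (intro emeasure_mono) (fastforce simp: special_space_def space_circle_base)+
 finally show ?thesis .
qed

lemma emeasure_strip:
 assumes A: "A \<in> sets M" and U: "U \<in> sets borel" and V: "V \<in> sets borel" and sub: "!!x u. (x, u) \<in> A ==> x \<in> U & u \<in> V"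
 shows "\<mu> M A <= leb U * leb V / ennreal c"
proof -
 have "A <= space M" using sets.sets_into_space[OF A] .
 hence sub': "A <= (U Int generic \<alpha>) \<times> V" using sub by (auto simp: space_M)
 have "\<mu> M A = \<mu> (cyl Y) A / F"
  unfolding F_def by (rule emeasure_special[OF roof_measurable A])
 also have "... <= \<mu> (cyl Y) A / ennreal c"
  using F_ge c_pos by (intro divide_antimono_ennreal) auto
 also have "\<mu> (cyl Y) A <= \<mu> (cyl Y) ((U Int generic \<alpha>) \<times> V)"
  using sub' sets_base[OF U] V by (intro emeasure_mono) auto
 also have "... = \<mu> Y (U Int generic \<alpha>) * leb V"
  using sets_base[OF U] V by (intro lborel.emeasure_pair_measure_Times) auto
 also have "\<mu> Y (U Int generic \<alpha>) = leb (U Int generic \<alpha>)"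
  using U by (intro emeasure_base) auto
 also have "... <= leb U" using U by (intro emeasure_mono) auto
 finally show ?thesis by (simp add: divide_right_mono_ennreal mult_right_mono)
qed

lemma coordinates_measurable [measurable]: "fst \<in> borel_measurable M" "snd \<in> borel_measurable M"
proof -
 have "(%x. x) \<in> borel_measurable Y"
  unfolding circle_base_def by (rule measurable_restrict_space1) simp
 from measurable_compose[OF measurable_special_fst_snd(1) this] show "fst \<in> borel_measurable M" .
qed (rule measurable_special_fst_snd)

text \<open>The exceptional times form a set \<open>Z\<close> that depends on the two orbits. Only the times at which both orbits are in
 \<open>G\<close> and close to each other count.\<close>

definition drift_separation :: "(real => real) => bool" where
 "drift_separation \<theta> \<longleftrightarrow> (\<forall>kap>0. \<exists>G\<in>sets M. \<exists>Hm>0. \<exists>eps>0.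
   \<mu> M (space M - G) <= ennreal kap & (\<forall>w\<in>G. snd w < Hm) &
   (\<forall>R>0. \<forall>w\<in>space M. \<forall>w'\<in>space M. \<exists>Z\<in>sets borel. leb Z <= ennreal (kap * R) &
    (\<forall>t\<in>{0..R}. T t w \<in> G --> T t w' \<in> G -->
      abs (fst (T t w) - fst (T t w')) < eps --> abs (snd (T t w) - snd (T t w')) < 1 -->
      \<theta> R <= abs (fst (T t w) - fst (T t w')) --> t \<in> Z)))"

lemma low_part_large:
 assumes "\<mu> M (space M) < \<infinity>" "0 < kap"
 obtains Hm where "0 < Hm" "\<mu> M {w \<in> space M. Hm <= snd w} <= ennreal kap"
proof -
 define A where "A n = {w \<in> space M. real n <= snd w}" for n
 have A: "A n \<in> sets M" for n unfolding A_def by measurable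
 have "(%n. \<mu> M (A n)) \<longlonglongrightarrow> \<mu> M (\<Inter>n. A n)"
 proof (rule Lim_emeasure_decseq)
  show "\<mu> M (A i) ~= \<infinity>" for i
   using emeasure_space[of M "A i"] assms(1) by (auto simp: less_top[symmetric] top_unique)
 qed (use A in \<open>auto simp: A_def decseq_def\<close>)
 moreover have "(\<Inter>n. A n) = {}"
 proof (rule ccontr)
  assume "(\<Inter>n. A n) ~= {}"
  then obtain w where w: "w \<in> (\<Inter>n. A n)" by blast
  obtain n where n: "snd w < real n" using reals_Archimedean2 by blast
  have "w \<in> A n" using w by blast
  thus False using n by (simp add: A_def)
 qed
 ultimately have "(%n. \<mu> M (A n)) \<longlonglongrightarrow> 0" by simp
 hence "\<forall>\<^sub>F n in sequentially. \<mu> M (A n) < ennreal kap"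
  using assms(2) by (intro order_tendstoD) auto
 then obtain n0 where "!!n. n \<ge> n0 ==> \<mu> M (A n) < ennreal kap" by (auto simp: eventually_sequentially)
 hence "\<mu> M (A (Suc n0)) < ennreal kap" by simp
 thus thesis using that[of "real (Suc n0)"] by (simp add: A_def)
qed

text \<open>When the two points are close to each other, their Birkhoff sums at the numbers \<open>l\<close>, \<open>l'\<close> of floors crossed differ by
 less than \<open>2\<close>. If \<open>l \<noteq> l'\<close>, then \<open>cross\<close> separates the points; every single \<open>l = l'\<close> accounts for a time of
 length at most \<open>Hm\<close>, the part of the floor below \<open>Hm\<close>.\<close>

lemma drift_window:
 fixes Hm K \<delta> Nj :: real
 assumes w: "(a, v) \<in> space M" "(a', v') \<in> space M" and W: "1 <= Nj" and j: "1 <= j"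
  and cross: "!!l l'. l ~= l' ==> real l <= 2 * Nj ==> real l' <= 2 * Nj ==>
       abs (S l a - S l' a') < 2 ==> (\<forall>z::int. \<delta> < abs (a' - a + (real l' - real l) * \<alpha> - z))"
  and card: "real (card {l. real l <= 2 * Nj & abs (S l a - S l a') < 2}) <= K" and Hm: "(0::real) < Hm"
 shows "\<exists>Z\<in>sets borel. leb Z <= ennreal (K * Hm) &
  (\<forall>s\<in>{0..c * Nj}. snd (T s (a, v)) < Hm --> abs (snd (T s (a, v)) - snd (T s (a', v'))) < 1 -->
    abs (v - v') < 1 --> abs (fst (T s (a, v)) - fst (T s (a', v'))) <= \<delta> --> s \<in> Z)"
proof -
 define L where "L = {l. real l <= 2 * Nj & abs (S l a - S l a') < 2}"
 have "L <= {..nat \<lceil>2 * Nj\<rceil>}" by (auto simp: L_def nat_le_iff) linarith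
 hence fin: "finite L" by (rule finite_subset) simp
 define Z where "Z = (\<Union>l\<in>L. {S l a - v..S l a - v + Hm})"
 have "leb Z <= ennreal (real (card L) * Hm)"
  unfolding Z_def using Hm fin by (intro emeasure_UN_le_card) auto
 also have "... <= ennreal (K * Hm)" using card Hm by (intro ennreal_leI mult_right_mono) (auto simp: L_def)
 finally have "leb Z <= ennreal (K * Hm)" .
 moreover have "Z \<in> sets borel" unfolding Z_def using fin by (intro sets.finite_UN) auto
 moreover have "s \<in> Z" if s: "s \<in> {0..c * Nj}" "snd (T s (a, v)) < Hm" "abs (snd (T s (a, v)) - snd (T s (a', v'))) < 1"
   "abs (v - v') < 1" "abs (fst (T s (a, v)) - fst (T s (a', v'))) <= \<delta>" for s
 proof -
  have s0: "0 <= s" using s by simp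
  obtain l where l: "S l a <= v + s" "v + s < S (Suc l) a" "T s (a, v) = (frac (a + real l * \<alpha>), v + s - S l a)"
   using flow_step[OF w(1) s0] by blast
  obtain l' where l': "S l' a' <= v' + s" "v' + s < S (Suc l') a'" "T s (a', v') = (frac (a' + real l' * \<alpha>), v' + s - S l' a')"
   using flow_step[OF w(2) s0] by blast
  have "c * (real l - 1) <= c * Nj" "c * (real l' - 1) <= c * Nj"
   using floors_le_time[OF w(1) s0 l(1)] floors_le_time[OF w(2) s0 l'(1)] s by auto
  hence "real l - 1 <= Nj" "real l' - 1 <= Nj" using c_pos by simp_all
  hence le: "real l <= 2 * Nj" "real l' <= 2 * Nj" using W by auto
  have close: "abs (S l a - S l' a') < 2" using s(3,4) by (simp add: l(3) l'(3))
  show ?thesis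
  proof (cases "l = l'")
   case True
   hence "l \<in> L" using le close by (simp add: L_def)
   moreover have "s \<in> {S l a - v..S l a - v + Hm}" using l(1) s(2) by (simp add: l(3))
   ultimately show ?thesis unfolding Z_def by blast
  next
   case False
   have "fst (T s (a', v')) - fst (T s (a, v)) = a' - a + (real l' - real l) * \<alpha>
     - of_int (\<lfloor>a' + real l' * \<alpha>\<rfloor> - \<lfloor>a + real l * \<alpha>\<rfloor>)"
    by (simp add: l(3) l'(3) frac_def algebra_simps)
   hence "\<delta> < abs (fst (T s (a', v')) - fst (T s (a, v)))" using cross[OF False le close] by metis
   thus ?thesis using s(5) by (simp add: abs_minus_commute)
  qed
 qed
 ultimately show ?thesis by blast
qed

lemma class_range_ex:
 fixes e0 x \<rho> :: real
 assumes "1 <= e0" "e0 <= x" "0 < \<rho>" "\<rho> < 1"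
 obtains i :: nat where "e0 / \<rho> ^ i <= x" "\<rho> * x < e0 / \<rho> ^ i"
proof -
 obtain k :: nat where k: "\<rho> ^ k < e0 / x" using real_arch_pow_inv[of "e0 / x" \<rho>] assms by auto
 define n where "n = (LEAST n. \<rho> ^ n * x < e0)"
 have "\<rho> ^ k * x < e0" using k assms by (simp add: field_simps)
 hence n: "\<rho> ^ n * x < e0" unfolding n_def by (rule LeastI)
 hence "n ~= 0" using assms by (auto intro!: gr0I)
 then obtain i where i: "n = Suc i" by (cases n) auto
 hence "\<not> \<rho> ^ i * x < e0" using not_less_Least[of i "%n. \<rho> ^ n * x < e0"] n_def by auto
 hence "e0 / \<rho> ^ i <= x" "\<rho> * x < e0 / \<rho> ^ i" using n i assms by (simp_all add: field_simps)
 thus thesis by (rule that)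
qed

text \<open>The times at which the two orbits are at a distance about \<open>2 ^ - j\<close> are treated together for all \<open>j\<close> in a range
 \<open>[u, u / \<rho>)\<close>: after one such time, the later ones in a window of length \<open>c * N j\<close> are rare by \<open>drift_window\<close>, since
 all distances \<open>2 ^ - j'\<close> in this range are at most \<open>2 powr (- \<rho> * j)\<close>. The condition on \<open>\<theta>\<close> says that
 the window is not longer than \<open>R\<close>, so that \<open>window_cover\<close> applies. The proportions for the ranges
 \<open>u = 1 / \<rho> ^ i\<close> form a geometric series.\<close>

theorem drift_separationI:
 assumes bs: "base_separation \<alpha> f N" and N1: "!!j. 1 <= j ==> 1 <= N j"
  and \<theta>pos: "!!R. 0 < R ==> 0 < \<theta> R"
  and \<theta>: "!!R j. 0 < R ==> 1 <= j ==> R < c * N j ==> (1/2) ^ j < \<theta> R"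
  and fin: "\<mu> M (space M) < \<infinity>"
 shows "drift_separation \<theta>"
 unfolding drift_separation_def
proof (intro allI impI)
 fix kap :: real assume kap: "0 < kap"
 obtain \<rho> p C where par: "0 < \<rho>" "\<rho> < 1" "0 < p" "0 < C"
  and sep: "\<forall>kap>0. \<exists>j0. \<exists>X\<in>sets borel. X <= {0<..<1} & leb ({0<..<1} - X) <= ennreal kap &
    (\<forall>j\<ge>j0. pair_separation \<alpha> f N \<rho> p C X j)"
  using bs unfolding base_separation_def by (elim exE conjE)
 obtain Hm where Hm: "0 < Hm" "\<mu> M {w \<in> space M. Hm <= snd w} <= ennreal (kap / 2)"
  using low_part_large[OF fin, of "kap / 2"] kap by auto
 have "0 < kap * c / (2 * Hm)" using kap Hm c_pos by simp
 from sep[rule_format, OF this] obtain j0 X where X: "X \<in> sets borel" "X <= {0<..<1}"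
  and Xm: "leb ({0<..<1} - X) <= ennreal (kap * c / (2 * Hm))"
  and cc: "\<forall>j\<ge>j0. pair_separation \<alpha> f N \<rho> p C X j"
  by (elim exE bexE conjE)
 have cross: "2 powr (- \<rho> * j) < abs (a' - a + (real l' - real l) * \<alpha> - of_int z)"
  if "j0 <= j" "a \<in> X" "a' \<in> X" "(1/2) ^ Suc j < abs (a - a')" "abs (a - a') <= (1/2) ^ j"
     "l ~= l'" "real l <= 2 * N j" "real l' <= 2 * N j" "abs (S l a - S l' a') < 2" for j a a' l l' z
  using cc[unfolded pair_separation_def, rule_format, OF that(1-5)] that(6-9) by simp
 have card: "card {l. real l <= 2 * N j & abs (S l a - S l a') < 2} <= C * j powr (- p) * N j"
  if "j0 <= j" "a \<in> X" "a' \<in> X" "(1/2) ^ Suc j < abs (a - a')" "abs (a - a') <= (1/2) ^ j" for j a a'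
  using cc[unfolded pair_separation_def, rule_format, OF that(1-5)] by simp
 define G where "G = {w \<in> space M. fst w \<in> X & snd w < Hm}"
 have G: "G \<in> sets M" unfolding G_def using X(1) by measurable
 have Gm: "\<mu> M (space M - G) <= ennreal kap"
 proof -
  define B where "B = {w \<in> space M. fst w \<in> {0<..<1} - X & snd w \<in> {0..<Hm}}"
  have B: "B \<in> sets M" unfolding B_def using X(1) by measurable
  have "\<mu> M B <= leb ({0<..<1} - X) * leb {0..<Hm} / ennreal c"
   using X(1) by (intro emeasure_strip[OF B]) (auto simp: B_def)
  also have "... <= ennreal (kap * c / (2 * Hm)) * ennreal Hm / ennreal c"
   using Hm by (intro divide_right_mono_ennreal mult_mono Xm) auto
  also have "... = ennreal (kap / 2)" using Hm kap c_pos by (simp add: ennreal_mult[symmetric] divide_ennreal)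
  finally have Bm: "\<mu> M B <= ennreal (kap / 2)" .
  have "space M - G <= B Un {w \<in> space M. Hm <= snd w}"
   using generic_self[of _ \<alpha>] by (fastforce simp: G_def B_def space_M)
  moreover have B': "{w \<in> space M. Hm <= snd w} \<in> sets M" by measurable
  ultimately have "\<mu> M (space M - G) <= \<mu> M (B Un {w \<in> space M. Hm <= snd w})"
   using B by (meson emeasure_mono sets.Un)
  also have "... <= \<mu> M B + \<mu> M {w \<in> space M. Hm <= snd w}"
   by (rule emeasure_subadditive[OF B B'])
  also have "... <= ennreal (kap / 2) + ennreal (kap / 2)"
   by (rule add_mono[OF Bm Hm(2)])
  also have "... = ennreal kap" using kap by (simp add: ennreal_plus[symmetric] del: ennreal_plus)
  finally show ?thesis .
 qed
 define x where "x = \<rho> powr p"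
 have x: "0 <= x" "x < 1" using par powr_less_mono2[of p \<rho> 1] by (auto simp: x_def)
 define K where "K = 4 * C * Hm / c"
 have K: "0 <= K" using par Hm c_pos by (simp add: K_def)
 have "(%i. K * x ^ i / (1 - x)) \<longlonglongrightarrow> K * 0 / (1 - x)"
  using x by (intro tendsto_intros LIMSEQ_power_zero) auto
 hence "eventually (%i. K * x ^ i / (1 - x) < kap) sequentially"
  using kap by (intro order_tendstoD(2)) auto
 then obtain i0 where i0: "K * x ^ i0 / (1 - x) < kap" by (auto simp: eventually_sequentially)
 obtain J0 :: nat where J0: "1 / \<rho> ^ i0 < real J0" using reals_Archimedean2 by blast
 define J where "J = max 1 (max j0 J0)"
 define eps :: real where "eps = (1/2) ^ J"
 have eps: "0 < eps" by (simp add: eps_def)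
 have main: "\<exists>Z\<in>sets borel. leb Z <= ennreal (kap * R) &
    (\<forall>t\<in>{0..R}. T t w \<in> G --> T t w' \<in> G -->
      abs (fst (T t w) - fst (T t w')) < eps --> abs (snd (T t w) - snd (T t w')) < 1 -->
      \<theta> R <= abs (fst (T t w) - fst (T t w')) --> t \<in> Z)"
  if R: "0 < R" and w: "w \<in> space M" "w' \<in> space M" for R w w'
 proof -
  define d where "d t = abs (fst (T t w) - fst (T t w'))" for t
  define A where "A = {t \<in> {0..R}. T t w \<in> G & T t w' \<in> G & d t < eps &
   abs (snd (T t w) - snd (T t w')) < 1 & \<theta> R <= d t}"
  have "\<exists>j. (1/2) ^ Suc j < d t & d t <= (1/2) ^ j" if "t \<in> A" for t
  proof -
   have "0 < d t" using \<theta>pos[OF R] that by (auto simp: A_def)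
   moreover have "eps <= 1" by (simp add: eps_def power_le_one)
   hence "d t <= 1" using that by (auto simp: A_def)
   ultimately show ?thesis using dyadic_class by blast
  qed
  then obtain cl :: "real => nat" where cl: "!!t. t \<in> A ==> (1/2) ^ Suc (cl t) < d t" "!!t. t \<in> A ==> d t <= (1/2) ^ cl t"
   by metis
  have clJ: "J <= cl t" if "t \<in> A" for t
  proof (rule ccontr)
   assume "\<not> J <= cl t"
   hence "((1/2::real)) ^ J <= (1/2) ^ Suc (cl t)" by (intro power_decreasing) auto
   thus False using cl(1)[OF that] that by (auto simp: A_def eps_def)
  qed
  define E where "E i = {t \<in> A. 1 / \<rho> ^ i <= real (cl t) & \<rho> * real (cl t) < 1 / \<rho> ^ i}" for i
  have AE: "A <= (\<Union>i\<in>{i0..}. E i)"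
  proof
   fix t assume t: "t \<in> A"
   have clt: "1 <= real (cl t)" "1 / \<rho> ^ i0 < real (cl t)" using clJ[OF t] J0 by (auto simp: J_def)
   obtain i where i: "1 / \<rho> ^ i <= real (cl t)" "\<rho> * real (cl t) < 1 / \<rho> ^ i"
    using class_range_ex[of 1 "real (cl t)" \<rho>] clt par by auto
   have "i0 <= i"
   proof (rule ccontr)
    assume "\<not> i0 <= i"
    hence "\<rho> ^ i0 <= \<rho> ^ Suc i" using par by (intro power_decreasing) auto
    hence "1 / \<rho> ^ Suc i <= 1 / \<rho> ^ i0" using par by (intro divide_left_mono) auto
    hence "1 / \<rho> ^ Suc i < real (cl t)" using clt by simp
    thus False using i(2) par by (simp add: field_simps)
   qed
   thus "t \<in> (\<Union>i\<in>{i0..}. E i)" using t i by (auto simp: E_def)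
  qed
  have "\<exists>Z\<in>sets borel. leb Z <= ennreal (K * R * x ^ i) & E i <= Z" for i
  proof -
   define \<eta> where "\<eta> = C * Hm / c * (1 / \<rho> ^ i) powr (- p)"
   have eta: "0 < \<eta>" using par Hm c_pos by (simp add: \<eta>_def)
   have "\<exists>Z\<in>sets borel. leb Z <= ennreal (4 * \<eta> * R) & E i <= Z"
   proof (rule window_cover[OF _ R eta c_pos, where W = "%t. c * N (cl t)"])
    show "E i <= {0..R}" by (auto simp: E_def A_def)
    fix t assume tE: "t \<in> E i"
    define j where "j = cl t"
    have t: "t \<in> A" "1 / \<rho> ^ i <= real j" "\<rho> * real j < 1 / \<rho> ^ i" using tE by (auto simp: E_def j_def)
    have J: "J <= j" using clJ[OF t(1)] by (simp add: j_def)
    hence j: "1 <= j" "j0 <= j" by (auto simp: J_def)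
    have dt: "\<theta> R <= d t" using t by (auto simp: A_def)
    have NR: "c * N j <= R"
     using \<theta>[OF R j(1)] dt cl(2)[OF t(1)] by (force simp: j_def)
    show "c <= c * N (cl t) & c * N (cl t) <= R" using NR N1[OF j(1)] c_pos by (simp add: j_def)
    have t0: "0 <= t" using t by (auto simp: A_def)
    obtain a v where av: "T t w = (a, v)" by fastforce
    obtain a' v' where av': "T t w' = (a', v')" by fastforce
    have sp: "(a, v) \<in> space M" "(a', v') \<in> space M"
     using flow_space[OF w(1) t0] flow_space[OF w(2) t0] by (simp_all add: av av')
    have aX: "a \<in> X" "a' \<in> X" and vv: "abs (v - v') < 1" using t(1) by (auto simp: A_def G_def av av')
    have aa: "(1/2) ^ Suc j < abs (a - a')" "abs (a - a') <= (1/2) ^ j"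
     using cl[OF t(1)] by (simp_all add: d_def av av' j_def)
    have "\<exists>Z\<in>sets borel. leb Z <= ennreal (C * j powr (- p) * N j * Hm) &
     (\<forall>s\<in>{0..c * N j}. snd (T s (a, v)) < Hm --> abs (snd (T s (a, v)) - snd (T s (a', v'))) < 1 -->
       abs (v - v') < 1 --> abs (fst (T s (a, v)) - fst (T s (a', v'))) <= 2 powr (- \<rho> * j) --> s \<in> Z)"
     using cross[OF j(2) aX aa] card[OF j(2) aX aa]
     by (intro drift_window[OF sp N1[OF j(1)] j(1)] Hm(1)) auto
    then obtain Z where Z: "Z \<in> sets borel" "leb Z <= ennreal (C * j powr (- p) * N j * Hm)"
     and Zs: "!!s. s \<in> {0..c * N j} ==> snd (T s (a, v)) < Hm ==> abs (snd (T s (a, v)) - snd (T s (a', v'))) < 1 ==>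
       abs (v - v') < 1 ==> abs (fst (T s (a, v)) - fst (T s (a', v'))) <= 2 powr (- \<rho> * j) ==> s \<in> Z"
     by blast
    show "\<exists>Z\<in>sets borel. leb Z <= ennreal (\<eta> * (c * N (cl t))) & E i Int {t..t + c * N (cl t)} <= Z"
    proof (intro bexI[of _ "(%s. t + s) ` Z"] conjI)
     show "(%s. t + s) ` Z \<in> sets borel" by (rule emeasure_translate[OF Z(1)])
     have "leb ((%s. t + s) ` Z) <= ennreal (C * j powr (- p) * N j * Hm)"
      using Z(2) by (simp add: emeasure_translate[OF Z(1)])
     also have "... <= ennreal (\<eta> * (c * N (cl t)))"
     proof (rule ennreal_leI)
      have "j powr (- p) <= (1 / \<rho> ^ i) powr (- p)"
       using t(2) par by (intro powr_mono2') auto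
      hence "C * j powr (- p) * N j * Hm <= C * (1 / \<rho> ^ i) powr (- p) * N j * Hm"
       using par Hm N1[OF j(1)] by (intro mult_right_mono mult_left_mono) auto
      thus "C * j powr (- p) * N j * Hm <= \<eta> * (c * N (cl t))"
       using c_pos by (simp add: \<eta>_def j_def field_simps)
     qed
     finally show "leb ((%s. t + s) ` Z) <= ennreal (\<eta> * (c * N (cl t)))" .
     show "E i Int {t..t + c * N (cl t)} <= (%s. t + s) ` Z"
     proof
      fix r assume r: "r \<in> E i Int {t..t + c * N (cl t)}"
      hence rA: "r \<in> A" "1 / \<rho> ^ i <= real (cl r)" by (auto simp: E_def)
      have rt: "0 <= r - t" using r by simp
      have Tr: "T r w = T (r - t) (a, v)" "T r w' = T (r - t) (a', v')"
       using flow_add[OF w(1) rt t0] flow_add[OF w(2) rt t0] by (simp_all add: av av')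
      have "d r <= 2 powr (- \<rho> * j)"
      proof -
       have "\<rho> * real j <= real (cl r)" using t(3) rA(2) by simp
       hence "2 powr (- real (cl r)) <= 2 powr (- \<rho> * real j)" by (intro powr_mono) auto
       moreover have "(1/2::real) ^ cl r = 2 powr (- real (cl r))"
        by (simp add: powr_minus powr_realpow power_one_over inverse_eq_divide)
       ultimately show ?thesis using cl(2)[OF rA(1)] by (metis order_trans)
      qed
      hence "r - t \<in> Z"
       using rA(1) r vv by (intro Zs) (auto simp: A_def G_def d_def Tr j_def)
      thus "r \<in> (%s. t + s) ` Z" by (intro image_eqI[of _ _ "r - t"]) auto
     qed
    qed
   qed
   moreover have "4 * \<eta> * R = K * R * x ^ i"
   proof -
    have "(1 / \<rho> ^ i) powr (- p) = x ^ i"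
    proof -
     have "1 / \<rho> ^ i = \<rho> powr (- real i)" using par by (simp add: powr_minus powr_realpow inverse_eq_divide)
     hence "(1 / \<rho> ^ i) powr (- p) = \<rho> powr (p * real i)" by (simp add: powr_powr mult.commute)
     also have "... = x ^ i" unfolding x_def powr_powr[symmetric] using par by (intro powr_realpow) auto
     finally show ?thesis .
    qed
    thus ?thesis by (simp add: \<eta>_def K_def)
   qed
   ultimately show ?thesis by simp
  qed
  then obtain Z where Z: "!!i. Z i \<in> sets borel" "!!i. leb (Z i) <= ennreal (K * R * x ^ i)" "!!i. E i <= Z i"
   by metis
  show ?thesis
  proof (intro bexI[of _ "\<Union>i\<in>{i0..}. Z i"] conjI ballI impI)
   have "leb (\<Union>i\<in>{i0..}. Z i) <= ennreal (K * R * x ^ i0 / (1 - x))"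
    using Z K R x by (intro emeasure_UN_geometric) auto
   also have "... <= ennreal (kap * R)"
   proof (rule ennreal_leI)
    have "K * x ^ i0 / (1 - x) * R <= kap * R" using i0 R by (intro mult_right_mono) auto
    thus "K * R * x ^ i0 / (1 - x) <= kap * R" by (simp add: mult_ac)
   qed
   finally show "leb (\<Union>i\<in>{i0..}. Z i) <= ennreal (kap * R)" .
   show "(\<Union>i\<in>{i0..}. Z i) \<in> sets borel" using Z by (intro sets.countable_UN') auto
   fix t assume "t \<in> {0..R}" "T t w \<in> G" "T t w' \<in> G" "abs (fst (T t w) - fst (T t w')) < eps"
    "abs (snd (T t w) - snd (T t w')) < 1" "\<theta> R <= abs (fst (T t w) - fst (T t w'))"
   hence "t \<in> A" by (simp add: A_def d_def)
   thus "t \<in> (\<Union>i\<in>{i0..}. Z i)" using AE Z(3) by blast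
  qed
 qed
 show "\<exists>G\<in>sets M. \<exists>Hm>0. \<exists>eps>0.
   \<mu> M (space M - G) <= ennreal kap & (\<forall>w\<in>G. snd w < Hm) &
   (\<forall>R>0. \<forall>w\<in>space M. \<forall>w'\<in>space M. \<exists>Z\<in>sets borel. leb Z <= ennreal (kap * R) &
    (\<forall>t\<in>{0..R}. T t w \<in> G --> T t w' \<in> G -->
      abs (fst (T t w) - fst (T t w')) < eps --> abs (snd (T t w) - snd (T t w')) < 1 -->
      \<theta> R <= abs (fst (T t w) - fst (T t w')) --> t \<in> Z))"
  using G Hm(1) eps Gm main by (intro bexI[of _ G] exI[of _ Hm] exI[of _ eps] conjI) (auto simp: G_def)
qed

end

section \<open>Towers\<close>

lemma cocycle_eq_0D:
 assumes S: "bij_betw S (space Y) (space Y)" and \<phi>: "!!y. y \<in> space Y ==> 0 < \<phi> y" and y: "y \<in> space Y"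
  and N: "cocycle Y S \<phi> N y = 0"
 shows "N = 0"
proof (rule ccontr)
 assume "N ~= 0"
 have it: "int_iterate Y S k y \<in> space Y" for k
 proof -
  have "(S ^^ k) y \<in> space Y" "(inv_into (space Y) S ^^ k) y \<in> space Y" for k
   using y S bij_betw_inv_into[OF S] by (induction k) (auto simp: bij_betw_def)
  thus ?thesis by (simp add: int_iterate_def)
 qed
 have "0 < (\<Sum>i<nat N. \<phi> (int_iterate Y S (int i) y))" if "0 < N"
  using that by (intro sum_pos \<phi> it) (auto simp: lessThan_empty_iff)
 moreover have "0 < (\<Sum>i=1..nat (- N). \<phi> (int_iterate Y S (- int i) y))" if "N < 0"
  using that by (intro sum_pos \<phi> it) (auto simp: lessThan_empty_iff)
 ultimately show False using N \<open>N \<noteq> 0\<close> by (cases "0 < N") (auto simp: cocycle_def)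
qed

lemma tower_level_eq:
 assumes "bij_betw S (space Y) (space Y)" "!!y. y \<in> space Y ==> 0 < \<phi> y" "B <= space Y" "!!y. y \<in> B ==> s < \<phi> y" "0 <= s"
 shows "tower_level Y S \<phi> B s = B \<times> {s}"
proof -
 have "special_flow Y S \<phi> s (y, 0) = (y, s)" if "y \<in> B" for y
  using special_flow_in_fibre[of S Y \<phi> y 0 s] assms that by auto
 thus ?thesis unfolding tower_level_def by force
qed

lemma level_measure_fibre:
 assumes S: "bij_betw S (space Y) (space Y)" and \<phi>: "!!y. y \<in> space Y ==> 0 < \<phi> y" and B: "B <= space Y" "!!y. y \<in> B ==> s < \<phi> y" "0 <= s"
 shows "level_measure Y S \<phi> s (B \<times> {s} Int E) = measure Y {y \<in> B. (y, s) \<in> E}"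
proof -
 have "{y \<in> space Y. special_flow Y S \<phi> s (y, 0) \<in> B \<times> {s} Int E} = {y \<in> B. (y, s) \<in> E}"
 proof (intro equalityI subsetI)
  fix y assume y: "y \<in> {y \<in> space Y. special_flow Y S \<phi> s (y, 0) \<in> B \<times> {s} Int E}"
  obtain N where N: "special_flow Y S \<phi> s (y, 0) = (int_iterate Y S N y, s - cocycle Y S \<phi> N y)"
   by (simp add: special_flow_def Let_def)
  hence "cocycle Y S \<phi> N y = 0" using y by auto
  hence "N = 0" using cocycle_eq_0D[of S Y \<phi> y N] S \<phi> y by auto
  thus "y \<in> {y \<in> B. (y, s) \<in> E}" using y N by (simp add: int_iterate_def cocycle_def)
 next
  fix y assume "y \<in> {y \<in> B. (y, s) \<in> E}"
  thus "y \<in> {y \<in> space Y. special_flow Y S \<phi> s (y, 0) \<in> B \<times> {s} Int E}"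
   using special_flow_in_fibre[of S Y \<phi> y 0 s] S \<phi> B by auto
 qed
 thus ?thesis by (simp add: level_measure_def)
qed

lemma AE_lborel_ex_in_interval:
 assumes "AE x in lborel. Q x" "a < (b::real)"
 obtains x where "a < x" "x < b" "Q x"
proof -
 obtain E where E: "{x \<in> space lborel. \<not> Q x} <= E" "leb E = 0" "E \<in> sets lborel"
  using assms(1) by (rule AE_E)
 have "\<not> {a<..<b} <= E"
 proof
  assume "{a<..<b} <= E"
  hence "leb {a<..<b} <= leb E" using E by (intro emeasure_mono) auto
  thus False using E assms(2) by simp
 qed
 then obtain x where x: "a < x" "x < b" "x \<notin> E" unfolding subset_iff greaterThanLessThan_iff by blast
 hence "Q x" using E(1) by auto
 thus thesis using that x by blast
qed

text \<open>Fubini's theorem, used to replace statements for almost every point of the flow space by statements for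
 almost every point of one horizontal section.\<close>

lemma AE_generic_height:
 fixes V :: "'a \<times> real => real => bool"
 assumes Y: "sigma_finite_measure Y" and V: "!!r. AE z in cyl Y. V z r" and ab: "a < b"
  and meas: "{x \<in> space ((cyl lborel) \<Otimes>\<^sub>M Y). \<not> V (snd x, fst (fst x)) (snd (fst x))} \<in> sets ((cyl lborel) \<Otimes>\<^sub>M Y)" (is "?E \<in> _")
 obtains s where "a < s" "s < b" "AE r in lborel. AE y in Y. V (y, s) r"
proof -
 interpret Y: sigma_finite_measure Y by (rule Y)
 interpret YL: pair_sigma_finite Y "lborel :: real measure" ..
 have V2: "AE s in lborel. AE y in Y. V (y, s) r" for r
 proof -
  have "AE y in Y. AE s in lborel. V (y, s) r" using YL.AE_pair[OF V] .
  moreover have "{x \<in> space (cyl Y). V (fst x, snd x) r} \<in> sets (cyl Y)"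
  proof -
   have "(%x. ((snd x, r), fst x)) \<in> cyl Y \<rightarrow>\<^sub>M (cyl lborel) \<Otimes>\<^sub>M Y" by measurable
   from sets.compl_sets[OF measurable_sets[OF this meas]]
   have "space (cyl Y) - ((%x. ((snd x, r), fst x)) -` ?E Int space (cyl Y)) \<in> sets (cyl Y)" .
   also have "space (cyl Y) - ((%x. ((snd x, r), fst x)) -` ?E Int space (cyl Y))
     = {x \<in> space (cyl Y). V (fst x, snd x) r}" by (auto simp: space_pair_measure)
   finally show ?thesis .
  qed
  ultimately show ?thesis using YL.AE_commute[of "%y s. V (y, s) r"] by simp
 qed
 define h where "h x = \<mu> Y (Pair x -` ?E)" for x
 have h [measurable]: "h \<in> borel_measurable (cyl lborel)"
  unfolding h_def by (rule Y.measurable_emeasure_Pair[OF meas])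
 have h0: "h (s, r) = 0 \<longleftrightarrow> (AE y in Y. V (y, s) r)" for s r
 proof -
  have "Pair (s, r) -` ?E = {y \<in> space Y. \<not> V (y, s) r}" by (auto simp: space_pair_measure)
  moreover have "Pair (s, r) -` ?E \<in> sets Y" by (rule sets_Pair1[OF meas])
  ultimately show ?thesis unfolding h_def by (subst AE_iff_measurable) auto
 qed
 have AEsr: "AE s in lborel. AE r in lborel. h (s, r) = 0"
 proof -
  have "AE r in lborel. AE s in lborel. h (s, r) = 0" using V2 by (simp add: h0)
  moreover have "{x \<in> space (cyl lborel). h (fst x, snd x) = 0} \<in> sets (cyl lborel)" by measurable
  ultimately show ?thesis using lborel_pair.AE_commute[of "%s r. h (s, r) = 0"] by simp
 qed
 obtain s where "a < s" "s < b" "AE r in lborel. h (s, r) = 0"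
  by (rule AE_lborel_ex_in_interval[OF AEsr ab])
 thus thesis using that by (simp add: h0)
qed

lemma majority_times_measurable:
 fixes N :: "'n measure"
 assumes N: "sigma_finite_measure N" and w: "w \<in> N \<rightarrow>\<^sub>M M" and U: "(%z. U (fst z) (snd z)) \<in> borel \<Otimes>\<^sub>M M \<rightarrow>\<^sub>M M'"
 shows "A \<in> sets M' ==> (%r. \<mu> N (hits N U w r A)) \<in> borel_measurable borel"
  and "finite P ==> P <= sets M' ==> {r \<in> {0..<R::real}. \<exists>A\<in>P. t <= measure N (hits N U w r A)} \<in> sets borel"
proof -
 interpret N: sigma_finite_measure N by (rule N)
 have m: "(%r. \<mu> N (hits N U w r A)) \<in> borel_measurable borel" if A: "A \<in> sets M'" for A
 proof -
  have "(%z. (fst z, w (snd z))) \<in> borel \<Otimes>\<^sub>M N \<rightarrow>\<^sub>M borel \<Otimes>\<^sub>M M" using w by simp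
  from measurable_sets[OF measurable_compose[OF this U] A]
  have "(%r. \<mu> N (Pair r -` ((%z. U (fst z) (w (snd z))) -` A Int space (borel \<Otimes>\<^sub>M N)))) \<in> borel_measurable borel"
   by (intro N.measurable_emeasure_Pair) simp
  moreover have "Pair r -` ((%z. U (fst z) (w (snd z))) -` A Int space (borel \<Otimes>\<^sub>M N)) = (hits N U w r A)" for r
   by (auto simp: space_pair_measure)
  ultimately show ?thesis by simp
 qed
 show "A \<in> sets M' ==> (%r. \<mu> N (hits N U w r A)) \<in> borel_measurable borel" by (rule m)
 assume P: "finite P" "P <= sets M'"
 have "(\<Union>A\<in>P. {r \<in> space borel. t <= measure N (hits N U w r A)}) \<in> sets borel"
 proof (intro sets.finite_UN P)
  fix A assume "A \<in> P"
  hence "A \<in> sets M'" using P by auto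
  note [measurable] = m[OF this]
  show "{r \<in> space borel. t <= measure N (hits N U w r A)} \<in> sets borel"
   unfolding measure_def by measurable
 qed
 moreover have "{r \<in> {0..<R}. \<exists>A\<in>P. t <= measure N (hits N U w r A)}
   = {0..<R} Int (\<Union>A\<in>P. {r \<in> space borel. t <= measure N (hits N U w r A)})" by auto
 ultimately show "{r \<in> {0..<R}. \<exists>A\<in>P. t <= measure N (hits N U w r A)} \<in> sets borel" by simp
qed

text \<open>The family consists of the points at a low height \<open>s1\<close> of the tower, distributed according to the measure of
 its base; it climbs the tower until \<open>R = H - s1\<close>. The time it spends in a set is the measure of a part of the
 tower, and the tower fills at least \<open>\<beta> - eps\<close> of the space. The statement mentions the flow only, no longer its
 representation.\<close>

theorem rank_one_orbits:
 fixes M :: "(real \<times> real) measure"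
 assumes rank: "beta_rank_one \<beta> M T" and eps: "0 < eps" "eps < 1/2" "2 * eps < \<beta>"
  and P: "finite P" "P <= sets M" "partition_on (space M) P"
  and coord [measurable]: "fst \<in> borel_measurable M" "snd \<in> borel_measurable M"
 obtains N :: "(real \<times> real) measure" and w R where
  "prob_space N" "w \<in> N \<rightarrow>\<^sub>M M" "0 < R"
  "!!A. A \<in> sets M ==> (\<integral>\<^sup>+ r\<in>{0..<R}. \<mu> N (hits N T w r A) \<partial>lborel) <= ennreal (4 * R / \<beta>) * \<mu> M A"
  "(1 - 4 * eps) * R <= measure lborel {r \<in> {0..<R}. \<exists>A\<in>P. 1 - eps <= measure N (hits N T w r A)}"
proof -
 have flow: "measure_preserving_flow M T" and mono: "\<exists>\<eta>\<in>{0<..<1}. \<exists>H>0. \<exists>Y S \<phi> B \<Theta>.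
      tower_representation M T \<eta> H Y S \<phi> B \<Theta> &
      measure (special_measure Y \<phi>) (tower Y S \<phi> B H) > \<beta> - eps &
      monochromatic_tower Y S \<phi> B \<Theta> H eps P"
  using rank P eps unfolding beta_rank_one_def ergodic_flow_def by blast+
 interpret prob_space M using flow by (simp add: measure_preserving_flow_def)
 have Tm [measurable]: "(%z. T (fst z) (snd z)) \<in> borel \<Otimes>\<^sub>M M \<rightarrow>\<^sub>M M"
  using flow by (simp add: measure_preserving_flow_def case_prod_unfold)
 from mono obtain \<eta> H Y S \<phi> B \<Theta> where \<eta>: "0 < \<eta>" "\<eta> < 1" and H: "0 < H"
  and rep: "tower_representation M T \<eta> H Y S \<phi> B \<Theta>"
  and tow: "measure (special_measure Y \<phi>) (tower Y S \<phi> B H) > \<beta> - eps"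
  and mon: "monochromatic_tower Y S \<phi> B \<Theta> H eps P"
  by (auto simp del: split_paired_Ex)
 interpret Y: prob_space Y using rep by (simp add: tower_representation_def ergodic_automorphism_def)
 have S: "bij_betw S (space Y) (space Y)" using rep by (simp add: tower_representation_def ergodic_automorphism_def)
 have \<phi> [measurable]: "\<phi> \<in> borel_measurable Y" and \<phi>pos: "!!y. y \<in> space Y ==> 0 < \<phi> y"
  and \<phi>H: "!!y. y \<in> space Y ==> \<phi> y <= H" and B [measurable]: "B \<in> sets Y"
  and Bpos: "0 < measure Y B" and BH: "!!y. y \<in> B ==> \<phi> y = H"
  and iso: "flow_isomorphism (special_measure Y \<phi>) (special_flow Y S \<phi>) M T \<Theta>"
  using rep \<eta> by (auto simp: tower_representation_def)
 have Bsub: "B <= space Y" using sets.sets_into_space[OF B] .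
 define Q where "Q = Y \<Otimes>\<^sub>M (lborel :: real measure)"
 define X where "X = special_space Y \<phi>"
 have X [measurable]: "X \<in> sets Q" unfolding X_def Q_def by (rule special_space_measurable[OF \<phi>])
 have sX: "space (special_measure Y \<phi>) = X" unfolding X_def by (rule space_special)
 have inX: "(y, s) \<in> X \<longleftrightarrow> y \<in> space Y & 0 <= s & s < \<phi> y" for y s by (simp add: X_def special_space_def)
 \<comment> \<open>The area \<open>\<Phi>\<close> under the roof.\<close>
 define \<Phi> where "\<Phi> = measure Q X"
 have tower: "tower Y S \<phi> B H = B \<times> {0..<H}"
 proof -
  have "tower_level Y S \<phi> B s = B \<times> {s}" if "s \<in> {0..<H}" for s
   using that BH Bsub by (intro tower_level_eq[OF S \<phi>pos]) auto
  thus ?thesis unfolding tower_def by auto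
 qed
 have BX: "B \<times> {0..<H} <= X" using Bsub BH by (auto simp: inX)
 have emB: "\<mu> Q (B \<times> {0..<H}) = ennreal (measure Y B * H)"
  unfolding Q_def using H by (subst lborel.emeasure_pair_measure_Times) (auto simp: Y.emeasure_eq_measure ennreal_mult)
 have "X <= space Y \<times> {0..<H}"
 proof
  fix z assume z: "z \<in> X"
  obtain y s where "z = (y, s)" by (cases z)
  thus "z \<in> space Y \<times> {0..<H}" using z \<phi>H[of y] by (simp add: inX)
 qed
 hence "\<mu> Q X <= \<mu> Q (space Y \<times> {0..<H})"
  unfolding Q_def by (intro emeasure_mono) auto
 also have "... = ennreal H" unfolding Q_def using H
  by (subst lborel.emeasure_pair_measure_Times) (auto simp: Y.emeasure_space_1)
 finally have "\<mu> Q X < \<infinity>" by (rule order.strict_trans1) simp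
 hence \<Phi>: "\<mu> Q X = ennreal \<Phi>" unfolding \<Phi>_def by (simp add: emeasure_eq_ennreal_measure less_top)
 have "ennreal (measure Y B * H) <= ennreal \<Phi>" unfolding emB[symmetric] \<Phi>[symmetric] using BX by (intro emeasure_mono) auto
 hence \<Phi>ge: "measure Y B * H <= \<Phi>" using Bpos H by (subst (asm) ennreal_le_iff) (auto simp: \<Phi>_def)
 moreover have "0 < measure Y B * H" using Bpos H by simp
 ultimately have \<Phi>pos: "0 < \<Phi>" by linarith
 have em: "\<mu> (special_measure Y \<phi>) A = \<mu> Q A / ennreal \<Phi>" if "A \<in> sets (special_measure Y \<phi>)" for A
  using emeasure_special[OF \<phi> that] \<Phi> by (simp add: Q_def X_def)
 have sets: "A \<in> sets (special_measure Y \<phi>) \<longleftrightarrow> A \<in> sets Q & A <= X" for A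
  unfolding Q_def X_def by (rule sets_special[OF \<phi>])
 have tB: "B \<times> {0..<H} \<in> sets (special_measure Y \<phi>)" unfolding sets using BX by (simp add: Q_def)
 have "measure (special_measure Y \<phi>) (B \<times> {0..<H}) = measure Y B * H / \<Phi>"
  using em[OF tB] emB \<Phi>pos Bpos H by (simp add: measure_def divide_ennreal)
 hence "\<beta> - eps < measure Y B * H / \<Phi>" using tow by (simp add: tower)
 hence \<beta>\<Phi>: "(\<beta> - eps) * \<Phi> <= measure Y B * H" using \<Phi>pos by (simp add: pos_less_divide_eq)
 have \<Theta> [measurable]: "\<Theta> \<in> special_measure Y \<phi> \<rightarrow>\<^sub>M M" and \<Theta>d: "distr (special_measure Y \<phi>) M \<Theta> = M"
  using iso by (auto simp: flow_isomorphism_def)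
 obtain x0 where x0: "x0 \<in> space M" using not_empty by auto
 define g where "g x = (if x \<in> X then \<Theta> x else x0)" for x
 have g [measurable]: "g \<in> Q \<rightarrow>\<^sub>M M"
 proof -
  have eq: "sets (special_measure Y \<phi>) = sets (restrict_space Q X)"
   unfolding special_measure_def Q_def[symmetric] X_def[symmetric] by (intro sets_restrict_space_cong) simp
  have "\<Theta> \<in> restrict_space Q X \<rightarrow>\<^sub>M M" using \<Theta> unfolding measurable_cong_sets[OF eq refl] .
  thus ?thesis unfolding g_def using x0 by (subst (asm) measurable_restrict_space_iff) auto
 qed
 have gA: "\<mu> Q {z \<in> X. g z \<in> A} = ennreal \<Phi> * \<mu> M A" if A [measurable]: "A \<in> sets M" for A
 proof -
  have e: "{z \<in> X. g z \<in> A} = \<Theta> -` A Int space (special_measure Y \<phi>)" by (auto simp: sX g_def)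
  have "\<mu> M A = \<mu> (distr (special_measure Y \<phi>) M \<Theta>) A" by (simp add: \<Theta>d)
  also have "... = \<mu> (special_measure Y \<phi>) (\<Theta> -` A Int space (special_measure Y \<phi>))" by (rule emeasure_distr[OF \<Theta> A])
  also have "... = \<mu> Q {z \<in> X. g z \<in> A} / ennreal \<Phi>"
   unfolding e using measurable_sets[OF \<Theta> A] by (rule em)
  finally have "\<mu> M A * ennreal \<Phi> = \<mu> Q {z \<in> X. g z \<in> A}"
   using \<Phi>pos by (simp add: ennreal_divide_times)
  thus ?thesis by (simp add: mult.commute)
 qed
 have g' [measurable]: "g \<in> Y \<Otimes>\<^sub>M borel \<rightarrow>\<^sub>M M"
  using g unfolding Q_def by (subst (asm) measurable_cong_sets[OF sets_pair_measure_cong[OF refl sets_lborel] refl])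
 have T' [measurable (raw)]: "(%x. T (r x) (u x)) \<in> L \<rightarrow>\<^sub>M M" if "r \<in> borel_measurable L" "u \<in> L \<rightarrow>\<^sub>M M" for L and r :: "'l => real" and u
  using measurable_compose[OF measurable_Pair[OF that] Tm] by simp
 \<comment> \<open>Along the tower the isomorphism carries vertical motion to the flow, up to null sets.\<close>
 define V where "V z r \<longleftrightarrow> (fst z \<in> B & 0 <= snd z & 0 <= r & snd z + r < H -->
   fst (g (fst z, snd z + r)) = fst (T r (g z)) & snd (g (fst z, snd z + r)) = snd (T r (g z)))" for z r
 have V1: "AE z in Q. V z r" for r
 proof (cases "0 <= r")
  case True
  have "AE z in special_measure Y \<phi>. \<Theta> (special_flow Y S \<phi> r z) = T r (\<Theta> z)"
   using iso by (simp add: flow_isomorphism_def)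
  hence "AE z in uniform_measure Q X. z \<in> X --> \<Theta> (special_flow Y S \<phi> r z) = T r (\<Theta> z)"
   unfolding special_measure_def Q_def[symmetric] X_def[symmetric] by (subst (asm) AE_restrict_space_iff) auto
  hence "AE z in Q. z \<in> X --> z \<in> X --> \<Theta> (special_flow Y S \<phi> r z) = T r (\<Theta> z)"
   using \<Phi> \<Phi>pos by (subst (asm) AE_uniform_measure) auto
  thus ?thesis
  proof eventually_elim
   case (elim z)
   obtain y s where z: "z = (y, s)" by (cases z)
   have "fst (g (y, s + r)) = fst (T r (g (y, s))) & snd (g (y, s + r)) = snd (T r (g (y, s)))"
    if h: "y \<in> B" "0 <= s" "s + r < H"
   proof -
    have y: "y \<in> space Y" using h Bsub by auto
    have "special_flow Y S \<phi> r (y, s) = (y, s + r)"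
     using special_flow_in_fibre[of S Y \<phi> y s r] S \<phi>pos y h BH True by auto
    moreover have "(y, s) \<in> X" "(y, s + r) \<in> X" using h y BH True by (auto simp: inX)
    ultimately show ?thesis using elim by (simp add: z g_def)
   qed
   thus ?case by (simp add: V_def z)
  qed
 qed (simp add: V_def)
 interpret YL: pair_sigma_finite Y "lborel :: real measure" ..
 have meas: "{x \<in> space ((cyl lborel) \<Otimes>\<^sub>M Y). \<not> V (snd x, fst (fst x)) (snd (fst x))} \<in> sets ((cyl lborel) \<Otimes>\<^sub>M Y)"
  unfolding V_def by measurable
 have sY: "sigma_finite_measure Y" ..
 have "0 < eps * H" using eps H by simp
 then obtain s1 where s1: "0 < s1" "s1 < eps * H" and V3: "AE r in lborel. AE y in Y. V (y, s1) r"
  by (rule AE_generic_height[OF sY V1[unfolded Q_def] _ meas])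
 define R where "R = H - s1"
 define N where "N = uniform_measure Y B"
 define w where "w y = g (y, s1)" for y
 have N: "prob_space N" unfolding N_def using Bpos by (intro prob_space_uniform_measure) (auto simp: Y.emeasure_eq_measure)
 interpret N: prob_space N by (rule N)
 have spN [simp]: "space N = space Y" and seN: "sets N = sets Y" by (simp_all add: N_def)
 have w: "w \<in> N \<rightarrow>\<^sub>M M" unfolding w_def N_def by simp
 have eN: "\<mu> N E = \<mu> Y (B Int E) / ennreal (measure Y B)" if "E \<in> sets Y" for E
  unfolding N_def using that by (subst emeasure_uniform_measure) (auto simp: Y.emeasure_eq_measure)
 have mN: "measure N E = measure Y (B Int E) / measure Y B" if "E \<in> sets Y" for E
  unfolding measure_def[of N] eN[OF that] using Bpos by (simp add: Y.emeasure_eq_measure divide_ennreal)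
 have AEN: "AE r in lborel. r \<in> {0..<R} --> (\<forall>A\<in>sets M. \<mu> N (hits N T w r A) = \<mu> N {y \<in> space N. g (y, s1 + r) \<in> A})"
  using V3
 proof eventually_elim
  case (elim r)
  show ?case
  proof (intro impI ballI)
   fix A assume r: "r \<in> {0..<R}" and A [measurable]: "A \<in> sets M"
   have "AE y in N. T r (w y) \<in> A \<longleftrightarrow> g (y, s1 + r) \<in> A"
    unfolding N_def
   proof (rule AE_uniform_measureI[OF B])
    show "AE y in Y. y \<in> B --> (T r (w y) \<in> A \<longleftrightarrow> g (y, s1 + r) \<in> A)"
     using elim
    proof eventually_elim
     case (elim y)
     have "g (y, s1 + r) = T r (g (y, s1))" if "y \<in> B"
      using elim that r s1 by (intro prod_eqI) (auto simp: V_def R_def)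
     thus ?case by (simp add: w_def)
    qed
   qed
   moreover have "(hits Y T w r A) \<in> sets Y" "{y \<in> space Y. g (y, s1 + r) \<in> A} \<in> sets Y"
    unfolding w_def by measurable
   ultimately show "\<mu> N (hits N T w r A) = \<mu> N {y \<in> space N. g (y, s1 + r) \<in> A}"
    by (intro emeasure_eq_AE) (auto simp: seN)
  qed
 qed
 have Hb: "eps * H <= H / 2" using mult_right_mono[of eps "1/2" H] eps H by simp
 have "s1 < H / 2" using s1(2) Hb by (rule order.strict_trans2)
 hence R: "0 < R" and HR: "H <= 2 * R" using H by (simp_all add: R_def)
 show thesis
 proof (rule that[OF N w R])
  fix A assume A [measurable]: "A \<in> sets M"
  define k where "k s = \<mu> N {y \<in> space N. g (y, s) \<in> A}" for s
  define W where "W = {z \<in> space (cyl Y). fst z \<in> B & snd z \<in> {0..<H} & g z \<in> A}"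
  have W [measurable]: "W \<in> sets (cyl Y)" unfolding W_def by measurable
  have kW: "indicator {0..<H} s * k s = \<mu> Y ((%y. (y, s)) -` W) / ennreal (measure Y B)" for s
  proof (cases "s \<in> {0..<H}")
   case True
   have "(%y. (y, s)) -` W = B Int {y \<in> space N. g (y, s) \<in> A}" using True Bsub by (auto simp: W_def space_pair_measure)
   thus ?thesis using True by (simp add: k_def eN)
  next
   case False
   hence "(%y. (y, s)) -` W = {}" by (auto simp: W_def)
   thus ?thesis using False by simp
  qed
  have [measurable]: "(%s. \<mu> Y ((%y. (y, s)) -` W)) \<in> borel_measurable lborel"
   by (rule YL.measurable_emeasure_Pair2[OF W])
  have km [measurable]: "(%s. indicator {0..<H} s * k s) \<in> borel_measurable lborel"
   unfolding kW by measurable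
  have "(\<integral>\<^sup>+ r\<in>{0..<R}. \<mu> N (hits N T w r A) \<partial>lborel) = (\<integral>\<^sup>+ r\<in>{0..<R}. k (s1 + r) \<partial>lborel)"
  proof (rule nn_integral_cong_AE)
   show "AE r in lborel. \<mu> N (hits N T w r A) * indicator {0..<R} r = k (s1 + r) * indicator {0..<R} r"
    using AEN
   proof eventually_elim
    case (elim r)
    thus ?case using A by (cases "r \<in> {0..<R}") (simp_all add: k_def)
   qed
  qed
  also have "... <= (\<integral>\<^sup>+ r. indicator {0..<H} (s1 + 1 * r) * k (s1 + 1 * r) \<partial>lborel)"
   using s1 by (intro nn_integral_mono) (auto simp: R_def indicator_def)
  also have "... = (\<integral>\<^sup>+ s. indicator {0..<H} s * k s \<partial>lborel)"
   using km by (subst nn_integral_real_affine[of "%s. indicator {0..<H} s * k s" 1 s1]) auto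
  also have "... = (\<integral>\<^sup>+ s. \<mu> Y ((%y. (y, s)) -` W) \<partial>lborel) / ennreal (measure Y B)"
   unfolding kW by (rule nn_integral_divide) measurable
  also have "... = \<mu> Q W / ennreal (measure Y B)"
   unfolding Q_def by (simp only: YL.emeasure_pair_measure_alt2[OF W])
  also have "... <= (ennreal \<Phi> * \<mu> M A) / ennreal (measure Y B)"
  proof (rule divide_right_mono_ennreal)
   have "{z \<in> X. g z \<in> A} = X Int (g -` A Int space Q)" using sets.sets_into_space[OF X] by auto
   hence "{z \<in> X. g z \<in> A} \<in> sets Q" using measurable_sets[OF g A] X by simp
   moreover have "W <= {z \<in> X. g z \<in> A}" using BX by (auto simp: W_def)
   ultimately have "\<mu> Q W <= \<mu> Q {z \<in> X. g z \<in> A}" by (intro emeasure_mono)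
   thus "\<mu> Q W <= ennreal \<Phi> * \<mu> M A" by (simp add: gA A)
  qed
  also have "... = ennreal (\<Phi> / measure Y B) * \<mu> M A"
   using Bpos \<Phi>pos by (simp add: divide_ennreal[symmetric] ennreal_times_divide mult.commute)
  also have "... <= ennreal (4 * R / \<beta>) * \<mu> M A"
  proof (intro mult_right_mono ennreal_leI)
   have "\<beta> * \<Phi> / 2 <= (\<beta> - eps) * \<Phi>" using \<Phi>pos eps by (simp add: mult_right_mono field_simps)
   hence "\<beta> * \<Phi> / 2 <= measure Y B * H" using \<beta>\<Phi> by linarith
   also have "... <= measure Y B * (2 * R)" using HR Bpos by (intro mult_left_mono) auto
   finally show "\<Phi> / measure Y B <= 4 * R / \<beta>" using Bpos eps by (simp add: field_simps)
  qed simp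
  finally show "(\<integral>\<^sup>+ r\<in>{0..<R}. \<mu> N (hits N T w r A) \<partial>lborel) <= ennreal (4 * R / \<beta>) * \<mu> M A" .
 next
  define D0 where "D0 = {s \<in> {0..<H}. monochromatic_level Y S \<phi> B \<Theta> eps P s}"
  have D0ge: "(1 - eps) * H <= measure lborel D0" using mon by (simp add: monochromatic_tower_def D0_def)
  moreover have "0 < (1 - eps) * H" using eps H by simp
  ultimately have D0 [measurable]: "D0 \<in> sets borel" using measure_notin_sets[of D0 lborel] by fastforce
  define Z where "Z = (%s. - s1 + s) ` (D0 Int {s1..<H})"
  have Z [measurable]: "Z \<in> sets borel" unfolding Z_def by (intro emeasure_translate) simp
  define D where "D = {r \<in> {0..<R}. \<exists>A\<in>P. 1 - eps <= measure N (hits N T w r A)}"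
  have [measurable]: "w \<in> Y \<rightarrow>\<^sub>M M" unfolding w_def by simp
  have Dm [measurable]: "D \<in> sets borel"
   unfolding D_def by (rule majority_times_measurable(2)[OF N.sigma_finite_measure_axioms w Tm P(1,2)])
  have "AE r in lborel. r \<in> Z --> r \<in> D"
   using AEN
  proof eventually_elim
   case (elim r)
   show ?case
   proof
    assume rZ: "r \<in> Z"
    hence r: "r \<in> {0..<R}" and s: "s1 + r \<in> D0" "0 <= s1 + r" "s1 + r < H" using s1 by (auto simp: Z_def R_def)
    have lt: "s1 + r < \<phi> y" if "y \<in> B" for y using that s BH by simp
    have lvl: "tower_level Y S \<phi> B (s1 + r) = B \<times> {s1 + r}"
     using lt s Bsub by (intro tower_level_eq[OF S \<phi>pos]) auto
    have lm: "level_measure Y S \<phi> (s1 + r) (B \<times> {s1 + r} Int E) = measure Y {y \<in> B. (y, s1 + r) \<in> E}" for E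
     using lt s Bsub by (intro level_measure_fibre[OF S \<phi>pos]) auto
    obtain A where A: "A \<in> P" "(1 - eps) * level_measure Y S \<phi> (s1 + r) (B \<times> {s1 + r}) <= level_measure Y S \<phi> (s1 + r) (B \<times> {s1 + r} Int \<Theta> -` A)"
     using s(1) by (auto simp: D0_def monochromatic_level_def lvl)
    have AM [measurable]: "A \<in> sets M" using A P by auto
    have "(1 - eps) * measure Y B <= measure Y {y \<in> B. \<Theta> (y, s1 + r) \<in> A}"
     using A(2) lm[of UNIV] lm[of "\<Theta> -` A"] by simp
    also have "{y \<in> B. \<Theta> (y, s1 + r) \<in> A} = B Int {y \<in> space N. g (y, s1 + r) \<in> A}"
     using Bsub lt s by (auto simp: g_def inX)
    also have "measure Y (B Int {y \<in> space N. g (y, s1 + r) \<in> A}) = measure N {y \<in> space N. g (y, s1 + r) \<in> A} * measure Y B"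
     using Bpos by (subst mN) simp_all
    finally have "1 - eps <= measure N {y \<in> space N. g (y, s1 + r) \<in> A}" using Bpos by simp
    also have "... = measure N (hits N T w r A)"
     using elim[rule_format, OF r AM] by (simp add: measure_def)
    finally show "r \<in> D" using r A(1) by (auto simp: D_def)
   qed
  qed
  hence "leb Z <= leb D" by (intro emeasure_mono_AE) auto
  moreover have "leb Z = leb (D0 Int {s1..<H})" unfolding Z_def by (intro emeasure_translate) simp
  ultimately have le: "leb (D0 Int {s1..<H}) <= leb D" by simp
  have D: "leb D = ennreal (measure lborel D)"
  proof -
   have "leb D <= leb {0..<R}" by (intro emeasure_mono) (auto simp: D_def)
   also have "... < \<infinity>" using R by simp
   finally show ?thesis by (intro emeasure_eq_ennreal_measure) auto
  qed
  have "ennreal (measure lborel D0) <= leb D0"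
   by (cases "leb D0 = \<infinity>") (simp_all add: emeasure_eq_ennreal_measure)
  also have "... <= leb ({0..s1} Un D0 Int {s1..<H})"
  proof (rule emeasure_mono)
   show "D0 <= {0..s1} Un D0 Int {s1..<H}" by (auto simp: D0_def)
  qed (use D0 in auto)
  also have "... <= leb {0..s1} + leb (D0 Int {s1..<H})"
   by (intro emeasure_subadditive) auto
  also have "... <= ennreal s1 + ennreal (measure lborel D)" using le s1 by (simp add: D add_left_mono)
  also have "... = ennreal (s1 + measure lborel D)" using s1 by (simp add: ennreal_plus)
  finally have "measure lborel D0 <= s1 + measure lborel D" using s1 by (subst (asm) ennreal_le_iff) auto
  hence "(1 - 2 * eps) * H <= measure lborel D" using D0ge s1 by (simp add: algebra_simps)
  moreover have "(1 - 4 * eps) * R <= (1 - 2 * eps) * R" using R eps by (intro mult_right_mono) auto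
  moreover have "(1 - 2 * eps) * R <= (1 - 2 * eps) * H" using s1 eps by (intro mult_left_mono) (auto simp: R_def)
  ultimately show "(1 - 4 * eps) * R <= measure lborel {r \<in> {0..<R}. \<exists>A\<in>P. 1 - eps <= measure N (hits N T w r A)}"
   by (simp add: D_def)
 qed
qed

section \<open>Concentration of families of orbits\<close>

lemma labels_partition:
 assumes "finite (q ` space M)" "!!l. {x \<in> space M. q x = l} \<in> sets M"
 defines "P \<equiv> (%l. {x \<in> space M. q x = l}) ` q ` space M"
 shows "finite P" "P <= sets M" "partition_on (space M) P"
proof -
 show "finite P" "P <= sets M" using assms by auto
 show "partition_on (space M) P"
  unfolding partition_on_def P_def by (auto simp: disjoint_def)
qed

context roof_flow begin

definition strip :: "real => real => real => (real \<times> real) set" where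
 "strip x \<delta> h = {z \<in> space M. snd z < h &
   (\<exists>n\<in>{0, 1}. \<exists>k\<in>{-1, 0, 1}. abs (fst z - (frac (x + n * \<alpha>) + k)) < \<delta>)}"

lemma strip_sets [measurable]: "strip x \<delta> h \<in> sets M"
 unfolding strip_def by measurable

lemma emeasure_strip_le:
 assumes "0 < \<delta>" "0 < h"
 shows "\<mu> M (strip x \<delta> h) <= ennreal (12 * \<delta> * h / c)"
proof -
 define I where "I = {0, 1::real} \<times> {-1, 0, 1::real}"
 define U where "U = (\<Union>i\<in>I. {frac (x + fst i * \<alpha>) + snd i - \<delta>..frac (x + fst i * \<alpha>) + snd i + \<delta>})"
 have cI: "finite I" "card I = 6" by (simp_all add: I_def)
 have U: "U \<in> sets borel" unfolding U_def using cI by (intro sets.finite_UN) auto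
 have "leb U <= ennreal (card I * (2 * \<delta>))"
  unfolding U_def using cI assms by (intro emeasure_UN_le_card) auto
 hence eU: "leb U <= ennreal (12 * \<delta>)" by (simp add: cI)
 have "\<mu> M (strip x \<delta> h) <= leb U * leb {0..<h} / ennreal c"
 proof (rule emeasure_strip)
  fix y v assume z: "(y, v) \<in> strip x \<delta> h"
  then obtain n k where nk: "n \<in> {0, 1}" "k \<in> {-1, 0, 1}" "abs (y - (frac (x + n * \<alpha>) + k)) < \<delta>"
   unfolding strip_def mem_Collect_eq fst_conv by blast
  hence "(n, k) \<in> I" "y \<in> {frac (x + n * \<alpha>) + k - \<delta>..frac (x + n * \<alpha>) + k + \<delta>}" by (auto simp: I_def)
  hence "y \<in> U" unfolding U_def by force
  thus "y \<in> U & v \<in> {0..<h}" using z by (auto simp: strip_def space_M)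
 qed (use U in auto)
 also have "... <= ennreal (12 * \<delta>) * ennreal h / ennreal c"
  using assms by (intro divide_right_mono_ennreal mult_mono eU) auto
 also have "... = ennreal (12 * \<delta> * h / c)" using assms c_pos by (simp add: ennreal_mult[symmetric] divide_ennreal)
 finally show ?thesis .
qed

text \<open>Within the time \<open>c\<close> an orbit meets at most one ceiling, so that points close to \<open>(x, u)\<close>
 stay in few vertical strips.\<close>

lemma flow_strip:
 assumes w: "w \<in> space M" and s: "0 <= s" "s < c" and close: "abs (fst w - x) < \<delta>" "\<delta> <= 1"
  and low: "snd w < h"
 shows "T s w \<in> strip x \<delta> (h + c)"
proof -
 obtain x' u where xu: "w = (x', u)" by (cases w)
 obtain n where n: "S n x' <= u + s" "u + s < S (Suc n) x'" "T s w = (frac (x' + real n * \<alpha>), u + s - S n x')"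
  using flow_step[of x' u s] w s xu by auto
 have x': "x' \<in> generic \<alpha>" using w by (auto simp: xu space_M)
 have "c * (real n - 1) <= s" using floors_le_time[of x' u s n] w s n(1) xu by simp
 hence "c * (real n - 1) < c * 1" using s by linarith
 hence "real n - 1 < 1" unfolding mult_less_cancel_left_pos[OF c_pos] .
 hence "n <= 1" by simp
 hence n01: "real n \<in> {0, 1}" by (cases n) auto
 define k where "k = \<lfloor>x + real n * \<alpha>\<rfloor> - \<lfloor>x' + real n * \<alpha>\<rfloor>"
 have e: "frac (x' + real n * \<alpha>) - frac (x + real n * \<alpha>) = x' - x + of_int k"
  by (simp add: frac_def k_def)
 have "abs (frac (x' + real n * \<alpha>) - frac (x + real n * \<alpha>)) < 1"
  using frac_ge_0[of "x' + real n * \<alpha>"] frac_lt_1[of "x' + real n * \<alpha>"] frac_ge_0[of "x + real n * \<alpha>"] frac_lt_1[of "x + real n * \<alpha>"] by linarith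
 hence "abs (of_int k :: real) < 2" using close e by (simp add: xu)
 hence "abs k < 2" by linarith
 hence "k \<in> {-1, 0, 1}" by auto
 hence k: "real_of_int k \<in> {-1, 0, 1}" by auto
 have "abs (fst (T s w) - (frac (x + real n * \<alpha>) + of_int k)) < \<delta>"
  unfolding n(3) fst_conv using close e by (simp add: xu)
 moreover have "T s w \<in> space M" by (rule flow_space[OF w s(1)])
 moreover have "snd (T s w) < h + c"
 proof -
  have "0 <= S n x'" by (rule order_trans[OF _ S_ge[OF x', of n]]) (use c_pos in simp)
  thus ?thesis unfolding n(3) snd_conv using s low by (simp add: xu)
 qed
 ultimately show ?thesis unfolding strip_def using n01 k by blast
qed

text \<open>\<open>G\<close> is the set of \<open>drift_separation\<close>, \<open>P\<close> a partition into small boxes. The premises hold for a family \<open>w\<close> of orbits that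
 spends little time outside \<open>G\<close> and has a majority colour at most times.\<close>

definition concentrates ::
 "(real => real \<times> real => real \<times> real) => real => (real \<times> real) set => (real \<times> real) set set =>
  (real => real) => real => 'n measure => bool" where
 "concentrates U eps G P d h N \<longleftrightarrow>
   (\<forall>w R. w \<in> N \<rightarrow>\<^sub>M M --> 0 < R -->
    (\<integral>\<^sup>+ r\<in>{0..<R}. \<mu> N (hits N U w r (space M - G)) \<partial>lborel) <= ennreal (R / 64) -->
    (1 - 4 * eps) * R <= measure lborel {r \<in> {0..<R}. \<exists>A\<in>P. 1 - eps <= measure N (hits N U w r A)} -->
    (\<exists>r\<in>{0..R / 2}. \<exists>x. 1 / 4 < measure N {y \<in> space N. abs (fst (U r (w y)) - x) < d R & snd (U r (w y)) < h}))"

text \<open>By Fubini's theorem some member \<open>w y0\<close> of the family is at most times in \<open>G\<close> and of the majority colour. At such a time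
 every other member of this kind lies in the same small box; by \<open>drift_separation\<close> it is then even
 within \<open>\<theta> R\<close> of \<open>w y0\<close>, up to few exceptional times. If the members within \<open>\<theta> R\<close> were always at most a quarter of the
 family, the times would not add up to \<open>R / 2\<close>.\<close>

theorem drift_family_concentrates:
 fixes U :: "real => real \<times> real => real \<times> real" and \<theta> :: "real => real"
 assumes drift: "drift_separation \<theta>" and kap: "0 < kap" "kap <= 1 / 256"
  and eps: "0 < eps" "eps <= 1 / 128"
  and Um: "(%z. U (fst z) (snd z)) \<in> borel \<Otimes>\<^sub>M M \<rightarrow>\<^sub>M M" and UT: "!!r z. 0 <= r ==> U r z = T r z"
 obtains G Hm where "G \<in> sets M" "0 < Hm" "\<mu> M (space M - G) <= ennreal kap"
  "\<forall>eps0>0. \<exists>P. finite P & P <= sets M & partition_on (space M) P &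
    (\<forall>N :: 'n measure. prob_space N --> concentrates U eps G P (%R. min eps0 (\<theta> R)) Hm N)"
proof -
 have U' [measurable (raw)]: "(%x. U (r x) (u x)) \<in> L \<rightarrow>\<^sub>M M" if "r \<in> borel_measurable L" "u \<in> L \<rightarrow>\<^sub>M M" for L and r :: "'l => real" and u
  using measurable_compose[OF measurable_Pair[OF that] Um] by simp
 from drift[unfolded drift_separation_def, rule_format, OF kap(1)]
 obtain G Hm eps1 where G [measurable]: "G \<in> sets M" and Hm: "0 < Hm" and eps1: "0 < eps1"
  and Gm: "\<mu> M (space M - G) <= ennreal kap" and GH: "\<forall>z\<in>G. snd z < Hm"
  and sep: "\<forall>R>0. \<forall>w\<in>space M. \<forall>w'\<in>space M.
    \<exists>Z\<in>sets borel. leb Z <= ennreal (kap * R) &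
    (\<forall>t\<in>{0..R}. T t w \<in> G --> T t w' \<in> G -->
      abs (fst (T t w) - fst (T t w')) < eps1 --> abs (snd (T t w) - snd (T t w')) < 1 -->
      \<theta> R <= abs (fst (T t w) - fst (T t w')) --> t \<in> Z)"
  by (elim bexE exE conjE)
 have main: "\<exists>P. finite P & P <= sets M & partition_on (space M) P &
    (\<forall>N :: 'n measure. prob_space N --> concentrates U eps G P (%R. min eps2 (\<theta> R)) Hm N)"
  if eps2: "0 < eps2" for eps2
 proof -
 define eps0 where "eps0 = min eps1 eps2"
 have eps0: "0 < eps0" "eps0 <= eps1" "eps0 <= eps2" using eps1 eps2 by (auto simp: eps0_def)
 obtain n :: nat where n: "1 / eps0 < real n" using reals_Archimedean2 by blast
 have n0: "0 < real n" using n eps0(1) by (meson less_trans zero_less_divide_1_iff)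
 \<comment> \<open>Two points of \<open>G\<close> with the same label differ by less than \<open>eps0\<close> in the base and by less than
  \<open>1\<close> in height.\<close>
 define q where "q z = (\<lfloor>real n * fst z\<rfloor>, \<lfloor>2 * min (snd z) Hm\<rfloor>)" for z :: "real \<times> real"
 have floor_close: "abs (a - b) < 1" if "\<lfloor>a\<rfloor> = \<lfloor>b\<rfloor>" for a b :: real using that by linarith
 have qG: "abs (fst z - fst z') < eps0" "abs (snd z - snd z') < 1" if z: "z \<in> G" "z' \<in> G" "q z = q z'" for z z'
 proof -
  have "abs (real n * fst z - real n * fst z') < 1" using z by (intro floor_close) (simp add: q_def)
  hence "n * abs (fst z - fst z') < 1" using n0 by (simp add: abs_mult flip: right_diff_distrib)
  hence "abs (fst z - fst z') < 1 / n" using n0 by (simp add: field_simps)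
  also have "1 / n < eps0" using n eps0 n0 by (simp add: field_simps)
  finally show "abs (fst z - fst z') < eps0" .
  have "abs (2 * min (snd z) Hm - 2 * min (snd z') Hm) < 1" using z by (intro floor_close) (simp add: q_def)
  thus "abs (snd z - snd z') < 1" using bspec[OF GH z(1)] bspec[OF GH z(2)] by simp
 qed
 have "q ` space M <= {0..int n} \<times> {0..\<lfloor>2 * Hm\<rfloor>}"
 proof
  fix l assume "l \<in> q ` space M"
  then obtain z where z: "z \<in> space M" "l = q z" by auto
  hence "0 < fst z" "fst z < 1" "0 <= snd z" using generic_self[of "fst z" \<alpha>] by (auto simp: space_M)
  hence "0 <= \<lfloor>real n * fst z\<rfloor>" "0 <= \<lfloor>2 * min (snd z) Hm\<rfloor>" using Hm by auto
  moreover have "\<lfloor>real n * fst z\<rfloor> <= \<lfloor>real n * 1\<rfloor>" using \<open>fst z < 1\<close> by (intro floor_mono mult_left_mono) auto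
  moreover have "\<lfloor>2 * min (snd z) Hm\<rfloor> <= \<lfloor>2 * Hm\<rfloor>" by (intro floor_mono) auto
  ultimately have "0 <= \<lfloor>real n * fst z\<rfloor>" "\<lfloor>real n * fst z\<rfloor> <= int n" "0 <= \<lfloor>2 * min (snd z) Hm\<rfloor>" "\<lfloor>2 * min (snd z) Hm\<rfloor> <= \<lfloor>2 * Hm\<rfloor>"
   by auto
  thus "l \<in> {0..int n} \<times> {0..\<lfloor>2 * Hm\<rfloor>}" by (simp add: z q_def)
 qed
 hence qfin: "finite (q ` space M)" by (rule finite_subset) simp
 have qm: "{z \<in> space M. q z = l} \<in> sets M" for l
 proof -
  have "{z \<in> space M. q z = l} = {z \<in> space M. \<lfloor>real n * fst z\<rfloor> = fst l & \<lfloor>2 * min (snd z) Hm\<rfloor> = snd l}"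
   by (auto simp: q_def prod_eq_iff)
  also have "... \<in> sets M" by measurable
  finally show ?thesis .
 qed
 define P where "P = (%l. {z \<in> space M. q z = l}) ` q ` space M"
 note P = labels_partition[of q M, OF qfin qm, folded P_def]
 have *: "\<exists>r\<in>{0..R / 2}. \<exists>x. 1 / 4 < measure N {y \<in> space N. abs (fst (U r (w y)) - x) < min eps2 (\<theta> R) & snd (U r (w y)) < Hm}"
  if N: "prob_space N" and w [measurable]: "w \<in> N \<rightarrow>\<^sub>M M" and R: "0 < R"
   and occ: "(\<integral>\<^sup>+ r\<in>{0..<R}. \<mu> N (hits N U w r (space M - G)) \<partial>lborel) <= ennreal (R / 64)"
   and mono: "(1 - 4 * eps) * R <= measure lborel {r \<in> {0..<R}. \<exists>A\<in>P. 1 - eps <= measure N (hits N U w r A)}"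
  for N :: "'n measure" and w R
 proof (rule ccontr)
 assume "\<not> ?thesis"
 hence box: "measure N {y \<in> space N. abs (fst (U r (w y)) - x) < min eps2 (\<theta> R) & snd (U r (w y)) < Hm} <= 1 / 4"
  if "r \<in> {0..R / 2}" for r x using that by (meson not_le)
 interpret N: prob_space N by (rule N)
 interpret NL: pair_sigma_finite N "lborel :: real measure" ..
 have wM: "w y \<in> space M" if "y \<in> space N" for y using measurable_space[OF w that] .
 have TM: "U r (w y) \<in> space M" if "y \<in> space N" "0 <= r" for y r using flow_space[OF wM[OF that(1)] that(2)] UT[OF that(2)] by simp
 define \<delta> where "\<delta> = min eps2 (\<theta> R)"
 \<comment> \<open>The times at which an orbit leaves \<open>G\<close> or the colour of the majority.\<close>
 define Bad where "Bad = {z \<in> space (cyl N). snd z \<in> {0..<R} & (U (snd z) (w (fst z)) \<notin> G \<or>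
   (\<exists>A\<in>P. U (snd z) (w (fst z)) \<in> A & measure N {y \<in> space N. U (snd z) (w y) \<in> A} < 1 - eps))}"
 note majority = majority_times_measurable(1)[OF N.sigma_finite_measure_axioms w Um]
 have majority': "(%r. measure N (hits N U w r A)) \<in> borel_measurable borel" if "A \<in> sets M" for A
  using majority[OF that] unfolding measure_def by measurable
 have Bad [measurable]: "Bad \<in> sets (cyl N)"
 proof -
  have "{z \<in> space (cyl N). U (snd z) (w (fst z)) \<in> A & measure N {y \<in> space N. U (snd z) (w y) \<in> A} < 1 - eps}
   \<in> sets (cyl N)" if "A \<in> P" for A
  proof -
   have [measurable]: "A \<in> sets M" using that P by auto
   note [measurable] = majority'[OF \<open>A \<in> sets M\<close>]
   show ?thesis by measurable
  qed
  hence "(\<Union>A\<in>P. {z \<in> space (cyl N). U (snd z) (w (fst z)) \<in> A & measure N {y \<in> space N. U (snd z) (w y) \<in> A} < 1 - eps})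
   \<in> sets (cyl N)" (is "?U \<in> _") using P by (intro sets.finite_UN) auto
  moreover have "{z \<in> space (cyl N). U (snd z) (w (fst z)) \<notin> G} \<in> sets (cyl N)" by measurable
  moreover have "{z \<in> space (cyl N). snd z \<in> {0..<R}} \<in> sets (cyl N)" by measurable
  ultimately have "{z \<in> space (cyl N). snd z \<in> {0..<R}} Int ({z \<in> space (cyl N). U (snd z) (w (fst z)) \<notin> G} Un ?U)
    \<in> sets (cyl N)" by blast
  also have "{z \<in> space (cyl N). snd z \<in> {0..<R}} Int ({z \<in> space (cyl N). U (snd z) (w (fst z)) \<notin> G} Un ?U) = Bad"
   unfolding Bad_def by blast
  finally show ?thesis .
 qed
 define D where "D = {r \<in> {0..<R}. \<exists>A\<in>P. 1 - eps <= measure N (hits N U w r A)}"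
 have D [measurable]: "D \<in> sets borel"
  unfolding D_def by (rule majority_times_measurable(2)[OF N.sigma_finite_measure_axioms w Um P(1,2)])
 have eBad: "\<mu> (cyl N) Bad <= ennreal (R / 16)"
 proof -
  have sec: "\<mu> N ((%y. (y, r)) -` Bad)
    <= \<mu> N (hits N U w r (space M - G)) * indicator {0..<R} r + ennreal eps * indicator {0..<R} r + indicator ({0..<R} - D) r" for r
  proof (cases "r \<in> {0..<R}")
   case False
   hence "(%y. (y, r)) -` Bad = {}" by (auto simp: Bad_def)
   thus ?thesis by simp
  next
   case r: True
   define A0 where "A0 = (hits N U w r (space M - G))"
   define A1 where "A1 = {y \<in> space N. \<exists>A\<in>P. U r (w y) \<in> A & measure N (hits N U w r A) < 1 - eps}"
   have A0: "A0 \<in> sets N" unfolding A0_def by measurable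
   have A1: "\<mu> N A1 <= ennreal eps + indicator ({0..<R} - D) r"
   proof (cases "r \<in> D")
    case True
    then obtain A where A: "A \<in> P" "1 - eps <= measure N (hits N U w r A)" by (auto simp: D_def)
    have [measurable]: "A \<in> sets M" using A P by auto
    have "A1 <= space N - (hits N U w r A)"
    proof
     fix y assume "y \<in> A1"
     then obtain A' where A': "y \<in> space N" "A' \<in> P" "U r (w y) \<in> A'" "measure N (hits N U w r A') < 1 - eps"
      by (auto simp: A1_def)
     have "A' ~= A" using A(2) A'(4) by auto
     hence "A' Int A = {}" using P(3) A(1) A'(2) by (auto simp: partition_on_def disjoint_def)
     thus "y \<in> space N - (hits N U w r A)" using A' by auto
    qed
    hence "\<mu> N A1 <= \<mu> N (space N - (hits N U w r A))" by (intro emeasure_mono) auto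
    also have "... = ennreal (1 - measure N (hits N U w r A))"
     by (simp add: N.emeasure_eq_measure N.prob_compl)
    also have "... <= ennreal eps" using A by (intro ennreal_leI) simp
    finally show ?thesis using True by simp
   next
    case False
    thus ?thesis using N.emeasure_le_1[of A1] r by (simp add: add_increasing)
   qed
   have "(%y. (y, r)) -` Bad <= A0 Un A1"
    using TM r by (auto simp: Bad_def A0_def A1_def space_pair_measure)
   moreover have "A1 = A1 Int space N" by (auto simp: A1_def)
   moreover have A1s: "A1 \<in> sets N"
   proof -
    have "A1 = (\<Union>A\<in>{A \<in> P. measure N (hits N U w r A) < 1 - eps}. (hits N U w r A))"
     by (auto simp: A1_def)
    moreover have "(hits N U w r A) \<in> sets N" if "A \<in> P" for A
    proof -
     have [measurable]: "A \<in> sets M" using that P by auto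
     show ?thesis by measurable
    qed
    ultimately show ?thesis using P(1) by auto
   qed
   ultimately have "\<mu> N ((%y. (y, r)) -` Bad) <= \<mu> N (A0 Un A1)" using A0 by (intro emeasure_mono) auto
   also have "... <= \<mu> N A0 + \<mu> N A1" using A0 A1s by (rule emeasure_subadditive)
   also have "... <= \<mu> N A0 + (ennreal eps + indicator ({0..<R} - D) r)" by (intro add_left_mono A1)
   finally show ?thesis using r by (simp add: A0_def add.assoc)
  qed
  have meas: "(%r. \<mu> N (hits N U w r (space M - G))) \<in> borel_measurable lborel"
   using majority by simp
  have "\<mu> (cyl N) Bad = (\<integral>\<^sup>+ r. \<mu> N ((%y. (y, r)) -` Bad) \<partial>lborel)"
   by (rule NL.emeasure_pair_measure_alt2[OF Bad])
  also have "... <= (\<integral>\<^sup>+ r. \<mu> N (hits N U w r (space M - G)) * indicator {0..<R} r + ennreal eps * indicator {0..<R} r + indicator ({0..<R} - D) r \<partial>lborel)"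
   by (intro nn_integral_mono sec)
  also have "... = (\<integral>\<^sup>+ r\<in>{0..<R}. \<mu> N (hits N U w r (space M - G)) \<partial>lborel) + ennreal eps * ennreal R + leb ({0..<R} - D)"
   using meas R by (simp add: nn_integral_add nn_integral_cmult_indicator)
  also have "... <= ennreal (R / 64) + ennreal eps * ennreal R + ennreal (4 * eps * R)"
  proof (intro add_mono order_refl occ)
   have DR: "D <= {0..<R}" by (auto simp: D_def)
   have "leb D <= leb {0..<R}" by (intro emeasure_mono DR) simp
   hence Dfin: "leb D < \<infinity>" by (rule order.strict_trans1) (use R in simp)
   have "leb ({0..<R} - D) = leb {0..<R} - leb D"
    using Dfin DR by (intro emeasure_Diff) auto
   also have "... = ennreal R - ennreal (measure lborel D)"
    using Dfin R by (simp add: emeasure_eq_ennreal_measure)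
   also have "... = ennreal (R - measure lborel D)" by (simp add: ennreal_minus)
   also have "... <= ennreal (4 * eps * R)" using mono by (intro ennreal_leI) (simp add: D_def algebra_simps)
   finally show "leb ({0..<R} - D) <= ennreal (4 * eps * R)" .
  qed
  also have "... = ennreal (R / 64 + eps * R + 4 * eps * R)"
   using R eps by (simp add: ennreal_mult[symmetric] ennreal_plus[symmetric] del: ennreal_plus)
  also have "... <= ennreal (R / 16)"
  proof (rule ennreal_leI)
   have "eps * R <= 1 / 128 * R" using eps R by (intro mult_right_mono) auto
   hence "R / 64 + 5 * (eps * R) <= R / 64 + 5 * (1 / 128 * R)" by (intro add_left_mono mult_left_mono) auto
   also have "... <= R / 16" using R by simp
   finally show "R / 64 + eps * R + 4 * eps * R <= R / 16" by (simp add: algebra_simps)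
  qed
  finally show ?thesis .
 qed
 have intBad: "\<mu> (cyl N) Bad = (\<integral>\<^sup>+ y. leb (Pair y -` Bad) \<partial>N)"
  by (rule lborel.emeasure_pair_measure_alt[OF Bad])
 have "\<exists>y0\<in>space N. leb (Pair y0 -` Bad) <= ennreal (R / 8)"
 proof (rule ccontr)
  assume "\<not> ?thesis"
  hence "!!y. y \<in> space N ==> ennreal (R / 8) <= leb (Pair y -` Bad)"
   by (meson linear)
  hence "(\<integral>\<^sup>+ y. ennreal (R / 8) \<partial>N) <= (\<integral>\<^sup>+ y. leb (Pair y -` Bad) \<partial>N)"
   by (intro nn_integral_mono)
  hence "ennreal (R / 8) <= ennreal (R / 16)" using eBad intBad by (simp add: N.emeasure_space_1)
  thus False using R by simp
 qed
 then obtain y0 where y0: "y0 \<in> space N" "leb (Pair y0 -` Bad) <= ennreal (R / 8)" by blast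
 define \<Gamma> where "\<Gamma> = {z \<in> space (cyl N). snd z \<in> {0..R / 2} &
   abs (fst (U (snd z) (w (fst z))) - fst (U (snd z) (w y0))) < \<delta> & snd (U (snd z) (w (fst z))) < Hm}"
 have "(%z. w y0) \<in> cyl N \<rightarrow>\<^sub>M M" using wM[OF y0(1)] by simp
 hence \<Gamma> [measurable]: "\<Gamma> \<in> sets (cyl N)" unfolding \<Gamma>_def by measurable
 have e\<Gamma>: "\<mu> (cyl N) \<Gamma> <= ennreal (R / 8)"
 proof -
  have sec: "\<mu> N ((%y. (y, r)) -` \<Gamma>) <= ennreal (1 / 4) * indicator {0..R / 2} r" for r
  proof (cases "r \<in> {0..R / 2}")
   case True
   hence "(%y. (y, r)) -` \<Gamma> = {y \<in> space N. abs (fst (U r (w y)) - fst (U r (w y0))) < \<delta> & snd (U r (w y)) < Hm}"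
    by (auto simp: \<Gamma>_def space_pair_measure)
   thus ?thesis using True box[OF True, of "fst (U r (w y0))", folded \<delta>_def] by (simp add: N.emeasure_eq_measure ennreal_leI)
  next
   case False
   hence "(%y. (y, r)) -` \<Gamma> = {}" by (auto simp: \<Gamma>_def)
   thus ?thesis by simp
  qed
  have "\<mu> (cyl N) \<Gamma> = (\<integral>\<^sup>+ r. \<mu> N ((%y. (y, r)) -` \<Gamma>) \<partial>lborel)"
   by (rule NL.emeasure_pair_measure_alt2[OF \<Gamma>])
  also have "... <= (\<integral>\<^sup>+ r. ennreal (1 / 4) * indicator {0..R / 2} r \<partial>lborel)" by (intro nn_integral_mono sec)
  also have "... = ennreal (R / 8)" using R by (simp add: nn_integral_cmult_indicator ennreal_mult[symmetric])
  finally show ?thesis .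
 qed
 have cover: "ennreal (R / 2) <= leb (Pair y -` \<Gamma>) + leb (Pair y -` Bad) + ennreal (R / 8 + R / 256)"
  if y: "y \<in> space N" for y
 proof -
  have sepU: "\<exists>Z\<in>sets borel. leb Z <= ennreal (kap * R) &
    (\<forall>t\<in>{0..R}. U t (w y) \<in> G --> U t (w y0) \<in> G -->
      abs (fst (U t (w y)) - fst (U t (w y0))) < eps1 --> abs (snd (U t (w y)) - snd (U t (w y0))) < 1 -->
      \<theta> R <= abs (fst (U t (w y)) - fst (U t (w y0))) --> t \<in> Z)"
   using sep[rule_format, OF R wM[OF y] wM[OF y0(1)]] by (simp add: UT)
  obtain Z where Z: "Z \<in> sets borel" "leb Z <= ennreal (kap * R)"
   and ZZ: "!!t. t \<in> {0..R} ==> U t (w y) \<in> G ==> U t (w y0) \<in> G ==>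
      abs (fst (U t (w y)) - fst (U t (w y0))) < eps1 ==> abs (snd (U t (w y)) - snd (U t (w y0))) < 1 ==>
      \<theta> R <= abs (fst (U t (w y)) - fst (U t (w y0))) ==> t \<in> Z"
   using sepU by blast
  have sub: "{0..R / 2} <= ((Pair y -` \<Gamma> Un Pair y -` Bad) Un Pair y0 -` Bad) Un Z"
  proof
   fix t assume t: "t \<in> {0..R / 2}"
   hence t': "t \<in> {0..<R}" "t \<in> {0..R}" using R by auto
   show "t \<in> ((Pair y -` \<Gamma> Un Pair y -` Bad) Un Pair y0 -` Bad) Un Z"
   proof (rule ccontr)
    assume c: "\<not> ?thesis"
    have g: "U t (w y') \<in> G" and maj: "!!A. A \<in> P ==> U t (w y') \<in> A ==> 1 - eps <= measure N (hits N U w t A)"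
     if "y' \<in> {y, y0}" for y'
     using c t' y y0 that by (auto simp: Bad_def space_pair_measure not_less)
    define A where "A y' = {z \<in> space M. q z = q (U t (w y'))}" for y'
    have A: "A y' \<in> P" "U t (w y') \<in> A y'" if "y' \<in> space N" for y'
     using TM[OF that, of t] t by (auto simp: P_def A_def)
    have As: "A y' \<in> sets M" if "y' \<in> space N" for y' using A[OF that] P by auto
    have "A y = A y0"
    proof (rule ccontr)
     assume "A y ~= A y0"
     hence dis: "A y Int A y0 = {}" by (auto simp: A_def)
     note [measurable] = As[OF y] As[OF y0(1)]
     have "measure N (hits N U w t (A y)) + measure N (hits N U w t (A y0))
      = measure N ((hits N U w t (A y)) Un (hits N U w t (A y0)))"
      using dis by (intro N.finite_measure_Union[symmetric]) auto
     also have "... <= 1" by simp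
     finally show False using maj[of y "A y"] maj[of y0 "A y0"] A y y0 eps by auto
    qed
    hence "q (U t (w y)) = q (U t (w y0))" using A(2)[OF y] by (simp add: A_def)
    hence qq: "abs (fst (U t (w y)) - fst (U t (w y0))) < eps0" "abs (snd (U t (w y)) - snd (U t (w y0))) < 1"
     using qG g by auto
    have "\<not> \<theta> R <= abs (fst (U t (w y)) - fst (U t (w y0)))"
     using ZZ[OF t'(2) g g _ qq(2)] qq(1) eps0(2) c by auto
    hence "(y, t) \<in> \<Gamma>" using qq t y bspec[OF GH g] eps0(3) by (auto simp: \<Gamma>_def \<delta>_def space_pair_measure)
    thus False using c by simp
   qed
  qed
  have s: "Pair y' -` \<Gamma> \<in> sets lborel" "Pair y' -` Bad \<in> sets lborel" for y'
   by (rule sets_Pair1[OF \<Gamma>], rule sets_Pair1[OF Bad])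
  have "ennreal (R / 2) = leb {0..R / 2}" using R by simp
  also have "... <= leb (((Pair y -` \<Gamma> Un Pair y -` Bad) Un Pair y0 -` Bad) Un Z)"
   using s Z by (intro emeasure_mono sub) auto
  also have "... <= leb ((Pair y -` \<Gamma> Un Pair y -` Bad) Un Pair y0 -` Bad) + leb Z"
   using s Z by (intro emeasure_subadditive) auto
  also have "... <= leb (Pair y -` \<Gamma> Un Pair y -` Bad) + leb (Pair y0 -` Bad) + leb Z"
   using s by (intro add_right_mono emeasure_subadditive) auto
  also have "... <= leb (Pair y -` \<Gamma>) + leb (Pair y -` Bad) + leb (Pair y0 -` Bad) + leb Z"
   using s by (intro add_right_mono emeasure_subadditive) auto
  also have "... <= leb (Pair y -` \<Gamma>) + leb (Pair y -` Bad) + ennreal (R / 8) + ennreal (kap * R)"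
   by (intro add_mono order_refl y0 Z)
  also have "... = leb (Pair y -` \<Gamma>) + leb (Pair y -` Bad) + ennreal (R / 8 + kap * R)"
   using R kap by (simp add: add.assoc ennreal_plus[symmetric] del: ennreal_plus)
  also have "... <= leb (Pair y -` \<Gamma>) + leb (Pair y -` Bad) + ennreal (R / 8 + R / 256)"
   using R kap by (intro add_left_mono ennreal_leI) auto
  finally show ?thesis .
 qed
 have m\<Gamma>: "(%y. leb (Pair y -` \<Gamma>)) \<in> borel_measurable N" "(%y. leb (Pair y -` Bad)) \<in> borel_measurable N"
  by (rule lborel.measurable_emeasure_Pair[OF \<Gamma>], rule lborel.measurable_emeasure_Pair[OF Bad])
 have "ennreal (R / 2) = (\<integral>\<^sup>+ y. ennreal (R / 2) \<partial>N)" by (simp add: N.emeasure_space_1)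
 also have "... <= (\<integral>\<^sup>+ y. leb (Pair y -` \<Gamma>) + leb (Pair y -` Bad) + ennreal (R / 8 + R / 256) \<partial>N)"
  by (intro nn_integral_mono cover)
 also have "... = \<mu> (cyl N) \<Gamma> + \<mu> (cyl N) Bad + ennreal (R / 8 + R / 256)"
  using m\<Gamma> by (simp add: nn_integral_add lborel.emeasure_pair_measure_alt[OF \<Gamma>] intBad N.emeasure_space_1)
 also have "... <= ennreal (R / 8) + ennreal (R / 16) + ennreal (R / 8 + R / 256)"
  by (intro add_mono e\<Gamma> eBad order_refl)
 also have "... = ennreal (R / 8 + R / 16 + (R / 8 + R / 256))"
  using R by (simp add: ennreal_plus[symmetric] del: ennreal_plus)
 finally show False using R by simp
 qed
 have "concentrates U eps G P (%R. min eps2 (\<theta> R)) Hm N" if "prob_space N" for N :: "'n measure"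
  unfolding concentrates_def using *[OF that] by blast
 thus ?thesis using P by blast
 qed
 show thesis by (rule that[OF G Hm Gm]) (use main in simp)
qed

text \<open>A concentrated quarter of the family would stay in a strip of measure \<open>O (\<theta> R)\<close> for a time bounded
 below, more than the occupation bound \<open>4 * R / \<beta>\<close> times the measure permits.\<close>

theorem drift_not_local_rank_one:
 assumes drift: "drift_separation \<theta>" and \<theta>pos: "!!R. 0 < R ==> 0 < \<theta> R"
  and lim: "((%R. R * \<theta> R) \<longlongrightarrow> 0) at_top"
 shows "\<not> local_rank_one M T"
proof
 assume "local_rank_one M T"
 then obtain \<beta> where \<beta>: "0 < \<beta>" "\<beta> <= 1" and rank: "beta_rank_one \<beta> M T"
  by (auto simp: local_rank_one_def)
 have flow: "measure_preserving_flow M T" using rank unfolding beta_rank_one_def ergodic_flow_def by blast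
 have Tm: "(%z. T (fst z) (snd z)) \<in> borel \<Otimes>\<^sub>M M \<rightarrow>\<^sub>M M"
  using flow by (simp add: measure_preserving_flow_def case_prod_unfold)
 have T' [measurable (raw)]: "(%x. T (r x) (u x)) \<in> L \<rightarrow>\<^sub>M M" if "r \<in> borel_measurable L" "u \<in> L \<rightarrow>\<^sub>M M" for L and r :: "'l => real" and u
  using measurable_compose[OF measurable_Pair[OF that] Tm] by simp
 define eps where "eps = \<beta> / 128"
 have eps: "0 < eps" "eps < 1/2" "2 * eps < \<beta>" "eps <= 1 / 128" using \<beta> by (auto simp: eps_def)
 have kap: "0 < \<beta> / 256" "\<beta> / 256 <= 1 / 256" using \<beta> by auto
 obtain G Hm where G [measurable]: "G \<in> sets M" and Hm: "0 < Hm" and Gm: "\<mu> M (space M - G) <= ennreal (\<beta> / 256)"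
  and conc: "\<forall>eps0>0. \<exists>P. finite P & P <= sets M & partition_on (space M) P &
    (\<forall>N :: (real \<times> real) measure. prob_space N --> concentrates T eps G P (%R. min eps0 (\<theta> R)) Hm N)"
 proof (rule drift_family_concentrates[OF drift kap eps(1,4) Tm refl])
 qed (rule that)
 define K where "K = 12 * (Hm + c) / (c * \<beta>)"
 have K: "0 < K" using Hm c_pos \<beta> by (simp add: K_def)
 have "\<forall>\<^sub>F R in at_top. R * \<theta> R < c / (32 * K)"
  using lim K c_pos by (intro order_tendstoD) auto
 then obtain R1 where R1: "!!R. R1 <= R ==> R * \<theta> R < c / (32 * K)" by (auto simp: eventually_at_top_linorder)
 define R0 where "R0 = max 1 R1"
 define eps0 where "eps0 = min 1 (min (1 / (64 * K)) (c / (32 * K * R0)))"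
 have eps0: "0 < eps0" "eps0 <= 1" "16 * K * eps0 <= 1 / 4" "eps0 <= c / (32 * K * R0)"
 proof -
  have R0: "0 < R0" by (simp add: R0_def)
  have "eps0 <= 1 / (64 * K)" by (simp add: eps0_def)
  thus "16 * K * eps0 <= 1 / 4" using K by (simp add: field_simps)
 qed (use K c_pos in \<open>auto simp: eps0_def R0_def\<close>)
 from conc[rule_format, OF eps0(1)] obtain P where P: "finite P" "P <= sets M" "partition_on (space M) P"
  and concP: "\<forall>N :: (real \<times> real) measure. prob_space N --> concentrates T eps G P (%R. min eps0 (\<theta> R)) Hm N"
  by (elim exE conjE)
 obtain N :: "(real \<times> real) measure" and w R where N: "prob_space N" and w [measurable]: "w \<in> N \<rightarrow>\<^sub>M M" and R: "0 < R"
  and occ: "!!A. A \<in> sets M ==> (\<integral>\<^sup>+ r\<in>{0..<R}. \<mu> N (hits N T w r A) \<partial>lborel) <= ennreal (4 * R / \<beta>) * \<mu> M A"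
  and mono: "(1 - 4 * eps) * R <= measure lborel {r \<in> {0..<R}. \<exists>A\<in>P. 1 - eps <= measure N (hits N T w r A)}"
  using rank_one_orbits[OF rank eps(1-3) P coordinates_measurable] by blast
 interpret N: prob_space N by (rule N)
 have wM: "w y \<in> space M" if "y \<in> space N" for y using measurable_space[OF w that] .
 have TM: "T r (w y) \<in> space M" if "y \<in> space N" "0 <= r" for y r using flow_space wM that by blast
 define \<delta> where "\<delta> = min eps0 (\<theta> R)"
 have \<delta>: "0 < \<delta>" "\<delta> <= 1" "\<delta> <= eps0" "\<delta> <= \<theta> R" using \<theta>pos[OF R] eps0 by (auto simp: \<delta>_def)
 \<comment> \<open>A thin box cannot catch a quarter of the orbits at once: they would all stay in a thin strip
  during a time that is not short compared with \<open>R\<close>, or at least not compared with \<open>c\<close>.\<close>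
 have box: "measure N {y \<in> space N. abs (fst (T r (w y)) - x) < \<delta> & snd (T r (w y)) < Hm} <= 1 / 4"
  if r: "r \<in> {0..R / 2}" for r x
 proof -
  define E where "E = {y \<in> space N. abs (fst (T r (w y)) - x) < \<delta> & snd (T r (w y)) < Hm}"
  have E: "E \<in> sets N" unfolding E_def by measurable
  define m where "m = min c (R / 2) / 2"
  have m: "0 < m" "m < c" "r + m < R" using c_pos R r by (auto simp: m_def)
  have "E <= (hits N T w t (strip x \<delta> (Hm + c)))" if t: "t \<in> {r..r + m}" for t
  proof
   fix y assume y: "y \<in> E"
   hence yN: "y \<in> space N" by (simp add: E_def)
   have "T (t - r) (T r (w y)) \<in> strip x \<delta> (Hm + c)"
    using y t m r \<delta> TM[OF yN, of r] by (intro flow_strip) (auto simp: E_def)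
   moreover have "T t (w y) = T (t - r) (T r (w y))"
    using flow_add[OF wM[OF yN], of "t - r" r] t r by simp
   ultimately show "y \<in> (hits N T w t (strip x \<delta> (Hm + c)))" using yN by simp
  qed
  hence EV: "\<mu> N E <= \<mu> N (hits N T w t (strip x \<delta> (Hm + c)))" if "t \<in> {r..r + m}" for t
   using that by (intro emeasure_mono) auto
  have "ennreal m * \<mu> N E = (\<integral>\<^sup>+ t\<in>{r..r + m}. \<mu> N E \<partial>lborel)"
   using m by (simp add: nn_integral_cmult_indicator mult.commute)
  also have "... <= (\<integral>\<^sup>+ t\<in>{0..<R}. \<mu> N (hits N T w t (strip x \<delta> (Hm + c))) \<partial>lborel)"
   using EV m r by (intro nn_integral_mono) (auto simp: indicator_def)
  also have "... <= ennreal (4 * R / \<beta>) * \<mu> M (strip x \<delta> (Hm + c))" by (rule occ[OF strip_sets])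
  also have "... <= ennreal (4 * R / \<beta>) * ennreal (12 * \<delta> * (Hm + c) / c)"
   using \<delta> Hm c_pos by (intro mult_left_mono emeasure_strip_le) auto
  also have "... = ennreal (4 * R * K * \<delta>)"
   using \<beta> R Hm c_pos \<delta> by (simp add: ennreal_mult[symmetric] K_def mult_ac)
  finally have "m * measure N E <= 4 * R * K * \<delta>"
   using m R K \<delta> by (simp add: N.emeasure_eq_measure ennreal_mult[symmetric])
  moreover have "4 * R * K * \<delta> <= m / 4"
  proof (cases "R / 2 <= c")
   case True
   hence "m = R / 4" by (simp add: m_def)
   moreover have "4 * R * K * \<delta> <= 4 * R * K * eps0" using \<delta> R K by (intro mult_left_mono) auto
   moreover have "R / 4 * (16 * K * eps0) <= R / 4 * (1 / 4)" using eps0 R by (intro mult_left_mono) auto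
   ultimately show ?thesis by (simp add: algebra_simps)
  next
   case False
   hence "m = c / 2" by (simp add: m_def)
   moreover have "R * \<delta> <= c / (32 * K)"
   proof (cases "R0 <= R")
    case True
    hence "R * \<theta> R < c / (32 * K)" by (intro R1) (simp add: R0_def)
    moreover have "R * \<delta> <= R * \<theta> R" using \<delta> R by (intro mult_left_mono) auto
    ultimately show ?thesis by linarith
   next
    case False
    hence "R * \<delta> <= R0 * (c / (32 * K * R0))" using \<delta> R eps0 by (intro mult_mono) auto
    also have "... = c / (32 * K)" by (simp add: R0_def)
    finally show ?thesis .
   qed
   hence "4 * K * (R * \<delta>) <= 4 * K * (c / (32 * K))" using K by (intro mult_left_mono) auto
   ultimately show ?thesis using K by (simp add: mult_ac)
  qed
  ultimately have "m * measure N E <= m * (1 / 4)" by simp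
  thus ?thesis using m unfolding E_def[symmetric] by (simp only: mult_le_cancel_left_pos)
 qed
 have occG: "(\<integral>\<^sup>+ r\<in>{0..<R}. \<mu> N (hits N T w r (space M - G)) \<partial>lborel) <= ennreal (R / 64)"
 proof -
  have "(\<integral>\<^sup>+ r\<in>{0..<R}. \<mu> N (hits N T w r (space M - G)) \<partial>lborel) <= ennreal (4 * R / \<beta>) * \<mu> M (space M - G)"
   by (rule occ) simp
  also have "... <= ennreal (4 * R / \<beta>) * ennreal (\<beta> / 256)" by (intro mult_left_mono Gm) simp
  also have "... = ennreal (R / 64)" using \<beta> R by (simp add: ennreal_mult[symmetric])
  finally show ?thesis .
 qed
 from concP[rule_format, OF N, unfolded concentrates_def, rule_format, OF w R occG mono] show False using box unfolding \<delta>_def by (meson not_le)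
qed

end

section \<open>Absence of local rank one\<close>

lemma kochergin_roof_flow:
 assumes "kochergin_roof \<gamma> f"
 obtains c where "roof_flow f c"
proof -
 obtain c C where c: "0 < c" "!!x. x \<in> {0<..<1} ==> c <= f x"
  by (rule kochergin_roof_bounds[OF assms]) blast
 have "C2_on_unit_interval f" using assms by (auto simp: kochergin_roof_def singular_roof_def)
 hence "roof_flow f c" using c C2_on_unit_interval_continuous(1) by unfold_locales auto
 thus thesis by (rule that)
qed

lemma arnold_roof_flow:
 assumes "arnold_roof f"
 obtains c where "roof_flow f c"
proof -
 obtain c C A B where c: "0 < c" "!!x. x \<in> {0<..<1} ==> c <= f x"
  by (rule arnold_roof_bounds[OF assms]) blast
 have "C2_on_unit_interval f" using assms by (auto simp: arnold_roof_def singular_roof_def)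
 hence "roof_flow f c" using c C2_on_unit_interval_continuous(1) by unfold_locales auto
 thus thesis by (rule that)
qed

lemma half_power_less_powr_minus:
 assumes "0 < a" "0 < x" "x < 2 powr (a * real j)"
 shows "(1/2) ^ j < x powr (- 1 / a)"
proof -
 have "x powr (1 / a) < (2 powr (a * real j)) powr (1 / a)"
  using assms by (intro powr_less_mono2) auto
 also have "... = 2 ^ j" using assms by (simp add: powr_powr powr_realpow)
 finally have "1 / 2 ^ j < 1 / x powr (1 / a)" using assms by (intro divide_strict_left_mono) auto
 thus ?thesis using assms by (simp add: powr_minus_divide power_one_over)
qed

context roof_flow begin

lemma kochergin_drift:
 assumes base: "base_separation \<alpha> f (%j. 2 powr (a * real j))" and a: "0 < a" and fin: "\<mu> M (space M) < \<infinity>"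
 shows "drift_separation (%R. (R / c) powr (- 1 / a))"
proof (rule drift_separationI[OF base _ _ _ fin])
 show "1 <= 2 powr (a * real j)" if "1 <= j" for j using a by (intro ge_one_powr_ge_zero) auto
 show "(1/2) ^ j < (R / c) powr (- 1 / a)" if "0 < R" "1 <= j" "R < c * 2 powr (a * real j)" for R j
  using that c_pos a by (intro half_power_less_powr_minus) (auto simp: divide_less_eq mult.commute)
qed (use c_pos in auto)

lemma kochergin_not_local_rank_one:
 assumes "base_separation \<alpha> f (%j. 2 powr (a * real j))" "0 < a" "a < 1"
 shows "\<not> local_rank_one M T"
proof
 assume rank: "local_rank_one M T"
 hence "prob_space M"
  unfolding local_rank_one_def beta_rank_one_def ergodic_flow_def measure_preserving_flow_def by blast
 then interpret PM: prob_space M .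
 have "drift_separation (%R. (R / c) powr (- 1 / a))"
  using assms by (intro kochergin_drift) (auto simp: PM.emeasure_space_1)
 moreover have "((%R. R * (R / c) powr (- 1 / a)) \<longlongrightarrow> 0) at_top"
 proof -
  define b where "b = 1 / a"
  have "1 < b" using assms by (simp add: b_def)
  hence "((%R. R * (R / c) powr (- b)) \<longlongrightarrow> 0) at_top" using c_pos by real_asymp
  thus ?thesis by (simp add: b_def)
 qed
 ultimately have "\<not> local_rank_one M T" using c_pos by (intro drift_not_local_rank_one) auto
 thus False using rank by contradiction
qed

text \<open>Inverting \<open>R = c * N j\<close> with \<open>N j = 2 ^ j / sqrt j\<close> yields \<open>2 ^ - j\<close> of the order
 \<open>1 / (R * sqrt (ln R))\<close>, barely less than \<open>1 / R\<close>.\<close>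

lemma arnold_not_local_rank_one:
 assumes base: "base_separation \<alpha> f (%j. 2 ^ j * real j powr (-1/2))"
 shows "\<not> local_rank_one M T"
proof
 assume rank: "local_rank_one M T"
 hence "prob_space M"
  unfolding local_rank_one_def beta_rank_one_def ergodic_flow_def measure_preserving_flow_def by blast
 then interpret PM: prob_space M .
 define \<theta> where "\<theta> R = (if R <= 2 * c then 1 else c / R * log 2 (R / c) powr (-1/2))" for R
 have \<theta>pos: "0 < \<theta> R" if "0 < R" for R
 proof (cases "R <= 2 * c")
  case False
  hence "2 < R / c" using c_pos by (simp add: field_simps)
  hence "0 < log 2 (R / c)" by (subst zero_less_log_cancel_iff) auto
  hence "log 2 (R / c) ~= 0" by linarith
  hence "0 < log 2 (R / c) powr (-1/2)" by (simp only: powr_gt_zero not_False_eq_True)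
  hence "0 < c / R * log 2 (R / c) powr (-1/2)" using that c_pos by (intro mult_pos_pos divide_pos_pos)
  thus ?thesis using False by (simp only: \<theta>_def if_False)
 qed (simp add: \<theta>_def)
 have "drift_separation \<theta>"
 proof (rule drift_separationI[OF base _ \<theta>pos])
  show "1 <= 2 ^ j * real j powr (-1/2)" if j: "1 <= j" for j :: nat
  proof -
   have "real j powr (1/2) <= real j powr 1" using j by (intro powr_mono) auto
   also have "... <= 2 ^ j" using less_exp[of j] by (simp add: of_nat_less_two_power less_imp_le)
   finally have "real j powr (1/2) <= 2 ^ j" .
   thus ?thesis using j by (simp add: powr_minus field_simps)
  qed
  show "(1/2) ^ j < \<theta> R" if h: "0 < R" "1 <= j" "R < c * (2 ^ j * real j powr (-1/2))" for R j
  proof (cases "R <= 2 * c")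
   case True
   have "(1/2::real) ^ j <= (1/2) ^ 1" using h(2) by (intro power_decreasing) auto
   thus ?thesis using True by (simp add: \<theta>_def)
  next
   case False
   hence Rc: "2 < R / c" using c_pos by (simp add: field_simps)
   have "real j powr (-1/2) <= real j powr 0" using h by (intro powr_mono) auto
   hence le1: "real j powr (-1/2) <= 1" using h by simp
   have Rlt: "R / c < 2 ^ j * real j powr (-1/2)" using h c_pos by (simp add: divide_less_eq mult.commute)
   also have "... <= 2 ^ j * 1" using le1 by (intro mult_left_mono) auto
   finally have "log 2 (R / c) < log 2 (2 ^ j)" using Rc by (subst log_less_cancel_iff) auto
   hence L: "log 2 (R / c) < real j" by (simp add: log_pow_cancel)
   have L0: "0 < log 2 (R / c)" using Rc by simp
   have "real j powr (-1/2) <= log 2 (R / c) powr (-1/2)" using L L0 by (intro powr_mono2') auto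
   hence "R / c < 2 ^ j * log 2 (R / c) powr (-1/2)"
    using Rlt by (meson less_le_trans mult_left_mono zero_le_numeral zero_le_power)
   thus ?thesis using False h c_pos by (simp add: \<theta>_def power_one_over field_simps)
  qed
 qed (auto simp: PM.emeasure_space_1)
 moreover have "((%R. R * \<theta> R) \<longlongrightarrow> 0) at_top"
 proof (rule Lim_transform_eventually)
  show "((%R. R * (c / R * log 2 (R / c) powr (-1/2))) \<longlongrightarrow> 0) at_top" using c_pos by real_asymp
  show "\<forall>\<^sub>F R in at_top. R * (c / R * log 2 (R / c) powr (-1/2)) = R * \<theta> R"
   using eventually_gt_at_top[of "2 * c"] by eventually_elim (auto simp: \<theta>_def)
 qed
 ultimately have "\<not> local_rank_one M T" using \<theta>pos by (intro drift_not_local_rank_one) auto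
 thus False using rank by contradiction
qed

end

theorem arnold_flow_not_local_rank_one:
 assumes "\<alpha> \<in> dioph_D" "arnold_flow \<alpha> M T"
 shows "\<not> local_rank_one M T"
proof -
 obtain f where f: "arnold_roof f" and MT: "M = special_measure (circle_base \<alpha>) f" "T = special_flow (circle_base \<alpha>) (rotation \<alpha>) f"
  using assms(2) by (auto simp: arnold_flow_def)
 obtain q p C where "log_diophantine \<alpha> q p C" using dioph_D_log_diophantine[OF assms(1)] by blast
 then interpret log_diophantine \<alpha> q p C .
 obtain c where "roof_flow f c" using arnold_roof_flow[OF f] by blast
 then interpret roof_flow \<alpha> f c .
 show ?thesis unfolding MT by (rule arnold_not_local_rank_one[OF arnold_base_separation[OF f]])
qed

theorem kochergin_flow_not_local_rank_one:
 assumes "\<alpha> \<in> dioph_D" "kochergin_flow \<alpha> \<gamma> M T"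
 shows "\<not> local_rank_one M T"
proof -
 obtain f where f: "kochergin_roof \<gamma> f" and MT: "M = special_measure (circle_base \<alpha>) f" "T = special_flow (circle_base \<alpha>) (rotation \<alpha>) f"
  using assms(2) by (auto simp: kochergin_flow_def)
 have \<gamma>: "0 < \<gamma>" using f by (simp add: kochergin_roof_def)
 obtain q p C where "log_diophantine \<alpha> q p C" using dioph_D_log_diophantine[OF assms(1)] by blast
 then interpret log_diophantine \<alpha> q p C .
 obtain c where "roof_flow f c" using kochergin_roof_flow[OF f] by blast
 then interpret roof_flow \<alpha> f c .
 have "1 / (1 + \<gamma>) < 1" using \<gamma> by simp
 then obtain a where a: "1 / (1 + \<gamma>) < a" "a < 1" using dense by blast
 have "0 < 1 / (1 + \<gamma>)" using \<gamma> by simp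
 hence "0 < a" using a(1) by linarith
 thus ?thesis unfolding MT
  by (rule kochergin_not_local_rank_one[OF kochergin_base_separation[OF f a]]) (rule a)
qed

section \<open>Measurability and invariance of the flow\<close>

lemma measurable_into_special:
 assumes g: "g \<in> L \<rightarrow>\<^sub>M Y" and h: "h \<in> borel_measurable L" and in_sp: "!!x. x \<in> space L ==> (g x, h x) \<in> special_space Y \<phi>"
 shows "(%x. (g x, h x)) \<in> L \<rightarrow>\<^sub>M special_measure Y \<phi>"
proof -
 have "(%x. (g x, h x)) \<in> L \<rightarrow>\<^sub>M cyl Y" using g h by simp
 also have "(L \<rightarrow>\<^sub>M cyl Y) = (L \<rightarrow>\<^sub>M uniform_measure (cyl Y) (special_space Y \<phi>))"
  by (rule measurable_cong_sets) simp_all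
 finally show ?thesis unfolding special_measure_def using in_sp by (intro measurable_restrict_space2) auto
qed

lemma measurable_into_circle_base:
 assumes "g \<in> borel_measurable L" "!!x. x \<in> space L ==> g x \<in> generic \<alpha>"
 shows "g \<in> L \<rightarrow>\<^sub>M circle_base \<alpha>"
 unfolding circle_base_def generic_def[symmetric] using assms by (intro measurable_restrict_space2) auto

lemma circle_base_borel: "(%x. x) \<in> borel_measurable (circle_base \<alpha>)"
 unfolding circle_base_def by (rule measurable_restrict_space1) simp

lemma rotation_measurable: "rotation \<alpha> \<in> circle_base \<alpha> \<rightarrow>\<^sub>M circle_base \<alpha>"
proof (rule measurable_into_circle_base)
 have "(%x. frac (x + \<alpha>)) \<in> borel_measurable borel" unfolding frac_def by measurable
 from measurable_compose[OF circle_base_borel this] show "rotation \<alpha> \<in> borel_measurable (circle_base \<alpha>)"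
  by (simp add: rotation_def[abs_def])
qed (simp add: space_circle_base rotation_generic)

text \<open>A rotation moves the arcs \<open>[0, 1 - \<beta>)\<close> and \<open>[1 - \<beta>, 1)\<close> by translations.\<close>

lemma rotation_preserves: "distr (circle_base \<alpha>) (circle_base \<alpha>) (rotation \<alpha>) = circle_base \<alpha>"
proof (rule measure_eqI)
 fix A assume A: "A \<in> sets (distr (circle_base \<alpha>) (circle_base \<alpha>) (rotation \<alpha>))"
 hence A': "A \<in> sets (circle_base \<alpha>)" by simp
 then obtain A1 where "A = generic \<alpha> Int A1" "A1 \<in> sets borel"
  unfolding circle_base_def generic_def[symmetric] by (auto simp: sets_restrict_space)
 hence Ab [measurable]: "A \<in> sets borel" and Asub: "A <= generic \<alpha>" by auto
 define b where "b = frac \<alpha>"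
 have b: "0 <= b" "b < 1" by (simp_all add: b_def frac_lt_1)
 have fl: "real_of_int \<lfloor>\<alpha>\<rfloor> = \<alpha> - b" by (simp add: b_def frac_def)
 have rot: "rotation \<alpha> x = (if x < 1 - b then x + b else x + b - 1)" if "x \<in> {0..<1}" for x
  unfolding rotation_def using that b
  by (intro frac_eqI[where z = "\<lfloor>\<alpha>\<rfloor> + (if x < 1 - b then 0 else 1)"]) (auto simp: fl)
 define A2 where "A2 = rotation \<alpha> -` A Int generic \<alpha>"
 have A2: "A2 = (%s. - b + s) ` (A Int {b..}) Un (%s. (1 - b) + s) ` (A Int {..<b})" (is "_ = ?P Un ?Q")
 proof (intro equalityI subsetI)
  fix x assume x: "x \<in> A2"
  hence x01: "x \<in> {0..<1}" by (auto simp: A2_def generic_def)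
  show "x \<in> ?P Un ?Q"
  proof (cases "x < 1 - b")
   case True
   hence "x + b \<in> A Int {b..}" using x rot[OF x01] x01 by (auto simp: A2_def)
   thus ?thesis by (intro UnI1 image_eqI[of _ _ "x + b"]) auto
  next
   case False
   hence "x + b - 1 \<in> A Int {..<b}" using x rot[OF x01] x01 by (auto simp: A2_def)
   thus ?thesis by (intro UnI2 image_eqI[of _ _ "x + b - 1"]) auto
  qed
 next
  fix x assume x: "x \<in> ?P Un ?Q"
  then obtain y where y: "y \<in> A" and xy: "x = y - b & b <= y \<or> x = y - b + 1 & y < b" by auto
  have yc: "y \<in> generic \<alpha>" "0 <= y" "y < 1" using y Asub by (auto simp: generic_def)
  have "x = frac (y + of_int (- 1) * \<alpha>)"
   using xy yc b by (intro frac_eqI[symmetric, where z = "- \<lfloor>\<alpha>\<rfloor> + (if b <= y then 0 else - 1)"]) (auto simp: fl)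
  hence xc: "x \<in> generic \<alpha>" using generic_frac[OF yc(1), of "- 1"] by simp
  hence "x \<in> {0..<1}" by (auto simp: generic_def)
  hence "rotation \<alpha> x = y" using rot[of x] xy yc b by auto
  thus "x \<in> A2" using xc y by (simp add: A2_def)
 qed
 have A2b: "A2 \<in> sets borel" unfolding A2
  using emeasure_translate(1)[of "A Int {b..}" "- b"] emeasure_translate(1)[of "A Int {..<b}" "1 - b"] by auto
 have A2c: "A2 <= generic \<alpha>" by (simp add: A2_def)
 have "\<mu> (distr (circle_base \<alpha>) (circle_base \<alpha>) (rotation \<alpha>)) A = \<mu> (circle_base \<alpha>) A2"
  using A' by (subst emeasure_distr[OF rotation_measurable]) (auto simp: A2_def space_circle_base)
 also have "... = leb A2" by (rule emeasure_base[OF A2b A2c])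
 also have "... = leb (?P Un ?Q)" by (simp only: A2)
 also have "... = leb ?P + leb ?Q"
 proof (rule plus_emeasure[symmetric])
  have "0 <= y" "y < 1" if "y \<in> A" for y using Asub that by (auto simp: generic_def)
  thus "?P Int ?Q = {}" by force
 qed (use emeasure_translate(1)[of "A Int {b..}" "- b"] emeasure_translate(1)[of "A Int {..<b}" "1 - b"] in auto)
 also have "... = leb (A Int {b..}) + leb (A Int {..<b})"
  by (subst (1 2) emeasure_translate(2)) auto
 also have "... = leb (A Int {b..} Un A Int {..<b})" by (rule plus_emeasure) auto
 also have "A Int {b..} Un A Int {..<b} = A" by auto
 also have "leb A = \<mu> (circle_base \<alpha>) A" using Ab Asub by (simp add: emeasure_base)
 finally show "\<mu> (distr (circle_base \<alpha>) (circle_base \<alpha>) (rotation \<alpha>)) A = \<mu> (circle_base \<alpha>) A" .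
qed simp

context roof_flow begin

lemma birkhoff_measurable: "S n \<in> borel_measurable Y"
proof -
 have "(%x. f (frac (x + real i * \<alpha>))) \<in> borel_measurable Y" for i
 proof (rule measurable_compose[OF _ roof_measurable], rule measurable_into_circle_base)
  have "(%x. frac (x + real i * \<alpha>)) \<in> borel_measurable borel" unfolding frac_def by measurable
  from measurable_compose[OF circle_base_borel this] show "(%x. frac (x + real i * \<alpha>)) \<in> borel_measurable Y" .
  show "frac (x + real i * \<alpha>) \<in> generic \<alpha>" if "x \<in> space Y" for x
   using that generic_frac[of x \<alpha> "int i"] by (simp add: space_circle_base)
 qed
 thus ?thesis unfolding birkhoff_def by (intro borel_measurable_sum)
qed

lemma fst_M [measurable]: "fst \<in> M \<rightarrow>\<^sub>M Y"
 by (rule measurable_special_fst_snd)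

theorem flow_measurable: "(%z. T (max 0 (fst z)) (snd z)) \<in> borel \<Otimes>\<^sub>M M \<rightarrow>\<^sub>M M"
proof -
 define n where "n z = (LEAST n. snd (snd z) + max 0 (fst z) < S (Suc n) (fst (snd z)))" for z :: "real \<times> real \<times> real"
 have Sm [measurable]: "(%z. S k (fst (snd z))) \<in> borel_measurable (borel \<Otimes>\<^sub>M M)" for k
  by (intro measurable_compose[OF _ birkhoff_measurable] measurable_compose[OF measurable_snd fst_M])
 have n [measurable]: "n \<in> borel \<Otimes>\<^sub>M M \<rightarrow>\<^sub>M count_space UNIV"
  unfolding n_def by (rule measurable_Least) measurable
 have n_prop: "S (n z) x <= u + max 0 t & u + max 0 t < S (Suc (n z)) x" if z: "z = (t, x, u)" "(x, u) \<in> space M" for z t x u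
 proof -
  obtain k where k: "u + max 0 t < S (Suc k) x" using flow_step[OF z(2), of "max 0 t"] by auto
  hence 1: "u + max 0 t < S (Suc (n z)) x" unfolding n_def z fst_conv snd_conv by (rule LeastI)
  have "S (n z) x <= u + max 0 t"
  proof (cases "n z")
   case (Suc m)
   hence "\<not> u + max 0 t < S (Suc m) x"
    using not_less_Least[of m "%n. u + max 0 t < S (Suc n) x"] unfolding n_def z fst_conv snd_conv by auto
   thus ?thesis using Suc by simp
  qed (use z in \<open>auto simp: space_M\<close>)
  thus ?thesis using 1 by simp
 qed
 have ev: "T (max 0 (fst z)) (snd z) = (frac (fst (snd z) + real (n z) * \<alpha>), snd (snd z) + max 0 (fst z) - S (n z) (fst (snd z)))"
  if "z \<in> space (borel \<Otimes>\<^sub>M M)" for z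
 proof -
  obtain t x u where z: "z = (t, x, u)" by (metis prod_cases3)
  hence xu: "(x, u) \<in> space M" using that by (simp add: space_pair_measure)
  hence "x \<in> generic \<alpha>" by (simp add: space_M)
  from flow_eval[OF this] n_prop[OF z xu] show ?thesis by (simp add: z)
 qed
 have "(%z. (frac (fst (snd z) + real (n z) * \<alpha>), snd (snd z) + max 0 (fst z) - S (n z) (fst (snd z)))) \<in> borel \<Otimes>\<^sub>M M \<rightarrow>\<^sub>M M"
 proof (rule measurable_into_special)
  show "(%z. snd (snd z) + max 0 (fst z) - S (n z) (fst (snd z))) \<in> borel_measurable (borel \<Otimes>\<^sub>M M)"
   by (rule measurable_compose_countable[OF _ n, where f = "%i z. snd (snd z) + max 0 (fst z) - S i (fst (snd z))"]) measurable
  show "(%z. frac (fst (snd z) + real (n z) * \<alpha>)) \<in> borel \<Otimes>\<^sub>M M \<rightarrow>\<^sub>M Y"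
  proof (rule measurable_into_circle_base)
   show "(%z. frac (fst (snd z) + real (n z) * \<alpha>)) \<in> borel_measurable (borel \<Otimes>\<^sub>M M)"
    unfolding frac_def by measurable
   show "frac (fst (snd z) + real (n z) * \<alpha>) \<in> generic \<alpha>" if "z \<in> space (borel \<Otimes>\<^sub>M M)" for z
    using that generic_frac[of "fst (snd z)" \<alpha> "int (n z)"] by (auto simp: space_pair_measure space_M)
  qed
  show "(frac (fst (snd z) + real (n z) * \<alpha>), snd (snd z) + max 0 (fst z) - S (n z) (fst (snd z))) \<in> special_space Y f"
   if "z \<in> space (borel \<Otimes>\<^sub>M M)" for z
   using flow_space[of "snd z" "max 0 (fst z)"] that unfolding ev[OF that, symmetric] space_special[symmetric] by (simp add: space_pair_measure mem_Times_iff)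
 qed
 thus ?thesis by (subst measurable_cong[OF ev]) auto
qed

lemma flow_measurable_at [measurable]:
 assumes "0 <= t"
 shows "T t \<in> M \<rightarrow>\<^sub>M M"
proof -
 have "(%z. (t, z)) \<in> M \<rightarrow>\<^sub>M borel \<Otimes>\<^sub>M M" by simp
 from measurable_compose[OF this flow_measurable] show ?thesis using assms by simp
qed

lemma sets_M: "A \<in> sets M \<longleftrightarrow> A \<in> sets (cyl Y) & A <= space M"
 using sets_special[OF roof_measurable] by (simp add: space_special)

lemma emeasure_M: "A \<in> sets M ==> \<mu> M A = (\<integral>\<^sup>+ x. leb (Pair x -` A) \<partial>Y) / F"
 using emeasure_special[OF roof_measurable] sets_M by (simp add: F_def lborel.emeasure_pair_measure_alt)

lemma flow_preserves_short:
 assumes t: "0 <= t" "t <= c" and A: "A \<in> sets M"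
 shows "\<mu> M {z \<in> space M. T t z \<in> A} = \<mu> M A"
proof -
 have AQ [measurable]: "A \<in> sets (cyl Y)" and Asub: "A <= space M" using A sets_M by auto
 define B where "B = {z \<in> space M. T t z \<in> A}"
 have B: "B \<in> sets M" unfolding B_def using A flow_measurable_at[OF t(1)] by measurable
 define lo hi where "lo x = Pair x -` A Int {t..}" and "hi x = Pair x -` A Int {..<t}" for x
 have sA: "Pair x -` A \<in> sets borel" for x using sets_Pair1[OF AQ, of x] by simp
 have s: "lo x \<in> sets borel" "hi x \<in> sets borel" for x using sA by (auto simp: lo_def hi_def)
 have mlo [measurable]: "(%x. leb (lo x)) \<in> borel_measurable Y"
 proof -
  have "A Int {z \<in> space (cyl Y). t <= snd z} \<in> sets (cyl Y)" by measurable
  from lborel.measurable_emeasure_Pair[OF this] show ?thesis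
   by (rule measurable_cong[THEN iffD1, rotated]) (auto simp: lo_def space_pair_measure intro!: arg_cong[where f = "leb"])
 qed
 have mhi [measurable]: "(%x. leb (hi x)) \<in> borel_measurable Y"
 proof -
  have "A Int {z \<in> space (cyl Y). snd z < t} \<in> sets (cyl Y)" by measurable
  from lborel.measurable_emeasure_Pair[OF this] show ?thesis
   by (rule measurable_cong[THEN iffD1, rotated]) (auto simp: hi_def space_pair_measure intro!: arg_cong[where f = "leb"])
 qed
 have sec: "leb (Pair x -` B) = leb (lo x) + leb (hi (rotation \<alpha> x))"
  if x: "x \<in> space Y" for x
 proof -
  have xc: "x \<in> generic \<alpha>" using x by (simp add: space_circle_base)
  hence fx: "frac x = x" by (simp add: generic_def)
  have rc: "frac (x + \<alpha>) \<in> generic \<alpha>" using generic_frac[OF xc, of 1] by simp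
  have S1: "S (Suc 0) x = f x" "S (Suc (Suc 0)) x = f x + f (frac (x + \<alpha>))" by (simp_all add: birkhoff_def fx)
  have cf: "c <= f x" "c <= f (frac (x + \<alpha>))" using roof_pos[OF xc] roof_pos[OF rc] .
  have T0: "T t (x, u) = (x, u + t)" if "0 <= u" "u + t < f x" for u
   using flow_eval[OF xc, of 0 u t] that t S1 by (simp add: birkhoff_0 fx)
  have T1: "T t (x, u) = (rotation \<alpha> x, u + t - f x)" if "u < f x" "f x <= u + t" for u
   using flow_eval[OF xc, of "Suc 0" u t] that t S1 cf by (simp add: rotation_def)
  have dA: "0 <= s" "s < f y" if "(y, s) \<in> A" for y s using that Asub by (auto simp: space_M)
  have "Pair x -` B = (%s. - t + s) ` lo x Un (%s. (f x - t) + s) ` hi (rotation \<alpha> x)" (is "_ = ?P Un ?Q")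
  proof (intro equalityI subsetI)
   fix u assume "u \<in> Pair x -` B"
   hence u: "0 <= u" "u < f x" "T t (x, u) \<in> A" by (auto simp: B_def space_M)
   show "u \<in> ?P Un ?Q"
   proof (cases "u + t < f x")
    case True
    hence "u + t \<in> lo x" using u T0 by (auto simp: lo_def)
    thus ?thesis by (intro UnI1 image_eqI[of _ _ "u + t"]) auto
   next
    case False
    hence "u + t - f x \<in> hi (rotation \<alpha> x)" using u T1 by (auto simp: hi_def)
    thus ?thesis by (intro UnI2 image_eqI[of _ _ "u + t - f x"]) auto
   qed
  next
   fix u assume "u \<in> ?P Un ?Q"
   thus "u \<in> Pair x -` B"
   proof
    assume "u \<in> ?P"
    hence "(x, u + t) \<in> A" "0 <= u" by (auto simp: lo_def)
    thus ?thesis using T0[of u] dA[of x "u + t"] xc t by (auto simp: B_def space_M)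
   next
    assume "u \<in> ?Q"
    hence h: "(rotation \<alpha> x, u + t - f x) \<in> A" "u < f x" by (auto simp: hi_def)
    thus ?thesis using T1[of u] dA[OF h(1)] xc t cf by (auto simp: B_def space_M)
   qed
  qed
  moreover have "?P Int ?Q = {}"
  proof -
   have "u < f x - t" if "u \<in> ?P" for u using that dA by (auto simp: lo_def)
   moreover have "f x - t <= u" if "u \<in> ?Q" for u using that dA by (auto simp: hi_def)
   ultimately show ?thesis by force
  qed
  hence "leb (?P Un ?Q) = leb ?P + leb ?Q"
   using emeasure_translate(1)[OF s(1), where t = "- t"] emeasure_translate(1)[OF s(2), where t = "f x - t"] by (intro plus_emeasure[symmetric]) auto
  ultimately show ?thesis using emeasure_translate(2)[OF s(1), where t = "- t"] emeasure_translate(2)[OF s(2), where t = "f x - t"] by simp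
 qed
 have "(\<integral>\<^sup>+ x. leb (Pair x -` B) \<partial>Y)
   = (\<integral>\<^sup>+ x. leb (lo x) + leb (hi (rotation \<alpha> x)) \<partial>Y)"
  by (rule nn_integral_cong[OF sec])
 also have "... = (\<integral>\<^sup>+ x. leb (lo x) \<partial>Y) + (\<integral>\<^sup>+ x. leb (hi (rotation \<alpha> x)) \<partial>Y)"
  using measurable_compose[OF rotation_measurable mhi] by (intro nn_integral_add) auto
 also have "(\<integral>\<^sup>+ x. leb (hi (rotation \<alpha> x)) \<partial>Y)
   = (\<integral>\<^sup>+ x. leb (hi x) \<partial>distr Y Y (rotation \<alpha>))"
  by (rule nn_integral_distr[OF rotation_measurable, symmetric]) simp
 also have "... = (\<integral>\<^sup>+ x. leb (hi x) \<partial>Y)" by (simp only: rotation_preserves)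
 also have "(\<integral>\<^sup>+ x. leb (lo x) \<partial>Y) + ... = (\<integral>\<^sup>+ x. leb (lo x) + leb (hi x) \<partial>Y)"
  by (rule nn_integral_add[symmetric]) auto
 also have "... = (\<integral>\<^sup>+ x. leb (Pair x -` A) \<partial>Y)"
 proof (rule nn_integral_cong)
  fix x
  have "lo x Un hi x = Pair x -` A" "lo x Int hi x = {}" by (auto simp: lo_def hi_def)
  thus "leb (lo x) + leb (hi x) = leb (Pair x -` A)"
   using plus_emeasure[of "lo x" lborel "hi x"] s by simp
 qed
 finally show ?thesis using emeasure_M[OF A] emeasure_M[OF B] by (simp add: B_def)
qed

text \<open>Short times compose to long ones; within a short time at most one ceiling is met.\<close>

theorem flow_preserves:
 assumes "0 <= t" "A \<in> sets M"
 shows "\<mu> M {z \<in> space M. T t z \<in> A} = \<mu> M A"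
proof -
 have "\<forall>t A. 0 <= t --> t <= real n * c --> A \<in> sets M --> \<mu> M {z \<in> space M. T t z \<in> A} = \<mu> M A" for n
 proof (induction n)
  case 0
  thus ?case using c_pos flow_preserves_short by simp
 next
  case (Suc n)
  show ?case
  proof (intro allI impI)
   fix t A assume t: "0 <= t" "t <= real (Suc n) * c" and A: "A \<in> sets M"
   show "\<mu> M {z \<in> space M. T t z \<in> A} = \<mu> M A"
   proof (cases "t <= c")
    case True
    thus ?thesis using t A flow_preserves_short by blast
   next
    case False
    hence tc: "0 <= t - c" "t - c <= real n * c" using t by (auto simp: algebra_simps)
    have "{z \<in> space M. T c z \<in> A} \<in> sets M" using A flow_measurable_at[OF less_imp_le[OF c_pos]] by measurable
    hence "\<mu> M {z \<in> space M. T (t - c) z \<in> {z \<in> space M. T c z \<in> A}} = \<mu> M {z \<in> space M. T c z \<in> A}"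
     using Suc.IH tc by blast
    moreover have "T (t - c) z \<in> {z \<in> space M. T c z \<in> A} \<longleftrightarrow> T t z \<in> A" if "z \<in> space M" for z
     using flow_space[OF that tc(1)] flow_add[OF that, of c "t - c"] tc c_pos by simp
    hence "{z \<in> space M. T (t - c) z \<in> {z \<in> space M. T c z \<in> A}} = {z \<in> space M. T t z \<in> A}" by blast
    ultimately show ?thesis using flow_preserves_short[of c A] A c_pos by simp
   qed
  qed
 qed
 moreover obtain n :: nat where "t / c < real n" using reals_Archimedean2 by blast
 hence "t <= real n * c" using c_pos by (simp add: divide_less_eq)
 ultimately show ?thesis using assms by blast
qed

end

section \<open>Shadowing for Kochergin flows\<close>

lemma nn_integral_powr_unit:
 fixes a :: real
 assumes "-1 < a"
 shows "(\<integral>\<^sup>+ x. ennreal (x powr a) * indicator {0..1} x \<partial>lborel) = ennreal (1 / (a + 1))"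
proof -
 have "((%x. x powr a) has_integral (1 powr (a + 1) / (a + 1))) {0..1}"
  using has_integral_powr_from_0[of a 1] assms by simp
 hence "((%x. if x \<in> {0..1} then x powr a else 0) has_integral (1 / (a + 1))) UNIV"
  unfolding has_integral_restrict_UNIV by simp
 from nn_integral_has_integral_lborel[OF _ _ this]
 have "(\<integral>\<^sup>+ x. ennreal (if x \<in> {0..1} then x powr a else 0) \<partial>lborel) = ennreal (1 / (a + 1))" by simp
 moreover have "(\<integral>\<^sup>+ x. ennreal (if x \<in> {0..1} then x powr a else 0) \<partial>lborel) = (\<integral>\<^sup>+ x. ennreal (x powr a) * indicator {0..1} x \<partial>lborel)"
  by (intro nn_integral_cong) (simp add: indicator_def)
 ultimately show ?thesis by simp
qed

lemma nn_integral_powr_both_ends: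
 fixes a :: real
 assumes a: "-1 < a"
 shows "(\<integral>\<^sup>+ x. ennreal (x powr a + (1 - x) powr a) \<partial>circle_base \<alpha>) <= ennreal (2 / (a + 1))"
proof -
 define h where "h x = ennreal (x powr a) * indicator {0..1} x" for x
 have h [measurable]: "h \<in> borel_measurable borel" unfolding h_def by measurable
 have "(\<integral>\<^sup>+ x. ennreal (x powr a + (1 - x) powr a) \<partial>circle_base \<alpha>)
   = (\<integral>\<^sup>+ x. ennreal (x powr a + (1 - x) powr a) * indicator (generic \<alpha>) x \<partial>lborel)"
  unfolding circle_base_def generic_def[symmetric] by (subst nn_integral_restrict_space) auto
 also have "... <= (\<integral>\<^sup>+ x. h x + h (1 + (- 1) * x) \<partial>lborel)"
 proof (rule nn_integral_mono)
  show "ennreal (x powr a + (1 - x) powr a) * indicator (generic \<alpha>) x <= h x + h (1 + (- 1) * x)" for x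
  proof (cases "x \<in> generic \<alpha>")
   case True
   hence "0 < x" "x < 1" using generic_self by auto
   thus ?thesis using True by (simp add: h_def ennreal_plus)
  qed simp
 qed
 also have "... = (\<integral>\<^sup>+ x. h x \<partial>lborel) + (\<integral>\<^sup>+ x. h (1 + (- 1) * x) \<partial>lborel)" by (rule nn_integral_add) auto
 also have "(\<integral>\<^sup>+ x. h (1 + (- 1) * x) \<partial>lborel) = (\<integral>\<^sup>+ x. h x \<partial>lborel)"
  using nn_integral_real_affine[of h "- 1" 1] by simp
 also have "(\<integral>\<^sup>+ x. h x \<partial>lborel) = ennreal (1 / (a + 1))" unfolding h_def by (rule nn_integral_powr_unit[OF a])
 also have "ennreal (1 / (a + 1)) + ennreal (1 / (a + 1)) = ennreal (2 / (a + 1))"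
  using a by (simp add: ennreal_plus[symmetric] del: ennreal_plus)
 finally show ?thesis .
qed

lemma nn_integral_rotation:
 assumes h: "h \<in> borel_measurable (circle_base \<alpha>)"
 shows "(\<integral>\<^sup>+ x. h (frac (x + real i * \<alpha>)) \<partial>circle_base \<alpha>) = (\<integral>\<^sup>+ x. h x \<partial>circle_base \<alpha>)"
proof -
 have "(\<integral>\<^sup>+ x. h ((rotation \<alpha> ^^ i) x) \<partial>circle_base \<alpha>) = (\<integral>\<^sup>+ x. h x \<partial>circle_base \<alpha>)"
  using h
 proof (induction i arbitrary: h)
  case (Suc i)
  have "(\<integral>\<^sup>+ x. h ((rotation \<alpha> ^^ Suc i) x) \<partial>circle_base \<alpha>) = (\<integral>\<^sup>+ x. (%y. h (rotation \<alpha> y)) ((rotation \<alpha> ^^ i) x) \<partial>circle_base \<alpha>)"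
   by simp
  also have "... = (\<integral>\<^sup>+ x. h (rotation \<alpha> x) \<partial>circle_base \<alpha>)"
   by (rule Suc.IH) (rule measurable_compose[OF rotation_measurable Suc.prems])
  also have "... = (\<integral>\<^sup>+ x. h x \<partial>distr (circle_base \<alpha>) (circle_base \<alpha>) (rotation \<alpha>))"
   by (rule nn_integral_distr[OF rotation_measurable, symmetric]) (use Suc.prems in simp)
  finally show ?case by (simp only: rotation_preserves)
 qed simp
 moreover have "(rotation \<alpha> ^^ i) x = frac (x + real i * \<alpha>)" if "x \<in> space (circle_base \<alpha>)" for x
  using that by (intro rotation_funpow) (auto simp: space_circle_base generic_def)
 ultimately show ?thesis by (simp cong: nn_integral_cong)
qed

text \<open>Outside \<open>X\<close>, the interval of radius \<open>\<rho>\<close> around a point is moved by the first \<open>t\<close> rotations as a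
 whole, and the Birkhoff sums vary on it by less than \<open>\<xi>\<close>.\<close>

definition shadowed :: "real => (real => real) => real => real => real => real => bool" where
 "shadowed \<alpha> f t \<rho> kap \<xi> \<longleftrightarrow>
  (\<exists>X\<in>sets (circle_base \<alpha>). \<mu> (circle_base \<alpha>) X <= ennreal kap &
   (\<forall>x\<in>generic \<alpha> - X. \<forall>y y' n. abs (y - x) <= \<rho> --> abs (y' - x) <= \<rho> --> real n <= t -->
     abs (birkhoff \<alpha> f n y - birkhoff \<alpha> f n y') < \<xi> & abs (frac (y + real n * \<alpha>) - frac (y' + real n * \<alpha>)) <= 2 * \<rho>))"

text \<open>A typical orbit of length \<open>R\<close> stays at distance \<open>\<delta>\<close>, slightly less than \<open>1 / R\<close>, from the singularity. The sum of the
 derivatives of the roof along it is therefore \<open>O (R powr (1 + \<gamma>))\<close> up to small powers, and \<open>\<rho>\<close> times this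
 tends to 0.\<close>

lemma kochergin_shadowing:
 assumes roof: "kochergin_roof \<gamma> f" and \<sigma>: "0 < \<sigma>" "\<sigma> <= 1" and c: "0 < c" and kap: "0 < kap" and \<xi>: "0 < \<xi>"
 shows "\<exists>R0. \<forall>R\<ge>R0. \<forall>\<rho>. 0 < \<rho> --> \<rho> <= R powr - (1 + \<gamma> + \<sigma>) -->
  shadowed \<alpha> f (R / c + 2) \<rho> kap \<xi>"
proof -
 let ?Y = "circle_base \<alpha>"
 have \<gamma>: "0 < \<gamma>" "\<gamma> < 1" using roof by (auto simp: kochergin_roof_def)
 have C2: "C2_on_unit_interval f" using roof by (auto simp: kochergin_roof_def singular_roof_def)
 obtain cf C where C: "0 < C" and df: "!!x. x \<in> {0<..<1} ==> abs (deriv f x) <= C * (x powr (-\<gamma>-1) + (1 - x) powr (-\<gamma>-1))"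
  by (rule kochergin_roof_bounds[OF roof]) blast
 define s where "s = \<sigma> / 8"
 have s: "0 < s" "s < 1" using \<sigma> by (auto simp: s_def)
 define e where "e = 1 - (1 + \<gamma> + \<sigma>) + (1 + \<sigma> / 2) * (\<gamma> + s)"
 have e: "e < 0"
 proof -
  have "e = - \<sigma> + \<sigma> / 2 * \<gamma> + s + \<sigma> * s / 2" by (simp add: e_def algebra_simps)
  moreover have "\<sigma> / 2 * \<gamma> <= \<sigma> / 2 * 1" using \<gamma> \<sigma> by (intro mult_left_mono) auto
  moreover have "\<sigma> * s <= 1 * s" using \<sigma> s by (intro mult_right_mono) auto
  moreover have "\<sigma> = 8 * s" by (simp add: s_def)
  ultimately show ?thesis using s by linarith
 qed
 define W where "W R = (1 / c + 5) * (2 * R powr (- \<sigma> / 2) + 16 * C / (\<xi> * s) * R powr e)" for R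
 have "(W \<longlongrightarrow> (1 / c + 5) * (2 * 0 + 16 * C / (\<xi> * s) * 0)) at_top"
  unfolding W_def using e \<sigma> by (intro tendsto_intros tendsto_neg_powr filterlim_ident) auto
 hence "\<forall>\<^sub>F R in at_top. W R < kap" using kap by (intro order_tendstoD(2)) auto
 moreover have "\<forall>\<^sub>F R in at_top. R powr - (1 + \<gamma> + \<sigma>) < R powr (- 1 - \<sigma> / 2) / 2" using \<gamma> \<sigma> by real_asymp
 moreover have "\<forall>\<^sub>F R in at_top. R powr (- 1 - \<sigma> / 2) < 1 / 2" using \<sigma> by real_asymp
 moreover have "\<forall>\<^sub>F R in at_top. (1::real) <= R" by (rule eventually_ge_at_top)
 ultimately have "\<forall>\<^sub>F R in at_top. W R < kap & R powr - (1 + \<gamma> + \<sigma>) < R powr (- 1 - \<sigma> / 2) / 2 & R powr (- 1 - \<sigma> / 2) < 1 / 2 & 1 <= R"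
  by eventually_elim auto
 then obtain R0 where R0: "!!R. R0 <= R ==> W R < kap & R powr - (1 + \<gamma> + \<sigma>) < R powr (- 1 - \<sigma> / 2) / 2 & R powr (- 1 - \<sigma> / 2) < 1 / 2 & 1 <= R"
  by (auto simp: eventually_at_top_linorder)
 show ?thesis
 proof (intro exI[of _ R0] allI impI)
  fix R \<rho> assume "R0 <= R" and \<rho>: "0 < \<rho>" "\<rho> <= R powr - (1 + \<gamma> + \<sigma>)"
  hence WR: "W R < kap" and R1: "1 <= R" using R0 by auto
  \<comment> \<open>Orbits that come within \<open>\<delta>\<close> of the singularity are discarded; on the others the derivative is
   controlled by the integrable function \<open>h\<close>.\<close>
  define \<delta> where "\<delta> = R powr (- 1 - \<sigma> / 2)"
  have \<delta>: "0 < \<delta>" "\<rho> < \<delta> / 2" "\<delta> < 1 / 2" using R0[OF \<open>R0 \<le> R\<close>] \<rho> by (auto simp: \<delta>_def)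
  define g where "g y = y powr (-\<gamma>-1) + (1 - y) powr (-\<gamma>-1)" for y :: real
  define A where "A = 8 * C * \<rho> / \<xi>"
  have A: "0 < A" using C \<rho> \<xi> by (simp add: A_def)
  define h where "h y = (if y < \<delta> \<or> 1 - \<delta> < y then 1 else A * g y)" for y
  have h0: "0 <= h y" for y using A by (simp add: h_def g_def)
  have hm: "h \<in> borel_measurable borel" unfolding h_def g_def by measurable
  let ?I = "indicator ({..<\<delta>} Un {1 - \<delta><..}) :: real => ennreal" and ?u = "%x. ennreal (x powr (s - 1) + (1 - x) powr (s - 1))"
   and ?K = "ennreal (A * \<delta> powr (- \<gamma> - s))" and ?B = "2 * \<delta> + A * \<delta> powr (- \<gamma> - s) * (2 / s)"
   and ?h = "%i x. h (frac (x + real i * \<alpha>))"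
  define n1 where "n1 = nat \<lfloor>R / c\<rfloor> + 4"
  have n1: "real n1 <= (1 / c + 5) * R"
  proof -
   have "0 <= R / c" using R1 c by simp
   hence "real n1 <= R / c + 4" by (simp add: n1_def)
   thus ?thesis using R1 by (simp add: algebra_simps)
  qed
  define H where "H x = (\<Sum>i<n1. ?h i x)" for x
  have hc: "(%x. ?h i x) \<in> borel_measurable ?Y" for i
  proof -
   have "(%x. frac (x + real i * \<alpha>)) \<in> borel_measurable borel" unfolding frac_def by measurable
   from measurable_compose[OF measurable_compose[OF circle_base_borel this] hm] show ?thesis .
  qed
  have Hm: "H \<in> borel_measurable ?Y" unfolding H_def using hc by (intro borel_measurable_sum)
  define X where "X = {x \<in> space ?Y. 1 <= ennreal (H x)}"
  have X: "X \<in> sets ?Y" unfolding X_def using Hm by measurable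
  have int_h: "(\<integral>\<^sup>+ x. ennreal (h x) \<partial>?Y) <= ennreal ?B"
  proof -
   have "(\<integral>\<^sup>+ x. ennreal (h x) \<partial>?Y)
    <= (\<integral>\<^sup>+ x. ?I x + ?K * ?u x \<partial>?Y)"
   proof (rule nn_integral_mono)
    fix x assume "x \<in> space ?Y"
    hence x: "0 < x" "x < 1" using generic_self[of x \<alpha>] by (auto simp: space_circle_base)
    show "ennreal (h x) <= ?I x + ?K * ?u x"
    proof (cases "x < \<delta> \<or> 1 - \<delta> < x")
     case False
     have b: "y powr (-\<gamma>-1) <= \<delta> powr (-\<gamma>-s) * y powr (s - 1)" if "\<delta> <= y" for y
     proof -
      have "y powr (-\<gamma>-1) = y powr (-\<gamma>-s) * y powr (s - 1)" by (simp add: powr_add[symmetric])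
      also have "... <= \<delta> powr (-\<gamma>-s) * y powr (s - 1)"
       using that \<delta> \<gamma> s by (intro mult_right_mono powr_mono2') auto
      finally show ?thesis .
     qed
     have "g x <= \<delta> powr (-\<gamma>-s) * (x powr (s - 1) + (1 - x) powr (s - 1))"
      using b[of x] b[of "1 - x"] False by (simp add: g_def distrib_left)
     hence "h x <= A * \<delta> powr (- \<gamma> - s) * (x powr (s - 1) + (1 - x) powr (s - 1))"
      using False A by (simp add: h_def mult.assoc)
     hence "ennreal (h x) <= ?K * ?u x"
      using A by (simp add: ennreal_mult[symmetric] ennreal_leI del: ennreal_plus)
     thus ?thesis by (simp add: add_increasing)
    qed (simp add: h_def add_increasing2)
   qed
   also have "... = (\<integral>\<^sup>+ x. ?I x \<partial>?Y)
     + (\<integral>\<^sup>+ x. ?K * ?u x \<partial>?Y)"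
   proof (rule nn_integral_add)
    have 1: "(%x. ?I x) \<in> borel_measurable borel"
     "(%x. ?K * ?u x) \<in> borel_measurable borel" by measurable
    show "(%x. ?I x) \<in> borel_measurable ?Y"
     "(%x. ?K * ?u x) \<in> borel_measurable ?Y"
     by (rule measurable_compose[OF circle_base_borel 1(1)], rule measurable_compose[OF circle_base_borel 1(2)])
   qed
   also have "(\<integral>\<^sup>+ x. ?K * ?u x \<partial>?Y)
     = ?K * (\<integral>\<^sup>+ x. ?u x \<partial>?Y)"
   proof (rule nn_integral_cmult)
    have "(%x. ?u x) \<in> borel_measurable borel" by measurable
    from measurable_compose[OF circle_base_borel this]
    show "(%x. ?u x) \<in> borel_measurable ?Y" .
   qed
   also have "(\<integral>\<^sup>+ x. ?I x \<partial>?Y)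
     + ?K * (\<integral>\<^sup>+ x. ?u x \<partial>?Y)
     <= ennreal (2 * \<delta>) + ?K * ennreal (2 / s)"
   proof (rule add_mono)
    show "?K * (\<integral>\<^sup>+ x. ?u x \<partial>?Y)
      <= ?K * ennreal (2 / s)"
     using nn_integral_powr_both_ends[of "s - 1" \<alpha>] s by (intro mult_left_mono) auto
   show "(\<integral>\<^sup>+ x. ?I x \<partial>?Y) <= ennreal (2 * \<delta>)"
   proof -
    have "(\<integral>\<^sup>+ x. ?I x \<partial>?Y)
     = (\<integral>\<^sup>+ x. ?I x * indicator (generic \<alpha>) x \<partial>lborel)"
     unfolding circle_base_def generic_def[symmetric] by (subst nn_integral_restrict_space) auto
    also have "... <= (\<integral>\<^sup>+ x. indicator ({0..\<delta>} Un {1 - \<delta>..1}) x \<partial>lborel)"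
     by (intro nn_integral_mono) (auto simp: indicator_def dest: generic_self)
    also have "... = leb ({0..\<delta>} Un {1 - \<delta>..1})" by (rule nn_integral_indicator) simp
    also have "... <= leb {0..\<delta>} + leb {1 - \<delta>..1}" by (rule emeasure_subadditive) auto
    also have "... = ennreal (2 * \<delta>)" using \<delta> by (simp add: ennreal_plus[symmetric] del: ennreal_plus)
    finally show ?thesis .
   qed
   qed
   also have "... = ennreal ?B"
    using \<delta> A s by (simp add: ennreal_mult[symmetric] ennreal_plus[symmetric] del: ennreal_plus)
   finally show ?thesis .
  qed
  have "\<mu> ?Y X <= (\<integral>\<^sup>+ x. ennreal (H x) \<partial>?Y)"
  proof -
   have "\<mu> ?Y X = (\<integral>\<^sup>+ x. indicator X x \<partial>?Y)" using X by simp
   also have "... <= (\<integral>\<^sup>+ x. ennreal (H x) \<partial>?Y)" by (intro nn_integral_mono) (auto simp: X_def indicator_def)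
   finally show ?thesis .
  qed
  also have "... = (\<integral>\<^sup>+ x. (\<Sum>i<n1. ennreal (?h i x)) \<partial>?Y)"
   unfolding H_def using h0 by (simp add: sum_ennreal)
  also have "... = (\<Sum>i<n1. \<integral>\<^sup>+ x. ennreal (?h i x) \<partial>?Y)"
   using hc by (intro nn_integral_sum) auto
  also have "... = (\<Sum>i<n1. \<integral>\<^sup>+ x. ennreal (h x) \<partial>?Y)"
  proof (intro sum.cong refl)
   fix i
   have "(%x. ennreal (h x)) \<in> borel_measurable ?Y" using measurable_compose[OF circle_base_borel hm] by simp
   from nn_integral_rotation[OF this] show "(\<integral>\<^sup>+ x. ennreal (?h i x) \<partial>?Y) = (\<integral>\<^sup>+ x. ennreal (h x) \<partial>?Y)" .
  qed
  also have "... <= (\<Sum>i<n1. ennreal ?B)" by (intro sum_mono int_h)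
  also have "... = ennreal (real n1 * ?B)"
   by (simp add: ennreal_mult' ennreal_of_nat_eq_real_of_nat)
  also have "... <= ennreal kap"
  proof (rule ennreal_leI)
   have "real n1 * ?B <= ((1 / c + 5) * R) * ?B"
    using n1 \<delta> A s by (intro mult_right_mono) auto
   also have "... = (1 / c + 5) * (2 * (R * \<delta>) + R * A * \<delta> powr (- \<gamma> - s) * (2 / s))" by (simp add: algebra_simps)
   also have "... <= W R"
    unfolding W_def
   proof (intro mult_left_mono add_mono)
    have "R * \<delta> = R powr 1 * R powr (- 1 - \<sigma> / 2)" using R1 by (simp add: \<delta>_def)
    also have "... = R powr (- \<sigma> / 2)" unfolding powr_add[symmetric] by simp
    finally show "R * \<delta> <= R powr (- \<sigma> / 2)" by simp
    have "R * \<rho> * \<delta> powr (- \<gamma> - s) <= R powr 1 * R powr - (1 + \<gamma> + \<sigma>) * R powr ((- 1 - \<sigma> / 2) * (- \<gamma> - s))"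
     using \<rho> R1 by (intro mult_mono) (auto simp: \<delta>_def powr_powr)
    also have "... = R powr e" unfolding powr_add[symmetric] e_def by (rule arg_cong[where f = "(powr) R"]) (simp add: field_simps)
    finally have "R * \<rho> * \<delta> powr (- \<gamma> - s) <= R powr e" .
    hence "16 * C / (\<xi> * s) * (R * \<rho> * \<delta> powr (- \<gamma> - s)) <= 16 * C / (\<xi> * s) * R powr e"
     using C \<xi> s by (intro mult_left_mono) auto
    thus "R * A * \<delta> powr (- \<gamma> - s) * (2 / s) <= 16 * C / (\<xi> * s) * R powr e"
     by (simp add: A_def field_simps)
   qed (use c in auto)
   finally show "real n1 * ?B <= kap" using WR by simp
  qed
  finally have Xk: "\<mu> ?Y X <= ennreal kap" .
  have main: "abs (birkhoff \<alpha> f n y - birkhoff \<alpha> f n y') < \<xi> & abs (frac (y + real n * \<alpha>) - frac (y' + real n * \<alpha>)) <= 2 * \<rho>"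
   if x: "x \<in> generic \<alpha> - X" and y: "abs (y - x) <= \<rho>" "abs (y' - x) <= \<rho>" and n: "real n <= R / c + 2" for x y y' n
  proof -
   have nn1: "n < n1"
   proof -
    have "0 <= R / c" using R1 c by simp
    hence "R / c + 2 < real n1" unfolding n1_def by linarith
    thus ?thesis using n by linarith
   qed
   have "\<not> 1 <= ennreal (H x)" using x by (auto simp: X_def space_circle_base)
   hence H1: "H x < 1" by (simp add: not_le)
   define p where "p i = frac (x + real i * \<alpha>)" for i
   have hi: "h (p i) <= H x" if "i < n1" for i
    unfolding H_def p_def using that h0 by (intro member_le_sum) auto
   have p: "\<delta> <= p i" "p i <= 1 - \<delta>" if "i < n1" for i
    using hi[OF that] H1 by (auto simp: h_def split: if_splits)
   have sumg: "A * (\<Sum>i<n. g (p i)) < 1"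
   proof -
    have "A * (\<Sum>i<n. g (p i)) = (\<Sum>i<n. h (p i))"
     unfolding sum_distrib_left
    proof (intro sum.cong refl)
     fix i assume "i \<in> {..<n}"
     thus "A * g (p i) = h (p i)" using p[of i] nn1 by (simp add: h_def not_less)
    qed
    also have "... <= H x" unfolding H_def p_def using nn1 h0 by (intro sum_mono2) auto
    finally show ?thesis using H1 by simp
   qed
   have fr: "frac (z + real i * \<alpha>) = p i + (z - x)" if "abs (z - x) <= \<rho>" "i < n1" for z i
    using p[OF that(2)] that(1) \<delta> by (intro frac_eqI[where z = "\<lfloor>x + real i * \<alpha>\<rfloor>"]) (auto simp: p_def frac_def)
   have dif: "abs (f (frac (y + real i * \<alpha>)) - f (frac (y' + real i * \<alpha>))) <= 8 * C * \<rho> * g (p i)" if i: "i < n" for i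
   proof -
    have i1: "i < n1" using i nn1 by simp
    define a b where "a = p i + (y - x)" and "b = p i + (y' - x)"
    have "abs (f b - f a) <= (4 * C * g (p i)) * abs (b - a)"
    proof -
     have seg: "t \<in> {0<..<1} & p i / 2 <= t & (1 - p i) / 2 <= 1 - t" if "t \<in> closed_segment a b" for t
     proof -
      have "abs (t - p i) <= \<rho>" using that y by (auto simp: closed_segment_eq_real_ivl a_def b_def split: if_splits)
      thus ?thesis using p[OF i1] \<delta> by auto
     qed
     have half: "t powr (-\<gamma>-1) <= 4 * v powr (-\<gamma>-1)" if "0 < v" "v / 2 <= t" for t v
     proof -
      have "t powr (-\<gamma>-1) <= (v / 2) powr (-\<gamma>-1)" using that \<gamma> by (intro powr_mono2') auto
      also have "... = v powr (-\<gamma>-1) * 2 powr (\<gamma> + 1)"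
      proof -
       have "2 powr (\<gamma> + 1) = 1 / 2 powr (-\<gamma>-1)" using powr_minus_divide[of 2 "-\<gamma>-1"] by (simp add: add.commute)
       thus ?thesis using that by (simp add: powr_divide)
      qed
      also have "... <= v powr (-\<gamma>-1) * 2 powr 2" using \<gamma> by (intro mult_left_mono powr_mono) auto
      finally show ?thesis by simp
     qed
     have "norm (f b - f a) <= (4 * C * g (p i)) * norm (b - a)"
     proof (rule field_differentiable_bound[where S = "closed_segment a b" and f' = "deriv f"])
      fix t assume t: "t \<in> closed_segment a b"
      show "(f has_field_derivative deriv f t) (at t within closed_segment a b)"
       using C2_on_unit_intervalD[OF C2, of t] seg[OF t] by (auto intro: has_field_derivative_at_within)
      have "abs (deriv f t) <= C * (t powr (-\<gamma>-1) + (1 - t) powr (-\<gamma>-1))" using df seg[OF t] by blast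
      also have "... <= C * (4 * p i powr (-\<gamma>-1) + 4 * (1 - p i) powr (-\<gamma>-1))"
       using C seg[OF t] p[OF i1] \<delta> by (intro mult_left_mono add_mono half) auto
      finally show "norm (deriv f t) <= 4 * C * g (p i)" by (simp add: g_def algebra_simps)
     qed auto
     thus ?thesis by simp
    qed
    also have "... <= (4 * C * g (p i)) * (2 * \<rho>)" using y C by (intro mult_left_mono) (auto simp: a_def b_def g_def)
    finally show ?thesis using fr[OF y(1) i1] fr[OF y(2) i1] by (simp add: a_def b_def abs_minus_commute mult_ac)
   qed
   have "abs (birkhoff \<alpha> f n y - birkhoff \<alpha> f n y') <= (\<Sum>i<n. abs (f (frac (y + real i * \<alpha>)) - f (frac (y' + real i * \<alpha>))))"
    unfolding birkhoff_def sum_subtractf[symmetric] by (rule sum_abs)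
   also have "... <= (\<Sum>i<n. 8 * C * \<rho> * g (p i))" using dif by (intro sum_mono) auto
   also have "... = \<xi> * (A * (\<Sum>i<n. g (p i)))" using \<xi> by (simp add: A_def sum_distrib_left[symmetric])
   also have "... < \<xi> * 1" using sumg \<xi> by (intro mult_strict_left_mono) auto
   finally have "abs (birkhoff \<alpha> f n y - birkhoff \<alpha> f n y') < \<xi>" by simp
   moreover have "abs (frac (y + real n * \<alpha>) - frac (y' + real n * \<alpha>)) <= 2 * \<rho>"
    using fr[OF y(1) nn1] fr[OF y(2) nn1] y by simp
   ultimately show ?thesis by simp
  qed
  show "shadowed \<alpha> f (R / c + 2) \<rho> kap \<xi>"
   unfolding shadowed_def
   using main by (intro bexI[OF _ X] conjI Xk) blast
 qed
qed

section \<open>Sections and compact parts of the flow space\<close>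

context roof_flow begin

lemma area_eq: "F = (\<integral>\<^sup>+ x. ennreal (f x) \<partial>Y)"
proof -
 have "F = (\<integral>\<^sup>+ x. leb (Pair x -` special_space Y f) \<partial>Y)"
  unfolding F_def by (rule lborel.emeasure_pair_measure_alt[OF special_space_measurable[OF roof_measurable]])
 also have "... = (\<integral>\<^sup>+ x. ennreal (f x) \<partial>Y)"
 proof (rule nn_integral_cong)
  fix x assume x: "x \<in> space Y"
  hence "Pair x -` special_space Y f = {0..<f x}" by (auto simp: special_space_def)
  moreover have "0 < f x" using roof_pos[of x] c_pos x by (simp add: space_circle_base)
  ultimately show "leb (Pair x -` special_space Y f) = ennreal (f x)" by simp
 qed
 finally show ?thesis .
qed

lemma prob_space_M:
 assumes "F < \<infinity>"
 shows "prob_space M"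
proof
 have "\<mu> M (space M) = F / F"
  using emeasure_special[OF roof_measurable sets.top] unfolding F_def by (simp only: space_special)
 also have "F / F = 1" using F_ge c_pos assms by (intro ennreal_divide_self) (auto simp: ennreal_neq_top top_unique)
 finally show "\<mu> M (space M) = 1" .
qed

lemma kochergin_area_finite:
 assumes "kochergin_roof \<gamma> f"
 shows "F < \<infinity>"
proof -
 have \<gamma>: "0 < \<gamma>" "\<gamma> < 1" using assms by (auto simp: kochergin_roof_def)
 obtain c1 C where C: "0 < C" and fC: "!!x. x \<in> {0<..<1} ==> f x <= C * (x powr (-\<gamma>) + (1 - x) powr (-\<gamma>))"
  by (rule kochergin_roof_bounds[OF assms]) blast
 have "F <= (\<integral>\<^sup>+ x. ennreal C * ennreal (x powr (-\<gamma>) + (1 - x) powr (-\<gamma>)) \<partial>Y)"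
  unfolding area_eq
 proof (rule nn_integral_mono)
  fix x assume "x \<in> space Y"
  hence "f x <= C * (x powr (-\<gamma>) + (1 - x) powr (-\<gamma>))" using generic_self[of x \<alpha>] by (intro fC) (simp add: space_circle_base)
  thus "ennreal (f x) <= ennreal C * ennreal (x powr (-\<gamma>) + (1 - x) powr (-\<gamma>))"
   using C by (simp add: ennreal_mult[symmetric] ennreal_leI del: ennreal_plus)
 qed
 also have "... = ennreal C * (\<integral>\<^sup>+ x. ennreal (x powr (-\<gamma>) + (1 - x) powr (-\<gamma>)) \<partial>Y)"
 proof (rule nn_integral_cmult)
  have "(%x. ennreal (x powr (-\<gamma>) + (1 - x) powr (-\<gamma>))) \<in> borel_measurable borel" by measurable
  from measurable_compose[OF circle_base_borel this]
  show "(%x. ennreal (x powr (-\<gamma>) + (1 - x) powr (-\<gamma>))) \<in> borel_measurable Y" .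
 qed
 also have "... <= ennreal C * ennreal (2 / (- \<gamma> + 1))"
  using nn_integral_powr_both_ends[of "-\<gamma>" \<alpha>] \<gamma> by (intro mult_left_mono) auto
 also have "... < \<infinity>" by (simp add: ennreal_mult_less_top)
 finally show ?thesis .
qed

lemma sets_M_borel:
 assumes "A \<in> sets M"
 shows "A \<in> sets borel"
proof (cases "generic \<alpha> = {}")
 case True
 hence "A = {}" using sets.sets_into_space[OF assms] by (auto simp: space_M)
 thus ?thesis by simp
next
 case False
 then obtain x0 where x0: "x0 \<in> generic \<alpha>" by auto
 define h where "h z = (if fst z \<in> generic \<alpha> then fst z else x0, snd z)" for z :: "real \<times> real"
 have [measurable]: "(fst :: real \<times> real => real) \<in> borel_measurable borel" "(snd :: real \<times> real => real) \<in> borel_measurable borel"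
  by (simp_all add: borel_measurable_continuous_onI continuous_on_fst continuous_on_snd)
 have "(%z :: real \<times> real. if fst z \<in> generic \<alpha> then fst z else x0) \<in> borel \<rightarrow>\<^sub>M Y"
 proof (rule measurable_into_circle_base)
  show "(%z :: real \<times> real. if fst z \<in> generic \<alpha> then fst z else x0) \<in> borel_measurable borel" by measurable
 qed (use x0 in auto)
 hence "h \<in> borel \<rightarrow>\<^sub>M cyl Y" unfolding h_def by (intro measurable_Pair) simp_all
 moreover have "A \<in> sets (cyl Y)" using assms sets_M by blast
 ultimately have 1: "h -` A Int space borel \<in> sets borel" by (rule measurable_sets)
 have 2: "{z :: real \<times> real. fst z \<in> generic \<alpha>} \<in> sets borel"
  using measurable_sets[of "fst :: real \<times> real => real" borel borel "generic \<alpha>"] by (simp add: vimage_def)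
 have 3: "A = (h -` A Int space borel) Int {z. fst z \<in> generic \<alpha>}"
  using sets.sets_into_space[OF assms] by (fastforce simp: h_def space_M)
 show ?thesis by (subst 3) (rule sets.Int[OF 1 2])
qed

lemma id_borel: "(%z. z) \<in> M \<rightarrow>\<^sub>M borel"
proof -
 have "(%z. (fst z, snd z)) \<in> M \<rightarrow>\<^sub>M borel" by (rule borel_measurable_Pair) measurable
 thus ?thesis by simp
qed

text \<open>Inner regularity of the distribution on the plane, which is a Polish space.\<close>

lemma inner_compact:
 assumes fin: "\<mu> M (space M) ~= \<infinity>" and B: "B \<in> sets M" and kap: "0 < kap"
 obtains K where "K <= B" "compact K" "K \<in> sets M" "\<mu> M (B - K) <= ennreal kap"
proof -
 define D where "D = distr M borel (%z. z)"
 have eD: "\<mu> D A = \<mu> M (A Int space M)" if "A \<in> sets borel" for A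
  unfolding D_def using that emeasure_distr[OF id_borel that] by (simp add: vimage_def Int_def conj_commute)
 have Bb: "B \<in> sets borel" and Bsub: "B <= space M" using sets_M_borel[OF B] sets.sets_into_space[OF B] by auto
 have Bfin: "\<mu> M B ~= \<infinity>" using emeasure_space[of M B] fin by (auto simp: top_unique)
 have "\<mu> D B = (SUP K\<in>{K. K <= B & compact K}. \<mu> D K)"
 proof (rule inner_regular)
  show "\<mu> D (space D) ~= \<infinity>" using eD[of UNIV] fin by (simp add: D_def)
 qed (use Bb in \<open>simp_all add: D_def\<close>)
 moreover have "\<mu> D B ~= \<infinity>" using eD[OF Bb] Bfin Bsub by (simp add: Int_absorb2)
 ultimately obtain K where K: "K <= B" "compact K" and le: "\<mu> D B < \<mu> D K + ennreal kap"
 proof -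
  assume a: "!!K. K <= B ==> compact K ==> \<mu> D B < \<mu> D K + ennreal kap ==> thesis"
   and SUP: "\<mu> D B = (SUP K\<in>{K. K <= B & compact K}. \<mu> D K)" and fB: "\<mu> D B ~= \<infinity>"
  have "\<exists>K\<in>{K. K <= B & compact K}. \<mu> D B < \<mu> D K + ennreal kap"
   by (rule SUP_approx_ennreal[OF _ _ SUP fB]) (use kap in auto)
  thus thesis using a by blast
 qed
 have Kb: "K \<in> sets borel" using K(2) by (simp add: compact_imp_closed)
 have KM: "K \<in> sets M"
 proof -
  have "(%z. z) -` K Int space M \<in> sets M" by (rule measurable_sets[OF id_borel Kb])
  moreover have "(%z. z) -` K Int space M = K" using K(1) Bsub by auto
  ultimately show ?thesis by simp
 qed
 have Kfin: "\<mu> M K ~= \<infinity>" using emeasure_mono[OF K(1) B] Bfin by (auto simp: top_unique)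
 have "\<mu> M (B - K) = \<mu> M B - \<mu> M K" by (rule emeasure_Diff[OF Kfin B KM K(1)])
 also have "... <= ennreal kap"
 proof -
  have "\<mu> D B = \<mu> M B" "\<mu> D K = \<mu> M K"
   using eD[OF Bb] eD[OF Kb] K(1) Bsub by (simp_all add: Int_absorb2 subset_trans)
  hence "\<mu> M B <= ennreal kap + \<mu> M K" using le by (simp add: add.commute less_imp_le)
  thus ?thesis using Bfin by (subst ennreal_minus_le_iff) (auto simp: add.commute)
 qed
 finally show thesis using that K KM by blast
qed

definition edge :: "real => (real \<times> real) set" where
 "edge \<xi> = {z \<in> space M. snd z < \<xi> \<or> f (fst z) < snd z + \<xi>}"

lemma roof_fst [measurable]: "(%z. f (fst z)) \<in> borel_measurable M"
 by (rule measurable_compose[OF fst_M roof_measurable])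

lemma edge_sets [measurable]: "edge \<xi> \<in> sets M"
 unfolding edge_def by measurable

lemma emeasure_edge:
 assumes \<xi>: "0 < \<xi>"
 shows "\<mu> M (edge \<xi>) <= ennreal (2 * \<xi> / c)"
proof -
 have "\<mu> M (edge \<xi>) = (\<integral>\<^sup>+ x. leb (Pair x -` edge \<xi>) \<partial>Y) / F" by (rule emeasure_M[OF edge_sets])
 also have "... <= (\<integral>\<^sup>+ x. ennreal (2 * \<xi>) \<partial>Y) / F"
 proof (intro divide_right_mono_ennreal nn_integral_mono)
  fix x
  have "leb (Pair x -` edge \<xi>) <= leb ({0..\<xi>} Un {f x - \<xi>..f x})"
   by (intro emeasure_mono) (auto simp: edge_def space_M)
  also have "... <= leb {0..\<xi>} + leb {f x - \<xi>..f x}" by (rule emeasure_subadditive) auto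
  also have "... = ennreal (2 * \<xi>)" using \<xi> by (simp add: ennreal_plus[symmetric] del: ennreal_plus)
  finally show "leb (Pair x -` edge \<xi>) <= ennreal (2 * \<xi>)" .
 qed
 also have "... = ennreal (2 * \<xi>) / F" using prob_space.emeasure_space_1[OF circle_base_prob[of \<alpha>]] by simp
 also have "... <= ennreal (2 * \<xi>) / ennreal c" using F_ge c_pos by (intro divide_antimono_ennreal) auto
 also have "... = ennreal (2 * \<xi> / c)" using \<xi> c_pos by (simp add: divide_ennreal)
 finally show ?thesis .
qed

text \<open>Away from the floor and the ceiling, a shadowing orbit has crossed the same number of floors.\<close>

lemma flow_shadow:
 assumes y: "y \<in> generic \<alpha>" "y' \<in> generic \<alpha>" and u: "0 <= u" "u < c" and r: "0 <= r" "r <= R"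
  and close: "!!n. real n <= R / c + 2 ==> abs (S n y - S n y') < \<xi> & abs (frac (y + real n * \<alpha>) - frac (y' + real n * \<alpha>)) <= \<rho>"
  and off: "T r (y, u) \<notin> edge \<xi>"
 shows "abs (fst (T r (y, u)) - fst (T r (y', u))) <= \<rho>" "abs (snd (T r (y, u)) - snd (T r (y', u))) < \<xi>"
proof -
 have sp: "(y, u) \<in> space M" using y(1) u roof_pos[OF y(1)] by (simp add: space_M)
 obtain n where n: "S n y <= u + r" "u + r < S (Suc n) y" "T r (y, u) = (frac (y + real n * \<alpha>), u + r - S n y)"
  using flow_step[OF sp r(1)] by blast
 have "c * (real n - 1) <= R" using floors_le_time[OF sp r(1) n(1)] r(2) by linarith
 hence "real n - 1 <= R / c" using c_pos by (simp add: pos_le_divide_eq mult.commute)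
 hence nR: "real n <= R / c + 2" "real (Suc n) <= R / c + 2" by simp_all
 have "T r (y, u) \<in> space M" by (rule flow_space[OF sp r(1)])
 hence e: "\<xi> <= u + r - S n y" "u + r - S n y + \<xi> <= f (frac (y + real n * \<alpha>))"
  using off by (auto simp: edge_def n(3))
 have "T r (y', u) = (frac (y' + real n * \<alpha>), u + r - S n y')"
  by (rule flow_eval[OF y(2)]) (use close[OF nR(1)] close[OF nR(2)] e in \<open>auto simp: birkhoff_Suc\<close>)
 thus "abs (fst (T r (y, u)) - fst (T r (y', u))) <= \<rho>" "abs (snd (T r (y, u)) - snd (T r (y', u))) < \<xi>"
  using close[OF nR(1)] by (auto simp: n(3) abs_minus_commute)
qed

text \<open>The orbits of a horizontal section sweep out, during a short time, a flow box of the phase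
 space; the flow preserves its measure.\<close>

lemma occupancy_window:
 assumes A: "A \<in> sets M" and t: "0 <= t" and u: "0 < u" "0 < m" "u + m < c" and fin: "F < \<infinity>"
 shows "(\<integral>\<^sup>+ r\<in>{t..t + m}. \<mu> Y {y \<in> space Y. T r (y, u) \<in> A} \<partial>lborel) <= F * \<mu> M A"
proof -
 interpret CB: prob_space "Y" by (rule circle_base_prob)
 interpret CL: pair_sigma_finite "Y" "lborel :: real measure" ..
 define B where "B = {z \<in> space M. T t z \<in> A}"
 have B: "B \<in> sets M" unfolding B_def using A flow_measurable_at[OF t] by measurable
 have BQ [measurable]: "B \<in> sets (cyl Y)" using B sets_M by blast
 define B1 where "B1 = B Int {z \<in> space (cyl Y). snd z \<in> {u..u + m}}"
 have B1 [measurable]: "B1 \<in> sets (cyl Y)" unfolding B1_def by (rule sets.Int[OF BQ]) measurable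
 define k where "k s = \<mu> Y ((%y. (y, s)) -` B1)" for s
 have k [measurable]: "k \<in> borel_measurable lborel" unfolding k_def by (rule CL.measurable_emeasure_Pair2[OF B1])
 have eq: "\<mu> Y {y \<in> space Y. T r (y, u) \<in> A} = k ((u - t) + 1 * r)" if r: "r \<in> {t..t + m}" for r
 proof -
  have "(%y. (y, (u - t) + 1 * r)) -` B1 = {y \<in> space Y. T r (y, u) \<in> A}"
  proof -
   have "(y, u + (r - t)) \<in> space M & T t (y, u + (r - t)) = T r (y, u)" if "y \<in> generic \<alpha>" for y
   proof -
    have fx: "c <= f y" by (rule roof_pos[OF that])
    have frc: "frac y = y" using that by (simp add: generic_def)
    have sp: "(y, u) \<in> space M" "(y, u + (r - t)) \<in> space M" using that u r fx by (auto simp: space_M)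
    have "T (r - t) (y, u) = (y, u + (r - t))"
     using flow_eval[OF that, of 0 u "r - t"] u r fx by (simp add: birkhoff_def frc)
    thus ?thesis using flow_add[OF sp(1), of t "r - t"] t r sp by simp
   qed
   thus ?thesis using r by (auto simp: B1_def B_def space_pair_measure space_circle_base algebra_simps)
  qed
  thus ?thesis by (simp add: k_def)
 qed
 have "(\<integral>\<^sup>+ r\<in>{t..t + m}. \<mu> Y {y \<in> space Y. T r (y, u) \<in> A} \<partial>lborel)
   <= (\<integral>\<^sup>+ r. k ((u - t) + 1 * r) \<partial>lborel)"
  using eq by (intro nn_integral_mono) (auto simp: indicator_def)
 also have "... = (\<integral>\<^sup>+ s. k s \<partial>lborel)"
  using nn_integral_real_affine[of k 1 "u - t"] k by simp
 also have "... = \<mu> (cyl Y) B1" unfolding k_def by (rule CL.emeasure_pair_measure_alt2[OF B1, symmetric])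
 also have "... <= \<mu> (cyl Y) B" by (rule emeasure_mono[OF _ BQ]) (auto simp: B1_def)
 also have "... = F * \<mu> M B"
 proof -
  have "0 < F" using F_ge c_pos by (meson ennreal_less_zero_iff less_le_trans)
  moreover have "\<mu> M B = \<mu> (cyl Y) B / F"
   using emeasure_special[OF roof_measurable B] by (simp only: F_def)
  ultimately show ?thesis using fin by (simp add: mult.commute[of F] ennreal_divide_times)
 qed
 also have "\<mu> M B = \<mu> M A" unfolding B_def by (rule flow_preserves[OF t A])
 finally show ?thesis .
qed

end

section \<open>Comparison of two flows\<close>

lemma separate_finite_compacts:
 fixes K :: "'i => 'a :: heine_borel set"
 assumes fin: "finite P" and K: "!!A. A \<in> P ==> compact (K A)" and dis: "!!A A'. A \<in> P ==> A' \<in> P ==> A ~= A' ==> K A Int K A' = {}"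
 obtains \<eta> :: real where "0 < \<eta>" "!!A A' z z'. A \<in> P ==> A' \<in> P ==> A ~= A' ==> z \<in> K A ==> z' \<in> K A' ==> \<eta> <= dist z z'"
proof -
 have "\<exists>d>0. \<forall>z\<in>K A. \<forall>z'\<in>K A'. d <= dist z z'" if "A \<in> P" "A' \<in> P" "A ~= A'" for A A'
  using separate_compact_closed[OF K[OF that(1)] compact_imp_closed[OF K[OF that(2)]] dis[OF that]] by blast
 hence "\<exists>d. 0 < d & (fst p ~= snd p --> (\<forall>z\<in>K (fst p). \<forall>z'\<in>K (snd p). d <= dist z z'))" if "p \<in> P \<times> P" for p
 proof (cases "fst p = snd p")
  case True
  thus ?thesis by (intro exI[of _ 1]) simp
 qed (use that in auto)
 then obtain d :: "'i \<times> 'i => real" where d: "\<forall>p\<in>P \<times> P. 0 < d p & (fst p ~= snd p --> (\<forall>z\<in>K (fst p). \<forall>z'\<in>K (snd p). d p <= dist z z'))"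
  using bchoice[of "P \<times> P" "%p d. 0 < d & (fst p ~= snd p --> (\<forall>z\<in>K (fst p). \<forall>z'\<in>K (snd p). d <= dist z z'))"] by blast
 define \<eta> where "\<eta> = Min (insert 1 (d ` (P \<times> P)))"
 have fin': "finite (insert 1 (d ` (P \<times> P)))" using fin by simp
 have "0 < \<eta>" unfolding \<eta>_def using d fin' by (subst Min_gr_iff) auto
 moreover have "\<eta> <= dist z z'" if "A \<in> P" "A' \<in> P" "A ~= A'" "z \<in> K A" "z' \<in> K A'" for A A' z z'
 proof -
  have "\<eta> <= d (A, A')" unfolding \<eta>_def using fin' that by (intro Min_le) auto
  also have "... <= dist z z'" using bspec[OF d, of "(A, A')"] that by auto
  finally show ?thesis .
 qed
 ultimately show thesis by (rule that)
qed

lemma dist_prod_less: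
 fixes z z' :: "real \<times> real"
 assumes "abs (fst z - fst z') <= a" "abs (snd z - snd z') < b"
 shows "dist z z' < a + b"
proof -
 have "dist z z' <= abs (fst z - fst z') + abs (snd z - snd z')"
  using sqrt_sum_squares_le_sum_abs[of "fst z - fst z'" "snd z - snd z'"]
  by (cases z; cases z') (simp add: dist_Pair_Pair dist_real_def)
 thus ?thesis using assms by linarith
qed

lemma emeasure_base_interval:
 assumes "0 <= a" "a <= b" "b <= 1"
 shows "{y \<in> space (circle_base \<alpha>). y \<in> {a..<b}} \<in> sets (circle_base \<alpha>)"
  and "\<mu> (circle_base \<alpha>) {y \<in> space (circle_base \<alpha>). y \<in> {a..<b}} = ennreal (b - a)"
proof -
 have e: "{y \<in> space (circle_base \<alpha>). y \<in> {a..<b}} = {a..<b} Int generic \<alpha>" by (auto simp: space_circle_base)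
 show "{y \<in> space (circle_base \<alpha>). y \<in> {a..<b}} \<in> sets (circle_base \<alpha>)"
  unfolding e by (rule sets_base) simp
 have "countable ({0} Un ({0<..<1} - generic \<alpha>))" using countable_circle_exceptions by simp
 hence null: "{0} Un ({0<..<1} - generic \<alpha>) \<in> null_sets lborel"
  by (intro countable_imp_null_set_lborel)
 have "\<mu> (circle_base \<alpha>) ({a..<b} Int generic \<alpha>) = leb ({a..<b} Int generic \<alpha>)"
  by (rule emeasure_base) auto
 also have "... = leb ({a..<b} - ({0} Un ({0<..<1} - generic \<alpha>)))"
  using assms by (intro arg_cong[where f = "leb"]) (fastforce dest: generic_self)
 also have "... = leb {a..<b}"
  using null by (intro emeasure_Diff_null_set) auto
 finally show "\<mu> (circle_base \<alpha>) {y \<in> space (circle_base \<alpha>). y \<in> {a..<b}} = ennreal (b - a)"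
  unfolding e using assms by simp
qed

context roof_flow begin

lemma AE_M:
 assumes "F < \<infinity>" "AE z in M. Q z"
 shows "AE z in cyl Y. z \<in> space M --> Q z"
proof -
 have sp: "space M = special_space Y f" by (rule space_special)
 have O: "special_space Y f \<in> sets (cyl Y)" by (rule special_space_measurable[OF roof_measurable])
 have "AE z in uniform_measure (cyl Y) (special_space Y f). z \<in> special_space Y f --> Q z"
  using assms(2) O unfolding special_measure_def by (subst (asm) AE_restrict_space_iff) auto
 moreover have "F ~= 0" using F_ge c_pos by auto
 ultimately have "AE z in cyl Y. z \<in> special_space Y f --> z \<in> special_space Y f --> Q z"
  using assms(1) unfolding F_def by (subst (asm) AE_uniform_measure) auto
 thus ?thesis unfolding sp by eventually_elim auto
qed

lemma extend_measurable:
 assumes h: "h \<in> M \<rightarrow>\<^sub>M N" and z0: "z0 \<in> space N"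
 shows "(%z. if z \<in> space M then h z else z0) \<in> cyl Y \<rightarrow>\<^sub>M N"
proof -
 have sp: "space M = special_space Y f" by (rule space_special)
 have O: "special_space Y f \<in> sets (cyl Y)" by (rule special_space_measurable[OF roof_measurable])
 have eq: "sets M = sets (restrict_space (cyl Y) (special_space Y f))"
  unfolding special_measure_def by (intro sets_restrict_space_cong) simp
 have "h \<in> restrict_space (cyl Y) (special_space Y f) \<rightarrow>\<^sub>M N"
  using h unfolding measurable_cong_sets[OF eq refl] .
 thus ?thesis unfolding sp using O z0 by (subst (asm) measurable_restrict_space_iff) auto
qed

lemma section_measurable:
 assumes "0 <= u" "u < c"
 shows "(%y. (y, u)) \<in> Y \<rightarrow>\<^sub>M M"
proof (rule measurable_into_special)
 show "(y, u) \<in> special_space Y f" if "y \<in> space Y" for y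
  using that roof_pos[of y] assms by (auto simp: special_space_def space_circle_base)
qed auto

lemma occupancy:
 assumes A: "A \<in> sets M" and u: "0 < u" "0 < m" "u + m < c" and fin: "F < \<infinity>" and mR: "m <= R"
 shows "(\<integral>\<^sup>+ r\<in>{0..<R}. \<mu> Y {y \<in> space Y. T r (y, u) \<in> A} \<partial>lborel) <= ennreal (2 * R / m) * (F * \<mu> M A)"
proof -
 interpret CB: prob_space "Y" by (rule circle_base_prob)
 define k where "k r = \<mu> Y {y \<in> space Y. T (max 0 r) (y, u) \<in> A}" for r
 have sig: "sigma_finite_measure Y" ..
 have uc: "0 <= u" "u < c" using u by auto
 have k [measurable]: "k \<in> borel_measurable borel" unfolding k_def
  by (rule majority_times_measurable(1)[OF sig section_measurable[OF uc] flow_measurable A])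
 define n where "n = nat \<lceil>R / m\<rceil>"
 have R: "0 < R" using mR u by linarith
 have n: "R / m <= real n" "real n <= 2 * R / m"
 proof -
  show "R / m <= real n" unfolding n_def by (rule real_nat_ceiling_ge)
  have "real n <= R / m + 1" unfolding n_def using R u by (simp add: ceiling_correct less_imp_le)
  moreover have "1 <= R / m" using mR u by simp
  ultimately show "real n <= 2 * R / m" by simp
 qed
 have cover: "indicator {0..<R} r <= (\<Sum>i<n. indicator {real i * m..real i * m + m} r :: ennreal)" for r
 proof (cases "r \<in> {0..<R}")
  case True
  define i where "i = nat \<lfloor>r / m\<rfloor>"
  have fl: "real i = of_int \<lfloor>r / m\<rfloor>" using True u by (simp add: i_def)
  have i1: "real i <= r / m" "r / m < real i + 1" unfolding fl by linarith+
  hence "real i * m <= r" "r <= real i * m + m" using u by (simp_all add: field_simps)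
  moreover have "r / m < R / m" using True u by (simp add: divide_strict_right_mono)
  hence "i < n" using i1(1) n(1) by (metis of_nat_less_iff le_less_trans less_le_trans)
  ultimately have "(1::ennreal) <= (\<Sum>i\<in>{i}. indicator {real i * m..real i * m + m} r)" by simp
  also have "... <= (\<Sum>i<n. indicator {real i * m..real i * m + m} r)" using \<open>i < n\<close> by (intro sum_mono2) auto
  finally show ?thesis using True by simp
 qed simp
 have win: "(\<integral>\<^sup>+ r. k r * indicator {real i * m..real i * m + m} r \<partial>lborel) <= F * \<mu> M A" for i
 proof -
  have "(\<integral>\<^sup>+ r. k r * indicator {real i * m..real i * m + m} r \<partial>lborel)
   = (\<integral>\<^sup>+ r\<in>{real i * m..real i * m + m}. \<mu> Y {y \<in> space Y. T r (y, u) \<in> A} \<partial>lborel)"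
  proof (rule nn_integral_cong)
   fix r
   have "0 <= real i * m" using u by simp
   hence "max 0 r = r" if "r \<in> {real i * m..real i * m + m}"
    using that unfolding atLeastAtMost_iff by (metis max.absorb2 order_trans)
   thus "k r * indicator {real i * m..real i * m + m} r
     = \<mu> Y {y \<in> space Y. T r (y, u) \<in> A} * indicator {real i * m..real i * m + m} r"
    by (cases "r \<in> {real i * m..real i * m + m}") (simp_all add: k_def)
  qed
  also have "... <= F * \<mu> M A" using u fin by (intro occupancy_window[OF A]) auto
  finally show ?thesis .
 qed
 have "(\<integral>\<^sup>+ r\<in>{0..<R}. \<mu> Y {y \<in> space Y. T r (y, u) \<in> A} \<partial>lborel)
   <= (\<integral>\<^sup>+ r. (\<Sum>i<n. k r * indicator {real i * m..real i * m + m} r) \<partial>lborel)"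
 proof (rule nn_integral_mono)
  fix r
  have "\<mu> Y {y \<in> space Y. T r (y, u) \<in> A} * indicator {0..<R} r = k r * indicator {0..<R} r"
   by (cases "r \<in> {0..<R}") (simp_all add: k_def)
  also have "... <= k r * (\<Sum>i<n. indicator {real i * m..real i * m + m} r)" by (intro mult_left_mono cover) simp
  finally show "\<mu> Y {y \<in> space Y. T r (y, u) \<in> A} * indicator {0..<R} r
    <= (\<Sum>i<n. k r * indicator {real i * m..real i * m + m} r)" by (simp add: sum_distrib_left)
 qed
 also have "... = (\<Sum>i<n. \<integral>\<^sup>+ r. k r * indicator {real i * m..real i * m + m} r \<partial>lborel)" by (rule nn_integral_sum) measurable
 also have "... <= (\<Sum>i<n. F * \<mu> M A)" by (intro sum_mono win)
 also have "... = ennreal (real n) * (F * \<mu> M A)" by (simp add: ennreal_of_nat_eq_real_of_nat)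
 also have "... <= ennreal (2 * R / m) * (F * \<mu> M A)" using n by (intro mult_right_mono ennreal_leI) auto
 finally show ?thesis .
qed

end

locale flow_pair = A: roof_flow \<alpha> f c + B: roof_flow \<alpha>' f' c'
 for \<alpha> f c \<alpha>' f' c'
begin

text \<open>Compact sets \<open>K A\<close> that fill most of the space and on which the colour \<open>A\<close> of the image is constant have a positive
 mutual distance \<open>\<eta>\<close>. An interval that is shadowed with precision \<open>\<xi> \<le> \<eta> / 4\<close> visits at each time only one of
 them. So among the \<open>L\<close> intervals of a grid there is one, \<open>I k\<close>, whose image under \<open>\<Theta>\<close> is a family of orbits
 of the second flow with a majority colour at most times, to which \<open>drift_family_concentrates\<close> applies. The quarter
 of \<open>I k\<close> that concentrates has length \<open>1 / (4 * L)\<close>, about \<open>R powr - e\<close>, while the strip into which it is mapped has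
 measure \<open>O (\<theta> R)\<close>.\<close>

theorem no_common_factor:
 fixes \<theta> :: "real => real"
 assumes shadow: "!!kap \<xi>. 0 < kap ==> 0 < \<xi> ==> \<exists>R0. \<forall>R\<ge>R0. \<forall>\<rho>. 0 < \<rho> --> \<rho> <= R powr - e -->
  shadowed \<alpha> f (R / c + 2) \<rho> kap \<xi>"
  and e: "0 < e" and finA: "A.F < \<infinity>" and finB: "B.F < \<infinity>"
  and drift: "B.drift_separation \<theta>" and \<theta>pos: "!!R. 0 < R ==> 0 < \<theta> R"
  and lim: "((%R. R powr e * \<theta> R) \<longlongrightarrow> 0) at_top"
  and \<Theta> [measurable]: "\<Theta> \<in> A.M \<rightarrow>\<^sub>M B.M" and \<Theta>d: "distr A.M B.M \<Theta> = B.M"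
  and comm: "!!t. 0 <= t ==> AE z in A.M. \<Theta> (A.T t z) = B.T t (\<Theta> z)"
 shows False
proof -
 interpret MA: prob_space A.M by (rule A.prob_space_M[OF finA])
 interpret MB: prob_space B.M by (rule B.prob_space_M[OF finB])
 interpret CB: prob_space "A.Y" by (rule circle_base_prob)
 have sigC: "sigma_finite_measure A.Y" ..
 define Fr where "Fr = enn2real A.F"
 have FF: "A.F = ennreal Fr" using finA by (simp add: Fr_def)
 have "ennreal c <= ennreal Fr" using A.F_ge FF by simp
 hence Fr: "0 < Fr" using A.c_pos by (meson ennreal_le_iff2 less_le_trans not_le)
 define m where "m = c / 4"
 have m: "0 < m" using A.c_pos by (simp add: m_def)
 define eps :: real where "eps = 1 / 128"
 have eps: "0 < eps" "eps <= 1 / 128" by (auto simp: eps_def)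
 define kap2 where "kap2 = m / (4 * 4096 * Fr)"
 have kap2: "0 < kap2" using m Fr by (simp add: kap2_def)
 define kap1 where "kap1 = min (1 / 256) (kap2 / 4)"
 have kap1: "0 < kap1" "kap1 <= 1 / 256" "kap1 <= kap2 / 4" using kap2 by (auto simp: kap1_def)
 define U where "U r z = B.T (max 0 r) z" for r z
 have Um: "(%z. U (fst z) (snd z)) \<in> borel \<Otimes>\<^sub>M B.M \<rightarrow>\<^sub>M B.M" unfolding U_def by (rule B.flow_measurable)
 have U: "U r z = B.T r z" if "0 <= r" for r z using that by (simp add: U_def max_def)
 obtain G Hm where G [measurable]: "G \<in> sets B.M" and Hm: "0 < Hm" and Gm: "\<mu> B.M (space B.M - G) <= ennreal kap1"
  and conc: "\<forall>eps0>0. \<exists>P. finite P & P <= sets B.M & partition_on (space B.M) P &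
    (\<forall>N :: real measure. prob_space N --> B.concentrates U eps G P (%R. min eps0 (\<theta> R)) Hm N)"
 proof (rule B.drift_family_concentrates[OF drift kap1(1,2) eps Um])
  show "U r z = B.T r z" if "0 <= r" for r z using that by (rule U)
 qed (rule that)
 from conc[rule_format, OF zero_less_one] obtain P where P: "finite P" "P <= sets B.M" "partition_on (space B.M) P"
  and concP: "\<forall>N :: real measure. prob_space N --> B.concentrates U eps G P (%R. min 1 (\<theta> R)) Hm N"
  by (elim exE conjE)
 \<comment> \<open>Compact pieces of the phase space on which the colour of the image is constant.\<close>
 define \<xi>0 where "\<xi>0 = kap2 * c / 8"
 have \<xi>0: "0 < \<xi>0" using kap2 A.c_pos by (simp add: \<xi>0_def)
 define kap3 where "kap3 = kap2 / (4 * (real (card P) + 1))"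
 have kap3: "0 < kap3" using kap2 by (simp add: kap3_def)
 define Q where "Q A = {z \<in> space A.M. \<Theta> z \<in> A Int G} - A.edge \<xi>0" for A
 have Qm: "Q A \<in> sets A.M" if "A \<in> P" for A
 proof -
  have [measurable]: "A \<in> sets B.M" using that P by auto
  show ?thesis unfolding Q_def by measurable
 qed
 have "\<exists>K. K <= Q A & compact K & K \<in> sets A.M & \<mu> A.M (Q A - K) <= ennreal kap3" if "A \<in> P" for A
  by (rule A.inner_compact[OF _ Qm[OF that] kap3]) (auto simp: MA.emeasure_space_1)
 then obtain K where K: "\<forall>A\<in>P. K A <= Q A & compact (K A) & K A \<in> sets A.M & \<mu> A.M (Q A - K A) <= ennreal kap3"
  using bchoice[of P "%A K. K <= Q A & compact K & K \<in> sets A.M & \<mu> A.M (Q A - K) <= ennreal kap3"] by blast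
 define KK where "KK = (\<Union>A\<in>P. K A)"
 have KK [measurable]: "KK \<in> sets A.M" unfolding KK_def using K P by (intro sets.finite_UN) auto
 have KQ: "z \<in> space A.M" "\<Theta> z \<in> A" "\<Theta> z \<in> G" "z \<notin> A.edge \<xi>0" if "A \<in> P" "z \<in> K A" for A z
  using bspec[OF K that(1)] that(2) by (auto simp: Q_def)
 have dis: "A = A'" if "A \<in> P" "A' \<in> P" "\<Theta> z \<in> A" "\<Theta> z \<in> A'" for A A' z
  using P(3) that by (auto simp: partition_on_def disjoint_def)
 have outK: "\<mu> A.M (space A.M - KK) <= ennreal kap2"
 proof -
  define E1 where "E1 = \<Theta> -` (space B.M - G) Int space A.M"
  have E1: "E1 \<in> sets A.M" unfolding E1_def by measurable
  have "\<mu> A.M E1 = \<mu> (distr A.M B.M \<Theta>) (space B.M - G)" unfolding E1_def by (rule emeasure_distr[symmetric]) auto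
  hence e1: "\<mu> A.M E1 <= ennreal kap1" using Gm by (simp add: \<Theta>d)
  have e2: "\<mu> A.M (A.edge \<xi>0) <= ennreal (kap2 / 4)"
   using A.emeasure_edge[OF \<xi>0] A.c_pos by (simp add: \<xi>0_def)
  define E3 where "E3 = (\<Union>A\<in>P. Q A - K A)"
  have E3: "E3 \<in> sets A.M" unfolding E3_def using K P Qm by (intro sets.finite_UN) auto
  have "\<mu> A.M E3 <= ennreal (card P * kap3)"
   unfolding E3_def using K P Qm kap3 by (intro emeasure_UN_le_card) auto
  also have "card P * kap3 = kap2 / 4 * (card P / (real (card P) + 1))" by (simp add: kap3_def)
  also have "... <= kap2 / 4 * 1" using kap2 by (intro mult_left_mono) auto
  finally have e3: "\<mu> A.M E3 <= ennreal (kap2 / 4)" by (simp add: ennreal_leI)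
  have "space A.M - KK <= (E1 Un A.edge \<xi>0) Un E3"
  proof
   fix z assume z: "z \<in> space A.M - KK"
   hence "\<Theta> z \<in> space B.M" using measurable_space[OF \<Theta>] by blast
   then obtain A where A: "A \<in> P" "\<Theta> z \<in> A" using P(3) by (auto simp: partition_on_def)
   thus "z \<in> (E1 Un A.edge \<xi>0) Un E3"
    using z measurable_space[OF \<Theta>, of z] by (auto simp: E1_def E3_def Q_def KK_def)
  qed
  hence "\<mu> A.M (space A.M - KK) <= \<mu> A.M ((E1 Un A.edge \<xi>0) Un E3)"
   using E1 E3 by (intro emeasure_mono) auto
  also have "... <= \<mu> A.M (E1 Un A.edge \<xi>0) + \<mu> A.M E3" using E1 E3 by (intro emeasure_subadditive) auto
  also have "... <= (\<mu> A.M E1 + \<mu> A.M (A.edge \<xi>0)) + \<mu> A.M E3"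
   using E1 by (intro add_right_mono emeasure_subadditive) auto
  also have "... <= (ennreal kap1 + ennreal (kap2 / 4)) + ennreal (kap2 / 4)" by (intro add_mono e1 e2 e3)
  also have "... = ennreal (kap1 + kap2 / 4 + kap2 / 4)" using kap1 kap2 by (simp add: ennreal_plus[symmetric] del: ennreal_plus)
  also have "... <= ennreal kap2" using kap1 kap2 by (intro ennreal_leI) auto
  finally show ?thesis .
 qed
 obtain \<eta> where \<eta>: "0 < \<eta>" and sepK: "!!A A' z z'. A \<in> P ==> A' \<in> P ==> A ~= A' ==> z \<in> K A ==> z' \<in> K A' ==> \<eta> <= dist z z'"
 proof (rule separate_finite_compacts[OF P(1)])
  show "compact (K A)" if "A \<in> P" for A using K that by blast
  show "K A Int K A' = {}" if "A \<in> P" "A' \<in> P" "A ~= A'" for A A' using dis KQ that by blast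
 qed (rule that)
 define \<xi> where "\<xi> = min \<xi>0 (\<eta> / 4)"
 have \<xi>: "0 < \<xi>" "\<xi> <= \<xi>0" "\<xi> <= \<eta> / 4" using \<xi>0 \<eta> by (auto simp: \<xi>_def)
 have edge_mono: "A.edge \<xi> <= A.edge \<xi>0" using \<xi>(2) by (auto simp: A.edge_def)
 obtain R0 where R0: "\<forall>R\<ge>R0. \<forall>\<rho>. 0 < \<rho> --> \<rho> <= R powr - e -->
  shadowed \<alpha> f (R / c + 2) \<rho> (1 / 4) \<xi>"
  using shadow[of "1 / 4" \<xi>] \<xi>(1) by auto
 define m' where "m' = min m (c' / 2)"
 have m': "0 < m'" "m' <= m" "m' < c'" using m B.c_pos by (auto simp: m'_def)
 define W where "W = Fr * (12 * (Hm + c') / c') / m'"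
 have W: "0 < W" using Fr Hm B.c_pos m' by (simp add: W_def)
 have "\<forall>\<^sub>F R in at_top. R powr e * \<theta> R < 1 / (8 * W)" using lim W by (intro order_tendstoD) auto
 moreover have "((%R. R powr - e) \<longlongrightarrow> 0) at_top" using e by (intro tendsto_neg_powr filterlim_ident) auto
 hence "\<forall>\<^sub>F R in at_top. R powr - e < \<eta> / 8" using \<eta> by (intro order_tendstoD) auto
 moreover have "\<forall>\<^sub>F R in at_top. max (max 1 R0) (max m (4 * m')) <= R" by (rule eventually_ge_at_top)
 ultimately have "\<forall>\<^sub>F R in at_top. R powr e * \<theta> R < 1 / (8 * W) & R powr - e < \<eta> / 8 & max (max 1 R0) (max m (4 * m')) <= R"
  by eventually_elim auto
 then obtain R where Rlim: "R powr e * \<theta> R < 1 / (8 * W)" and R\<eta>: "R powr - e < \<eta> / 8" and R: "1 <= R" "R0 <= R" "m <= R" "4 * m' <= R"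
  by (auto simp: eventually_at_top_linorder)
 define L where "L = nat \<lceil>R powr e\<rceil>"
 have Re1: "1 <= R powr e" using R e by (intro ge_one_powr_ge_zero) auto
 have L: "R powr e <= real L" "real L <= 2 * R powr e" "1 <= real L"
 proof -
  show 1: "R powr e <= real L" unfolding L_def by (rule real_nat_ceiling_ge)
  have "real L <= R powr e + 1" unfolding L_def using Re1 by (simp add: ceiling_correct less_imp_le)
  thus "real L <= 2 * R powr e" using Re1 by simp
  show "1 <= real L" using 1 Re1 by linarith
 qed
 define \<rho> where "\<rho> = 1 / real L"
 have \<rho>: "0 < \<rho>" "\<rho> <= R powr - e"
 proof -
  show "0 < \<rho>" using L(3) by (simp add: \<rho>_def)
  have "0 < real L" "0 < R powr e" using L(3) Re1 by linarith+
  thus "\<rho> <= R powr - e" unfolding \<rho>_def powr_minus_divide by (intro divide_left_mono L(1) mult_pos_pos) auto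
 qed
 from R0[rule_format, OF R(2) \<rho>, unfolded shadowed_def] obtain X where X: "X \<in> sets A.Y" "\<mu> A.Y X <= ennreal (1 / 4)"
  and close: "\<forall>x\<in>generic \<alpha> - X. \<forall>y y' n. abs (y - x) <= \<rho> --> abs (y' - x) <= \<rho> --> real n <= R / c + 2 -->
     abs (A.S n y - A.S n y') < \<xi> & abs (frac (y + real n * \<alpha>) - frac (y' + real n * \<alpha>)) <= 2 * \<rho>"
  by (elim bexE conjE)
 \<comment> \<open>A height at which the isomorphism respects the orbits of almost all points of the section.\<close>
 obtain z0 where z0: "z0 \<in> space A.M" using MA.not_empty by auto
 define g1 where "g1 z = (if z \<in> space A.M then z else z0)" for z
 have g1 [measurable]: "g1 \<in> A.Y \<Otimes>\<^sub>M borel \<rightarrow>\<^sub>M A.M"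
  using A.extend_measurable[OF measurable_ident_sets[OF refl] z0]
  unfolding g1_def measurable_cong_sets[OF sets_pair_measure_cong[OF refl sets_lborel] refl] .
 have TA [measurable (raw)]: "(%x. A.T (max 0 (r x)) (w x)) \<in> N \<rightarrow>\<^sub>M A.M" if "r \<in> borel_measurable N" "w \<in> N \<rightarrow>\<^sub>M A.M" for N and r :: "'l => real" and w
  using measurable_compose[OF measurable_Pair[OF that] A.flow_measurable] by simp
 have TB [measurable (raw)]: "(%x. B.T (max 0 (r x)) (w x)) \<in> N \<rightarrow>\<^sub>M B.M" if "r \<in> borel_measurable N" "w \<in> N \<rightarrow>\<^sub>M B.M" for N and r :: "'l => real" and w
  using measurable_compose[OF measurable_Pair[OF that] B.flow_measurable] by simp
 define V where "V z r \<longleftrightarrow> (fst z \<in> space A.Y --> 0 <= snd z --> snd z < c -->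
   fst (\<Theta> (A.T (max 0 r) (g1 z))) = fst (B.T (max 0 r) (\<Theta> (g1 z))) & snd (\<Theta> (A.T (max 0 r) (g1 z))) = snd (B.T (max 0 r) (\<Theta> (g1 z))))" for z r
 have inM: "(y, s) \<in> space A.M" if "y \<in> space A.Y" "0 <= s" "s < c" for y s
  using that A.roof_pos[of y] by (auto simp: A.space_M space_circle_base)
 have V1: "AE z in cyl A.Y. V z r" for r
 proof -
  have "AE z in cyl A.Y. z \<in> space A.M --> \<Theta> (A.T (max 0 r) z) = B.T (max 0 r) (\<Theta> z)"
   by (rule A.AE_M[OF finA comm]) simp
  thus ?thesis
  proof eventually_elim
   case (elim z)
   thus ?case using inM[of "fst z" "snd z"] by (auto simp: V_def g1_def)
  qed
 qed
 have measV: "{x \<in> space ((cyl lborel) \<Otimes>\<^sub>M A.Y). \<not> V (snd x, fst (fst x)) (snd (fst x))} \<in> sets ((cyl lborel) \<Otimes>\<^sub>M A.Y)"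
  unfolding V_def by measurable
 obtain u where u: "0 < u" "u < c / 4" and AEu: "AE r in lborel. AE y in A.Y. V (y, u) r"
  using AE_generic_height[OF sigC V1 _ measV, of 0 "c / 4"] A.c_pos by auto
 have uc: "0 <= u" "u < c" "u + m < c" "u + m' < c" using u m' A.c_pos by (auto simp: m_def)
 have sec [measurable]: "(%y. (y, u)) \<in> A.Y \<rightarrow>\<^sub>M A.M" by (rule A.section_measurable[OF uc(1,2)])
 define w where "w y = \<Theta> (y, u)" for y
 have w [measurable]: "w \<in> A.Y \<rightarrow>\<^sub>M B.M" unfolding w_def by measurable
 have AEw: "AE r in lborel. r \<in> {0..<R} --> (AE y in A.Y. \<Theta> (A.T r (y, u)) = U r (w y))"
  using AEu
 proof eventually_elim
  case (elim r)
  show ?case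
  proof
   assume r: "r \<in> {0..<R}"
   have "AE y in A.Y. y \<in> space A.Y" by simp
   thus "AE y in A.Y. \<Theta> (A.T r (y, u)) = U r (w y)"
    using elim
   proof eventually_elim
    case (elim y)
    hence "g1 (y, u) = (y, u)" using inM[of y u] uc by (simp add: g1_def)
    thus ?case using elim r uc by (intro prod_eqI) (auto simp: V_def U_def w_def max_def)
   qed
  qed
 qed
 \<comment> \<open>The short intervals of the grid, and the one that will be used.\<close>
 define I where "I k = {y \<in> space A.Y. y \<in> {real k / L..<(real k + 1) / L}}" for k
 have I: "I k \<in> sets A.Y" "\<mu> A.Y (I k) = ennreal \<rho>" if "k < L" for k
 proof -
  have "real k + 1 <= real L" using that by linarith
  hence h: "0 <= real k / real L" "real k / real L <= (real k + 1) / real L" "(real k + 1) / real L <= 1"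
   using L(3) by (auto simp: divide_right_mono)
  show "I k \<in> sets A.Y" unfolding I_def by (rule emeasure_base_interval(1)[OF h])
  have "(real k + 1) / L - real k / L = \<rho>" by (simp add: \<rho>_def add_divide_distrib)
  thus "\<mu> A.Y (I k) = ennreal \<rho>"
   unfolding I_def using emeasure_base_interval(2)[OF h, of \<alpha>] by simp
 qed
 have Idis: "disjoint_family_on I {..<L}"
  unfolding disjoint_family_on_def
 proof (intro ballI impI)
  fix k k' assume "k \<in> {..<L}" "k' \<in> {..<L}" "k ~= k'"
  have "k = k'" if "y \<in> I k" "y \<in> I k'" for y
  proof -
   have "real k <= y * L" "y * L < real k + 1" "real k' <= y * L" "y * L < real k' + 1"
    using that L(3) by (auto simp: I_def divide_le_eq less_divide_eq pos_le_divide_eq)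
   thus ?thesis by linarith
  qed
  thus "I k Int I k' = {}" using \<open>k \<noteq> k'\<close> by blast
 qed
 have Iclose: "abs (y - y') <= \<rho>" if "y \<in> I k" "y' \<in> I k" for y y' k
 proof -
  have "abs (y - y') <= (real k + 1) / L - real k / L" using that by (auto simp: I_def)
  thus ?thesis by (simp add: \<rho>_def add_divide_distrib)
 qed
 define N where "N k = uniform_measure A.Y (I k)" for k
 have Np: "prob_space (N k)" if "k < L" for k
  unfolding N_def using I[OF that] \<rho> by (intro prob_space_uniform_measure) auto
 have spN [simp]: "space (N k) = space A.Y" and seN [simp, measurable_cong]: "sets (N k) = sets A.Y" for k
  by (simp_all add: N_def)
 have NE: "ennreal \<rho> * \<mu> (N k) E = \<mu> A.Y (I k Int E)" if "k < L" "E \<in> sets A.Y" for k E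
  unfolding N_def using I[OF that(1)] \<rho> that
  by (subst emeasure_uniform_measure) (auto simp: mult.commute[of "ennreal \<rho>"] ennreal_divide_times)
 define bad where "bad r = {y \<in> space A.Y. A.T r (y, u) \<in> space A.M - KK}" for r
 have badm: "bad r \<in> sets A.Y" if "0 <= r" for r
 proof -
  have "bad r = {y \<in> space A.Y. A.T (max 0 r) (y, u) \<in> space A.M - KK}" using that by (simp add: bad_def max_def)
  also have "... \<in> sets A.Y" by measurable
  finally show ?thesis .
 qed
 define J where "J k = (\<integral>\<^sup>+ r\<in>{0..<R}. \<mu> (N k) (bad r) \<partial>lborel)" for k
 have Jm: "(%r. \<mu> (N k) (bad r) * indicator {0..<R} r) \<in> borel_measurable lborel" if "k < L" for k
 proof -
  interpret Nk: prob_space "N k" by (rule Np[OF that])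
  have "(%r. \<mu> (N k) {y \<in> space (N k). A.T (max 0 r) (y, u) \<in> space A.M - KK}) \<in> borel_measurable borel"
   by (rule majority_times_measurable(1)[OF _ _ A.flow_measurable]) (use sec in \<open>auto intro: Nk.sigma_finite_measure_axioms\<close>)
  hence "(%r. \<mu> (N k) {y \<in> space (N k). A.T (max 0 r) (y, u) \<in> space A.M - KK} * indicator {0..<R} r) \<in> borel_measurable lborel" by simp
  also have "(%r. \<mu> (N k) {y \<in> space (N k). A.T (max 0 r) (y, u) \<in> space A.M - KK} * indicator {0..<R} r)
    = (%r. \<mu> (N k) (bad r) * indicator {0..<R} r)"
  proof
   fix r show "\<mu> (N k) {y \<in> space (N k). A.T (max 0 r) (y, u) \<in> space A.M - KK} * indicator {0..<R} r = \<mu> (N k) (bad r) * indicator {0..<R} r"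
    by (cases "r \<in> {0..<R}") (simp_all add: bad_def max_def)
  qed
  finally show ?thesis .
 qed
 have Jsum: "(\<Sum>k<L. ennreal \<rho> * J k) <= ennreal (R / 8192)"
 proof -
  have "(\<Sum>k<L. ennreal \<rho> * J k) = (\<Sum>k<L. \<integral>\<^sup>+ r. ennreal \<rho> * (\<mu> (N k) (bad r) * indicator {0..<R} r) \<partial>lborel)"
   unfolding J_def using Jm by (intro sum.cong refl nn_integral_cmult[symmetric]) auto
  also have "... = (\<integral>\<^sup>+ r. (\<Sum>k<L. ennreal \<rho> * (\<mu> (N k) (bad r) * indicator {0..<R} r)) \<partial>lborel)"
   using Jm by (intro nn_integral_sum[symmetric] borel_measurable_times) auto
  also have "... <= (\<integral>\<^sup>+ r\<in>{0..<R}. \<mu> A.Y (bad r) \<partial>lborel)"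
  proof (rule nn_integral_mono)
   fix r
   show "(\<Sum>k<L. ennreal \<rho> * (\<mu> (N k) (bad r) * indicator {0..<R} r)) <= \<mu> A.Y (bad r) * indicator {0..<R} r"
   proof (cases "r \<in> {0..<R}")
    case True
    hence bm: "bad r \<in> sets A.Y" by (intro badm) simp
    have "(\<Sum>k<L. ennreal \<rho> * \<mu> (N k) (bad r)) = (\<Sum>k<L. \<mu> A.Y (I k Int bad r))"
     using NE bm by (intro sum.cong) auto
    also have "... = \<mu> A.Y (\<Union>k<L. I k Int bad r)"
    proof (rule sum_emeasure)
     show "disjoint_family_on (%k. I k Int bad r) {..<L}" using Idis unfolding disjoint_family_on_def by blast
    qed (use I bm in auto)
    also have "... <= \<mu> A.Y (bad r)" using bm by (intro emeasure_mono) auto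
    finally show ?thesis using True by simp
   qed simp
  qed
  also have "... <= ennreal (2 * R / m) * (A.F * \<mu> A.M (space A.M - KK))"
   unfolding bad_def by (rule A.occupancy) (use u m uc finA R in auto)
  also have "... <= ennreal (2 * R / m) * (ennreal Fr * ennreal kap2)"
   unfolding FF by (intro mult_left_mono outK) auto
  also have "... = ennreal (R / 8192)" using m R Fr kap2 by (simp add: ennreal_mult[symmetric] kap2_def)
  finally show ?thesis .
 qed
 define good where "good = {k. k < L & \<not> I k <= X}"
 have "\<exists>k\<in>good. J k <= ennreal (R / 4096)"
 proof (rule ccontr)
  assume "\<not> ?thesis"
  hence J: "ennreal (R / 4096) <= J k" if "k \<in> good" for k using that by (meson linear)
  have "ennreal \<rho> * of_nat (card ({..<L} - good)) = (\<Sum>k\<in>{..<L} - good. \<mu> A.Y (I k))"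
   using I by (simp add: mult.commute)
  also have "... = \<mu> A.Y (\<Union>k\<in>{..<L} - good. I k)"
  proof (rule sum_emeasure)
   show "disjoint_family_on I ({..<L} - good)" using Idis unfolding disjoint_family_on_def by blast
  qed (use I in auto)
  also have "... <= \<mu> A.Y X" using X by (intro emeasure_mono) (auto simp: good_def)
  also have "... <= ennreal (1 / 4)" by (rule X)
  finally have "\<rho> * real (card ({..<L} - good)) <= 1 / 4"
   using \<rho> by (simp add: ennreal_of_nat_eq_real_of_nat ennreal_mult[symmetric])
  moreover have "card ({..<L} - good) = L - card good" "card good <= L"
   using card_Diff_subset[of good "{..<L}"] card_mono[of "{..<L}" good] by (auto simp: good_def)
  hence "real (card ({..<L} - good)) = real L - real (card good)" by simp
  ultimately have "\<rho> * real L - \<rho> * real (card good) <= 1 / 4" by (simp add: right_diff_distrib)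
  moreover have "\<rho> * real L = 1" using L(3) by (simp add: \<rho>_def)
  ultimately have cg: "3 / 4 <= \<rho> * real (card good)" by linarith
  have "ennreal (\<rho> * real (card good) * (R / 4096)) = (\<Sum>k\<in>good. ennreal \<rho> * ennreal (R / 4096))"
   using \<rho> R by (simp add: ennreal_of_nat_eq_real_of_nat ennreal_mult[symmetric] mult_ac)
  also have "... <= (\<Sum>k\<in>good. ennreal \<rho> * J k)" by (intro sum_mono mult_left_mono J) auto
  also have "... <= (\<Sum>k<L. ennreal \<rho> * J k)" by (intro sum_mono2) (auto simp: good_def)
  also have "... <= ennreal (R / 8192)" by (rule Jsum)
  finally have "\<rho> * real (card good) * (R / 4096) <= R / 8192" using R by (subst (asm) ennreal_le_iff) auto
  moreover have "3 / 4 * (R / 4096) <= \<rho> * real (card good) * (R / 4096)" using cg R by (intro mult_right_mono) auto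
  ultimately show False using R by linarith
 qed
 then obtain k where k: "k < L" "\<not> I k <= X" "J k <= ennreal (R / 4096)" by (auto simp: good_def)
 interpret N: prob_space "N k" by (rule Np[OF k(1)])
 obtain x where x: "x \<in> I k" "x \<notin> X" using k(2) by auto
 have xc: "x \<in> generic \<alpha> - X" using x by (auto simp: I_def space_circle_base)
 have Ic: "y \<in> generic \<alpha>" if "y \<in> I k" for y using that by (simp add: I_def space_circle_base)
 have sameK: "A = A'" if y: "y \<in> I k" "y' \<in> I k" and r: "0 <= r" "r <= R" and AP: "A \<in> P" "A' \<in> P"
  and inK: "A.T r (y, u) \<in> K A" "A.T r (y', u) \<in> K A'" for y y' r A A'
 proof (rule ccontr)
  assume ne: "A ~= A'"
  have cl: "abs (A.S n y - A.S n y') < \<xi> & abs (frac (y + real n * \<alpha>) - frac (y' + real n * \<alpha>)) <= 2 * \<rho>" if "real n <= R / c + 2" for n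
   using bspec[OF close xc] Iclose[OF y(1) x(1)] Iclose[OF y(2) x(1)] that by blast
  have off: "A.T r (y, u) \<notin> A.edge \<xi>" using KQ(4)[OF AP(1) inK(1)] edge_mono by blast
  have "dist (A.T r (y, u)) (A.T r (y', u)) < 2 * \<rho> + \<xi>"
   by (intro dist_prod_less A.flow_shadow[OF Ic[OF y(1)] Ic[OF y(2)] uc(1,2) r cl off])
  moreover have "2 * \<rho> + \<xi> <= \<eta>" using \<rho>(2) R\<eta> \<xi>(3) \<eta> by linarith
  ultimately show False using sepK[OF AP ne inK] by linarith
 qed
 have wN: "w \<in> N k \<rightarrow>\<^sub>M B.M" using w by (simp add: measurable_cong_sets[OF seN refl])
 have AEN: "AE r in lborel. r \<in> {0..<R} --> (\<forall>E\<in>sets B.M. \<mu> (N k) (hits (N k) U w r E) = \<mu> (N k) {y \<in> space (N k). \<Theta> (A.T r (y, u)) \<in> E})"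
  using AEw
 proof eventually_elim
  case (elim r)
  show ?case
  proof (intro impI ballI)
   fix E assume r: "r \<in> {0..<R}" and E [measurable]: "E \<in> sets B.M"
   have mx: "max 0 r = r" using r by (simp add: max_def)
   have "AE y in A.Y. y \<in> I k --> (U r (w y) \<in> E \<longleftrightarrow> \<Theta> (A.T r (y, u)) \<in> E)"
    using elim[rule_format, OF r] by eventually_elim simp
   hence "AE y in N k. U r (w y) \<in> E \<longleftrightarrow> \<Theta> (A.T r (y, u)) \<in> E"
    unfolding N_def by (rule AE_uniform_measureI[OF I(1)[OF k(1)]])
   moreover have "{y \<in> space A.Y. B.T (max 0 r) (w y) \<in> E} \<in> sets A.Y" by measurable
   moreover have "{y \<in> space A.Y. \<Theta> (A.T (max 0 r) (y, u)) \<in> E} \<in> sets A.Y" by measurable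
   ultimately show "\<mu> (N k) (hits (N k) U w r E) = \<mu> (N k) {y \<in> space (N k). \<Theta> (A.T r (y, u)) \<in> E}"
    by (intro emeasure_eq_AE) (auto simp: U_def mx)
  qed
 qed
 have \<Theta>m: "{y \<in> space A.Y. \<Theta> (A.T r (y, u)) \<in> E} \<in> sets A.Y" if "0 <= r" and [measurable]: "E \<in> sets B.M" for r E
 proof -
  have "{y \<in> space A.Y. \<Theta> (A.T (max 0 r) (y, u)) \<in> E} \<in> sets A.Y" by measurable
  thus ?thesis using that(1) by (simp add: max_def)
 qed
 have occG: "(\<integral>\<^sup>+ r\<in>{0..<R}. \<mu> (N k) (hits (N k) U w r (space B.M - G)) \<partial>lborel) <= ennreal (R / 64)"
 proof -
  have "AE r in lborel. \<mu> (N k) (hits (N k) U w r (space B.M - G)) * indicator {0..<R} r <= \<mu> (N k) (bad r) * indicator {0..<R} r"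
   using AEN
  proof eventually_elim
   case (elim r)
   show ?case
   proof (cases "r \<in> {0..<R}")
    case True
    have "{y \<in> space (N k). \<Theta> (A.T r (y, u)) \<in> space B.M - G} <= bad r"
    proof
     fix y assume y: "y \<in> {y \<in> space (N k). \<Theta> (A.T r (y, u)) \<in> space B.M - G}"
     hence "A.T r (y, u) \<in> space A.M" using A.flow_space[OF inM[of y u]] uc True by simp
     moreover have "A.T r (y, u) \<notin> KK"
     proof
      assume "A.T r (y, u) \<in> KK"
      then obtain A where "A \<in> P" "A.T r (y, u) \<in> K A" by (auto simp: KK_def)
      from KQ(3)[OF this] show False using y by simp
     qed
     ultimately show "y \<in> bad r" using y by (simp add: bad_def)
    qed
    hence "\<mu> (N k) {y \<in> space (N k). \<Theta> (A.T r (y, u)) \<in> space B.M - G} <= \<mu> (N k) (bad r)"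
     using badm[of r] True by (intro emeasure_mono) auto
    thus ?thesis using elim[rule_format, OF True, of "space B.M - G"] True by simp
   qed simp
  qed
  hence "(\<integral>\<^sup>+ r\<in>{0..<R}. \<mu> (N k) (hits (N k) U w r (space B.M - G)) \<partial>lborel) <= J k"
   unfolding J_def by (rule nn_integral_mono_AE)
  also have "... <= ennreal (R / 4096)" by (rule k)
  also have "... <= ennreal (R / 64)" using R by (intro ennreal_leI) auto
  finally show ?thesis .
 qed
 have mono: "(1 - 4 * eps) * R <= measure lborel {r \<in> {0..<R}. \<exists>A\<in>P. 1 - eps <= measure (N k) (hits (N k) U w r A)}"
 proof -
  define D where "D = {r \<in> {0..<R}. \<exists>A\<in>P. 1 - eps <= measure (N k) (hits (N k) U w r A)}"
  have D: "D \<in> sets borel"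
   unfolding D_def by (rule majority_times_measurable(2)[OF N.sigma_finite_measure_axioms wN Um P(1,2)])
  define Z where "Z = {r \<in> {0..<R}. 1 <= ennreal (1 / eps) * \<mu> (N k) (bad r)}"
  have Z: "Z \<in> sets borel"
  proof -
   note [measurable] = Jm[OF k(1)]
   have "{r \<in> space borel. r \<in> {0..<R} & 1 <= ennreal (1 / eps) * (\<mu> (N k) (bad r) * indicator {0..<R} r)} \<in> sets borel" by measurable
   also have "{r \<in> space borel. r \<in> {0..<R} & 1 <= ennreal (1 / eps) * (\<mu> (N k) (bad r) * indicator {0..<R} r)} = Z"
    by (auto simp: Z_def)
   finally show ?thesis .
  qed
  have eZ: "leb Z <= ennreal (4 * eps * R)"
  proof -
   have "leb Z <= ennreal (1 / eps) * J k"
    unfolding Z_def J_def by (rule nn_integral_Markov_inequality[OF Jm[OF k(1)]]) simp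
   also have "... <= ennreal (1 / eps) * ennreal (R / 4096)" by (intro mult_left_mono k) simp
   also have "... = ennreal (4 * eps * R)"
   proof -
    have "ennreal (1 / eps) * ennreal (R / 4096) = ennreal (1 / eps * (R / 4096))"
     using R eps(1) by (intro ennreal_mult[symmetric]) auto
    also have "1 / eps * (R / 4096) = 4 * eps * R" by (simp add: eps_def)
    finally show ?thesis .
   qed
   finally show ?thesis .
  qed
  have NI: "measure (N k) (I k) = 1"
   using NE[OF k(1) I(1)[OF k(1)]] I(2)[OF k(1)] \<rho>(1) by (simp add: N.emeasure_eq_measure ennreal_mult[symmetric])
  have "AE r in lborel. r \<in> {0..<R} --> r \<in> Z Un D"
   using AEN
  proof eventually_elim
   case (elim r)
   show ?case
   proof
    assume r: "r \<in> {0..<R}"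
    have r0: "0 <= r" "r <= R" using r by auto
    have bs: "bad r \<in> sets (N k)" using badm[OF r0(1)] by simp
    show "r \<in> Z Un D"
    proof (cases "r \<in> Z")
     case False
     hence "\<not> 1 <= ennreal (1 / eps) * ennreal (measure (N k) (bad r))" using r by (simp add: Z_def N.emeasure_eq_measure)
     hence "\<not> 1 <= 1 / eps * measure (N k) (bad r)" using eps(1) by (simp add: ennreal_mult[symmetric] del: ennreal_1 flip: ennreal_1)
     hence p: "measure (N k) (bad r) < eps" using eps(1) by (simp add: field_simps)
     have "\<not> I k <= bad r"
     proof
      assume "I k <= bad r"
      hence "1 <= measure (N k) (bad r)" unfolding NI[symmetric] using bs by (rule N.finite_measure_mono)
      thus False using p eps by simp
     qed
     then obtain y0 where y0: "y0 \<in> I k" "y0 \<notin> bad r" by blast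
     have inKK: "A.T r (y, u) \<in> KK" if "y \<in> I k" "y \<notin> bad r" for y
     proof -
      have "y \<in> space A.Y" using that(1) by (simp add: I_def)
      moreover from this have "A.T r (y, u) \<in> space A.M" using A.flow_space[OF inM[of y u] r0(1)] uc by simp
      ultimately show ?thesis using that(2) by (simp add: bad_def)
     qed
     obtain A where A: "A \<in> P" "A.T r (y0, u) \<in> K A" using inKK[OF y0] by (auto simp: KK_def)
     have As: "A \<in> sets B.M" using A(1) P(2) by blast
     define E where "E = {y \<in> space (N k). \<Theta> (A.T r (y, u)) \<in> A}"
     have E: "E \<in> sets (N k)" unfolding E_def using \<Theta>m[OF r0(1) As] by simp
     have "I k <= bad r Un E"
     proof
      fix y assume y: "y \<in> I k"
      show "y \<in> bad r Un E"
      proof (cases "y \<in> bad r")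
       case False
       then obtain A' where A': "A' \<in> P" "A.T r (y, u) \<in> K A'" using inKK[OF y] by (auto simp: KK_def)
       have "A' = A" by (rule sameK[OF y y0(1) r0 A'(1) A(1) A'(2) A(2)])
       hence "\<Theta> (A.T r (y, u)) \<in> A" using KQ(2)[OF A'] by simp
       thus ?thesis using y by (simp add: E_def I_def)
      qed simp
     qed
     hence "1 <= measure (N k) (bad r Un E)" unfolding NI[symmetric] using bs E by (intro N.finite_measure_mono) auto
     also have "... <= measure (N k) (bad r) + measure (N k) E" using bs E by (rule measure_Un_le)
     finally have "1 - eps <= measure (N k) E" using p by linarith
     also have "measure (N k) E = measure (N k) (hits (N k) U w r A)"
      using elim[rule_format, OF r As] by (simp add: E_def measure_def)
     finally show ?thesis using A(1) r by (auto simp: D_def)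
    qed simp
   qed
  qed
  hence "leb {0..<R} <= leb (Z Un D)" using Z D by (intro emeasure_mono_AE) auto
  also have "... <= leb Z + leb D" using Z D by (intro emeasure_subadditive) auto
  also have "leb D = ennreal (measure lborel D)"
  proof -
   have "leb D <= leb {0..<R}" by (intro emeasure_mono) (auto simp: D_def)
   also have "... < \<infinity>" using R by simp
   finally show ?thesis by (intro emeasure_eq_ennreal_measure) auto
  qed
  finally have "leb {0..<R} <= ennreal (4 * eps * R) + ennreal (measure lborel D)"
   using eZ by (meson add_right_mono order_trans)
  hence "ennreal R <= ennreal (4 * eps * R + measure lborel D)"
   using R eps(1) by (simp add: ennreal_plus)
  hence "R <= 4 * eps * R + measure lborel D" using R eps(1) by (subst (asm) ennreal_le_iff) auto
  thus ?thesis unfolding D_def[symmetric] by (simp add: algebra_simps)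
 qed
 have Rpos: "0 < R" using R by simp
 from concP[rule_format, OF N.prob_space_axioms, unfolded B.concentrates_def, rule_format, OF wN Rpos occG mono] obtain r x' where r: "r \<in> {0..R / 2}"
  and big: "1 / 4 < measure (N k) {y \<in> space (N k). abs (fst (U r (w y)) - x') < min 1 (\<theta> R) & snd (U r (w y)) < Hm}"
  by blast
 define \<delta> where "\<delta> = min 1 (\<theta> R)"
 have \<delta>: "0 < \<delta>" "\<delta> <= 1" "\<delta> <= \<theta> R" using \<theta>pos[OF Rpos] by (auto simp: \<delta>_def)
 define E where "E = {y \<in> space (N k). abs (fst (U r (w y)) - x') < \<delta> & snd (U r (w y)) < Hm}"
 define S where "S = \<Theta> -` B.strip x' \<delta> (Hm + c') Int space A.M"
 have S: "S \<in> sets A.M" unfolding S_def by measurable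
 have wM: "w y \<in> space B.M" if "y \<in> space A.Y" for y using measurable_space[OF w that] .
 have "AE t in lborel. ennreal (\<rho> * measure (N k) E) * indicator {r..r + m'} t
   <= \<mu> A.Y {y \<in> space A.Y. A.T t (y, u) \<in> S} * indicator {r..r + m'} t"
  using AEN
 proof eventually_elim
  case (elim t)
  show ?case
  proof (cases "t \<in> {r..r + m'}")
   case t: True
   hence tR: "t \<in> {0..<R}" "0 <= t" using r R m' by auto
   define E' where "E' = {y \<in> space (N k). \<Theta> (A.T t (y, u)) \<in> B.strip x' \<delta> (Hm + c')}"
   have E': "E' \<in> sets A.Y" unfolding E'_def using \<Theta>m[OF tR(2) B.strip_sets] by simp
   have E1: "E <= (hits (N k) U w t (B.strip x' \<delta> (Hm + c')))"
   proof
    fix y assume y: "y \<in> E"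
    have ys: "y \<in> space A.Y" using y by (simp add: E_def)
    have Tr: "U r (w y) = B.T r (w y)" "U t (w y) = B.T t (w y)" using r tR by (auto intro: U)
    have "B.T (t - r) (B.T r (w y)) \<in> B.strip x' \<delta> (Hm + c')"
     using y t m' \<delta> B.flow_space[OF wM[OF ys], of r] r by (intro B.flow_strip) (auto simp: E_def Tr)
    moreover have "B.T t (w y) = B.T (t - r) (B.T r (w y))"
     using B.flow_add[OF wM[OF ys], of "t - r" r] t r by simp
    ultimately show "y \<in> (hits (N k) U w t (B.strip x' \<delta> (Hm + c')))" using ys by (simp add: Tr)
   qed
   have "(hits (N k) U w t (B.strip x' \<delta> (Hm + c'))) \<in> sets (N k)"
   proof -
    have "{y \<in> space A.Y. B.T (max 0 t) (w y) \<in> B.strip x' \<delta> (Hm + c')} \<in> sets A.Y" by measurable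
    thus ?thesis by (simp add: U_def)
   qed
   from emeasure_mono[OF E1 this] have "\<mu> (N k) E <= \<mu> (N k) E'"
    using elim[rule_format, OF tR(1) B.strip_sets] by (simp add: E'_def)
   hence "ennreal \<rho> * \<mu> (N k) E <= ennreal \<rho> * \<mu> (N k) E'" by (intro mult_left_mono) auto
   also have "... = \<mu> A.Y (I k Int E')" by (rule NE[OF k(1) E'])
   also have "... <= \<mu> A.Y E'" using E' by (intro emeasure_mono) auto
   also have "E' = {y \<in> space A.Y. A.T t (y, u) \<in> S}"
    using A.flow_space[OF inM[of _ u] tR(2)] uc by (auto simp: E'_def S_def)
   finally show ?thesis using t \<rho> by (simp add: N.emeasure_eq_measure ennreal_mult[symmetric])
  qed simp
 qed
 hence "(\<integral>\<^sup>+ t. ennreal (\<rho> * measure (N k) E) * indicator {r..r + m'} t \<partial>lborel)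
   <= (\<integral>\<^sup>+ t\<in>{r..r + m'}. \<mu> A.Y {y \<in> space A.Y. A.T t (y, u) \<in> S} \<partial>lborel)"
  by (rule nn_integral_mono_AE)
 also have "... <= A.F * \<mu> A.M S"
  using r u m' uc finA by (intro A.occupancy_window[OF S]) auto
 also have "\<mu> A.M S = \<mu> B.M (B.strip x' \<delta> (Hm + c'))"
  using emeasure_distr[OF \<Theta> B.strip_sets, of x' \<delta> "Hm + c'"] unfolding \<Theta>d S_def by (rule sym)
 also have "A.F * ... <= ennreal Fr * ennreal (12 * \<delta> * (Hm + c') / c')"
  unfolding FF using \<delta> Hm B.c_pos by (intro mult_left_mono B.emeasure_strip_le) auto
 also have "... = ennreal (m' * (W * \<delta>))"
  using Fr \<delta> Hm B.c_pos m' by (simp add: ennreal_mult[symmetric] W_def mult_ac)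
 also have "(\<integral>\<^sup>+ t. ennreal (\<rho> * measure (N k) E) * indicator {r..r + m'} t \<partial>lborel) = ennreal (m' * (\<rho> * measure (N k) E))"
  using m' \<rho> by (simp add: nn_integral_cmult_indicator ennreal_mult[symmetric] mult.commute)
 finally have "m' * (\<rho> * measure (N k) E) <= m' * (W * \<delta>)" using m' W \<delta> by (subst (asm) ennreal_le_iff) auto
 hence "\<rho> * measure (N k) E <= W * \<delta>" using m' by simp
 hence "real L * (\<rho> * measure (N k) E) <= real L * (W * \<delta>)" by (intro mult_left_mono) auto
 moreover have "real L * (\<rho> * measure (N k) E) = measure (N k) E" using L(3) by (simp add: \<rho>_def)
 ultimately have "measure (N k) E <= real L * (W * \<delta>)" by simp
 also have "... <= (2 * R powr e) * (W * \<theta> R)" using L \<delta> W by (intro mult_mono) auto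
 also have "... = 2 * W * (R powr e * \<theta> R)" by simp
 also have "... < 2 * W * (1 / (8 * W))" using Rlim W by (intro mult_strict_left_mono) auto
 also have "... = 1 / 4" using W by simp
 finally show False using big by (simp add: E_def \<delta>_def)
qed

end

lemma (in roof_flow) distr_flow:
 assumes "0 <= t"
 shows "distr M M (T t) = M"
proof (rule measure_eqI)
 fix A assume "A \<in> sets (distr M M (T t))"
 hence A: "A \<in> sets M" by simp
 have "T t -` A Int space M = {z \<in> space M. T t z \<in> A}" by auto
 thus "\<mu> (distr M M (T t)) A = \<mu> M A"
  using emeasure_distr[OF flow_measurable_at[OF assms] A] flow_preserves[OF assms A] by simp
qed simp

lemma flow_isomorphism_inverse:
 assumes iso: "flow_isomorphism M T M' T' \<Theta>"
  and T: "!!t. 0 <= t ==> T t \<in> M \<rightarrow>\<^sub>M M" "!!t. 0 <= t ==> distr M M (T t) = M"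
 obtains \<Psi> where "\<Psi> \<in> M' \<rightarrow>\<^sub>M M" "distr M' M \<Psi> = M" "!!t::real. 0 <= t ==> AE y in M'. \<Psi> (T' t y) = T t (\<Psi> y)"
proof -
 obtain \<Psi> where \<Psi>: "\<Psi> \<in> M' \<rightarrow>\<^sub>M M" "distr M' M \<Psi> = M"
  and inv: "AE x in M. \<Psi> (\<Theta> x) = x" "AE y in M'. \<Theta> (\<Psi> y) = y"
  using iso unfolding flow_isomorphism_def by (elim conjE exE)
 have comm: "AE x in M. \<Theta> (T t x) = T' t (\<Theta> x)" for t using iso unfolding flow_isomorphism_def by blast
 have "AE y in M'. \<Psi> (T' t y) = T t (\<Psi> y)" if t: "0 <= t" for t
 proof -
  have "AE x in distr M' M \<Psi>. \<Theta> (T t x) = T' t (\<Theta> x)" unfolding \<Psi>(2) by (rule comm)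
  from AE_distrD[OF \<Psi>(1) this] have 1: "AE y in M'. \<Theta> (T t (\<Psi> y)) = T' t (\<Theta> (\<Psi> y))" .
  have "AE x in distr M M (T t). \<Psi> (\<Theta> x) = x" unfolding T(2)[OF t] by (rule inv(1))
  from AE_distrD[OF T(1)[OF t] this] have "AE x in distr M' M \<Psi>. \<Psi> (\<Theta> (T t x)) = T t x" unfolding \<Psi>(2) .
  from AE_distrD[OF \<Psi>(1) this] have "AE y in M'. \<Psi> (\<Theta> (T t (\<Psi> y))) = T t (\<Psi> y)" .
  with 1 inv(2) show ?thesis by eventually_elim simp
 qed
 with \<Psi> show thesis by (rule that)
qed

text \<open>An exponent \<open>1 / a\<close> strictly between \<open>1 + \<gamma> + \<sigma>\<close> and \<open>1 + \<gamma>'\<close> is available as the rate at which the second flow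
 separates orbits.\<close>

theorem kochergin_no_factor:
 fixes \<alpha> \<alpha>' \<gamma> \<gamma>' :: real and f f' :: "real => real"
 assumes D: "\<alpha>' \<in> dioph_D" and f: "kochergin_roof \<gamma> f" and f': "kochergin_roof \<gamma>' f'" and \<gamma>: "\<gamma> < \<gamma>'"
 defines "M \<equiv> special_measure (circle_base \<alpha>) f" and "T \<equiv> special_flow (circle_base \<alpha>) (rotation \<alpha>) f"
  and "M' \<equiv> special_measure (circle_base \<alpha>') f'" and "T' \<equiv> special_flow (circle_base \<alpha>') (rotation \<alpha>') f'"
 assumes \<Theta>: "\<Theta> \<in> M \<rightarrow>\<^sub>M M'" "distr M M' \<Theta> = M'" "!!t. 0 <= t ==> AE z in M. \<Theta> (T t z) = T' t (\<Theta> z)"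
 shows False
proof -
 have g: "0 < \<gamma>" "\<gamma>' < 1" using f f' by (auto simp: kochergin_roof_def)
 obtain c where "roof_flow f c" using kochergin_roof_flow[OF f] by blast
 then interpret A: roof_flow \<alpha> f c .
 obtain c' where "roof_flow f' c'" using kochergin_roof_flow[OF f'] by blast
 then interpret B: roof_flow \<alpha>' f' c' .
 interpret flow_pair \<alpha> f c \<alpha>' f' c' ..
 obtain q p C where "log_diophantine \<alpha>' q p C" using dioph_D_log_diophantine[OF D] by blast
 then interpret log_diophantine \<alpha>' q p C .
 define \<sigma> where "\<sigma> = (\<gamma>' - \<gamma>) / 2"
 have \<sigma>: "0 < \<sigma>" "\<sigma> <= 1" "1 + \<gamma> + \<sigma> < 1 + \<gamma>'" using \<gamma> g by (auto simp: \<sigma>_def field_simps)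
 have "1 / (1 + \<gamma>') < 1 / (1 + \<gamma> + \<sigma>)" using \<sigma> g by (intro divide_strict_left_mono) auto
 then obtain a where a: "1 / (1 + \<gamma>') < a" "a < 1 / (1 + \<gamma> + \<sigma>)" using dense by blast
 have "0 < 1 / (1 + \<gamma>')" using g \<gamma> by simp
 hence a0: "0 < a" using a(1) by linarith
 have "1 / (1 + \<gamma> + \<sigma>) < 1" using g \<sigma> by simp
 hence a1: "a < 1" using a(2) by linarith
 have ae: "1 + \<gamma> + \<sigma> < 1 / a" using a(2) a0 g \<sigma> by (simp add: field_simps)
 have finB: "B.F < \<infinity>" by (rule B.kochergin_area_finite[OF f'])
 have drift: "B.drift_separation (%R. (R / c') powr (- 1 / a))"
  using B.kochergin_drift[OF kochergin_base_separation[OF f' a(1) a1] a0] prob_space.emeasure_space_1[OF B.prob_space_M[OF finB]] by simp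
 have lim: "((%R. R powr (1 + \<gamma> + \<sigma>) * (R / c') powr (- 1 / a)) \<longlongrightarrow> 0) at_top"
 proof (rule Lim_transform_eventually)
  have "((%R. R powr (1 + \<gamma> + \<sigma> - 1 / a) / c' powr (- 1 / a)) \<longlongrightarrow> 0 / c' powr (- 1 / a)) at_top"
   using ae B.c_pos by (intro tendsto_intros tendsto_neg_powr filterlim_ident) auto
  thus "((%R. R powr (1 + \<gamma> + \<sigma> - 1 / a) / c' powr (- 1 / a)) \<longlongrightarrow> 0) at_top" by simp
  show "\<forall>\<^sub>F R in at_top. R powr (1 + \<gamma> + \<sigma> - 1 / a) / c' powr (- 1 / a) = R powr (1 + \<gamma> + \<sigma>) * (R / c') powr (- 1 / a)"
   using eventually_gt_at_top[of 0]
  proof eventually_elim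
   case (elim R)
   have "R powr (1 + \<gamma> + \<sigma> - 1 / a) = R powr (1 + \<gamma> + \<sigma>) * R powr (- 1 / a)"
    unfolding powr_add[symmetric] by simp
   moreover have "(R / c') powr (- 1 / a) = R powr (- 1 / a) / c' powr (- 1 / a)"
    using elim B.c_pos by (simp add: powr_divide)
   ultimately show ?case by simp
  qed
 qed
 show False
 proof (rule no_common_factor[OF _ _ A.kochergin_area_finite[OF f] finB drift _ lim \<Theta>[unfolded M_def T_def M'_def T'_def]])
  show "\<exists>R0. \<forall>R\<ge>R0. \<forall>\<rho>. 0 < \<rho> --> \<rho> <= R powr - (1 + \<gamma> + \<sigma>) -->
   shadowed \<alpha> f (R / c + 2) \<rho> kap \<xi>"
   if "0 < kap" "0 < \<xi>" for kap \<xi>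
   by (rule kochergin_shadowing[OF f \<sigma>(1,2) A.c_pos that])
 qed (use g \<sigma> B.c_pos in auto)
qed

theorem kochergin_flows_not_isomorphic:
 assumes "\<alpha> \<in> dioph_D" "\<alpha>' \<in> dioph_D" "\<gamma> ~= \<gamma>'" "kochergin_flow \<alpha> \<gamma> M T" "kochergin_flow \<alpha>' \<gamma>' M' T'"
 shows "\<not> flow_isomorphic M T M' T'"
proof
 assume "flow_isomorphic M T M' T'"
 then obtain \<Theta> where iso: "flow_isomorphism M T M' T' \<Theta>" by (auto simp: flow_isomorphic_def)
 obtain f where f: "kochergin_roof \<gamma> f" and M: "M = special_measure (circle_base \<alpha>) f" "T = special_flow (circle_base \<alpha>) (rotation \<alpha>) f"
  using assms(4) by (auto simp: kochergin_flow_def)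
 obtain f' where f': "kochergin_roof \<gamma>' f'" and M': "M' = special_measure (circle_base \<alpha>') f'" "T' = special_flow (circle_base \<alpha>') (rotation \<alpha>') f'"
  using assms(5) by (auto simp: kochergin_flow_def)
 show False
 proof (cases "\<gamma> < \<gamma>'")
  case True
  have "\<Theta> \<in> M \<rightarrow>\<^sub>M M'" "distr M M' \<Theta> = M'" "!!t. AE z in M. \<Theta> (T t z) = T' t (\<Theta> z)"
   using iso by (auto simp: flow_isomorphism_def)
  thus False unfolding M M' by (rule kochergin_no_factor[OF assms(2) f f' True])
 next
  case False
  hence lt: "\<gamma>' < \<gamma>" using assms(3) by simp
  obtain c where "roof_flow f c" using kochergin_roof_flow[OF f] by blast
  then interpret A: roof_flow \<alpha> f c .
  obtain \<Psi> where "\<Psi> \<in> M' \<rightarrow>\<^sub>M M" "distr M' M \<Psi> = M" "!!t. 0 <= t ==> AE y in M'. \<Psi> (T' t y) = T t (\<Psi> y)"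
   by (rule flow_isomorphism_inverse[OF iso]) (use A.flow_measurable_at A.distr_flow in \<open>simp_all add: M\<close>)
  thus False unfolding M M' by (rule kochergin_no_factor[OF assms(1) f' f lt])
 qed
qed

theorem corollary1p4:
 shows "(\<forall>\<alpha> M T. \<alpha> \<in> dioph_D \<inter> dioph_E \<longrightarrow> arnold_flow \<alpha> M T \<longrightarrow> \<not> local_rank_one M T) \<and>
     (\<forall>\<alpha> \<gamma> M T. \<alpha> \<in> dioph_D \<longrightarrow> kochergin_flow \<alpha> \<gamma> M T \<longrightarrow> \<not> local_rank_one M T) \<and>
     (\<forall>\<alpha> \<alpha>' \<gamma> \<gamma>' M T M' T'.
      \<alpha> \<in> dioph_D \<longrightarrow> \<alpha>' \<in> dioph_D \<longrightarrow> \<gamma> \<noteq> \<gamma>' \<longrightarrow>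
      kochergin_flow \<alpha> \<gamma> M T \<longrightarrow> kochergin_flow \<alpha>' \<gamma>' M' T' \<longrightarrow>
      \<not> flow_isomorphic M T M' T')"
proof (intro conjI allI impI)
 show "\<not> local_rank_one M T" if "\<alpha> \<in> dioph_D \<inter> dioph_E" "arnold_flow \<alpha> M T" for \<alpha> M T
  using that by (intro arnold_flow_not_local_rank_one) auto
qed (rule kochergin_flow_not_local_rank_one kochergin_flows_not_isomorphic; assumption)+

end
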